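(* Let $R,T_0>0$, $\gamma>0$, and let $a=a(x,t)\in L^\infty(\mathbb R_x;C_{\rm c}^\infty(\mathbb R_t))$ with $\operatorname{supp}a\subset[-R,R]\times[-T_0,T_0]$. Let $g\in C_{\rm c}^\infty((R,\infty))$ and let $u(t,x)$ be the unique solution of $$D_t^2u(t,x)-a(x,t)\int_{-\infty}^te^{-\gamma(t-t')}D_tu(t',x)\,dt'-D_x^2u(t,x)=0$$ satisfying $u(t,x)=g(t-x)$ for $t<0$. Let $T,R_+$ be the transmission and reflection operators of the stationary problem for $P=D_x^2-\omega^2+A(x)$ described in the context. Then $$u(t,x)=\begin{cases} g(t-x)+(\mathscr R_+g)(x+t),& x<-R,\\ (\mathscr Tg)(t-x),& x>R,\end{cases}$$ where $\mathscr R_+g$ and $\mathscr Tg$ are defined by $$\widehat{\mathscr R_+g}(\omega):=(R_+\widehat g)(\omega),\qquad \widehat{\mathscr Tg}(\omega):=(T\widehat g)(\omega).$$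
   Context: All functions are complex valued; $D_t=\frac1i\partial_t$, $D_x=\frac1i\partial_x$, $\mathbb C_+=\{\operatorname{Im}\omega>0\}$, $\mathscr O(\mathbb C_+)$ denotes holomorphic functions on $\mathbb C_+$. The solution $u$ is taken in the class $C^0(\mathbb R_t;H^1(\mathbb R_x))\cap C^1(\mathbb R_t;L^2(\mathbb R_x))$, where existence and uniqueness hold. Fourier transform convention: $\widehat h(\omega)=\int_{\mathbb R}h(t)e^{i\omega t}dt$, $h(t)=\frac1{2\pi}\int\widehat h(\omega)e^{-i\omega t}d\omega$. Functions in $\omega^{-1}H_\beta$ (defined below) are identified with Fourier transforms of distributions on $\mathbb R$ through their boundary values from $\mathbb C_+$ (that is, $\omega^{-1}$ is interpreted as $(\omega+i0)^{-1}$). For $\alpha\in\mathbb R$, $$H_\alpha:=\Big\{f\in\mathscr O(\mathbb C_+):\ \sup_{\sigma>0}e^{-2\sigma\alpha}\int_{\mathbb R}|f(\lambda+i\sigma)|^2d\lambda<\infty\Big\};$$ $\mathscr H_\alpha$ is the space of $f:\mathbb R\times\mathbb C_+\to\mathbb C$ with $f(x,\bullet)\in\mathscr O(\mathbb C_+)$ and $\sup_{\sigma>0}e^{-2\sigma\alpha}\int_{\mathbb R}\|f(\cdot,\lambda+i\sigma)\|_{L^2(\mathbb R)}^2d\lambda<\infty$; $\mathscr H_\infty=\bigcup_\alpha\mathscr H_\alpha$; and $\mathscr H_{\infty,\rm loc}$ is the space of $u$ with $u(x,\bullet)\in\mathscr O(\mathbb C_+)$ and $\chi(x)u\in\mathscr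 H_\infty$ for all $\chi\in C_{\rm c}^\infty(\mathbb R)$. For nonvanishing holomorphic $m(\omega)$, $mX=\{mg:g\in X\}$ with the transported norm. The stationary operator is $P:=D_x^2-\omega^2+A(x)$ with $A(x):=-i\,a(x,D_\omega)\frac{\omega}{\omega+i\gamma}$ (first multiply by $\frac{\omega}{\omega+i\gamma}$, then apply $-i\,a(x,D_\omega)$), where $$[a(x,D_\omega)v](x,\omega+i\sigma):=\frac1{2\pi}\int_{\mathbb R}\widehat{a(x,\bullet)}(\omega-\lambda)\,v(x,\lambda+i\sigma)\,d\lambda,\qquad\omega\in\mathbb R,\ \sigma>0 .$$ $T$ and $R_+$ are operators, bounded $(\omega+i)^{-1}H_\alpha\to\omega^{-1}H_{\alpha+2R}$ for all $\alpha\in\mathbb R$, such that for every $f\in(\omega+i)^{-1}H_{-R}$ there is a unique solution $U(x,\omega)\in\omega^{-1}\mathscr H_{\infty,\rm loc}$ of $PU=0$ with $U(x,\omega)=f(\omega)e^{i\omega x}+(R_+f)(\omega)e^{-i\omega x}$ for $x<-R$ and $U(x,\omega)=(Tf)(\omega)e^{i\omega x}$ for $x>R$. Such operators exist. (Note $\widehat g\in(\omega+i)^{-1}H_{-R}$ for $g\in C_{\rm c}^\infty((R,\infty))$.) *)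

theory Defs
  imports "HOL-Complex_Analysis.Complex_Analysis"
begin

section \<open>Smooth functions, test functions, Schwartz functions\<close>

definition dir_deriv :: "'a::euclidean_space \<Rightarrow> ('a \<Rightarrow> complex) \<Rightarrow> 'a \<Rightarrow> complex" where
  "dir_deriv v f = (\<lambda>p. frechet_derivative f (at p) v)"

definition smooth :: "('a::euclidean_space \<Rightarrow> complex) \<Rightarrow> bool" where
  "smooth f \<longleftrightarrow> (\<forall>vs. set vs \<subseteq> Basis \<longrightarrow> (\<forall>p. foldr dir_deriv vs f differentiable (at p)))"

definition supp :: "('a::euclidean_space \<Rightarrow> complex) \<Rightarrow> 'a set" where
  "supp f = closure {p. f p \<noteq> 0}"

definition test_functions :: "('a::euclidean_space \<Rightarrow> complex) set" where
  "test_functions = {f. smooth f \<and> compact (supp f)}"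

definition schwartz :: "(real \<Rightarrow> complex) set" where
  "schwartz = {f. smooth f \<and>
     (\<forall>k n. bounded (range (\<lambda>x. of_real (x ^ k) * (dir_deriv 1 ^^ n) f x)))}"

definition D :: "'a::euclidean_space \<Rightarrow> ('a \<Rightarrow> complex) \<Rightarrow> 'a \<Rightarrow> complex" where
  "D v f = (\<lambda>p. (1 / \<i>) * dir_deriv v f p)"


section \<open>Fourier transform\<close>

definition fourier :: "(real \<Rightarrow> complex) \<Rightarrow> complex \<Rightarrow> complex" where
  "fourier h \<omega> = (LINT t|lebesgue. h t * exp (\<i> * \<omega> * of_real t))"

abbreviation upper_half :: "complex set" where
  "upper_half \<equiv> {z. Im z > 0}"

text \<open>
  The (possibly growing) function \<open>h\<close> is a tempered distribution whose Fourier transform is the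
  boundary value \<open>F(\<bullet> + i0)\<close> of \<open>F\<close>, a function on the upper half plane. The Fourier transform of
  \<open>h\<close> is taken by duality, with pairing \<open>\<langle>fourier h, \<phi>\<rangle> = \<langle>h, fourier \<phi>\<rangle>\<close>, and the boundary value
  is the limit of \<open>F(\<bullet> + i\<sigma>)\<close> in the sense of tempered distributions as \<open>\<sigma>\<close> decreases to 0.
\<close>
definition has_fourier_boundary_value :: "(real \<Rightarrow> complex) \<Rightarrow> (complex \<Rightarrow> complex) \<Rightarrow> bool" where
  "has_fourier_boundary_value h F \<longleftrightarrow> (\<forall>\<phi>\<in>schwartz.
     integrable lebesgue (\<lambda>t. h t * fourier \<phi> (of_real t)) \<and>
     (\<forall>\<sigma>>0. integrable lebesgue (\<lambda>l. F (Complex l \<sigma>) * \<phi> l)) \<and>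
     ((\<lambda>\<sigma>. LINT l|lebesgue. F (Complex l \<sigma>) * \<phi> l)
        \<longlongrightarrow> (LINT t|lebesgue. h t * fourier \<phi> (of_real t))) (at_right 0))"


section \<open>The time-dependent equation\<close>

text \<open>
  \<open>L\<^sup>\<infinity>(\<real>; C\<^sub>c\<^sup>\<infinity>(\<real>))\<close>, for a representative \<open>a x t\<close>. For maps into functions supported in a fixed
  compact set (a separable Frechet space), measurability is measurability of all point evaluations.
\<close>
definition Linf_Cc_smooth :: "(real \<Rightarrow> real \<Rightarrow> complex) set" where
  "Linf_Cc_smooth = {a.
     (\<forall>t. (\<lambda>x. a x t) \<in> borel_measurable lebesgue) \<and>
     (AE x in lebesgue. a x \<in> test_functions) \<and>
     (\<exists>K. compact K \<and> (AE x in lebesgue. supp (a x) \<subseteq> K)) \<and>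
     (\<forall>n. \<exists>C. AE x in lebesgue. \<forall>t. norm ((dir_deriv 1 ^^ n) (a x) t) \<le> C)}"

definition L2 :: "(real \<Rightarrow> complex) set" where
  "L2 = {f. f \<in> borel_measurable lebesgue \<and> integrable lebesgue (\<lambda>x. (norm (f x))\<^sup>2)}"

definition L2_norm :: "(real \<Rightarrow> complex) \<Rightarrow> real" where
  "L2_norm f = sqrt (LINT x|lebesgue. (norm (f x))\<^sup>2)"

definition weak_deriv :: "(real \<Rightarrow> complex) \<Rightarrow> (real \<Rightarrow> complex) \<Rightarrow> bool" where
  "weak_deriv f f' \<longleftrightarrow> (\<forall>\<phi>\<in>test_functions.
     (LINT x|lebesgue. f x * dir_deriv 1 \<phi> x) = - (LINT x|lebesgue. f' x * \<phi> x))"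

definition C0_L2 :: "(real \<Rightarrow> real \<Rightarrow> complex) set" where
  "C0_L2 = {v. (\<forall>t. v t \<in> L2) \<and>
     (\<forall>t. ((\<lambda>s. L2_norm (\<lambda>x. v s x - v t x)) \<longlongrightarrow> 0) (at t))}"

definition C0_H1 :: "(real \<Rightarrow> real \<Rightarrow> complex) set" where
  "C0_H1 = {v. v \<in> C0_L2 \<and> (\<exists>w\<in>C0_L2. \<forall>t. weak_deriv (v t) (w t))}"

definition has_L2_time_deriv ::
    "(real \<Rightarrow> real \<Rightarrow> complex) \<Rightarrow> (real \<Rightarrow> real \<Rightarrow> complex) \<Rightarrow> bool" where
  "has_L2_time_deriv v v' \<longleftrightarrow>
     (\<forall>t. ((\<lambda>h. L2_norm (\<lambda>x. (v (t + h) x - v t x) / of_real h - v' t x)) \<longlongrightarrow> 0) (at 0))"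

definition memory :: "real \<Rightarrow> (real \<Rightarrow> real \<Rightarrow> complex) \<Rightarrow> real \<Rightarrow> real \<Rightarrow> complex" where
  "memory \<gamma> v t x = (LINT t':{..t}|lebesgue. of_real (exp (- \<gamma> * (t - t'))) * v t' x)"

text \<open>
  \<open>u\<close> lies in \<open>C\<^sup>0(\<real>; H\<^sup>1) \<inter> C\<^sup>1(\<real>; L\<^sup>2)\<close> and solves
  \<open>D\<^sub>t\<^sup>2 u - a \<integral>\<^bsub>t' < t\<^esub> e\<^bsup>- \<gamma> (t - t')\<^esup> D\<^sub>t u dt' - D\<^sub>x\<^sup>2 u = 0\<close> in the sense of distributions on
  \<open>\<real>\<^sub>t \<times> \<real>\<^sub>x\<close>. Curves of \<open>L\<^sup>2\<close> classes are given by jointly measurable representatives, so that the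
  integral over the past makes sense for almost every \<open>x\<close>. The transpose of \<open>D\<^sup>2\<close> is \<open>D\<^sup>2\<close>.
\<close>
definition wave_solution ::
    "(real \<Rightarrow> real \<Rightarrow> complex) \<Rightarrow> real \<Rightarrow> (real \<Rightarrow> real \<Rightarrow> complex) \<Rightarrow> bool" where
  "wave_solution a \<gamma> u \<longleftrightarrow>
     (\<lambda>(t, x). u t x) \<in> borel_measurable lebesgue \<and> u \<in> C0_H1 \<and>
     (\<exists>ut. (\<lambda>(t, x). ut t x) \<in> borel_measurable lebesgue \<and> ut \<in> C0_L2 \<and> has_L2_time_deriv u ut \<and>
        (\<forall>\<phi>\<in>test_functions.
           (LINT p|lebesgue. (case p of (t, x) \<Rightarrow>
                u t x * D (1, 0) (D (1, 0) \<phi>) (t, x)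
              - a x t * memory \<gamma> (\<lambda>t' x'. (1 / \<i>) * ut t' x') t x * \<phi> (t, x)
              - u t x * D (0, 1) (D (0, 1) \<phi>) (t, x))) = 0))"


section \<open>Spaces of holomorphic functions on the upper half plane\<close>

text \<open>
  Elements are total functions on \<open>\<complex>\<close>; only their values on the upper half plane are relevant.
\<close>

definition H_norm_sq :: "real \<Rightarrow> (complex \<Rightarrow> complex) \<Rightarrow> ennreal" where
  "H_norm_sq \<alpha> f = (SUP \<sigma>\<in>{0<..}.
     ennreal (exp (- 2 * \<sigma> * \<alpha>)) * (\<integral>\<^sup>+ l. ennreal ((norm (f (Complex l \<sigma>)))\<^sup>2) \<partial>lebesgue))"

definition H :: "real \<Rightarrow> (complex \<Rightarrow> complex) set" where
  "H \<alpha> = {f. f holomorphic_on upper_half \<and> H_norm_sq \<alpha> f < \<infinity>}"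

definition H_norm :: "real \<Rightarrow> (complex \<Rightarrow> complex) \<Rightarrow> real" where
  "H_norm \<alpha> f = sqrt (enn2real (H_norm_sq \<alpha> f))"

text \<open>The space \<open>m X\<close> with its transported norm, for \<open>X = H \<alpha>\<close>.\<close>

definition mult_H :: "(complex \<Rightarrow> complex) \<Rightarrow> real \<Rightarrow> (complex \<Rightarrow> complex) set" where
  "mult_H m \<alpha> = {f. \<exists>h\<in>H \<alpha>. \<forall>z\<in>upper_half. f z = m z * h z}"

definition mult_H_norm :: "(complex \<Rightarrow> complex) \<Rightarrow> real \<Rightarrow> (complex \<Rightarrow> complex) \<Rightarrow> real" where
  "mult_H_norm m \<alpha> f = H_norm \<alpha> (\<lambda>z. f z / m z)"

definition HH :: "real \<Rightarrow> (real \<Rightarrow> complex \<Rightarrow> complex) set" where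
  "HH \<alpha> = {f. (\<forall>x. f x holomorphic_on upper_half) \<and>
     (\<forall>z\<in>upper_half. (\<lambda>x. f x z) \<in> borel_measurable lebesgue) \<and>
     (SUP \<sigma>\<in>{0<..}. ennreal (exp (- 2 * \<sigma> * \<alpha>)) *
        (\<integral>\<^sup>+ l. (\<integral>\<^sup>+ x. ennreal ((norm (f x (Complex l \<sigma>)))\<^sup>2) \<partial>lebesgue) \<partial>lebesgue)) < \<infinity>}"

definition HH_inf :: "(real \<Rightarrow> complex \<Rightarrow> complex) set" where
  "HH_inf = (\<Union>\<alpha>. HH \<alpha>)"

definition HH_inf_loc :: "(real \<Rightarrow> complex \<Rightarrow> complex) set" where
  "HH_inf_loc = {f. (\<forall>x. f x holomorphic_on upper_half) \<and>
     (\<forall>\<eta>\<in>test_functions. (\<lambda>x z. \<eta> x * f x z) \<in> HH_inf)}"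

definition mult_HH_inf_loc :: "(complex \<Rightarrow> complex) \<Rightarrow> (real \<Rightarrow> complex \<Rightarrow> complex) set" where
  "mult_HH_inf_loc m = {f. \<exists>h\<in>HH_inf_loc. \<forall>x. \<forall>z\<in>upper_half. f x z = m z * h x z}"

definition bounded_operator ::
    "(complex \<Rightarrow> complex) \<Rightarrow> real \<Rightarrow> (complex \<Rightarrow> complex) \<Rightarrow> real \<Rightarrow>
     ((complex \<Rightarrow> complex) \<Rightarrow> complex \<Rightarrow> complex) \<Rightarrow> bool" where
  "bounded_operator m \<alpha> m' \<beta> S \<longleftrightarrow>
     (\<forall>f\<in>mult_H m \<alpha>. S f \<in> mult_H m' \<beta>) \<and>
     (\<forall>f\<in>mult_H m \<alpha>. \<forall>h\<in>mult_H m \<alpha>. \<forall>z\<in>upper_half. S (\<lambda>w. f w + h w) z = S f z + S h z) \<and>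
     (\<forall>f\<in>mult_H m \<alpha>. \<forall>c. \<forall>z\<in>upper_half. S (\<lambda>w. c * f w) z = c * S f z) \<and>
     (\<exists>C. \<forall>f\<in>mult_H m \<alpha>. mult_H_norm m' \<beta> (S f) \<le> C * mult_H_norm m \<alpha> f)"


section \<open>The stationary problem\<close>

definition a_D_omega ::
    "(real \<Rightarrow> real \<Rightarrow> complex) \<Rightarrow> (real \<Rightarrow> complex \<Rightarrow> complex) \<Rightarrow> real \<Rightarrow> complex \<Rightarrow> complex" where
  "a_D_omega a v x z = 1 / (2 * of_real pi) *
     (LINT l|lebesgue. fourier (a x) (of_real (Re z - l)) * v x (Complex l (Im z)))"

definition A_op ::
    "(real \<Rightarrow> real \<Rightarrow> complex) \<Rightarrow> real \<Rightarrow> (real \<Rightarrow> complex \<Rightarrow> complex) \<Rightarrow> real \<Rightarrow> complex \<Rightarrow> complex" where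
  "A_op a \<gamma> v x z = - \<i> * a_D_omega a (\<lambda>x \<omega>. \<omega> / (\<omega> + \<i> * of_real \<gamma>) * v x \<omega>) x z"

text \<open>
  \<open>(D\<^sub>x\<^sup>2 - \<omega>\<^sup>2 + A(x)) U = 0\<close>, in the sense of distributions in \<open>x\<close> for every \<open>\<omega>\<close> in the upper
  half plane.
\<close>
definition P_null ::
    "(real \<Rightarrow> real \<Rightarrow> complex) \<Rightarrow> real \<Rightarrow> (real \<Rightarrow> complex \<Rightarrow> complex) \<Rightarrow> bool" where
  "P_null a \<gamma> U \<longleftrightarrow> (\<forall>\<omega>\<in>upper_half. \<forall>\<phi>\<in>test_functions.
     (LINT x|lebesgue. U x \<omega> * D 1 (D 1 \<phi>) x - \<omega>\<^sup>2 * U x \<omega> * \<phi> x + A_op a \<gamma> U x \<omega> * \<phi> x) = 0)"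

definition scattering_solution ::
    "real \<Rightarrow> (real \<Rightarrow> real \<Rightarrow> complex) \<Rightarrow> real \<Rightarrow> (complex \<Rightarrow> complex) \<Rightarrow> (complex \<Rightarrow> complex) \<Rightarrow>
     (complex \<Rightarrow> complex) \<Rightarrow> (real \<Rightarrow> complex \<Rightarrow> complex) \<Rightarrow> bool" where
  "scattering_solution R a \<gamma> f r \<tau> U \<longleftrightarrow>
     U \<in> mult_HH_inf_loc (\<lambda>\<omega>. 1 / \<omega>) \<and> P_null a \<gamma> U \<and>
     (AE x in lebesgue. \<forall>\<omega>\<in>upper_half.
        (x < - R \<longrightarrow> U x \<omega> = f \<omega> * exp (\<i> * \<omega> * of_real x) + r \<omega> * exp (- \<i> * \<omega> * of_real x)) \<and>
        (x > R \<longrightarrow> U x \<omega> = \<tau> \<omega> * exp (\<i> * \<omega> * of_real x)))"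

text \<open>
  \<open>T\<close> and \<open>Rp\<close> are the transmission and reflection operators. Uniqueness of \<open>U\<close> is up to equality
  for almost every \<open>x\<close>, since the elements of the underlying space are \<open>L\<^sup>2\<close> functions of \<open>x\<close>.
\<close>
definition scattering_operators ::
    "real \<Rightarrow> (real \<Rightarrow> real \<Rightarrow> complex) \<Rightarrow> real \<Rightarrow> ((complex \<Rightarrow> complex) \<Rightarrow> complex \<Rightarrow> complex) \<Rightarrow>
     ((complex \<Rightarrow> complex) \<Rightarrow> complex \<Rightarrow> complex) \<Rightarrow> bool" where
  "scattering_operators R a \<gamma> T Rp \<longleftrightarrow>
     (\<forall>\<alpha>. bounded_operator (\<lambda>\<omega>. 1 / (\<omega> + \<i>)) \<alpha> (\<lambda>\<omega>. 1 / \<omega>) (\<alpha> + 2 * R) T) \<and>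
     (\<forall>\<alpha>. bounded_operator (\<lambda>\<omega>. 1 / (\<omega> + \<i>)) \<alpha> (\<lambda>\<omega>. 1 / \<omega>) (\<alpha> + 2 * R) Rp) \<and>
     (\<forall>f\<in>mult_H (\<lambda>\<omega>. 1 / (\<omega> + \<i>)) (- R).
        \<exists>U. scattering_solution R a \<gamma> f (Rp f) (T f) U \<and>
            (\<forall>V. scattering_solution R a \<gamma> f (Rp f) (T f) V \<longrightarrow>
                 (AE x in lebesgue. \<forall>\<omega>\<in>upper_half. V x \<omega> = U x \<omega>)))"

end

theory Submission
 imports Defs "HOL-Probability.Probability" "HOL-Real_Asymp.Real_Asymp"
begin

text \<open>
 Outside \<open>{- R..R}\<close> the equation is the free wave equation, and for \<open>t < 0\<close> the solution is
 \<open>g (t - x)\<close>, which lives on \<open>x < - R\<close> only. Nothing can therefore enter from the right, and nothing but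
 \<open>g (t - x)\<close> from the left: there are functions \<open>hT\<close>, \<open>hR\<close> of one variable, vanishing on \<open>{..<- R}\<close>, with
 \<open>u t x = hT (t - x)\<close> for \<open>x > R\<close> and \<open>u t x = g (t - x) + hR (x + t)\<close> for \<open>x < - R\<close> (\<open>right_profile\<close>,
 \<open>left_profile\<close>). The theorem says that the Fourier transforms of \<open>hT\<close> and \<open>hR\<close> are \<open>T\<close> and \<open>Rp\<close>
 applied to the Fourier transform of \<open>g\<close>.

 After the time \<open>T0\<close> the coefficient \<open>a\<close> is switched off, so that the \<open>L\<^sup>2\<close> norms of \<open>u\<close> and of its time
 derivative grow at most linearly (\<open>linear_growth\<close>). Hence \<open>u\<close> has a Fourier-Laplace transform \<open>U x z\<close> for
 \<open>Im z > 0\<close>, and the transforms of \<open>hT\<close> and \<open>hR\<close> are holomorphic functions whose boundary values are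
 the distributional Fourier transforms (\<open>causal_boundary_value\<close>). Multiplication by \<open>a\<close> in time becomes
 convolution along the line \<open>Im z = \<sigma>\<close> and the memory term becomes
 \<open>- \<i> * z / (z + \<i> * \<gamma>) * U x z\<close>; so \<open>U\<close> solves the same stationary equation as the scattering solution \<open>V\<close>
 with incoming wave \<open>fourier g\<close> (\<open>A_transform\<close>, \<open>stationary_weak\<close>).

 On a line \<open>Im z = \<sigma>\<close> the difference \<open>Z = V - U\<close> has no incoming part. It decays exponentially in
 \<open>x\<close> and is the convolution of \<open>A Z\<close> with the outgoing Green function \<open>green z\<close> of \<open>\<partial>\<^sub>x\<^sup>2 + z\<^sup>2\<close>
 (\<open>green_representation\<close>). The \<open>L\<^sup>1\<close> norm of that Green function is at most \<open>1 / \<sigma>\<^sup>2\<close>, while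
 \<open>A\<close> is bounded on \<open>L\<^sup>2\<close> of the line independently of \<open>\<sigma>\<close>, by Young's inequality. For
 large \<open>\<sigma>\<close> this is a contraction and \<open>Z = 0\<close> (\<open>stationary_uniqueness\<close>). Thus the scattering data agree
 with the transforms of the profiles high up in the half plane, and by analytic continuation everywhere
 (\<open>scattering_data_are_transforms\<close>).
\<close>

abbreviation (input) "\<D> \<equiv> test_functions"
abbreviation (input) "borel_fun \<equiv> borel_measurable borel"
abbreviation (input) "borel_fun2 \<equiv> borel_measurable (borel \<Otimes>\<^sub>M borel)"
abbreviation (input) "ddx \<equiv> dir_deriv (1::real)"
abbreviation (input) osc :: "complex \<Rightarrow> real \<Rightarrow> complex" where "osc z t \<equiv> exp (\<i> * z * of_real t)"
abbreviation (input) wt :: "real \<Rightarrow> real" where "wt t \<equiv> (1 + t\<^sup>2)\<^sup>2"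
abbreviation (input) nn_lborel (binder "NN " 60) where "nn_lborel f \<equiv> integral\<^sup>N lborel f"
abbreviation (input) "enorm x \<equiv> ennreal (norm x)"

section \<open>Smooth functions\<close>

lemma dir_deriv_eq: "(f has_derivative f') (at p) \<Longrightarrow> dir_deriv v f p = f' v"
 by (simp add: dir_deriv_def frechet_derivative_at[symmetric])

lemma dir_deriv_1_eq: "(f has_vector_derivative d) (at x) \<Longrightarrow> ddx f x = d" for x :: real
 by (simp add: has_vector_derivative_def dir_deriv_eq)

text \<open>
 The iterated directional derivatives in the definition of \<open>smooth\<close> are handled by coinduction: a class of differentiable functions that
 is closed under partial derivatives consists of smooth functions.
\<close>
lemma smooth_coinduct:
 assumes "f \<in> S" and "\<And>f p. f \<in> S \<Longrightarrow> f differentiable (at p)"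
  and "\<And>f b. f \<in> S \<Longrightarrow> b \<in> Basis \<Longrightarrow> dir_deriv b f \<in> S"
 shows "smooth f"
proof -
 have "foldr dir_deriv vs f \<in> S" if "set vs \<subseteq> Basis" for vs
  using that by (induction vs) (simp_all add: assms(1,3))
 then show ?thesis unfolding smooth_def using assms(2) by blast
qed

lemma smooth_differentiable: "smooth f \<Longrightarrow> f differentiable (at p)"
 unfolding smooth_def by (drule spec[of _ "[]"]) simp

lemma smooth_dir_deriv: "smooth f \<Longrightarrow> b \<in> Basis \<Longrightarrow> smooth (dir_deriv b f)"
 unfolding smooth_def
proof (intro allI impI)
 fix vs :: "'a list" and p
 assume "\<forall>vs. set vs \<subseteq> Basis \<longrightarrow> (\<forall>p. foldr dir_deriv vs f differentiable at p)" "b \<in> Basis" "set vs \<subseteq> Basis"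
 from this(1)[rule_format, of "vs @ [b]" p] this(2,3) show "foldr dir_deriv vs (dir_deriv b f) differentiable at p" by auto
qed

lemma smooth_has_derivative:
 "smooth f \<Longrightarrow> (f has_derivative (\<lambda>v. dir_deriv v f p)) (at p)"
 using smooth_differentiable[of f p] unfolding dir_deriv_def
 by (simp add: frechet_derivative_works)

lemma smooth_has_vector_derivative:
 fixes f :: "real \<Rightarrow> complex"
 assumes "smooth f"
 shows "(f has_vector_derivative ddx f x) (at x)"
proof -
 have d: "(f has_derivative (\<lambda>v. dir_deriv v f x)) (at x)" using assms by (rule smooth_has_derivative)
 have "dir_deriv (v *\<^sub>R 1) f x = v *\<^sub>R ddx f x" for v
  by (rule linear_cmul[OF has_derivative_linear[OF d]])
 then have "(\<lambda>v. dir_deriv v f x) = (\<lambda>v. v *\<^sub>R ddx f x)"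
  by (metis mult.right_neutral real_scaleR_def)
 with d show ?thesis unfolding has_vector_derivative_def by simp
qed

lemma smooth_continuous: "smooth f \<Longrightarrow> continuous_on S f"
 by (meson continuous_at_imp_continuous_on differentiable_imp_continuous_within smooth_differentiable)

lemma smooth_borel: "smooth f \<Longrightarrow> f \<in> borel_fun"
 using smooth_continuous by (rule borel_measurable_continuous_onI)

inductive_set smooth_algebra :: "('a::euclidean_space \<Rightarrow> complex) set" where
 base: "smooth f \<Longrightarrow> f \<in> smooth_algebra"
| add: "f \<in> smooth_algebra \<Longrightarrow> g \<in> smooth_algebra \<Longrightarrow> (\<lambda>p. f p + g p) \<in> smooth_algebra"
| mult: "f \<in> smooth_algebra \<Longrightarrow> g \<in> smooth_algebra \<Longrightarrow> (\<lambda>p. f p * g p) \<in> smooth_algebra"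

lemma smooth_algebra_deriv:
 assumes "f \<in> smooth_algebra"
 shows "(\<forall>p. f differentiable (at p)) \<and> (\<forall>b\<in>Basis. dir_deriv b f \<in> smooth_algebra)"
 using assms
proof induction
 case (base f)
 then show ?case by (auto intro: smooth_differentiable smooth_algebra.base smooth_dir_deriv)
next
 case (add f g)
 have "((\<lambda>p. f p + g p) has_derivative (\<lambda>v. dir_deriv v f p + dir_deriv v g p)) (at p)" for p
  unfolding dir_deriv_def using add by (intro has_derivative_add) (auto simp: frechet_derivative_works)
 then have "dir_deriv b (\<lambda>p. f p + g p) = (\<lambda>p. dir_deriv b f p + dir_deriv b g p)" for b
  by (intro ext dir_deriv_eq)
 with add show ?case by (simp add: smooth_algebra.add differentiable_add)
next
 case (mult f g)
 have "((\<lambda>p. f p * g p) has_derivative (\<lambda>v. f p * dir_deriv v g p + dir_deriv v f p * g p)) (at p)" for p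
  unfolding dir_deriv_def using mult by (intro has_derivative_mult) (auto simp: frechet_derivative_works)
 then have "dir_deriv b (\<lambda>p. f p * g p) = (\<lambda>p. f p * dir_deriv b g p + dir_deriv b f p * g p)" for b
  by (intro ext dir_deriv_eq)
 with mult show ?case by (simp add: smooth_algebra.add smooth_algebra.mult differentiable_mult)
qed

lemma smooth_algebra_smooth: "f \<in> smooth_algebra \<Longrightarrow> smooth f"
 by (rule smooth_coinduct[of f smooth_algebra]) (auto simp: smooth_algebra_deriv)

lemma smooth_add: "smooth f \<Longrightarrow> smooth g \<Longrightarrow> smooth (\<lambda>p. f p + g p)"
 and smooth_mult: "smooth f \<Longrightarrow> smooth g \<Longrightarrow> smooth (\<lambda>p. f p * g p)"
 by (rule smooth_algebra_smooth, (rule smooth_algebra.add smooth_algebra.mult), (erule smooth_algebra.base)+)+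

lemma smooth_const: "smooth (\<lambda>_. c)"
 by (rule smooth_coinduct[of _ "range (\<lambda>c _. c)"])
  (auto simp: dir_deriv_eq[OF has_derivative_const] fun_eq_iff intro!: image_eqI[of _ _ 0])

lemma smooth_cmult: "smooth f \<Longrightarrow> smooth (\<lambda>p. c * f p)"
 by (intro smooth_mult smooth_const)

lemma smooth_diff: "smooth f \<Longrightarrow> smooth g \<Longrightarrow> smooth (\<lambda>p. f p - g p)"
 using smooth_add[of f "\<lambda>p. -1 * g p"] smooth_cmult[of g "-1"] by simp

lemma dir_deriv_compose_affine:
 fixes \<psi> :: "real \<Rightarrow> complex" and l :: "'a::euclidean_space \<Rightarrow> real"
 assumes "bounded_linear l" "smooth \<psi>"
 shows "((\<lambda>p. \<psi> (l p + c)) has_derivative (\<lambda>v. l v *\<^sub>R ddx \<psi> (l p + c))) (at p)"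
proof -
 have 1: "((\<lambda>p. l p + c) has_derivative l) (at p)"
  using assms(1) by (auto intro!: derivative_eq_intros bounded_linear_imp_has_derivative)
 have "(\<psi> has_derivative (\<lambda>v. v *\<^sub>R ddx \<psi> (l p + c))) (at (l p + c))"
  using smooth_has_vector_derivative[OF assms(2)] unfolding has_vector_derivative_def .
 from has_derivative_compose[OF 1 this] show ?thesis .
qed

lemma smooth_compose_affine:
 fixes \<psi> :: "real \<Rightarrow> complex" and l :: "'a::euclidean_space \<Rightarrow> real"
 assumes "bounded_linear l" "smooth \<psi>"
 shows "smooth (\<lambda>p. \<psi> (l p + c))"
proof (rule smooth_coinduct[of _ "{(\<lambda>p. k * \<phi> (l p + c)) | k \<phi>. smooth \<phi>}"])
 show "(\<lambda>p. \<psi> (l p + c)) \<in> {\<lambda>p. k * \<phi> (l p + c) |k \<phi>. smooth \<phi>}"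
  by (rule CollectI, rule exI[of _ 1], rule exI[of _ \<psi>]) (simp add: assms(2))
next
 fix f :: "'a \<Rightarrow> complex" and p
 assume "f \<in> {\<lambda>p. k * \<phi> (l p + c) |k \<phi>. smooth \<phi>}"
 then obtain k \<phi> where f: "f = (\<lambda>p. k * \<phi> (l p + c))" and s: "smooth \<phi>" by blast
 have d: "(f has_derivative (\<lambda>v. k * (l v *\<^sub>R ddx \<phi> (l p + c)))) (at p)" for p
  unfolding f by (intro has_derivative_mult_right dir_deriv_compose_affine assms(1) s)
 then show "f differentiable (at p)" by (auto simp: differentiable_def)
 fix b :: 'a assume "b \<in> Basis"
 have "dir_deriv b f = (\<lambda>p. (k * of_real (l b)) * ddx \<phi> (l p + c))"
  using dir_deriv_eq[OF d] by (auto simp: fun_eq_iff scaleR_conv_of_real)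
 then show "dir_deriv b f \<in> {\<lambda>p. k * \<phi> (l p + c) |k \<phi>. smooth \<phi>}"
  using smooth_dir_deriv[OF s, of 1] by (intro CollectI exI[of _ "k * of_real (l b)"] exI[of _ "ddx \<phi>"]) simp
qed

lemma smooth_coinduct_real:
 fixes f :: "real \<Rightarrow> complex"
 assumes "f \<in> S" and "\<And>f. f \<in> S \<Longrightarrow> \<exists>f'\<in>S. \<forall>x. (f has_vector_derivative f' x) (at x)"
 shows "smooth f"
proof (rule smooth_coinduct[of f S])
 fix f p assume "f \<in> S"
 then obtain f' where f': "f' \<in> S" "\<And>x. (f has_vector_derivative f' x) (at x)" using assms(2) by blast
 then show "f differentiable (at p)" by (meson differentiableI_vector)
 have "ddx f = f'" using dir_deriv_1_eq[OF f'(2)] by auto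
 then show "dir_deriv b f \<in> S" if "b \<in> Basis" for b using that f' by simp
qed fact

lemma smooth_antiderivative:
 fixes f :: "real \<Rightarrow> complex"
 assumes "\<And>x. (f has_vector_derivative g x) (at x)" "smooth g"
 shows "smooth f"
proof (rule smooth_coinduct_real[of _ "insert f {g. smooth g}"])
 fix h assume "h \<in> insert f {g. smooth g}"
 then show "\<exists>f'\<in>insert f {g. smooth g}. \<forall>x. (h has_vector_derivative f' x) (at x)"
  using assms smooth_has_vector_derivative[of h] smooth_dir_deriv[of h 1]
  by (cases "h = f") (auto intro!: bexI[of _ g] bexI[of _ "ddx h"])
qed simp

lemma smooth_exp: "smooth (\<lambda>t::real. exp (k * of_real t))"
proof (rule smooth_coinduct_real[of _ "range (\<lambda>c t. c * exp (k * of_real t))"])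
 show "(\<lambda>t::real. exp (k * of_real t)) \<in> range (\<lambda>c t. c * exp (k * of_real t))"
  by (rule image_eqI[of _ _ 1]) simp_all
 fix f assume "f \<in> range (\<lambda>c (t::real). c * exp (k * of_real t))"
 then obtain c where f: "f = (\<lambda>t::real. c * exp (k * of_real t))" by blast
 have "(f has_vector_derivative (c * k) * exp (k * of_real x)) (at x)" for x
  unfolding f by (rule has_vector_derivative_real_field)
   (auto intro!: derivative_eq_intros)
 then show "\<exists>f'\<in>range (\<lambda>c t. c * exp (k * of_real t)). \<forall>x. (f has_vector_derivative f' x) (at x)"
  by (intro bexI[of _ "\<lambda>t. (c * k) * exp (k * of_real t)"]) simp_all
qed

lemma poly_exp_inverse_tendsto: "((\<lambda>x. poly p (1/x) * exp (- (1/x))) \<longlongrightarrow> 0) (at_right (0::real))"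
proof -
 have *: "((\<lambda>y. poly p y * exp (- y)) \<longlongrightarrow> 0) at_top" for p :: "real poly"
 proof (induction p)
  case 0 show ?case by simp
 next
  case (pCons a p)
  have "((\<lambda>y. coeff (pCons a p) n * (y ^ n / exp y)) \<longlongrightarrow> coeff (pCons a p) n * 0) at_top" for n
   by (intro tendsto_mult_left tendsto_power_div_exp_0)
  then have "((\<lambda>y. \<Sum>n\<le>degree (pCons a p). coeff (pCons a p) n * (y ^ n / exp y)) \<longlongrightarrow> (\<Sum>n\<le>degree (pCons a p). 0)) at_top"
   by (intro tendsto_sum) simp
  moreover have "(\<lambda>y. \<Sum>n\<le>degree (pCons a p). coeff (pCons a p) n * (y ^ n / exp y)) = (\<lambda>y. poly (pCons a p) y * exp (-y))"
   by (simp only: poly_altdef sum_distrib_right exp_minus divide_inverse mult.assoc)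
  ultimately show ?case by simp
 qed
 show ?thesis
  using filterlim_compose[OF *[of p] filterlim_inverse_at_top_right] by (simp add: inverse_eq_divide)
qed

definition flat_exp :: "real poly \<Rightarrow> real \<Rightarrow> real" where
 "flat_exp p x = (if x > 0 then poly p (1/x) * exp (- (1/x)) else 0)"

text \<open>
 The functions \<open>p (1 / x) * exp (- 1 / x)\<close>, \<open>p\<close> a polynomial, extended by zero, are closed under differentiation. This
 makes the classical flat function smooth by coinduction.
\<close>
lemma flat_exp_deriv:
 "(flat_exp p has_real_derivative flat_exp ([:0,0,1:] * (p - pderiv p)) x) (at x)"
proof -
 consider "x > 0" | "x < 0" | "x = 0" by linarith
 then show ?thesis
 proof cases
  case 1
  have "((\<lambda>x. poly p (1/x) * exp (- (1/x))) has_real_derivative flat_exp ([:0,0,1:] * (p - pderiv p)) x) (at x)"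
   using 1 by (auto intro!: derivative_eq_intros DERIV_chain'[OF _ poly_DERIV] simp: flat_exp_def field_simps power2_eq_square)
  moreover have "\<forall>\<^sub>F y in nhds x. flat_exp p y = poly p (1/y) * exp (- (1/y))"
   using eventually_nhds_in_open[of "{0<..}" x] 1 by (auto simp: flat_exp_def elim: eventually_mono)
  ultimately show ?thesis by (subst DERIV_cong_ev[OF refl _ refl]) auto
 next
  case 2
  have "\<forall>\<^sub>F y in nhds x. flat_exp p y = 0"
   using eventually_nhds_in_open[of "{..<0}" x] 2 by (auto simp: flat_exp_def elim: eventually_mono)
  then show ?thesis using 2 by (subst DERIV_cong_ev[OF refl _ refl, of _ "\<lambda>_. 0"]) (auto simp: flat_exp_def)
 next
  case 3
  have r: "((\<lambda>h. flat_exp p h / h) \<longlongrightarrow> 0) (at_right 0)"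
  proof (rule Lim_transform_eventually[OF poly_exp_inverse_tendsto[of "pCons 0 p"]])
   show "\<forall>\<^sub>F x in at_right 0. poly (pCons 0 p) (1 / x) * exp (- (1 / x)) = flat_exp p x / x"
    by (auto simp: eventually_at_filter flat_exp_def)
  qed
  have l: "((\<lambda>h. flat_exp p h / h) \<longlongrightarrow> 0) (at_left 0)"
   by (rule tendsto_eventually) (auto simp: eventually_at_filter flat_exp_def)
  show ?thesis using filterlim_split_at[OF l r] 3 by (simp add: DERIV_def flat_exp_def)
 qed
qed

lemma smooth_flat_exp: "smooth (\<lambda>x. of_real (flat_exp p x))"
proof (rule smooth_coinduct_real[of _ "range (\<lambda>p x. of_real (flat_exp p x))"])
 fix f assume "f \<in> range (\<lambda>p x. complex_of_real (flat_exp p x))"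
 then obtain p where f: "f = (\<lambda>x. of_real (flat_exp p x))" by blast
 show "\<exists>f'\<in>range (\<lambda>p x. complex_of_real (flat_exp p x)). \<forall>x. (f has_vector_derivative f' x) (at x)"
  unfolding f using flat_exp_deriv[of p]
  by (intro bexI[of _ "\<lambda>x. of_real (flat_exp ([:0,0,1:] * (p - pderiv p)) x)"])
   (auto intro!: has_vector_derivative_of_real simp: has_real_derivative_iff_has_vector_derivative)
qed simp

lemma smooth_reflect: "smooth \<psi> \<Longrightarrow> smooth (\<lambda>x. \<psi> (c - x))" for \<psi> :: "real \<Rightarrow> complex"
 using smooth_compose_affine[of "\<lambda>x. - x" \<psi> c] by (simp add: bounded_linear_minus bounded_linear_ident)

lemma smooth_affine: "smooth \<psi> \<Longrightarrow> smooth (\<lambda>x. \<psi> (k * x + c))" for \<psi> :: "real \<Rightarrow> complex"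
 using smooth_compose_affine[of "\<lambda>x. k * x" \<psi> c] by (simp add: bounded_linear_mult_right)

text \<open>
 Normalising the antiderivative of \<open>exp (- 1 / x) * exp (- 1 / (1 - x))\<close>, which is supported in \<open>{0..1}\<close>, gives a smooth
 transition from 0 to 1.
\<close>
lemma exists_smooth_step:
 "\<exists>H::real \<Rightarrow> real. smooth (\<lambda>x. of_real (H x)) \<and> (\<forall>x\<le>0. H x = 0) \<and> (\<forall>x\<ge>1. H x = 1) \<and> (\<forall>x. 0 \<le> H x \<and> H x \<le> 1)"
proof -
 define B where "B x = flat_exp 1 x * flat_exp 1 (1 - x)" for x
 have sB: "smooth (\<lambda>x. of_real (B x))"
  unfolding B_def of_real_mult
  by (intro smooth_mult smooth_flat_exp smooth_reflect[OF smooth_flat_exp])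
 have contB: "continuous_on S B" for S
 proof -
  have "continuous_on S (\<lambda>x. Re (of_real (B x)))" by (intro continuous_intros smooth_continuous[OF sB])
  then show ?thesis by simp
 qed
 have B0: "B x \<ge> 0" for x by (simp add: B_def flat_exp_def)
 have Bz: "B x = 0" if "x \<le> 0 \<or> x \<ge> 1" for x using that by (auto simp: B_def flat_exp_def)
 define G where "G x = integral {-1..x} B" for x
 have int: "B integrable_on {a..b}" for a b using contB by (rule integrable_continuous_real)
 have G_deriv: "(G has_real_derivative B x) (at x)" if "x > -1" for x
 proof -
  have "(G has_real_derivative B x) (at x within {-1..x+1})" unfolding G_def
   using that by (intro integral_has_real_derivative contB) auto
  then show ?thesis using that at_within_Icc_at[of "-1" x "x+1"] by simp
 qed
 have Gz: "G x = 0" if "x \<le> 0" for x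
 proof -
  have "G x = integral {-1..x} (\<lambda>_. 0)" unfolding G_def using that by (intro integral_cong Bz) auto
  then show ?thesis by simp
 qed
 have G1: "G x = G 1" if "x \<ge> 1" for x
 proof -
  have "integral {1..x} B = integral {1..x} (\<lambda>_. 0)" by (intro integral_cong Bz) auto
  with Henstock_Kurzweil_Integration.integral_combine[of "-1" 1 x B] that int show ?thesis by (simp add: G_def)
 qed
 have mono: "G x \<le> G y" if "x \<le> y" for x y
  unfolding G_def using that B0 int by (intro integral_subset_le) auto
 have deriv: "(G has_real_derivative B x) (at x)" for x
 proof (cases "x > -1")
  case False
  then have "\<forall>\<^sub>F y in nhds x. G y = 0"
   using eventually_nhds_in_open[of "{..<0}" x] by (auto simp: Gz elim: eventually_mono)
  then show ?thesis using False by (subst DERIV_cong_ev[OF refl _ refl, of _ "\<lambda>_. 0"]) (auto simp: Bz)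
 qed (rule G_deriv)
 have pos: "G 1 > 0"
 proof -
  have "0 < integral {0..1} B"
  proof (rule ccontr)
   assume "\<not> ?thesis"
   then have "integral {0..1} B = 0" using integral_nonneg[OF int, of 0 1] B0 by force
   then have "B (1/2) = 0" using integral_eq_0_iff[of 0 1 B] contB B0 by auto
   then show False by (simp add: B_def flat_exp_def)
  qed
  also have "... \<le> G 1" unfolding G_def using B0 int by (intro integral_subset_le) auto
  finally show ?thesis .
 qed
 have smG: "smooth (\<lambda>x. of_real (G x))"
  by (rule smooth_antiderivative[OF has_vector_derivative_of_real sB])
   (use deriv in \<open>simp add: has_real_derivative_iff_has_vector_derivative\<close>)
 show ?thesis
 proof (intro exI[of _ "\<lambda>x. G x / G 1"] conjI allI impI)
  show "smooth (\<lambda>x. of_real (G x / G 1))"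
   using smooth_cmult[OF smG, of "of_real (1 / G 1)"] by (simp add: field_simps)
  show "0 \<le> G x / G 1" for x using mono[of "min x 0" x] Gz[of "min x 0"] pos by simp
  show "G x / G 1 \<le> 1" for x using mono[of x "max x 1"] G1[of "max x 1"] pos by simp
  show "G x / G 1 = 0" if "x \<le> 0" for x using Gz[OF that] by simp
  show "G x / G 1 = 1" if "x \<ge> 1" for x using G1[OF that] pos by simp
 qed
qed

definition smooth_step :: "real \<Rightarrow> real" where
 "smooth_step = (SOME H. smooth (\<lambda>x. of_real (H x)) \<and> (\<forall>x\<le>0. H x = 0) \<and> (\<forall>x\<ge>1. H x = 1) \<and> (\<forall>x. 0 \<le> H x \<and> H x \<le> 1))"

lemma smooth_smooth_step: "smooth (\<lambda>x. of_real (smooth_step x))"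
 and smooth_step_0: "x \<le> 0 \<Longrightarrow> smooth_step x = 0"
 and smooth_step_1: "x \<ge> 1 \<Longrightarrow> smooth_step x = 1"
 and smooth_step_nonneg: "0 \<le> smooth_step x"
 and smooth_step_le_1: "smooth_step x \<le> 1"
 using someI_ex[OF exists_smooth_step] unfolding smooth_step_def by blast+

section \<open>Test functions on the line\<close>

lemma in_supp: "f x \<noteq> 0 \<Longrightarrow> x \<in> supp f"
 unfolding supp_def by (rule subsetD[OF closure_subset]) simp

lemma supp_subset: "(\<And>x. f x \<noteq> 0 \<Longrightarrow> x \<in> K) \<Longrightarrow> closed K \<Longrightarrow> supp f \<subseteq> K"
 unfolding supp_def by (rule closure_minimal) auto

lemma test_functionsI:
 "smooth f \<Longrightarrow> (\<And>x. f x \<noteq> 0 \<Longrightarrow> x \<in> K) \<Longrightarrow> compact K \<Longrightarrow> f \<in> \<D>"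
 unfolding test_functions_def
 using supp_subset[of f K] by (auto intro: compact_imp_closed simp: supp_def compact_eq_bounded_closed bounded_subset)

lemma test_functionsD: "f \<in> \<D> \<Longrightarrow> smooth f" "f \<in> \<D> \<Longrightarrow> compact (supp f)"
 by (auto simp: test_functions_def)

lemma dir_deriv_in_supp:
 fixes f :: "real \<Rightarrow> complex"
 assumes "ddx f x \<noteq> 0"
 shows "x \<in> supp f"
proof (rule ccontr)
 assume "x \<notin> supp f"
 then have "\<forall>\<^sub>F y in nhds x. y \<in> - supp f"
  by (intro eventually_nhds_in_open) (auto simp: supp_def)
 then have ev: "\<forall>\<^sub>F y in nhds x. 0 = f y" by (rule eventually_mono) (metis ComplD in_supp)
 have "(f has_derivative (\<lambda>_. 0)) (at x)"
  by (rule has_derivative_transform_eventually[OF has_derivative_const])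
   (use ev eventually_nhds_x_imp_x[OF ev] in \<open>auto simp: eventually_at_filter elim: eventually_mono\<close>)
 then show False using assms dir_deriv_eq[of f "\<lambda>_. 0" x 1] by simp
qed

lemma test_function_support:
 fixes f :: "real \<Rightarrow> complex"
 assumes "f \<in> \<D>"
 obtains M where "M > 0" "supp f \<subseteq> {-M..M}" "\<And>x. \<bar>x\<bar> > M \<Longrightarrow> f x = 0"
proof -
 obtain M where M: "M > 0" "\<forall>x\<in>supp f. norm x \<le> M"
  using test_functionsD(2)[OF assms] compact_imp_bounded bounded_pos by metis
 show ?thesis
  by (rule that[of M]) (use M in_supp[of f] in \<open>force simp: abs_le_iff\<close>)+
qed

lemma test_dir_deriv: "f \<in> \<D> \<Longrightarrow> ddx f \<in> \<D>" for f :: "real \<Rightarrow> complex"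
 by (rule test_functionsI[of _ "supp f"]) (auto simp: test_functionsD smooth_dir_deriv dir_deriv_in_supp)

lemma test_mult: "f \<in> \<D> \<Longrightarrow> smooth g \<Longrightarrow> (\<lambda>x. g x * f x) \<in> \<D>"
 by (rule test_functionsI[of _ "supp f"]) (auto simp: test_functionsD smooth_mult in_supp)

lemma test_affine:
 fixes f :: "real \<Rightarrow> complex"
 assumes f: "f \<in> \<D>" and k: "k \<noteq> 0"
 shows "(\<lambda>x. f (k * x + c)) \<in> \<D>"
proof (rule test_functionsI)
 show "smooth (\<lambda>x. f (k * x + c))" by (intro smooth_affine test_functionsD f)
 show "compact ((\<lambda>y. (y - c) / k) ` supp f)"
  using k by (intro compact_continuous_image test_functionsD f continuous_intros) auto
 show "x \<in> (\<lambda>y. (y - c) / k) ` supp f" if "f (k * x + c) \<noteq> 0" for x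
  using in_supp[of f "k * x + c", OF that] k by (intro image_eqI[of _ _ "k * x + c"]) auto
qed

lemma dir_deriv_affine:
 fixes f :: "real \<Rightarrow> complex"
 assumes f: "smooth f"
 shows "ddx (\<lambda>x. f (k * x + c)) = (\<lambda>x. of_real k * ddx f (k * x + c))"
proof
 fix x
 show "ddx (\<lambda>x. f (k * x + c)) x = of_real k * ddx f (k * x + c)"
  using dir_deriv_eq[OF dir_deriv_compose_affine[OF bounded_linear_mult_right f, of k c x], of 1]
  by (simp add: scaleR_conv_of_real)
qed

lemma continuous_compact_supp_bounded:
 fixes f :: "real \<Rightarrow> complex"
 assumes "f \<in> \<D>"
 obtains C where "C \<ge> 0" "\<And>x. norm (f x) \<le> C"
proof -
 have "compact (f ` supp f)"
  using assms by (intro compact_continuous_image smooth_continuous test_functionsD)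
 then obtain C where C: "\<And>y. y \<in> f ` supp f \<Longrightarrow> norm y \<le> C"
  using compact_imp_bounded bounded_iff by metis
 show ?thesis
 proof (rule that[of "max C 0"])
  show "norm (f x) \<le> max C 0" for x
   by (cases "f x = 0") (use C[of "f x"] in_supp[of f x] in auto)
 qed simp
qed

lemma test_borel: "f \<in> \<D> \<Longrightarrow> f \<in> borel_fun"
 by (simp add: test_functionsD smooth_borel)

lemma borel_lebesgue: "f \<in> borel_fun \<Longrightarrow> f \<in> borel_measurable lebesgue"
 by (simp add: measurable_completion)

definition bump :: "real \<Rightarrow> real \<Rightarrow> real \<Rightarrow> real \<Rightarrow> complex" where
 "bump k a b y = of_real (smooth_step (k * (y - a)) * smooth_step (k * (b - y)))"

lemma smooth_bump: "smooth (bump k a b)"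
proof -
 have "smooth (\<lambda>y. of_real (smooth_step (k * y + k * (-a))) * of_real (smooth_step ((-k) * y + k * b)))"
  by (intro smooth_mult smooth_affine[OF smooth_smooth_step])
 then show ?thesis by (simp add: bump_def[abs_def] algebra_simps)
qed

lemma bump_nz: "k > 0 \<Longrightarrow> bump k a b y \<noteq> 0 \<Longrightarrow> a < y \<and> y < b"
 by (rule ccontr) (auto simp: bump_def smooth_step_0 not_less mult_nonneg_nonpos)

lemma bump_test: "k > 0 \<Longrightarrow> bump k a b \<in> \<D>"
proof (rule test_functionsI[OF smooth_bump, of _ _ _ "{a..b}"])
 fix x assume "k > 0" "bump k a b x \<noteq> 0"
 from bump_nz[OF this] show "x \<in> {a..b}" by simp
qed simp

lemma supp_bump: "k > 0 \<Longrightarrow> supp (bump k a b) \<subseteq> {a..b}"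
proof (rule supp_subset)
 fix x assume "k > 0" "bump k a b x \<noteq> 0"
 from bump_nz[OF this] show "x \<in> {a..b}" by simp
qed simp

lemma norm_bump: "norm (bump k a b y) \<le> 1"
 by (simp add: bump_def norm_mult mult_le_one smooth_step_le_1 smooth_step_nonneg del: of_real_mult)

lemma bump_tendsto: "(\<lambda>n. bump (Suc n) a b y) \<longlonglongrightarrow> indicator {a<..<b} y"
proof (cases "a < y \<and> y < b")
 case True
 define d where "d = min (y - a) (b - y)"
 have d: "d > 0" using True by (simp add: d_def)
 obtain N where N: "1 / d < real N" using reals_Archimedean2 by blast
 have "\<forall>\<^sub>F n in sequentially. bump (Suc n) a b y = 1"
  using eventually_ge_at_top[of N]
 proof eventually_elim
  case (elim n)
  have "1 \<le> real (Suc n) * d" using N d elim by (simp add: field_simps) (smt (verit) mult_left_mono of_nat_mono)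
  moreover have "real (Suc n) * d \<le> real (Suc n) * (y - a)" "real (Suc n) * d \<le> real (Suc n) * (b - y)"
   by (auto simp: d_def intro!: mult_left_mono)
  ultimately have "1 \<le> real (Suc n) * (y - a)" "1 \<le> real (Suc n) * (b - y)" by linarith+
  then show ?case by (simp add: bump_def smooth_step_1 del: of_nat_Suc)
 qed
 then show ?thesis using True by (auto intro: tendsto_eventually)
next
 case False
 have "bump (Suc n) a b y = 0" for n using bump_nz[of "Suc n" a b y] False by auto
 then show ?thesis using False by (auto simp: indicator_def)
qed

section \<open>The fundamental lemma of the calculus of variations\<close>

lemma borel_version:
 fixes f :: "'a::euclidean_space \<Rightarrow> complex"
 assumes "f \<in> borel_measurable lebesgue"
 shows "\<exists>f'\<in>borel_fun. AE x in lborel. f x = f' x"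
proof -
 have "(\<lambda>x. Re (f x)) \<in> borel_measurable lebesgue" "(\<lambda>x. Im (f x)) \<in> borel_measurable lebesgue"
  using assms by measurable
 from this[THEN completion_ex_borel_measurable_real] obtain r i
  where ri: "r \<in> borel_measurable lborel" "i \<in> borel_measurable lborel"
   "AE x in lborel. Re (f x) = r x" "AE x in lborel. Im (f x) = i x" by blast
 have [measurable]: "r \<in> borel_fun" "i \<in> borel_fun" using ri(1,2) by auto
 have "(\<lambda>x. of_real (r x) + \<i> * of_real (i x)) \<in> borel_fun" by measurable
 moreover have "AE x in lborel. f x = of_real (r x) + \<i> * of_real (i x)"
  using ri(3,4) by eventually_elim (simp add: complex_eq_iff)
 ultimately show ?thesis by (intro bexI)
qed

lemma AE_lebesgue: "(AE x in lebesgue. P x) \<longleftrightarrow> (AE x in lborel. P x)"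
 by (rule AE_completion_iff)

text \<open>
 The open intervals are closed under intersection and generate the Borel sets, so a function all of whose interval integrals vanish has vanishing
 integral over every Borel set.
\<close>
lemma AE_eq_0_if_interval_integrals_0:
 fixes f :: "real \<Rightarrow> complex"
 assumes f: "integrable lborel f"
  and z: "\<And>a b. (LINT x:{a<..<b}|lborel. f x) = 0"
 shows "AE x in lborel. f x = 0"
proof (rule sigma_finite_measure.density_zero[OF sigma_finite_lborel f])
 have gen: "sets (borel :: real measure) = sigma_sets UNIV (range (\<lambda>(a, b). {a<..<b}))"
 proof -
  have "(\<lambda>(a::real, b). box a b) = (\<lambda>(a, b). {a<..<b})" by (auto simp: fun_eq_iff)
  then show ?thesis by (subst borel_eq_box) (simp only: sets_measure_of Pow_UNIV subset_UNIV)
 qed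
 have set_int: "set_integrable lborel A f" if "A \<in> sets lborel" for A
  using f that integrable_mult_indicator unfolding set_integrable_def by blast
 have all: "(LINT x:UNIV|lborel. f x) = 0"
 proof -
  have "(\<lambda>n::nat. LBINT x. indicat_real {-real n<..<real n} x *\<^sub>R f x) \<longlonglongrightarrow> (LBINT x. f x)"
  proof (rule integral_dominated_convergence[where w = "\<lambda>x. norm (f x)"])
   show "AE x in lborel. (\<lambda>i. indicat_real {- real i<..<real i} x *\<^sub>R f x) \<longlonglongrightarrow> f x"
   proof (rule AE_I2, rule tendsto_eventually)
    fix x
    obtain N where "\<bar>x\<bar> < real N" using reals_Archimedean2 by blast
    then show "\<forall>\<^sub>F i in sequentially. indicat_real {- real i<..<real i} x *\<^sub>R f x = f x"
     by (intro eventually_mono[OF eventually_ge_at_top[of N]]) (auto simp: indicator_def)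
   qed
  qed (use f in \<open>auto simp: indicator_def\<close>)
  then show ?thesis using z by (simp add: set_lebesgue_integral_def LIMSEQ_const_iff)
 qed
 fix A :: "real set"
 assume "A \<in> sets lborel"
 then have mem: "A \<in> sigma_sets UNIV (range (\<lambda>(a, b). {a<..<b}))"
  by (simp add: gen)
 have stable: "Int_stable (range (\<lambda>(a::real, b). {a<..<b}))"
 proof (rule Int_stableI_image)
  fix i j :: "real \<times> real"
  show "\<exists>k\<in>UNIV. (case i of (a, b) \<Rightarrow> {a<..<b}) \<inter> (case j of (a, b) \<Rightarrow> {a<..<b}) = (case k of (a, b) \<Rightarrow> {a<..<b})"
   by (cases i; cases j) (auto intro!: bexI[of _ "(max (fst i) (fst j), min (snd i) (snd j))"])
 qed
 have "range (\<lambda>(a::real, b). {a<..<b}) \<subseteq> Pow UNIV" by simp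
 from stable this mem show "(LINT x:A|lborel. f x) = 0"
 proof (induction rule: sigma_sets_induct_disjoint)
  case (basic A)
  then show ?case using z by auto
 next
  case empty
  show ?case by (simp add: set_lebesgue_integral_def)
 next
  case (compl A)
  then have A: "A \<in> sets lborel"
   by (simp add: gen)
  have "(LINT x:(UNIV - A) \<union> A|lborel. f x) = (LINT x:UNIV - A|lborel. f x) + (LINT x:A|lborel. f x)"
   using A by (intro set_integral_Un set_int) auto
  then show ?case using all compl by simp
 next
  case (union A)
  then have A: "A i \<in> sets lborel" for i
   by (auto simp: gen)
  have "(LINT x:(\<Union>i. A i)|lborel. f x) = (\<Sum>i. LINT x:A i|lborel. f x)"
   using union(1) A by (intro lebesgue_integral_countable_add set_int) (auto simp: disjoint_family_on_def)
  then show ?case by (simp add: union)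
 qed
qed

text \<open>
 The smooth bumps tend boundedly to the indicator of an interval, so the integrals over all intervals in \<open>S\<close> vanish.
\<close>
lemma fundamental_lemma:
 fixes f :: "real \<Rightarrow> complex"
 assumes S: "open S"
  and int: "\<And>a b. {a..b} \<subseteq> S \<Longrightarrow> set_integrable lebesgue {a..b} f"
  and z: "\<And>\<psi>. \<psi> \<in> \<D> \<Longrightarrow> supp \<psi> \<subseteq> S \<Longrightarrow> (LINT x|lebesgue. f x * \<psi> x) = 0"
 shows "AE x in lebesgue. x \<in> S \<longrightarrow> f x = 0"
proof -
 have loc: "AE x in lebesgue. x \<in> {a..b} \<longrightarrow> f x = 0" if ab: "{a..b} \<subseteq> S" for a b
 proof -
  define g where "g x = indicat_real {a..b} x *\<^sub>R f x" for x
  have gi: "integrable lebesgue g" using int[OF ab] by (simp add: g_def[abs_def] set_integrable_def)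
  then obtain g' where g': "g' \<in> borel_fun" "AE x in lborel. g x = g' x"
   using borel_version[of g] by (auto simp: integrable_iff_bounded)
  have g'L: "integrable lebesgue g'"
   using gi by (rule integrable_cong_AE_imp) (use g' in \<open>auto simp: AE_lebesgue borel_lebesgue elim: eventually_mono\<close>)
  then have g'i: "integrable lborel g'" using g'(1) by (simp add: integrable_completion)
  have "(LINT x:{c<..<d}|lborel. g' x) = 0" for c d
  proof -
   define \<psi> where "\<psi> n = bump (Suc n) (max a c) (min b d)" for n
   have ind: "indicator {max a c<..<min b d} x * g x = indicator {c<..<d} x * g x" if "x \<noteq> a" "x \<noteq> b" for x
    using that by (auto simp: g_def indicator_def)
   have "(\<lambda>n. LINT x|lebesgue. \<psi> n x * g x) \<longlonglongrightarrow> (LINT x|lebesgue. indicator {max a c<..<min b d} x * g x)"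
   proof (rule integral_dominated_convergence[where w = "\<lambda>x. norm (g x)"])
    show "AE x in lebesgue. (\<lambda>n. \<psi> n x * g x) \<longlonglongrightarrow> indicator {max a c<..<min b d} x * g x"
     unfolding \<psi>_def by (intro AE_I2 tendsto_mult_right bump_tendsto)
    show "AE x in lebesgue. norm (\<psi> i x * g x) \<le> norm (g x)" for i
     unfolding \<psi>_def by (intro AE_I2) (simp add: norm_mult mult_left_le_one_le norm_bump)
    have "g \<in> borel_measurable lebesgue" using gi by auto
    then show "(\<lambda>x. \<psi> i x * g x) \<in> borel_measurable lebesgue"
     "(\<lambda>x. indicator {max a c<..<min b d} x * g x) \<in> borel_measurable lebesgue" for i
     unfolding \<psi>_def by (auto intro!: borel_measurable_times borel_lebesgue[OF test_borel[OF bump_test]] borel_measurable_indicator)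
   qed (use gi in auto)
   moreover have "(LINT x|lebesgue. \<psi> n x * g x) = 0" for n
   proof -
    have "supp (\<psi> n) \<subseteq> {a..b}" using supp_bump[of "Suc n" "max a c" "min b d"] by (auto simp: \<psi>_def)
    then have 1: "(LINT x|lebesgue. f x * \<psi> n x) = 0"
     using ab by (intro z) (auto simp: \<psi>_def bump_test)
    have "\<psi> n x = 0" if "x \<notin> {a..b}" for x
     using in_supp[of "\<psi> n" x] that \<open>supp (\<psi> n) \<subseteq> {a..b}\<close> by (metis subsetD)
    then have "(\<lambda>x. \<psi> n x * g x) = (\<lambda>x. f x * \<psi> n x)"
     by (auto simp: fun_eq_iff g_def indicator_def)
    note 1 this
    then show ?thesis by simp
   qed
   ultimately have "(LINT x|lebesgue. indicator {max a c<..<min b d} x * g x) = 0"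
    by (simp add: LIMSEQ_const_iff)
   moreover have "(LINT x|lebesgue. indicator {max a c<..<min b d} x * g x) = (LINT x|lebesgue. indicat_real {c<..<d} x *\<^sub>R g' x)"
   proof (rule integral_cong_AE)
    show "AE x in lebesgue. indicator {max a c<..<min b d} x * g x = indicat_real {c<..<d} x *\<^sub>R g' x"
     using g'(2)[folded AE_lebesgue] AE_lebesgue[THEN iffD2, OF AE_lborel_singleton[of a]]
      AE_lebesgue[THEN iffD2, OF AE_lborel_singleton[of b]]
    proof eventually_elim
     case (elim x)
     have e: "indicat_real {c<..<d} x *\<^sub>R g' x = indicator {c<..<d} x * g x"
      using elim(1) by (simp add: indicator_def)
     show ?case unfolding e using elim(2,3) by (rule ind)
    qed
    have "g \<in> borel_measurable lebesgue" "g' \<in> borel_measurable lebesgue" using gi g'L by auto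
    then show "(\<lambda>x. indicator {max a c<..<min b d} x * g x) \<in> borel_measurable lebesgue"
     "(\<lambda>x. indicat_real {c<..<d} x *\<^sub>R g' x) \<in> borel_measurable lebesgue"
     by (auto intro!: borel_measurable_times borel_measurable_scaleR borel_measurable_indicator)
   qed
   ultimately show ?thesis
    using g'(1) by (simp add: set_lebesgue_integral_def integral_completion)
  qed
  from AE_eq_0_if_interval_integrals_0[OF g'i this] g'(2)
  show ?thesis unfolding AE_lebesgue by eventually_elim (auto simp: g_def)
 qed
 let ?Q = "{(a::rat, b::rat). {of_rat a..of_rat b} \<subseteq> S}"
 have "AE x in lebesgue. \<forall>(a, b)\<in>?Q. x \<in> {of_rat a..of_rat b} \<longrightarrow> f x = 0"
 proof (subst AE_ball_countable)
  show "\<forall>y\<in>?Q. AE x in lebesgue. case y of (a, b) \<Rightarrow> x \<in> {of_rat a..of_rat b} \<longrightarrow> f x = 0"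
   using loc by (auto simp del: atLeastAtMost_iff)
 qed (rule countable_subset[OF subset_UNIV], simp)
 then show ?thesis
 proof eventually_elim
  case (elim x)
  show ?case
  proof
   assume "x \<in> S"
   then obtain e where e: "e > 0" "ball x e \<subseteq> S" using S open_contains_ball by blast
   obtain a b where "of_rat a \<in> {x - e<..<x}" "of_rat b \<in> {x<..<x + e}"
    using of_rat_dense[of "x - e" x] of_rat_dense[of x "x + e"] e(1) by auto
   then have "{of_rat a..of_rat b} \<subseteq> ball x e" "x \<in> {of_rat a..of_rat b}" by (auto simp: dist_real_def)
   then show "f x = 0" using elim e(2) by blast
  qed
 qed
qed

section \<open>Square integrable functions\<close>

definition pairing :: "(real \<Rightarrow> complex) \<Rightarrow> (real \<Rightarrow> complex) \<Rightarrow> complex" where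
 "pairing f g = (LINT x|lebesgue. f x * g x)"

lemma L2_D:
 assumes "f \<in> L2"
 shows "f \<in> borel_measurable lebesgue" "integrable lebesgue (\<lambda>x. (norm (f x))\<^sup>2)"
 using assms by (auto simp: L2_def)

lemma L2_norm_nonneg: "0 \<le> L2_norm f"
 by (simp add: L2_norm_def)

lemma L2_norm_sq: "(L2_norm f)\<^sup>2 = (LINT x|lebesgue. (norm (f x))\<^sup>2)"
 by (simp add: L2_norm_def)

lemma L2_nn_integral: "f \<in> L2 \<Longrightarrow> (\<integral>\<^sup>+x. ennreal ((norm (f x))\<^sup>2) \<partial>lebesgue) = ennreal ((L2_norm f)\<^sup>2)"
 by (simp add: L2_norm_sq nn_integral_eq_integral L2_D)

lemma L2_I_nn:
 assumes "f \<in> borel_measurable lebesgue" "(\<integral>\<^sup>+x. ennreal ((norm (f x))\<^sup>2) \<partial>lebesgue) \<le> ennreal (c\<^sup>2)" "0 \<le> c"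
 shows "f \<in> L2" "L2_norm f \<le> c"
proof -
 have "integrable lebesgue (\<lambda>x. (norm (f x))\<^sup>2)"
 proof (rule integrableI_bounded)
  show "(\<integral>\<^sup>+x. enorm ((norm (f x))\<^sup>2) \<partial>lebesgue) < \<infinity>"
   using le_less_trans[OF assms(2) ennreal_less_top] by simp
 qed (use assms(1) in measurable)
 with assms(1) show L: "f \<in> L2" by (simp add: L2_def)
 show "L2_norm f \<le> c"
  using assms(2,3) L2_norm_nonneg[of f] unfolding L2_nn_integral[OF L]
  by (simp add: power2_le_iff_abs_le abs_le_square_iff)
qed

lemma Cauchy_Schwarz_L2_nn:
 assumes "f \<in> L2" "g \<in> L2"
 shows "(\<integral>\<^sup>+x. enorm (f x * g x) \<partial>lebesgue) \<le> ennreal (L2_norm f * L2_norm g)"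
proof -
 note [measurable] = L2_D(1)[OF assms(1)] L2_D(1)[OF assms(2)]
 let ?I = "\<integral>\<^sup>+x. enorm (f x) * enorm (g x) \<partial>lebesgue"
 have "?I\<^sup>2 \<le> (\<integral>\<^sup>+x. enorm (f x)^2 \<partial>lebesgue) * (\<integral>\<^sup>+x. enorm (g x)^2 \<partial>lebesgue)"
  by (rule Cauchy_Schwarz_nn_integral) measurable
 also have "\<dots> = ennreal ((L2_norm f * L2_norm g)\<^sup>2)"
  using L2_nn_integral[OF assms(1)] L2_nn_integral[OF assms(2)]
  by (simp add: ennreal_power ennreal_mult' power_mult_distrib)
 finally have le: "?I\<^sup>2 \<le> ennreal ((L2_norm f * L2_norm g)\<^sup>2)" .
 have "?I \<le> ennreal (L2_norm f * L2_norm g)"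
 proof (cases ?I)
  case (real r)
  then show ?thesis using le L2_norm_nonneg[of f] L2_norm_nonneg[of g]
   by (simp add: ennreal_power abs_le_square_iff[symmetric])
 qed (use le in \<open>auto simp: top_unique power2_eq_square ennreal_mult_top\<close>)
 then show ?thesis by (simp add: norm_mult ennreal_mult')
qed

lemma L2_mult_integrable:
 assumes "f \<in> L2" "g \<in> L2"
 shows "integrable lebesgue (\<lambda>x. f x * g x)"
proof (rule integrableI_bounded)
 note [measurable] = L2_D(1)[OF assms(1)] L2_D(1)[OF assms(2)]
 show "(\<lambda>x. f x * g x) \<in> borel_measurable lebesgue" by measurable
 show "(\<integral>\<^sup>+x. enorm (f x * g x) \<partial>lebesgue) < \<infinity>"
  using le_less_trans[OF Cauchy_Schwarz_L2_nn[OF assms] ennreal_less_top] by simp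
qed

lemma Cauchy_Schwarz_L2:
 assumes "f \<in> L2" "g \<in> L2"
 shows "(LINT x|lebesgue. norm (f x * g x)) \<le> L2_norm f * L2_norm g"
proof -
 have "ennreal (LINT x|lebesgue. norm (f x * g x)) \<le> ennreal (L2_norm f * L2_norm g)"
  using Cauchy_Schwarz_L2_nn[OF assms] L2_mult_integrable[OF assms]
  by (subst nn_integral_eq_integral[symmetric]) auto
 then show ?thesis using L2_norm_nonneg[of f] L2_norm_nonneg[of g] by simp
qed

lemma pairing_bound:
 assumes "f \<in> L2" "g \<in> L2"
 shows "norm (pairing f g) \<le> L2_norm f * L2_norm g"
 unfolding pairing_def using order_trans[OF integral_norm_bound Cauchy_Schwarz_L2[OF assms]] .

lemma L2_mono:
 assumes "f \<in> L2" "g \<in> borel_measurable lebesgue" "AE x in lebesgue. norm (g x) \<le> norm (f x)"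
 shows "g \<in> L2" "L2_norm g \<le> L2_norm f"
proof -
 have "(\<integral>\<^sup>+x. ennreal ((norm (g x))\<^sup>2) \<partial>lebesgue) \<le> (\<integral>\<^sup>+x. ennreal ((norm (f x))\<^sup>2) \<partial>lebesgue)"
  by (rule nn_integral_mono_AE) (use assms(3) in \<open>auto elim!: eventually_mono intro!: ennreal_leI power_mono\<close>)
 then show "g \<in> L2" "L2_norm g \<le> L2_norm f"
  using L2_I_nn[OF assms(2)] L2_norm_nonneg[of f] by (auto simp: L2_nn_integral[OF assms(1)])
qed

lemma L2_norm_cong:
 assumes "f \<in> borel_measurable lebesgue" "g \<in> borel_measurable lebesgue" "AE x in lebesgue. f x = g x"
 shows "L2_norm f = L2_norm g"
proof -
 have [measurable]: "f \<in> borel_measurable lebesgue" "g \<in> borel_measurable lebesgue" using assms by auto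
 show ?thesis unfolding L2_norm_def
  by (intro arg_cong[of _ _ sqrt] integral_cong_AE) (use assms(3) in \<open>auto elim: eventually_mono\<close>)
qed

lemma L2_cmult:
 assumes "f \<in> L2"
 shows "(\<lambda>x. c * f x) \<in> L2" "L2_norm (\<lambda>x. c * f x) = norm c * L2_norm f"
proof -
 have [measurable]: "f \<in> borel_measurable lebesgue" using assms L2_D by auto
 have e: "(\<lambda>x. (norm (c * f x))\<^sup>2) = (\<lambda>x. (norm c)\<^sup>2 * (norm (f x))\<^sup>2)" by (simp add: norm_mult power_mult_distrib)
 show "(\<lambda>x. c * f x) \<in> L2" using L2_D[OF assms] by (simp add: L2_def e)
 show "L2_norm (\<lambda>x. c * f x) = norm c * L2_norm f" by (simp add: L2_norm_def e real_sqrt_mult)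
qed

lemma L2_add:
 assumes "f \<in> L2" "g \<in> L2"
 shows "(\<lambda>x. f x + g x) \<in> L2" "L2_norm (\<lambda>x. f x + g x) \<le> L2_norm f + L2_norm g"
proof -
 note [measurable] = L2_D(1)[OF assms(1)] L2_D(1)[OF assms(2)]
 note i = L2_D(2)[OF assms(1)] L2_D(2)[OF assms(2)] integrable_norm[OF L2_mult_integrable[OF assms]]
 have pt: "(norm (f x + g x))\<^sup>2 \<le> (norm (f x))\<^sup>2 + 2 * norm (f x * g x) + (norm (g x))\<^sup>2" for x
  using power_mono[OF norm_triangle_ineq[of "f x" "g x"], of 2] by (simp add: power2_sum norm_mult algebra_simps)
 have ib: "integrable lebesgue (\<lambda>x. (norm (f x))\<^sup>2 + 2 * norm (f x * g x) + (norm (g x))\<^sup>2)"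
  using i by (intro Bochner_Integration.integrable_add integrable_mult_right) auto
 have sq: "integrable lebesgue (\<lambda>x. (norm (f x + g x))\<^sup>2)"
  by (rule Bochner_Integration.integrable_bound[OF ib]) (use pt in \<open>auto intro!: AE_I2 order_trans[OF pt]\<close>)
 then show "(\<lambda>x. f x + g x) \<in> L2" by (simp add: L2_def)
 have "(L2_norm (\<lambda>x. f x + g x))\<^sup>2 \<le> (LINT x|lebesgue. (norm (f x))\<^sup>2 + 2 * norm (f x * g x) + (norm (g x))\<^sup>2)"
  unfolding L2_norm_sq using sq ib pt by (intro integral_mono) auto
 also have "\<dots> = (L2_norm f)\<^sup>2 + 2 * (LINT x|lebesgue. norm (f x * g x)) + (L2_norm g)\<^sup>2"
  unfolding L2_norm_sq using i by (simp add: Bochner_Integration.integral_add)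
 also have "\<dots> \<le> (L2_norm f + L2_norm g)\<^sup>2"
  using Cauchy_Schwarz_L2[OF assms] by (simp add: power2_sum)
 finally show "L2_norm (\<lambda>x. f x + g x) \<le> L2_norm f + L2_norm g"
  by (rule power2_le_imp_le) (simp add: L2_norm_nonneg)
qed

lemma L2_diff:
 assumes "f \<in> L2" "g \<in> L2"
 shows "(\<lambda>x. f x - g x) \<in> L2" "L2_norm (\<lambda>x. f x - g x) \<le> L2_norm f + L2_norm g"
 using L2_add[OF assms(1) L2_cmult(1)[OF assms(2), of "-1"]] L2_cmult(2)[OF assms(2), of "-1"] by simp_all

lemma L2_norm_triangle_diff:
 assumes "f \<in> L2" "g \<in> L2"
 shows "L2_norm f \<le> L2_norm g + L2_norm (\<lambda>x. f x - g x)"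
 using L2_add(2)[OF assms(2) L2_diff(1)[OF assms]] by simp

lemma L2_norm_eq_0: 
 assumes "f \<in> L2" "L2_norm f = 0" shows "AE x in lebesgue. f x = 0"
proof -
 have "(LINT x|lebesgue. (norm (f x))\<^sup>2) = 0" using assms(2) by (simp add: L2_norm_def)
 then show ?thesis using integral_nonneg_eq_0_iff_AE[OF L2_D(2)[OF assms(1)]] by simp
qed

lemma L2_mult_bounded:
 assumes "f \<in> L2" "h \<in> borel_measurable lebesgue" "\<And>x. norm (h x) \<le> C" "0 \<le> C"
 shows "(\<lambda>x. h x * f x) \<in> L2" "L2_norm (\<lambda>x. h x * f x) \<le> C * L2_norm f"
proof -
 note [measurable] = L2_D(1)[OF assms(1)] assms(2)
 have "AE x in lebesgue. norm (h x * f x) \<le> norm (of_real C * f x)"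
  using assms(3,4) by (intro AE_I2) (simp add: norm_mult mult_right_mono)
 from L2_mono[OF L2_cmult(1)[OF assms(1)] _ this] L2_cmult(2)[OF assms(1), of "of_real C"] assms(4)
 show "(\<lambda>x. h x * f x) \<in> L2" "L2_norm (\<lambda>x. h x * f x) \<le> C * L2_norm f" by auto
qed

lemma lebesgue_affine_measurable_real: "k \<noteq> 0 \<Longrightarrow> (\<lambda>x::real. c + k * x) \<in> lebesgue \<rightarrow>\<^sub>M lebesgue"
 using lebesgue_affine_measurable[of "\<lambda>_. k" c] by simp

lemma AE_lebesgue_affine:
 fixes k c :: real
 assumes k: "k \<noteq> 0" and ae: "AE x in lebesgue. P x"
 shows "AE x in lebesgue. P (c + k * x)"
proof -
 from ae obtain N where N: "N \<in> null_sets lebesgue" "{x. \<not> P x} \<subseteq> N"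
  by (auto simp: eventually_ae_filter)
 have "AE x in distr lebesgue lebesgue (\<lambda>x. c + k * x). x \<notin> N"
 proof -
  have "AE x in lebesgue. x \<notin> N" using N(1) by (rule AE_not_in)
  then show ?thesis
   by (subst (asm) lebesgue_real_affine[OF k, of c], subst (asm) AE_density) (use k in auto)
 qed
 then have "AE x in lebesgue. c + k * x \<notin> N"
 proof (subst (asm) AE_distr_iff)
  have "{x \<in> space lebesgue. x \<notin> N} = space lebesgue - N" by auto
  then show "{x \<in> space lebesgue. x \<notin> N} \<in> sets lebesgue" using N(1) by (auto simp only: sets.compl_sets null_setsD2)
 qed (use lebesgue_affine_measurable_real[OF k] in auto)
 then show ?thesis by (rule eventually_mono) (use N(2) in auto)
qed

lemma L2_affine:
 assumes f: "f \<in> L2" and s: "\<bar>s\<bar> = 1"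
 shows "(\<lambda>x. f (c + s * x)) \<in> L2" "L2_norm (\<lambda>x. f (c + s * x)) = L2_norm f"
proof -
 have s0: "s \<noteq> 0" using s by auto
 have "(\<lambda>x. f (c + s * x)) \<in> borel_measurable lebesgue"
  using measurable_compose[OF lebesgue_affine_measurable_real[OF s0] L2_D(1)[OF f]] .
 then show "(\<lambda>x. f (c + s * x)) \<in> L2"
  using lebesgue_integrable_real_affine_iff[OF s0, of "\<lambda>x. (norm (f x))\<^sup>2" c] L2_D(2)[OF f] by (simp add: L2_def)
 show "L2_norm (\<lambda>x. f (c + s * x)) = L2_norm f"
  using lebesgue_integral_real_affine[OF s0, of "\<lambda>x. (norm (f x))\<^sup>2" c] s by (simp add: L2_norm_def)
qed

lemma pairing_affine:
 assumes "\<bar>s\<bar> = 1"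
 shows "pairing f g = pairing (\<lambda>x. f (c + s * x)) (\<lambda>x. g (c + s * x))"
 unfolding pairing_def using lebesgue_integral_real_affine[of s "\<lambda>x. f x * g x" c] assms by auto

lemma indicator_L2: "{a..b} \<noteq> {} \<Longrightarrow> (indicator {a..b} :: real \<Rightarrow> complex) \<in> L2"
 "a \<le> b \<Longrightarrow> L2_norm (indicator {a..b}) = sqrt (b - a)"
proof -
 have [simp]: "(norm (indicator {a..b} x :: complex))\<^sup>2 = indicat_real {a..b} x" for x by (simp add: indicator_def)
 have "integrable lebesgue (indicat_real {a..b})"
  by (rule integrable_real_indicator) (auto simp: emeasure_lborel_Icc_eq)
 then show "(indicator {a..b} :: real \<Rightarrow> complex) \<in> L2" by (auto simp: L2_def intro!: borel_measurable_indicator)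
 show "a \<le> b \<Longrightarrow> L2_norm (indicator {a..b}) = sqrt (b - a)" by (simp add: L2_norm_def)
qed

lemma test_L2:
 assumes "\<psi> \<in> \<D>"
 shows "\<psi> \<in> L2"
proof -
 obtain M where M: "M > 0" "supp \<psi> \<subseteq> {-M..M}" "\<And>x. \<bar>x\<bar> > M \<Longrightarrow> \<psi> x = 0" using test_function_support[OF assms] by metis
 obtain C where C: "C \<ge> 0" "\<And>x. norm (\<psi> x) \<le> C" using continuous_compact_supp_bounded[OF assms] by metis
 have "(\<lambda>x. \<psi> x * indicator {-M..M} x) \<in> L2"
  using L2_mult_bounded(1)[OF indicator_L2(1)[of "-M" M] borel_lebesgue[OF test_borel[OF assms]] C(2,1)] M(1) by auto
 moreover have "(\<lambda>x. \<psi> x * indicator {-M..M} x) = \<psi>" 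
 proof
  fix x show "\<psi> x * indicator {-M..M} x = \<psi> x"
   using M(3)[of x] by (cases "\<bar>x\<bar> \<le> M") (auto simp: indicator_def abs_le_iff)
 qed
 ultimately show ?thesis by simp
qed

lemma fundamental_lemma_L2:
 fixes f :: "real \<Rightarrow> complex"
 assumes S: "open S" and f: "f \<in> L2"
  and z: "\<And>\<psi>. \<psi> \<in> \<D> \<Longrightarrow> supp \<psi> \<subseteq> S \<Longrightarrow> pairing f \<psi> = 0"
 shows "AE x in lebesgue. x \<in> S \<longrightarrow> f x = 0"
proof (rule fundamental_lemma[OF S])
 fix a b :: real
 show "set_integrable lebesgue {a..b} f"
 proof (cases "a \<le> b")
  case True
  have "integrable lebesgue (\<lambda>x. indicator {a..b} x * f x)" using True by (intro L2_mult_integrable indicator_L2 f) auto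
  moreover have "(\<lambda>x. indicator {a..b} x * f x) = (\<lambda>x. indicat_real {a..b} x *\<^sub>R f x)" by (auto simp: indicator_def)
  ultimately show ?thesis by (simp add: set_integrable_def)
 qed simp
qed (use z in \<open>auto simp: pairing_def\<close>)

section \<open>Continuously differentiable curves of square integrable functions\<close>

lemma pairing_diff:
 assumes "f \<in> L2" "f' \<in> L2" "g \<in> L2"
 shows "pairing (\<lambda>x. f x - f' x) g = pairing f g - pairing f' g"
 unfolding pairing_def by (simp add: left_diff_distrib Bochner_Integration.integral_diff L2_mult_integrable assms)

lemma pairing_commute: "pairing f g = pairing g f"
 by (simp add: pairing_def mult.commute)

lemma pairing_add:
 assumes "f \<in> L2" "f' \<in> L2" "g \<in> L2"
 shows "pairing (\<lambda>x. f x + f' x) g = pairing f g + pairing f' g"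
 unfolding pairing_def by (simp add: distrib_right Bochner_Integration.integral_add L2_mult_integrable assms)

lemma pairing_cmult: "pairing (\<lambda>x. c * f x) g = c * pairing f g" "pairing f (\<lambda>x. c * g x) = c * pairing f g"
 unfolding pairing_def by (simp_all add: mult.assoc mult.left_commute[of _ c])

lemma tendsto_pairing:
 assumes v: "\<And>s. v s \<in> L2" "v0 \<in> L2" "((\<lambda>s. L2_norm (\<lambda>x. v s x - v0 x)) \<longlongrightarrow> 0) F"
  and w: "\<And>s. w s \<in> L2" "w0 \<in> L2" "((\<lambda>s. L2_norm (\<lambda>x. w s x - w0 x)) \<longlongrightarrow> 0) F"
 shows "((\<lambda>s. pairing (v s) (w s)) \<longlongrightarrow> pairing v0 w0) F"
proof (rule LIM_zero_cancel)
 let ?V = "\<lambda>s. L2_norm (\<lambda>x. v s x - v0 x)" and ?W = "\<lambda>s. L2_norm (\<lambda>x. w s x - w0 x)"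
 have lim: "((\<lambda>s. ?V s * (L2_norm w0 + ?W s) + L2_norm v0 * ?W s) \<longlongrightarrow> 0 * (L2_norm w0 + 0) + L2_norm v0 * 0) F"
  by (intro tendsto_intros v w)
 have le: "norm (pairing (v s) (w s) - pairing v0 w0) \<le> ?V s * (L2_norm w0 + ?W s) + L2_norm v0 * ?W s" for s
 proof -
  have "pairing (v s) (w s) - pairing v0 w0 = pairing (\<lambda>x. v s x - v0 x) (w s) + pairing v0 (\<lambda>x. w s x - w0 x)"
   by (simp add: pairing_diff v w pairing_commute[of v0])
  also have "norm \<dots> \<le> ?V s * L2_norm (w s) + L2_norm v0 * ?W s"
   by (intro norm_triangle_le add_mono pairing_bound L2_diff v w)
  also have "\<dots> \<le> ?V s * (L2_norm w0 + ?W s) + L2_norm v0 * ?W s"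
   by (intro add_mono mult_left_mono L2_norm_triangle_diff v w L2_norm_nonneg order_refl)
  finally show ?thesis .
 qed
 show "((\<lambda>s. pairing (v s) (w s) - pairing v0 w0) \<longlongrightarrow> 0) F"
  by (rule Lim_null_comparison[OF always_eventually]) (use le lim in auto)
qed

lemma C0_L2_D:
 assumes "v \<in> C0_L2"
 shows "v t \<in> L2" "((\<lambda>s. L2_norm (\<lambda>x. v s x - v t x)) \<longlongrightarrow> 0) (at t)"
 using assms by (auto simp: C0_L2_def)

lemma C0_L2_pairing_continuous:
 assumes "v \<in> C0_L2" "w \<in> C0_L2"
 shows "continuous_on S (\<lambda>t. pairing (v t) (w t))"
 by (rule continuous_at_imp_continuous_on)
  (auto simp: continuous_at intro!: tendsto_pairing C0_L2_D assms)

lemma C0_L2_norm_continuous: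
 assumes "v \<in> C0_L2"
 shows "continuous_on S (\<lambda>t. L2_norm (v t))"
proof (rule continuous_at_imp_continuous_on, rule ballI, unfold continuous_at)
 fix t
 note v = C0_L2_D[OF assms]
 show "((\<lambda>t. L2_norm (v t)) \<longlongrightarrow> L2_norm (v t)) (at t)"
 proof (rule LIM_zero_cancel, rule Lim_null_comparison[OF always_eventually v(2)], rule allI)
  fix s
  have "L2_norm (\<lambda>x. v t x - v s x) = L2_norm (\<lambda>x. v s x - v t x)"
   by (simp add: L2_norm_def norm_minus_commute)
  then show "norm (L2_norm (v s) - L2_norm (v t)) \<le> L2_norm (\<lambda>x. v s x - v t x)"
   using L2_norm_triangle_diff[OF v(1)[of t] v(1)[of s]] L2_norm_triangle_diff[OF v(1)[of s] v(1)[of t]] by simp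
 qed
qed

definition C1_curve :: "(real \<Rightarrow> real \<Rightarrow> complex) \<Rightarrow> (real \<Rightarrow> real \<Rightarrow> complex) \<Rightarrow> bool" where
 "C1_curve v v' \<longleftrightarrow> v \<in> C0_L2 \<and> v' \<in> C0_L2 \<and> has_L2_time_deriv v v'"

lemma C1_curveD:
 assumes "C1_curve v v'"
 shows "v \<in> C0_L2" "v' \<in> C0_L2" "v t \<in> L2" "v' t \<in> L2"
  "((\<lambda>h. L2_norm (\<lambda>x. (v (t + h) x - v t x) / of_real h - v' t x)) \<longlongrightarrow> 0) (at 0)"
 using assms by (auto simp: C1_curve_def has_L2_time_deriv_def C0_L2_def)

lemma has_vector_derivative_quotient:
 fixes f :: "real \<Rightarrow> complex"
 assumes "((\<lambda>h. (f (t + h) - f t) / of_real h) \<longlongrightarrow> d0) (at 0)"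
 shows "(f has_vector_derivative d0) (at t)"
 unfolding has_vector_derivative_def has_derivative_at
proof (intro conjI)
 have "((\<lambda>h. norm ((f (t + h) - f t) / of_real h - d0)) \<longlongrightarrow> 0) (at 0)"
  using assms by (simp add: tendsto_norm_zero LIM_zero)
 moreover have "norm ((f (t + h) - f t) / of_real h - d0) = norm (f (t + h) - f t - h *\<^sub>R d0) / norm h" if "h \<noteq> 0" for h
 proof -
  have "(f (t + h) - f t) / of_real h - d0 = (f (t + h) - f t - h *\<^sub>R d0) / of_real h"
   using that by (simp add: field_simps scaleR_conv_of_real)
  then show ?thesis by (simp add: norm_divide)
 qed
 ultimately show "((\<lambda>h. norm (f (t + h) - f t - h *\<^sub>R d0) / norm h) \<longlongrightarrow> 0) (at 0)"
  by (elim Lim_transform_eventually) (auto simp: eventually_at_filter)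
qed (rule bounded_linear_scaleR_left)

text \<open>
 Differentiability in \<open>L\<^sup>2\<close> turns into ordinary differentiability after pairing; this is how the weak equation is reduced to
 ordinary calculus in time.
\<close>
lemma pairing_has_vector_derivative:
 assumes v: "C1_curve v v'" and w: "C1_curve w w'"
 shows "((\<lambda>t. pairing (v t) (w t)) has_vector_derivative (pairing (v' t) (w t) + pairing (v t) (w' t))) (at t)"
proof (rule has_vector_derivative_quotient)
 note V = C1_curveD[OF v] and W = C1_curveD[OF w]
 let ?v = "\<lambda>h x. (v (t + h) x - v t x) / of_real h" and ?w = "\<lambda>h x. (w (t + h) x - w t x) / of_real h"
 have vL: "?v h \<in> L2" and wL: "?w h \<in> L2" for h
  using L2_cmult(1)[OF L2_diff(1)[OF V(3) V(3)], of "1 / of_real h"] L2_cmult(1)[OF L2_diff(1)[OF W(3) W(3)], of "1 / of_real h"] by simp_all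
 have wc: "((\<lambda>h. L2_norm (\<lambda>x. w (t + h) x - w t x)) \<longlongrightarrow> 0) (at 0)"
  using C0_L2_D(2)[OF W(1), of t] by (subst (asm) LIM_offset_zero_iff) auto
 have "((\<lambda>h. pairing (?v h) (w (t + h)) + pairing (v t) (?w h)) \<longlongrightarrow> pairing (v' t) (w t) + pairing (v t) (w' t)) (at 0)"
  by (intro tendsto_add tendsto_pairing vL wL V W wc) (simp add: L2_norm_def)
 moreover have "pairing (?v h) (w (t + h)) + pairing (v t) (?w h) = (pairing (v (t + h)) (w (t + h)) - pairing (v t) (w t)) / of_real h" for h
 proof -
  have "pairing (?v h) (w (t + h)) = (pairing (v (t+h)) (w (t+h)) - pairing (v t) (w (t+h))) / of_real h"
   using pairing_cmult(1)[of "1 / of_real h" "\<lambda>x. v (t + h) x - v t x" "w (t + h)"] by (simp add: pairing_diff V W)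
  moreover have "pairing (v t) (?w h) = (pairing (v t) (w (t+h)) - pairing (v t) (w t)) / of_real h"
   using pairing_cmult(1)[of "1 / of_real h" "\<lambda>x. w (t + h) x - w t x" "v t"] by (simp add: pairing_diff V W pairing_commute[of "v t"])
  ultimately show ?thesis by (simp add: diff_divide_distrib)
 qed
 ultimately show "((\<lambda>h. (pairing (v (t + h)) (w (t + h)) - pairing (v t) (w t)) / of_real h) \<longlongrightarrow> pairing (v' t) (w t) + pairing (v t) (w' t)) (at 0)"
  by simp
qed

section \<open>Operations on curves of square integrable functions\<close>

lemma eventually_at_ballI:
 fixes a :: real
 assumes "\<And>x. x \<in> ball a d \<Longrightarrow> x \<noteq> a \<Longrightarrow> P x" "0 < d"
 shows "\<forall>\<^sub>F x in at a. P x"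
 unfolding eventually_at using assms by (auto simp: dist_commute)

lemma vector_derivative_bound:
 fixes f :: "real \<Rightarrow> complex"
 assumes d: "\<And>t. a \<le> t \<Longrightarrow> t \<le> b \<Longrightarrow> (f has_vector_derivative f' t) (at t)"
  and B: "\<And>t. a \<le> t \<Longrightarrow> t \<le> b \<Longrightarrow> norm (f' t) \<le> B" and ab: "a \<le> b"
 shows "norm (f b - f a) \<le> B * (b - a)"
proof (cases "a = b")
 case False
 then have "a < b" using ab by simp
 moreover have "continuous_on {a..b} f"
  using d by (intro continuous_at_imp_continuous_on) (auto intro!: has_vector_derivative_continuous[OF d])
 ultimately obtain t where t: "t \<in> {a<..<b}" "norm (f b - f a) \<le> norm ((b - a) *\<^sub>R f' t)"
  using mvt_general[of a b f "\<lambda>t h. h *\<^sub>R f' t"] d by (auto simp: has_vector_derivative_def)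
 have "norm ((b - a) *\<^sub>R f' t) \<le> (b - a) * B" using B[of t] t(1) by (auto intro!: mult_left_mono)
 with t(2) show ?thesis by (simp only: mult.commute[of B])
qed simp

lemma test_lipschitz:
 fixes \<psi> :: "real \<Rightarrow> complex"
 assumes "\<psi> \<in> \<D>"
 obtains C where "C \<ge> 0" "\<And>x y. norm (\<psi> x - \<psi> y) \<le> C * \<bar>x - y\<bar>"
proof -
 obtain C where C: "C \<ge> 0" "\<And>x. norm (ddx \<psi> x) \<le> C"
  using continuous_compact_supp_bounded[OF test_dir_deriv[OF assms]] by metis
 have "norm (\<psi> x - \<psi> y) \<le> C * \<bar>x - y\<bar>" for x y
 proof (cases "y \<le> x")
  case True
  then show ?thesis using vector_derivative_bound[OF smooth_has_vector_derivative[OF test_functionsD(1)[OF assms]] C(2)] by simp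
 next
  case False
  then show ?thesis using vector_derivative_bound[OF smooth_has_vector_derivative[OF test_functionsD(1)[OF assms]] C(2), of x y]
   by (simp add: norm_minus_commute)
 qed
 with C(1) show ?thesis using that by metis
qed

lemma L2_bounded_interval:
 assumes "f \<in> borel_measurable lebesgue" "\<And>x. norm (f x) \<le> e" "\<And>x. x \<notin> {a..b} \<Longrightarrow> f x = 0" "a \<le> b" "0 \<le> e"
 shows "f \<in> L2" "L2_norm f \<le> e * sqrt (b - a)"
proof -
 have e: "(\<lambda>x. f x * indicator {a..b} x) = f" using assms(3) by (auto simp: fun_eq_iff indicator_def)
 have ne: "{a..b} \<noteq> {}" using assms by simp
 show "f \<in> L2" "L2_norm f \<le> e * sqrt (b - a)"
  using L2_mult_bounded[OF indicator_L2(1)[OF ne] assms(1,2,5)] indicator_L2(2)[OF assms(4)] unfolding e by simp_all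
qed

lemma test_translation_C0:
 assumes "\<psi> \<in> \<D>"
 shows "(\<lambda>t x. \<psi> (x + c * t)) \<in> C0_L2"
proof -
 have L2: "(\<lambda>x. \<psi> (x + k)) \<in> L2" for k using test_L2[OF test_affine[OF assms, of 1 k]] by simp
 obtain M where M: "M > 0" "\<And>x. \<bar>x\<bar> > M \<Longrightarrow> \<psi> x = 0" using test_function_support[OF assms] by metis
 obtain C where C: "C \<ge> 0" "\<And>x y. norm (\<psi> x - \<psi> y) \<le> C * \<bar>x - y\<bar>" using test_lipschitz[OF assms] by metis
 show ?thesis unfolding C0_L2_def
 proof (intro CollectI conjI allI L2)
  fix t
  let ?N = "M + \<bar>c\<bar> * (\<bar>t\<bar> + 1)"
  have N: "?N \<ge> 0" using M by simp
  show "((\<lambda>s. L2_norm (\<lambda>x. \<psi> (x + c * s) - \<psi> (x + c * t))) \<longlongrightarrow> 0) (at t)"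
  proof (rule Lim_null_comparison)
   show "\<forall>\<^sub>F s in at t. norm (L2_norm (\<lambda>x. \<psi> (x + c * s) - \<psi> (x + c * t))) \<le> C * \<bar>c * s - c * t\<bar> * sqrt (?N - - ?N)"
   proof (rule eventually_at_ballI[where d = 1])
    fix s assume "s \<in> ball t 1" "s \<noteq> t"
    then have s: "\<bar>s\<bar> \<le> \<bar>t\<bar> + 1" by (auto simp: dist_real_def)
    have "L2_norm (\<lambda>x. \<psi> (x + c * s) - \<psi> (x + c * t)) \<le> C * \<bar>c * s - c * t\<bar> * sqrt (?N - - ?N)"
    proof (rule L2_bounded_interval)
     show "(\<lambda>x. \<psi> (x + c * s) - \<psi> (x + c * t)) \<in> borel_measurable lebesgue" using L2_D(1)[OF L2_diff(1)[OF L2 L2]] .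
     show "norm (\<psi> (x + c * s) - \<psi> (x + c * t)) \<le> C * \<bar>c * s - c * t\<bar>" for x using C(2)[of "x + c * s" "x + c * t"] by simp
     fix x assume x: "x \<notin> {- ?N..?N}"
     have "\<bar>c * s\<bar> \<le> \<bar>c\<bar> * (\<bar>t\<bar> + 1)" "\<bar>c * t\<bar> \<le> \<bar>c\<bar> * (\<bar>t\<bar> + 1)"
      unfolding abs_mult using s by (auto intro!: mult_left_mono)
     then have "\<bar>x + c * s\<bar> > M" "\<bar>x + c * t\<bar> > M" using x by (auto simp: not_le)
     then show "\<psi> (x + c * s) - \<psi> (x + c * t) = 0" using M(2) by simp
    qed (use N C(1) in auto)
    then show "norm (L2_norm (\<lambda>x. \<psi> (x + c * s) - \<psi> (x + c * t))) \<le> C * \<bar>c * s - c * t\<bar> * sqrt (?N - - ?N)"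
     by (simp add: L2_norm_nonneg)
   qed simp
   have "((\<lambda>s. C * \<bar>c * s - c * t\<bar> * sqrt (?N - - ?N)) \<longlongrightarrow> C * \<bar>c * t - c * t\<bar> * sqrt (?N - - ?N)) (at t)"
    by (intro tendsto_intros)
   then show "((\<lambda>s. C * \<bar>c * s - c * t\<bar> * sqrt (?N - - ?N)) \<longlongrightarrow> 0) (at t)" by simp
  qed
 qed
qed

text \<open>
 Pairing with a translated test function is the device by which the wave equation is tested along characteristics. The translates form a continuously
 differentiable curve in \<open>L\<^sup>2\<close>.
\<close>
lemma test_translation_C1:
 assumes "\<psi> \<in> \<D>"
 shows "C1_curve (\<lambda>t x. \<psi> (x + c * t)) (\<lambda>t x. of_real c * ddx \<psi> (x + c * t))"
proof -
 let ?d = "ddx \<psi>"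
 have d: "?d \<in> \<D>" using test_dir_deriv[OF assms] .
 have "(\<lambda>t x. of_real c * ?d (x + c * t)) \<in> C0_L2"
 proof -
  note c = C0_L2_D[OF test_translation_C0[OF d, of c]]
  have "L2_norm (\<lambda>x. of_real c * ?d (x + c * s) - of_real c * ?d (x + c * t)) = \<bar>c\<bar> * L2_norm (\<lambda>x. ?d (x + c * s) - ?d (x + c * t))" for s t
   using L2_cmult(2)[OF L2_diff(1)[OF c(1) c(1)], of "of_real c" s t] by (simp add: right_diff_distrib)
  then show ?thesis unfolding C0_L2_def using L2_cmult(1)[OF c(1)] tendsto_mult_left[OF c(2), of "\<bar>c\<bar>"] by simp
 qed
 moreover have "has_L2_time_deriv (\<lambda>t x. \<psi> (x + c * t)) (\<lambda>t x. of_real c * ?d (x + c * t))"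
  unfolding has_L2_time_deriv_def
 proof
  fix t
  obtain M where M: "M > 0" "\<And>x. \<bar>x\<bar> > M \<Longrightarrow> \<psi> x = 0" using test_function_support[OF assms] by metis
  have M': "?d x = 0" if "\<bar>x\<bar> > M" for x
  proof (rule ccontr)
   assume "?d x \<noteq> 0"
   then have "x \<in> supp \<psi>" by (rule dir_deriv_in_supp)
   moreover have "supp \<psi> \<subseteq> cball 0 M" by (rule supp_subset) (use M(2) in \<open>force simp: not_le[symmetric]\<close>, simp)
   ultimately show False using that by (auto simp: subset_iff)
  qed
  obtain C where C: "C \<ge> 0" "\<And>x y. norm (?d x - ?d y) \<le> C * \<bar>x - y\<bar>" using test_lipschitz[OF d] by metis
  let ?N = "M + \<bar>c\<bar> * (\<bar>t\<bar> + 1)"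
  have N: "?N \<ge> 0" using M by simp
  let ?q = "\<lambda>h x. (\<psi> (x + c * (t + h)) - \<psi> (x + c * t)) / of_real h - of_real c * ?d (x + c * t)"
  show "((\<lambda>h. L2_norm (?q h)) \<longlongrightarrow> 0) (at 0)"
  proof (rule Lim_null_comparison)
   show "\<forall>\<^sub>F h in at 0. norm (L2_norm (?q h)) \<le> C * c\<^sup>2 * \<bar>h\<bar> * sqrt (?N - - ?N)"
   proof (rule eventually_at_ballI[where d = 1])
    fix h :: real assume "h \<in> ball 0 1" "h \<noteq> 0"
    then have h: "\<bar>t + h\<bar> \<le> \<bar>t\<bar> + 1" "h \<noteq> 0" by (auto simp: dist_real_def)
    have "L2_norm (?q h) \<le> C * c\<^sup>2 * \<bar>h\<bar> * sqrt (?N - - ?N)"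
    proof (rule L2_bounded_interval)
     have [measurable]: "(\<lambda>x. \<psi> (x + k)) \<in> borel_measurable lebesgue" "(\<lambda>x. ?d (x + k)) \<in> borel_measurable lebesgue" for k
      using borel_lebesgue[OF test_borel[OF test_affine[OF assms, of 1 k]]] borel_lebesgue[OF test_borel[OF test_affine[OF d, of 1 k]]] by simp_all
     show "?q h \<in> borel_measurable lebesgue" by measurable
     show "norm (?q h x) \<le> C * c\<^sup>2 * \<bar>h\<bar>" for x
     proof -
      let ?a = "x + c * t" and ?b = "x + c * (t + h)"
      have "norm (\<psi> ?b - \<psi> ?a - (?b - ?a) *\<^sub>R ?d ?a) \<le> norm (?b - ?a) * (C * \<bar>c * h\<bar>)"
      proof (rule vector_differentiable_bound_linearization[where S = "closed_segment ?a ?b"])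
       show "(\<psi> has_vector_derivative ?d y) (at y within closed_segment ?a ?b)" for y
        by (rule has_vector_derivative_at_within[OF smooth_has_vector_derivative[OF test_functionsD(1)[OF assms]]])
       show "norm (?d y - ?d ?a) \<le> C * \<bar>c * h\<bar>" if "y \<in> closed_segment ?a ?b" for y
       proof -
        have "\<bar>y - ?a\<bar> \<le> \<bar>c * h\<bar>" using that by (auto simp: closed_segment_eq_real_ivl algebra_simps split: if_splits)
        then show ?thesis using C(2)[of y ?a] mult_left_mono[OF _ C(1)] by (meson order_trans)
       qed
      qed auto
      moreover have "?q h x = (\<psi> ?b - \<psi> ?a - (?b - ?a) *\<^sub>R ?d ?a) / of_real h"
       using h(2) by (simp add: field_simps scaleR_conv_of_real)
      ultimately have "norm (?q h x) \<le> norm (?b - ?a) * (C * \<bar>c * h\<bar>) / \<bar>h\<bar>"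
       using h(2) by (simp add: norm_divide divide_right_mono)
      also have "norm (?b - ?a) = \<bar>c\<bar> * \<bar>h\<bar>" by (simp add: algebra_simps abs_mult)
      also have "\<bar>c\<bar> * \<bar>h\<bar> * (C * \<bar>c * h\<bar>) / \<bar>h\<bar> = C * (\<bar>c\<bar> * \<bar>c\<bar>) * \<bar>h\<bar>" using h(2) by (simp add: abs_mult)
      also have "\<bar>c\<bar> * \<bar>c\<bar> = c\<^sup>2" by (simp add: power2_eq_square)
      finally show ?thesis .
     qed
     fix x assume x: "x \<notin> {- ?N..?N}"
     have "\<bar>c * (t + h)\<bar> \<le> \<bar>c\<bar> * (\<bar>t\<bar> + 1)" "\<bar>c * t\<bar> \<le> \<bar>c\<bar> * (\<bar>t\<bar> + 1)"
      unfolding abs_mult using h by (auto intro!: mult_left_mono)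
     then have "\<bar>x + c * (t + h)\<bar> > M" "\<bar>x + c * t\<bar> > M" using x by (auto simp: not_le)
     then show "?q h x = 0" using M(2) M' by simp
    qed (use N C(1) in auto)
    then show "norm (L2_norm (?q h)) \<le> C * c\<^sup>2 * \<bar>h\<bar> * sqrt (?N - - ?N)"
     by (simp add: L2_norm_nonneg)
   qed simp
   have "((\<lambda>h. C * c\<^sup>2 * \<bar>h\<bar> * sqrt (?N - - ?N)) \<longlongrightarrow> C * c\<^sup>2 * \<bar>0\<bar> * sqrt (?N - - ?N)) (at 0)"
    by (intro tendsto_intros)
   then show "((\<lambda>h. C * c\<^sup>2 * \<bar>h\<bar> * sqrt (?N - - ?N)) \<longlongrightarrow> 0) (at 0)" by simp
  qed
 qed
 ultimately show ?thesis using test_translation_C0[OF assms] by (simp add: C1_curve_def)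
qed

lemma C1_curve_const: "f \<in> L2 \<Longrightarrow> C1_curve (\<lambda>_. f) (\<lambda>_ _. 0)"
 using L2_cmult(1)[of f 0] by (simp add: C1_curve_def C0_L2_def has_L2_time_deriv_def L2_norm_def)

lemma L2_norm_squeeze:
 assumes "(G \<longlongrightarrow> 0) F" "\<And>s. L2_norm (f s) \<le> G s"
 shows "((\<lambda>s. L2_norm (f s)) \<longlongrightarrow> 0) F"
 by (rule Lim_null_comparison[OF always_eventually assms(1)]) (simp add: assms(2) L2_norm_nonneg)

lemma C1_curve_quotient_L2:
 assumes "C1_curve v v'"
 shows "(\<lambda>x. (v (t + h) x - v t x) / of_real h - v' t x) \<in> L2"
proof -
 note V = C1_curveD[OF assms]
 have e: "(\<lambda>x. (v (t + h) x - v t x) / of_real h - v' t x) = (\<lambda>x. (1 / of_real h) * (v (t + h) x - v t x) - v' t x)"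
  by (simp add: fun_eq_iff)
 show ?thesis unfolding e by (intro L2_diff L2_cmult V)
qed

lemma C1_curve_diff:
 assumes "C1_curve v v'" "C1_curve w w'"
 shows "C1_curve (\<lambda>t x. v t x - w t x) (\<lambda>t x. v' t x - w' t x)"
proof -
 note V = C1_curveD[OF assms(1)] and W = C1_curveD[OF assms(2)]
 have C0: "(\<lambda>t x. f t x - g t x) \<in> C0_L2" if "f \<in> C0_L2" "g \<in> C0_L2" for f g
  unfolding C0_L2_def
 proof (intro CollectI conjI allI)
  note f = C0_L2_D[OF that(1)] and g = C0_L2_D[OF that(2)]
  show "(\<lambda>x. f t x - g t x) \<in> L2" for t by (intro L2_diff f g)
  fix t
  have e: "(\<lambda>x. f s x - g s x - (f t x - g t x)) = (\<lambda>x. f s x - f t x - (g s x - g t x))" for s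
   by (simp add: fun_eq_iff)
  have "L2_norm (\<lambda>x. f s x - g s x - (f t x - g t x)) \<le> L2_norm (\<lambda>x. f s x - f t x) + L2_norm (\<lambda>x. g s x - g t x)" for s
   unfolding e by (intro L2_diff f g)
  then show "((\<lambda>s. L2_norm (\<lambda>x. f s x - g s x - (f t x - g t x))) \<longlongrightarrow> 0) (at t)"
   by (rule L2_norm_squeeze[OF tendsto_add_zero[OF f(2)[of t] g(2)[of t]]])
 qed
 have "has_L2_time_deriv (\<lambda>t x. v t x - w t x) (\<lambda>t x. v' t x - w' t x)"
  unfolding has_L2_time_deriv_def
 proof
  fix t
  let ?v = "\<lambda>h x. (v (t + h) x - v t x) / of_real h - v' t x" and ?w = "\<lambda>h x. (w (t + h) x - w t x) / of_real h - w' t x"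
  have vL: "?v h \<in> L2" and wL: "?w h \<in> L2" for h
   using C1_curve_quotient_L2[OF assms(1)] C1_curve_quotient_L2[OF assms(2)] by blast+
  have "(\<lambda>x. (v (t + h) x - w (t + h) x - (v t x - w t x)) / of_real h - (v' t x - w' t x)) = (\<lambda>x. ?v h x - ?w h x)" for h
   by (simp add: fun_eq_iff diff_divide_distrib)
  then show "((\<lambda>h. L2_norm (\<lambda>x. (v (t + h) x - w (t + h) x - (v t x - w t x)) / of_real h - (v' t x - w' t x))) \<longlongrightarrow> 0) (at 0)"
   using L2_norm_squeeze[OF tendsto_add_zero[OF V(5)[of t] W(5)[of t]] L2_diff(2)[OF vL wL]] by simp
 qed
 with C0[OF V(1) W(1)] C0[OF V(2) W(2)] show ?thesis by (simp add: C1_curve_def)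
qed

lemma C1_curve_mult:
 assumes v: "C1_curve v v'" and h: "h \<in> borel_measurable lebesgue" "\<And>x. norm (h x) \<le> C"
 shows "C1_curve (\<lambda>t x. h x * v t x) (\<lambda>t x. h x * v' t x)"
proof -
 note V = C1_curveD[OF v]
 have C: "C \<ge> 0" using h(2) norm_ge_zero order_trans by blast
 note m = L2_mult_bounded[OF _ h C]
 have C0: "(\<lambda>t x. h x * f t x) \<in> C0_L2" if "f \<in> C0_L2" for f
  unfolding C0_L2_def
 proof (intro CollectI conjI allI)
  note f = C0_L2_D[OF that(1)]
  show "(\<lambda>x. h x * f t x) \<in> L2" for t by (intro m f)
  show "((\<lambda>s. L2_norm (\<lambda>x. h x * f s x - h x * f t x)) \<longlongrightarrow> 0) (at t)" for t
   unfolding right_diff_distrib[symmetric]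
   by (rule L2_norm_squeeze[OF tendsto_mult_right_zero[OF f(2)[of t], of C] m(2)[OF L2_diff(1)[OF f(1) f(1)]]])
 qed
 have "has_L2_time_deriv (\<lambda>t x. h x * v t x) (\<lambda>t x. h x * v' t x)"
  unfolding has_L2_time_deriv_def
 proof
  fix t
  let ?v = "\<lambda>k x. (v (t + k) x - v t x) / of_real k - v' t x"
  have vL: "?v k \<in> L2" for k by (rule C1_curve_quotient_L2[OF v])
  have "(\<lambda>x. (h x * v (t + k) x - h x * v t x) / of_real k - h x * v' t x) = (\<lambda>x. h x * ?v k x)" for k
   by (simp add: fun_eq_iff algebra_simps diff_divide_distrib)
  then show "((\<lambda>k. L2_norm (\<lambda>x. (h x * v (t + k) x - h x * v t x) / of_real k - h x * v' t x)) \<longlongrightarrow> 0) (at 0)"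
   using L2_norm_squeeze[OF tendsto_mult_right_zero[OF V(5)[of t], of C] m(2)[OF vL]] by simp
 qed
 with C0[OF V(1)] C0[OF V(2)] show ?thesis by (simp add: C1_curve_def)
qed

lemma C1_curve_reflect:
 assumes v: "C1_curve v v'"
 shows "C1_curve (\<lambda>t x. v t (- x)) (\<lambda>t x. v' t (- x))"
proof -
 note V = C1_curveD[OF v]
 have r: "(\<lambda>x. f (- x)) \<in> L2" "L2_norm (\<lambda>x. f (- x)) = L2_norm f" if "f \<in> L2" for f
  using L2_affine[OF that, of "-1" 0] by simp_all
 have vL: "(\<lambda>x. (v (t + k) x - v t x) / of_real k - v' t x) \<in> L2" for t k
  by (rule C1_curve_quotient_L2[OF v])
 show ?thesis
  using V(5) r(2)[OF vL] r(2)[OF L2_diff(1)[OF V(3) V(3)]] r(2)[OF L2_diff(1)[OF V(4) V(4)]] r(1)[OF V(3)] r(1)[OF V(4)]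
   C0_L2_D(2)[OF V(1)] C0_L2_D(2)[OF V(2)]
  by (simp add: C1_curve_def C0_L2_def has_L2_time_deriv_def)
qed

lemma C1_curve_mean_value:
 assumes v: "C1_curve v v'" and B: "\<And>t. a \<le> t \<Longrightarrow> t \<le> b \<Longrightarrow> L2_norm (v' t) \<le> B" and ab: "a \<le> b"
 shows "L2_norm (\<lambda>x. v b x - v a x) \<le> B * (b - a)"
proof -
 note V = C1_curveD[OF v]
 define d where "d x = v b x - v a x" for x
 define z where "z x = cnj (d x)" for x
 have dL: "d \<in> L2" unfolding d_def by (intro L2_diff V)
 have zL: "z \<in> L2" "L2_norm z = L2_norm d"
  using L2_D[OF dL] borel_measurable_continuous_on[of cnj d lebesgue, OF continuous_on_cnj[OF continuous_on_id]]
  by (auto simp: z_def[abs_def] L2_def L2_norm_def)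
 have "((\<lambda>t. pairing (v t) z) has_vector_derivative pairing (v' t) z) (at t)" for t
  using pairing_has_vector_derivative[OF v C1_curve_const[OF zL(1)], of t] by (simp add: pairing_def)
 then have "norm (pairing (v b) z - pairing (v a) z) \<le> (B * L2_norm z) * (b - a)"
 proof (rule vector_derivative_bound)
  fix t assume "a \<le> t" "t \<le> b"
  then show "norm (pairing (v' t) z) \<le> B * L2_norm z"
   using pairing_bound[OF V(4) zL(1)] B by (meson L2_norm_nonneg mult_right_mono order_trans)
 qed fact
 moreover have "pairing (v b) z - pairing (v a) z = of_real ((L2_norm d)\<^sup>2)"
 proof -
  have "pairing (v b) z - pairing (v a) z = pairing d z" unfolding d_def by (rule pairing_diff[symmetric]) (intro V zL(1))+
  also have "\<dots> = of_real ((L2_norm d)\<^sup>2)"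
   by (simp only: pairing_def z_def complex_norm_square[symmetric] L2_norm_sq integral_complex_of_real)
  finally show ?thesis .
 qed
 ultimately have "(L2_norm d)\<^sup>2 \<le> (B * (b - a)) * L2_norm d"
  by (simp add: zL(2) mult_ac norm_power del: of_real_power)
 moreover have "0 \<le> B * (b - a)" using B[of a] ab L2_norm_nonneg[of "v' a"] by (auto intro!: mult_nonneg_nonneg)
 ultimately have "L2_norm d \<le> B * (b - a)"
  using L2_norm_nonneg[of d] by (cases "L2_norm d = 0") (auto simp: power2_eq_square)
 then show ?thesis by (simp add: d_def[abs_def])
qed

text \<open>
 The functions that vanish on \<open>S\<close> form a closed subspace of \<open>L\<^sup>2\<close>; it contains the difference quotients from the
 past, hence their limits, and by continuity the values at \<open>t0\<close>.
\<close>
lemma C1_curve_vanishing_past: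
 assumes v: "C1_curve v v'" and S: "S \<in> sets lebesgue" and z: "\<And>t. t < t0 \<Longrightarrow> AE x in lebesgue. x \<in> S \<longrightarrow> v t x = 0"
  and t: "t \<le> t0"
 shows "AE x in lebesgue. x \<in> S \<longrightarrow> v t x = 0" "AE x in lebesgue. x \<in> S \<longrightarrow> v' t x = 0"
proof -
 define u where "u t x = indicator S x * v t x" for t x
 define u' where "u' t x = indicator S x * v' t x" for t x
 have u: "C1_curve u u'" unfolding u_def[abs_def] u'_def[abs_def]
  by (rule C1_curve_mult[OF v, where C = 1]) (use S in \<open>auto simp: indicator_def\<close>)
 note U = C1_curveD[OF u]
 have um [measurable]: "u s \<in> borel_measurable lebesgue" "u' s \<in> borel_measurable lebesgue" for s using U L2_D by auto
 have u0: "AE x in lebesgue. u s x = 0" if "s < t0" for s using z[OF that] by (auto simp: u_def elim: eventually_mono)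
 have n0: "L2_norm (u s) = 0" if "s < t0" for s
  using L2_norm_cong[of "u s" "\<lambda>_. 0"] u0[OF that] by (simp add: L2_norm_def)
 have n0': "L2_norm (u' s) = 0" if "s < t0" for s
 proof -
  have "\<forall>\<^sub>F h in at 0. L2_norm (\<lambda>x. (u (s + h) x - u s x) / of_real h - u' s x) = L2_norm (u' s)"
  proof (rule eventually_at_ballI[where d = "t0 - s"])
   fix h assume "h \<in> ball 0 (t0 - s)" "h \<noteq> (0::real)"
   then have "s + h < t0" by (auto simp: dist_real_def)
   then have "AE x in lebesgue. u (s + h) x = 0" by (rule u0)
   then have "AE x in lebesgue. (u (s + h) x - u s x) / of_real h - u' s x = - u' s x"
    using u0[OF that] by eventually_elim simp
   then have "L2_norm (\<lambda>x. (u (s + h) x - u s x) / of_real h - u' s x) = L2_norm (\<lambda>x. - u' s x)"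
    by (intro L2_norm_cong) measurable
   then show "L2_norm (\<lambda>x. (u (s + h) x - u s x) / of_real h - u' s x) = L2_norm (u' s)" by (simp add: L2_norm_def)
  qed (use that in simp)
  then have "((\<lambda>h::real. L2_norm (u' s)) \<longlongrightarrow> 0) (at 0)" using U(5)[of s] by (simp cong: tendsto_cong)
  then show ?thesis by (simp add: tendsto_const_iff)
 qed
 have ext: "f t0 = 0" if "continuous_on UNIV f" "\<And>s. s < t0 \<Longrightarrow> f s = 0" for f :: "real \<Rightarrow> real"
 proof -
  have "(f \<longlongrightarrow> f t0) (at_left t0)" using that(1) by (simp add: continuous_on_def filterlim_at_split)
  moreover have "(f \<longlongrightarrow> 0) (at_left t0)"
   by (rule tendsto_eventually) (auto simp: eventually_at_filter that(2))
  ultimately show ?thesis by (rule tendsto_unique[rotated]) simp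
 qed
 have "L2_norm (u t) = 0" "L2_norm (u' t) = 0"
  using n0 n0' t ext[OF C0_L2_norm_continuous[OF U(1)] n0] ext[OF C0_L2_norm_continuous[OF U(2)] n0'] by (cases "t < t0"; simp)+
 from L2_norm_eq_0[OF U(3) this(1)] L2_norm_eq_0[OF U(4) this(2)]
 show "AE x in lebesgue. x \<in> S \<longrightarrow> v t x = 0" "AE x in lebesgue. x \<in> S \<longrightarrow> v' t x = 0"
  by (auto simp: u_def u'_def elim!: eventually_mono split: split_indicator_asm)
qed

section \<open>Integration by parts and transport along characteristics\<close>

lemma integrable_test_mult:
 assumes "\<eta> \<in> \<D>" "continuous_on UNIV q"
 shows "integrable lborel (\<lambda>t::real. \<eta> t * (q t :: complex))"
proof -
 have "integrable lborel (\<lambda>t. indicator (supp \<eta>) t *\<^sub>R (\<eta> t * q t))"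
  by (intro borel_integrable_compact continuous_on_mult smooth_continuous test_functionsD assms(1) continuous_on_subset[OF assms(2)]) auto
 moreover have "(\<lambda>t. indicator (supp \<eta>) t *\<^sub>R (\<eta> t * q t)) = (\<lambda>t. \<eta> t * q t)"
  using in_supp[of \<eta>] by (auto simp: fun_eq_iff indicator_def)
 ultimately show ?thesis by simp
qed

lemma test_integration_by_parts:
 fixes p :: "real \<Rightarrow> complex"
 assumes \<eta>: "\<eta> \<in> \<D>"
  and p: "\<And>t. (p has_vector_derivative p' t) (at t)" "continuous_on UNIV p'"
 shows "(LBINT t. ddx \<eta> t * p t) = - (LBINT t. \<eta> t * p' t)"
proof -
 obtain M where M: "M > 0" "supp \<eta> \<subseteq> {-M..M}" "\<And>x. \<bar>x\<bar> > M \<Longrightarrow> \<eta> x = 0" using test_function_support[OF \<eta>] by metis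
 have pc: "continuous_on UNIV p"
  using p(1) by (auto intro!: continuous_at_imp_continuous_on has_vector_derivative_continuous)
 have i1: "integrable lborel (\<lambda>t. ddx \<eta> t * p t)" and i2: "integrable lborel (\<lambda>t. \<eta> t * p' t)"
  by (intro integrable_test_mult test_dir_deriv \<eta> pc p)+
 let ?f = "\<lambda>t. \<eta> t * p' t + ddx \<eta> t * p t"
 have fc: "continuous_on S ?f" for S
  by (intro continuous_intros smooth_continuous test_functionsD test_dir_deriv \<eta> continuous_on_subset[OF pc] continuous_on_subset[OF p(2)]) auto
 have deriv: "((\<lambda>t. \<eta> t * p t) has_vector_derivative ?f t) (at t)" for t
  by (rule has_vector_derivative_mult[OF smooth_has_vector_derivative[OF test_functionsD(1)[OF \<eta>]] p(1)])
 have "(LBINT t. indicator {-(M+1)..M+1} t *\<^sub>R ?f t) = \<eta> (M+1) * p (M+1) - \<eta> (-(M+1)) * p (-(M+1))"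
 proof (rule integral_FTC_Icc[OF _ _ fc])
  show "-(M+1) \<le> M+1" using M(1) by simp
  show "((\<lambda>t. \<eta> t * p t) has_vector_derivative ?f x) (at x within {-(M+1)..M+1})" for x
   by (rule has_vector_derivative_at_within[OF deriv])
 qed
 also have "\<dots> = 0" using M by simp
 also have "(\<lambda>t. indicator {-(M+1)..M+1} t *\<^sub>R ?f t) = ?f"
 proof
  fix t
  have "\<eta> t = 0 \<and> ddx \<eta> t = 0" if "t \<notin> {-(M+1)..M+1}"
  proof -
   have "t \<notin> supp \<eta>" using M that by auto
   then show ?thesis using in_supp[of \<eta> t] dir_deriv_in_supp[of \<eta> t] by auto
  qed
  then show "indicator {-(M+1)..M+1} t *\<^sub>R ?f t = ?f t" by (auto simp: indicator_def)
 qed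
 finally show ?thesis using i1 i2 by (simp add: eq_neg_iff_add_eq_0 add.commute)
qed

abbreviation "step_density \<equiv> ddx (\<lambda>x. of_real (smooth_step x) :: complex)"

lemma step_density_supp: "x \<notin> {0..1} \<Longrightarrow> step_density x = 0"
proof -
 assume x: "x \<notin> {0..1}"
 have "\<forall>\<^sub>F y in nhds x. y \<in> - {0..1}" using x by (intro eventually_nhds_in_open) auto
 then have ev: "\<forall>\<^sub>F y in nhds x. of_real (smooth_step x) = (of_real (smooth_step y) :: complex)"
 proof (cases "x < 0")
  case True
  then have "\<forall>\<^sub>F y in nhds x. y \<in> {..<0}" by (intro eventually_nhds_in_open) auto
  then show ?thesis using True by (auto elim!: eventually_mono simp: smooth_step_0)
 next
  case False
  then have "x > 1" using x by auto
  then have "\<forall>\<^sub>F y in nhds x. y \<in> {1<..}" by (intro eventually_nhds_in_open) auto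
  then show ?thesis using \<open>x > 1\<close> by (auto elim!: eventually_mono simp: smooth_step_1)
 qed
 have "((\<lambda>x. of_real (smooth_step x) :: complex) has_derivative (\<lambda>_. 0)) (at x)"
  by (rule has_derivative_transform_eventually[OF has_derivative_const[of "of_real (smooth_step x)"]])
   (use ev in \<open>auto simp: eventually_at_filter elim: eventually_mono\<close>)
 then show ?thesis by (rule dir_deriv_eq)
qed

lemma step_density_test: "step_density \<in> \<D>"
 by (rule test_functionsI[of _ "{0..1}"]) (use step_density_supp in \<open>auto intro!: smooth_dir_deriv smooth_smooth_step\<close>)

lemma step_density_integral: "(LBINT x. step_density x) = 1"
proof -
 have "(LBINT x. indicator {0..1} x *\<^sub>R step_density x) = of_real (smooth_step 1) - of_real (smooth_step 0)"
  by (rule integral_FTC_Icc)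
   (auto intro!: has_vector_derivative_at_within smooth_has_vector_derivative smooth_smooth_step
    smooth_continuous smooth_dir_deriv)
 also have "(\<lambda>x. indicator {0..1} x *\<^sub>R step_density x) = step_density"
  using step_density_supp by (auto simp: fun_eq_iff indicator_def)
 finally show ?thesis by (simp add: smooth_step_0 smooth_step_1)
qed

text \<open>
 The dilates of \<open>step_density\<close> form an approximate identity supported to the right of the point.
\<close>
lemma mollifier_tendsto:
 fixes m :: "real \<Rightarrow> complex"
 assumes m: "continuous_on UNIV m"
 shows "(\<lambda>n. LBINT y. of_real (Suc n) * step_density (real (Suc n) * y + (- real (Suc n) * s)) * m y) \<longlonglongrightarrow> m s"
proof -
 obtain C where C: "C \<ge> 0" "\<And>x. norm (step_density x) \<le> C"
  using continuous_compact_supp_bounded[OF step_density_test] by metis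
 have "bounded (m ` {s..s+1})" by (intro compact_imp_bounded compact_continuous_image continuous_on_subset[OF m]) auto
 then obtain B where B: "\<And>y. y \<in> {s..s+1} \<Longrightarrow> norm (m y) \<le> B" unfolding bounded_iff by (meson imageI)
 have [measurable]: "m \<in> borel_fun" "step_density \<in> borel_fun"
  using borel_measurable_continuous_onI[OF m] test_borel[OF step_density_test] by auto
 have eq: "(LBINT y. of_real (Suc n) * step_density (real (Suc n) * y + (- real (Suc n) * s)) * m y) =
  (LBINT z. step_density z * m (s + z / real (Suc n)))" for n
 proof -
  let ?k = "1 / real (Suc n)"
  have "(LBINT y. of_real (Suc n) * step_density (real (Suc n) * y + (- real (Suc n) * s)) * m y) =
   \<bar>?k\<bar> *\<^sub>R (LBINT z. of_real (Suc n) * step_density (real (Suc n) * (s + ?k * z) + (- real (Suc n) * s)) * m (s + ?k * z))"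
   by (rule lborel_integral_real_affine) simp
  also have "\<dots> = (LBINT z. ?k *\<^sub>R (of_real (Suc n) * step_density (real (Suc n) * (s + ?k * z) + (- real (Suc n) * s)) * m (s + ?k * z)))"
   by (subst integral_scaleR_right) simp
  also have "\<dots> = (LBINT z. step_density z * m (s + z / real (Suc n)))"
  proof (rule Bochner_Integration.integral_cong[OF refl])
   fix z :: real
   have "real (Suc n) * (s + ?k * z) + (- real (Suc n) * s) = z" by (simp add: field_simps)
   then show "?k *\<^sub>R (of_real (Suc n) * step_density (real (Suc n) * (s + ?k * z) + (- real (Suc n) * s)) * m (s + ?k * z)) = step_density z * m (s + z / real (Suc n))"
    by (simp only: scaleR_conv_of_real) (simp add: field_simps del: of_nat_Suc)
  qed
  finally show ?thesis .
 qed
 have "(\<lambda>n. LBINT z. step_density z * m (s + z / real (Suc n))) \<longlonglongrightarrow> (LBINT z. step_density z * m s)"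
 proof (rule integral_dominated_convergence[where w = "\<lambda>z. C * B * indicat_real {0..1} z"])
  show "AE z in lborel. (\<lambda>n. step_density z * m (s + z / real (Suc n))) \<longlonglongrightarrow> step_density z * m s"
  proof (intro AE_I2 tendsto_mult_left)
   fix z
   have "(\<lambda>n. s + z / real (Suc n)) \<longlonglongrightarrow> s + z * 0"
    unfolding divide_inverse by (intro tendsto_intros LIMSEQ_inverse_real_of_nat)
   then show "(\<lambda>n. m (s + z / real (Suc n))) \<longlonglongrightarrow> m s"
    using m by (intro continuous_on_tendsto_compose[OF m]) auto
  qed
  show "AE z in lborel. norm (step_density z * m (s + z / real (Suc n))) \<le> C * B * indicat_real {0..1} z" for n
  proof (rule AE_I2)
   fix z
   show "norm (step_density z * m (s + z / real (Suc n))) \<le> C * B * indicat_real {0..1} z"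
   proof (cases "z \<in> {0..1}")
    case True
    then have "s + z / real (Suc n) \<in> {s..s+1}" by (auto simp: field_simps)
    then show ?thesis using True C B by (simp add: norm_mult mult_mono)
   qed (simp add: step_density_supp)
  qed
 qed auto
 then show ?thesis unfolding eq using step_density_integral by simp
qed

text \<open>
 The difference of two mollifiers, at \<open>s\<close> and at \<open>t\<close>, has integral zero and is therefore the derivative of a test function.
 In the limit this compares the values of \<open>m\<close> at \<open>s\<close> and \<open>t\<close>.
\<close>
lemma du_Bois_Reymond:
 fixes m :: "real \<Rightarrow> complex"
 assumes m: "continuous_on UNIV m" and J: "open J" "convex J"
  and z: "\<And>\<eta>. \<eta> \<in> \<D> \<Longrightarrow> supp \<eta> \<subseteq> J \<Longrightarrow> (LBINT t. ddx \<eta> t * m t) = 0"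
  and st: "s \<in> J" "t \<in> J"
 shows "m s = m t"
proof -
 have main: "m s = m t" if st: "s \<in> J" "t \<in> J" "s \<le> t" for s t
 proof -
  obtain e where e: "e > 0" "ball t e \<subseteq> J" using J(1) st(2) open_contains_ball by blast
  have sub: "{s..t + e/2} \<subseteq> J"
  proof
   fix y assume y: "y \<in> {s..t + e/2}"
   have "t + e/2 \<in> J" using e by (auto simp: dist_real_def intro!: subsetD[OF e(2)])
   then have "closed_segment s (t + e/2) \<subseteq> J" using J(2) st(1) by (simp add: closed_segment_subset)
   then show "y \<in> J" using y by (auto simp: closed_segment_eq_real_ivl split: if_splits)
  qed
  define I where "I s n = (LBINT y. of_real (Suc n) * step_density (real (Suc n) * y + (- real (Suc n) * s)) * m y)" for s n
  obtain N where N: "2 / e < real N" using reals_Archimedean2 by blast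
  have "\<forall>\<^sub>F n in sequentially. I s n = I t n"
   using eventually_ge_at_top[of N]
  proof eventually_elim
   case (elim n)
   let ?k = "real (Suc n)"
   define \<eta>1 where "\<eta>1 s y = complex_of_real (smooth_step (?k * y + (- ?k * s)))" for s y
   define \<eta> where "\<eta> y = \<eta>1 s y - \<eta>1 t y" for y
   have sm: "smooth (\<eta>1 s)" for s unfolding \<eta>1_def[abs_def] by (rule smooth_affine[OF smooth_smooth_step])
   have d1: "ddx (\<eta>1 s) = (\<lambda>y. of_real ?k * step_density (?k * y + (- ?k * s)))" for s
    unfolding \<eta>1_def[abs_def] by (rule dir_deriv_affine[OF smooth_smooth_step])
   have d: "ddx \<eta> = (\<lambda>y. ddx (\<eta>1 s) y - ddx (\<eta>1 t) y)"
    unfolding \<eta>_def[abs_def] by (intro ext dir_deriv_1_eq has_vector_derivative_diff smooth_has_vector_derivative sm)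
   have ke: "1 / ?k \<le> e / 2"
   proof -
    have "2 / e < ?k" using N elim by simp
    then show ?thesis using e(1) by (simp add: field_simps del: of_nat_Suc)
   qed
   have nz: "y \<in> {s..t + e/2}" if "\<eta> y \<noteq> 0" for y
   proof (rule ccontr)
    assume "y \<notin> {s..t + e/2}"
    then consider "y < s" | "y > t + e/2" by fastforce
    then show False
    proof cases
     case 1
     then have "?k * y + (- ?k * s) \<le> 0" "?k * y + (- ?k * t) \<le> 0" using st(3) by (simp_all add: mult_left_mono del: of_nat_Suc)
     then show False using that by (simp add: \<eta>_def \<eta>1_def smooth_step_0)
    next
     case 2
     then have "1 / ?k \<le> y - t" "1 / ?k \<le> y - s" using ke st(3) by linarith+
     then have "1 \<le> ?k * y + (- ?k * s)" "1 \<le> ?k * y + (- ?k * t)" by (simp_all add: field_simps del: of_nat_Suc)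
     then show False using that by (simp add: \<eta>_def \<eta>1_def smooth_step_1)
    qed
   qed
   have ct: "\<eta> \<in> \<D>"
   proof (rule test_functionsI[OF _ nz])
    show "smooth \<eta>" unfolding \<eta>_def[abs_def] by (intro smooth_diff sm)
   qed (assumption, rule compact_Icc)
   have cs: "supp \<eta> \<subseteq> J" using supp_subset[of \<eta> "{s..t + e/2}"] nz sub by auto
   have int: "integrable lborel (\<lambda>y. ddx (\<eta>1 s) y * m y)" for s
   proof -
    have "(\<lambda>y. step_density (?k * y + (- ?k * s))) \<in> \<D>" by (rule test_affine[OF step_density_test]) simp
    from integrable_test_mult[OF test_mult[OF this smooth_const] m]
    show ?thesis unfolding d1 .
   qed
   have "0 = (LBINT t. ddx \<eta> t * m t)" using z[OF ct cs] by simp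
   also have "\<dots> = I s n - I t n"
    using int[of s] int[of t] by (simp add: d left_diff_distrib I_def d1)
   finally show ?case by simp
  qed
  then have "(\<lambda>n. I s n) \<longlonglongrightarrow> m t"
   using mollifier_tendsto[OF m, of t] unfolding I_def by (simp add: tendsto_cong)
  then show ?thesis using mollifier_tendsto[OF m, of s] LIMSEQ_unique unfolding I_def by blast
 qed
 show ?thesis using main[OF st] main[OF st(2) st(1)] by (metis linear)
qed

text \<open>
 For \<open>c\<^sup>2 = 1\<close> the operator \<open>\<partial>\<^sub>t\<^sup>2 - \<partial>\<^sub>x\<^sup>2\<close> factors into
 \<open>\<partial>\<^sub>t + c \<partial>\<^sub>x\<close> and \<open>\<partial>\<^sub>t - c \<partial>\<^sub>x\<close>. The quantity \<open>m\<close>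
 is the pairing of \<open>v' + c \<partial>\<^sub>x v\<close> with a test function carried by the characteristics \<open>x + c t = const\<close>, and
 the weak equation says that its derivative is zero.
\<close>
lemma transport_constant:
 assumes v: "C1_curve v v'" and \<psi>: "\<psi> \<in> \<D>" and J: "open J" "convex J"
  and weak: "\<And>\<eta>. \<eta> \<in> \<D> \<Longrightarrow> supp \<eta> \<subseteq> J \<Longrightarrow>
   (LBINT t. ddx (ddx \<eta>) t * pairing (v t) (\<lambda>x. \<psi> (x + c * t))
    + 2 * of_real c * (ddx \<eta> t * pairing (v t) (\<lambda>x. ddx \<psi> (x + c * t)))) = 0"
  and st: "s \<in> J" "t \<in> J"
 defines "m \<equiv> \<lambda>t. pairing (v' t) (\<lambda>x. \<psi> (x + c * t)) - of_real c * pairing (v t) (\<lambda>x. ddx \<psi> (x + c * t))"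
 shows "m s = m t" "continuous_on UNIV m"
proof -
 define p where "p t = pairing (v t) (\<lambda>x. \<psi> (x + c * t))" for t
 define r where "r t = pairing (v t) (\<lambda>x. ddx \<psi> (x + c * t))" for t
 define q where "q t = pairing (v' t) (\<lambda>x. \<psi> (x + c * t))" for t
 note V = C1_curveD[OF v]
 have d\<psi>: "ddx \<psi> \<in> \<D>" by (rule test_dir_deriv[OF \<psi>])
 have cr: "continuous_on UNIV r" and cq: "continuous_on UNIV q"
  unfolding r_def[abs_def] q_def[abs_def] by (intro C0_L2_pairing_continuous V test_translation_C0 \<psi> d\<psi>)+
 have m_eq: "m t = q t - of_real c * r t" for t by (simp add: m_def q_def r_def)
 show mc: "continuous_on UNIV m" unfolding m_eq[abs_def] by (intro continuous_intros cr cq)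
 have dp: "(p has_vector_derivative q t + of_real c * r t) (at t)" for t
  using pairing_has_vector_derivative[OF v test_translation_C1[OF \<psi>, of c], of t]
  unfolding p_def[abs_def] q_def r_def by (simp add: pairing_cmult)
 show "m s = m t"
 proof (rule du_Bois_Reymond[OF mc J _ st])
  fix \<eta> :: "real \<Rightarrow> complex" assume \<eta>: "\<eta> \<in> \<D>" "supp \<eta> \<subseteq> J"
  let ?d = "ddx \<eta>"
  have d: "?d \<in> \<D>" by (rule test_dir_deriv[OF \<eta>(1)])
  have pc: "continuous_on UNIV p" using dp by (auto intro!: continuous_at_imp_continuous_on has_vector_derivative_continuous)
  have i: "integrable lborel (\<lambda>t. ddx ?d t * p t)" "integrable lborel (\<lambda>t. ?d t * r t)" "integrable lborel (\<lambda>t. ?d t * q t)"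
   by (intro integrable_test_mult test_dir_deriv d pc cr cq)+
  have "(LBINT t. ddx ?d t * p t) = - (LBINT t. ?d t * (q t + of_real c * r t))"
   by (rule test_integration_by_parts[OF d dp]) (intro continuous_intros cr cq)
  also have "\<dots> = - ((LBINT t. ?d t * q t) + of_real c * (LBINT t. ?d t * r t))"
   using i by (simp add: distrib_left mult.left_commute[of _ "of_real c"])
  finally have 1: "(LBINT t. ddx ?d t * p t) = - ((LBINT t. ?d t * q t) + of_real c * (LBINT t. ?d t * r t))" .
  have "(LBINT t. ddx ?d t * p t) + 2 * of_real c * (LBINT t. ?d t * r t) = 0"
   using weak[OF \<eta>] i by (simp add: p_def[symmetric] r_def[symmetric])
  then have "(LBINT t. ?d t * q t) = of_real c * (LBINT t. ?d t * r t)" unfolding 1 by (simp add: algebra_simps)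
  then show "(LBINT t. ?d t * m t) = 0"
   using i by (simp add: m_eq right_diff_distrib mult.left_commute[of _ "of_real c"])
 qed
qed

section \<open>Outgoing solutions are translates of a profile\<close>

lemma zero_by_continuity:
 fixes f :: "real \<Rightarrow> complex"
 assumes "continuous_on UNIV f" "\<And>s. s < t0 \<Longrightarrow> f s = 0"
 shows "f t0 = 0"
proof -
 have "(f \<longlongrightarrow> f t0) (at_left t0)" using assms(1) by (simp add: continuous_on_def filterlim_at_split)
 moreover have "(f \<longlongrightarrow> 0) (at_left t0)"
  by (rule tendsto_eventually) (auto simp: eventually_at_filter assms(2))
 ultimately show ?thesis by (rule tendsto_unique[rotated]) simp
qed

lemma pairing_eq_0_disjoint:
 assumes "AE x in lebesgue. x \<in> S \<longrightarrow> f x = 0" "\<And>x. g x \<noteq> 0 \<Longrightarrow> x \<in> S"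
 shows "pairing f g = 0"
proof -
 have "AE x in lebesgue. f x * g x = 0" using assms(1) by eventually_elim (use assms(2) in auto)
 then show ?thesis unfolding pairing_def by (rule integral_eq_zero_AE)
qed

text \<open>
 A characteristic that moves to the left and meets the support of \<open>\<psi>\<close> at time \<open>t\<close> has stayed in \<open>x > R\<close>
 for all earlier times, and there the solution was zero in the past. So the conserved quantity of \<open>transport_constant\<close> vanishes, which
 is the equation \<open>\<partial>\<^sub>t v + \<partial>\<^sub>x v = 0\<close>.
\<close>
lemma outgoing_first_order:
 assumes v: "C1_curve v v'"
  and past: "\<And>t. t < 0 \<Longrightarrow> AE x in lebesgue. x \<in> {R<..} \<longrightarrow> v t x = 0"
  and weak: "\<And>\<eta> \<psi>. \<eta> \<in> \<D> \<Longrightarrow> \<psi> \<in> \<D> \<Longrightarrow>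
   (\<And>t x. \<eta> t \<noteq> 0 \<Longrightarrow> x + t \<in> supp \<psi> \<Longrightarrow> x > R) \<Longrightarrow>
   (LBINT t. ddx (ddx \<eta>) t * pairing (v t) (\<lambda>x. \<psi> (x + 1 * t))
    + 2 * of_real 1 * (ddx \<eta> t * pairing (v t) (\<lambda>x. ddx \<psi> (x + 1 * t)))) = 0"
  and \<psi>: "\<psi> \<in> \<D>" "supp \<psi> \<subseteq> {R<..}"
 shows "pairing (v' t) \<psi> = pairing (v t) (ddx \<psi>)"
proof -
 define \<phi> where "\<phi> y = \<psi> (y - t)" for y
 have \<phi>: "\<phi> \<in> \<D>" using test_affine[OF \<psi>(1), of 1 "- t"] by (simp add: \<phi>_def[abs_def])
 have d\<phi>: "ddx \<phi> = (\<lambda>y. ddx \<psi> (y - t))"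
  using dir_deriv_affine[OF test_functionsD(1)[OF \<psi>(1)], of 1 "- t"] by (simp add: \<phi>_def[abs_def])
 have supp\<phi>: "y - t > R" if "y \<in> supp \<phi>" for y
 proof -
  have "closed ((\<lambda>y. y - t) -` supp \<psi>)"
   by (intro continuous_closed_vimage continuous_intros) (auto simp: supp_def)
  then have "supp \<phi> \<subseteq> (\<lambda>y. y - t) -` supp \<psi>" by (intro supp_subset) (auto simp: \<phi>_def intro: in_supp)
  then show ?thesis using that \<psi>(2) by auto
 qed
 define m where "m s = pairing (v' s) (\<lambda>x. \<phi> (x + 1 * s)) - of_real 1 * pairing (v s) (\<lambda>x. ddx \<phi> (x + 1 * s))" for s
 have weak': "(LBINT t. ddx (ddx \<eta>) t * pairing (v t) (\<lambda>x. \<phi> (x + 1 * t))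
    + 2 * of_real 1 * (ddx \<eta> t * pairing (v t) (\<lambda>x. ddx \<phi> (x + 1 * t)))) = 0"
  if "\<eta> \<in> \<D>" "supp \<eta> \<subseteq> {..<t}" for \<eta>
 proof (rule weak[OF that(1) \<phi>])
  fix s x assume "\<eta> s \<noteq> 0" "x + s \<in> supp \<phi>"
  with that(2) in_supp[of \<eta> s] supp\<phi>[of "x + s"] show "x > R" by auto
 qed
 have const: "m s = m s'" if "s < t" "s' < t" for s s'
  unfolding m_def by (rule transport_constant(1)[OF v \<phi> _ _ weak', of "{..<t}"]) (use that in auto)
 have cont: "continuous_on UNIV m"
  unfolding m_def[abs_def] by (rule transport_constant(2)[OF v \<phi> _ _ weak', of "{..<t}" "t - 1" "t - 1"]) auto
 have "m s = 0" if "s < min 0 t" for s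
 proof -
  have "pairing (v' s) (\<lambda>x. \<phi> (x + 1 * s)) = 0"
   by (rule pairing_eq_0_disjoint[OF C1_curve_vanishing_past(2)[OF v _ past]])
    (use that supp\<phi>[OF in_supp] in fastforce)+
  moreover have "pairing (v s) (\<lambda>x. ddx \<phi> (x + 1 * s)) = 0"
   by (rule pairing_eq_0_disjoint[OF past]) (use that supp\<phi>[OF dir_deriv_in_supp] in fastforce)+
  ultimately show ?thesis by (simp add: m_def)
 qed
 then have z0: "m (min 0 t - 1) = 0" by (simp add: min_def)
 have "m s = 0" if "s < t" for s using const[OF that, of "min 0 t - 1"] z0 by (simp add: min_def split: if_splits)
 from zero_by_continuity[OF cont this] have "m t = 0" by blast
 then show ?thesis by (simp add: m_def d\<phi> \<phi>_def)
qed

text \<open>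
 The first order equation makes \<open>v t (x + t)\<close> locally independent of \<open>t\<close>. The values of \<open>h\<close> are read off at
 integer times, which cover successively more of the line, and agree on overlaps.
\<close>
lemma outgoing_profile:
 assumes v: "C1_curve v v'"
  and past: "\<And>t. t < 0 \<Longrightarrow> AE x in lebesgue. x \<in> {R<..} \<longrightarrow> v t x = 0"
  and weak: "\<And>\<eta> \<psi>. \<eta> \<in> \<D> \<Longrightarrow> \<psi> \<in> \<D> \<Longrightarrow>
   (\<And>t x. \<eta> t \<noteq> 0 \<Longrightarrow> x + t \<in> supp \<psi> \<Longrightarrow> x > R) \<Longrightarrow>
   (LBINT t. ddx (ddx \<eta>) t * pairing (v t) (\<lambda>x. \<psi> (x + 1 * t))
    + 2 * of_real 1 * (ddx \<eta> t * pairing (v t) (\<lambda>x. ddx \<psi> (x + 1 * t)))) = 0"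
 obtains h where "h \<in> borel_measurable lebesgue" "AE s in lebesgue. s < - R \<longrightarrow> h s = 0"
  "\<And>t. AE x in lebesgue. x > R \<longrightarrow> v t x = h (t - x)"
proof -
 note V = C1_curveD[OF v]
 have step: "AE y in lebesgue. y \<in> {R - t0<..} \<longrightarrow> v t (y + t) = v t0 (y + t0)" if t: "t0 \<le> t" for t t0
 proof -
  have L: "(\<lambda>y. v s (y + s)) \<in> L2" for s using L2_affine(1)[OF V(3), of 1 s s] by (simp add: add.commute)
  have "AE y in lebesgue. y \<in> {R - t0<..} \<longrightarrow> v t (y + t) - v t0 (y + t0) = 0"
  proof (rule fundamental_lemma_L2)
   fix \<psi> :: "real \<Rightarrow> complex" assume \<psi>: "\<psi> \<in> \<D>" "supp \<psi> \<subseteq> {R - t0<..}"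
   define q where "q s = pairing (v s) (\<lambda>x. \<psi> (x + (-1) * s))" for s
   have "(q has_vector_derivative 0) (at s)" if "t0 \<le> s" for s
   proof -
    define \<phi> where "\<phi> x = \<psi> (x + (-1) * s)" for x
    have \<phi>: "\<phi> \<in> \<D>" using test_affine[OF \<psi>(1), of 1 "- s"] by (simp add: \<phi>_def[abs_def])
    have d\<phi>: "ddx \<phi> = (\<lambda>y. ddx \<psi> (y + (-1) * s))"
     using dir_deriv_affine[OF test_functionsD(1)[OF \<psi>(1)], of 1 "- s"] by (simp add: \<phi>_def[abs_def])
    have "closed ((\<lambda>y. y - s) -` supp \<psi>)"
     by (intro continuous_closed_vimage continuous_intros) (auto simp: supp_def)
    then have "supp \<phi> \<subseteq> (\<lambda>y. y - s) -` supp \<psi>" by (intro supp_subset) (auto simp: \<phi>_def intro: in_supp)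
    then have "supp \<phi> \<subseteq> {R<..}" using \<psi>(2) that by fastforce
    from outgoing_first_order[OF v past weak \<phi> this, of s]
    have "pairing (v' s) \<phi> = pairing (v s) (ddx \<phi>)" by blast
    then have "pairing (v' s) (\<lambda>x. \<psi> (x + (-1) * s)) + pairing (v s) (\<lambda>x. of_real (-1) * ddx \<psi> (x + (-1) * s)) = 0"
     unfolding pairing_cmult by (simp add: d\<phi>) (simp add: \<phi>_def[abs_def])
    with pairing_has_vector_derivative[OF v test_translation_C1[OF \<psi>(1), of "-1"], of s]
    show ?thesis unfolding q_def[abs_def] by simp
   qed
   then have "norm (q t - q t0) \<le> 0 * (t - t0)" by (intro vector_derivative_bound[OF _ _ t]) auto
   then have "q t = q t0" by simp
   moreover have "q s = pairing (\<lambda>y. v s (y + s)) \<psi>" for s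
    unfolding q_def using pairing_affine[of 1 "v s" "\<lambda>x. \<psi> (x + (-1) * s)" s] by (simp add: add.commute)
   ultimately show "pairing (\<lambda>y. v t (y + t) - v t0 (y + t0)) \<psi> = 0"
    using pairing_diff[OF L L test_L2[OF \<psi>(1)]] by simp
  qed (auto intro: L2_diff L)
  then show ?thesis by simp
 qed
 have step': "AE s in lebesgue. s < t0 - R \<longrightarrow> v t (t - s) = v t0 (t0 - s)" if "t0 \<le> t" for t t0
  using AE_lebesgue_affine[of "-1" _ 0, OF _ step[OF that]] by (auto elim: eventually_mono)
 (* the integer time n s is the first one at which the ray t - x = s has reached x > R *)
 define n where "n s = nat (\<lfloor>s + R\<rfloor> + 1)" for s
 have n1: "s < real (n s) - R" for s unfolding n_def by linarith
 have n2: "n s \<le> N" if "s + R < real N" for s N unfolding n_def using that by linarith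
 define h where "h s = v (real (n s)) (real (n s) - s)" for s
 show ?thesis
 proof (rule that)
  show "h \<in> borel_measurable lebesgue" unfolding h_def
  proof (rule measurable_compose_countable[where f = "\<lambda>k s. v (real k) (real k - s)"])
   show "(\<lambda>s. v (real k) (real k - s)) \<in> borel_measurable lebesgue" for k
    using L2_D(1)[OF L2_affine(1)[OF V(3), of "-1" k "real k"]] by simp
   have "n \<in> measurable borel (count_space UNIV)" unfolding n_def[abs_def] by measurable
   then show "n \<in> measurable lebesgue (count_space UNIV)" by (simp add: measurable_completion)
  qed
  have "AE x in lebesgue. x \<in> {R<..} \<longrightarrow> v 0 x = 0"
   by (rule C1_curve_vanishing_past(1)[OF v _ past]) auto
  from AE_lebesgue_affine[of "-1" _ 0, OF _ this]
  have "AE s in lebesgue. - s \<in> {R<..} \<longrightarrow> v 0 (- s) = 0" by simp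
  then show "AE s in lebesgue. s < - R \<longrightarrow> h s = 0"
  proof eventually_elim
   case (elim s)
   have "n s = 0" if "s < - R" using n2[of s 0] that by simp
   then show ?case using elim by (auto simp: h_def)
  qed
  fix t
  obtain N where N: "t \<le> real N" using real_arch_simple by blast
  have "AE s in lebesgue. \<forall>k. k \<le> N \<longrightarrow> s < real k - R \<longrightarrow> v (real N) (real N - s) = v (real k) (real k - s)"
   unfolding AE_all_countable by (auto intro!: step')
  with step'[OF N] have "AE s in lebesgue. s < t - R \<longrightarrow> v t (t - s) = h s"
  proof eventually_elim
   case (elim s)
   show ?case
   proof
    assume s: "s < t - R"
    then have "n s \<le> N" using N by (intro n2) simp
    then show "v t (t - s) = h s" using elim s n1[of s] by (simp add: h_def)
   qed
  qed
  from AE_lebesgue_affine[of "-1" _ t, OF _ this]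
  show "AE x in lebesgue. x > R \<longrightarrow> v t x = h (t - x)" by (auto elim: eventually_mono)
 qed
qed

section \<open>Jointly measurable representatives and Fubini\<close>

lemma LINT_version:
 fixes f g :: "'a::euclidean_space \<Rightarrow> complex"
 assumes "g \<in> borel_fun" "AE x in lborel. f x = g x"
 shows "f \<in> borel_measurable lebesgue" "integrable lebesgue f \<longleftrightarrow> integrable lborel g" "(LINT x|lebesgue. f x) = (LBINT x. g x)"
proof -
 have g: "g \<in> borel_measurable lebesgue" using assms(1) by (simp add: measurable_completion)
 have ae: "AE x in lebesgue. g x = f x" using assms(2) unfolding AE_lebesgue by (auto elim: eventually_mono)
 show f: "f \<in> borel_measurable lebesgue" by (rule borel_measurable_AE[OF g ae])
 show "integrable lebesgue f \<longleftrightarrow> integrable lborel g"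
  using integrable_cong_AE[OF g f ae] integrable_completion[of g lborel] assms(1) by simp
 show "(LINT x|lebesgue. f x) = (LBINT x. g x)"
  using integral_cong_AE[OF g f ae] integral_completion[of g lborel] assms(1) by simp
qed

lemma AE_lborel_pairD:
 fixes P :: "real \<times> real \<Rightarrow> bool"
 assumes "AE p in lborel. P p"
 shows "AE t in lborel. AE x in lborel. P (t, x)" "AE x in lborel. AE t in lborel. P (t, x)"
proof -
 show "AE t in lborel. AE x in lborel. P (t, x)"
  by (rule lborel_pair.AE_pair) (subst lborel_prod, rule assms)
 obtain N where N: "{p. \<not> P p} \<subseteq> N" "N \<in> null_sets (lborel :: (real \<times> real) measure)"
  using assms by (auto simp: eventually_ae_filter)
 have "AE p in lborel. p \<notin> N" by (rule AE_not_in[OF N(2)])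
 then have 1: "AE t in lborel. AE x in lborel. (t, x) \<notin> N"
  by (intro lborel_pair.AE_pair) (subst lborel_prod)
 have "N \<in> sets borel" using N(2) by (auto simp: null_sets_def)
 then have "{p \<in> space (lborel \<Otimes>\<^sub>M lborel). (fst p, snd p) \<notin> N} \<in> sets (lborel \<Otimes>\<^sub>M (lborel :: real measure) :: (real \<times> real) measure)"
  unfolding lborel_prod by (simp add: Compl_eq[symmetric])
 from lborel_pair.AE_commute[OF this] 1 have "AE x in lborel. AE t in lborel. (t, x) \<notin> N" by simp
 then show "AE x in lborel. AE t in lborel. P (t, x)"
  by (rule eventually_mono, elim eventually_mono) (use N(1) in auto)
qed

lemma AE_lborel_pairI:
 fixes P :: "real \<times> real \<Rightarrow> bool"
 assumes "{p. P p} \<in> sets borel" "AE t in lborel. AE x in lborel. P (t, x)"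
 shows "AE p in lborel. P p"
proof -
 have "AE p in lborel \<Otimes>\<^sub>M lborel. P p"
  by (rule lborel_pair.AE_pair_measure) (use assms in \<open>simp_all only: lborel_prod space_lborel sets_lborel UNIV_I simp_thms space_borel\<close>)
 then show ?thesis by (subst (asm) lborel_prod)
qed

lemma AE_lborel_snd:
 assumes "AE x in lborel. P x"
 shows "AE p in lborel. P (snd (p :: real \<times> real))"
proof -
 obtain N where N: "{x. \<not> P x} \<subseteq> N" "N \<in> null_sets (lborel :: real measure)"
  using assms by (auto simp: eventually_ae_filter)
 have "AE x in lborel. x \<notin> N" by (rule AE_not_in[OF N(2)])
 moreover have "{p :: real \<times> real. snd p \<notin> N} \<in> sets borel"
 proof -
  have [measurable]: "N \<in> sets borel" using N(2) by (auto simp: null_sets_def)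
  have "Measurable.pred borel (\<lambda>p :: real \<times> real. snd p \<notin> N)" unfolding borel_prod[symmetric] by measurable
  then show ?thesis by (simp add: pred_def)
 qed
 ultimately have "AE p in lborel. snd (p :: real \<times> real) \<notin> N" by (intro AE_lborel_pairI) auto
 then show ?thesis by (rule eventually_mono) (use N(1) in auto)
qed

text \<open>
 The distinguished representatives of a curve of \<open>L\<^sup>2\<close> classes are only Lebesgue measurable in the pair; a Borel representative
 has Borel sections.
\<close>
definition joint_version :: "(real \<Rightarrow> real \<Rightarrow> complex) \<Rightarrow> (real \<times> real \<Rightarrow> complex) \<Rightarrow> bool" where
 "joint_version v v1 \<longleftrightarrow> v1 \<in> borel_fun \<and> (AE p in lborel. v (fst p) (snd p) = v1 p)"

lemma joint_version_exists:
 assumes "(\<lambda>(t, x). v t x) \<in> borel_measurable lebesgue"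
 obtains v1 where "joint_version v v1"
proof -
 from borel_version[OF assms] obtain v1 where "v1 \<in> borel_fun" "AE p in lborel. (case p of (t, x) \<Rightarrow> v t x) = v1 p"
  by blast
 then show ?thesis by (intro that[of v1]) (simp add: joint_version_def case_prod_beta)
qed

lemma joint_versionD:
 assumes "joint_version v v1"
 shows "v1 \<in> borel_fun" "AE t in lborel. AE x in lborel. v t x = v1 (t, x)"
  "AE x in lborel. AE t in lborel. v t x = v1 (t, x)"
 using assms AE_lborel_pairD[of "\<lambda>p. v (fst p) (snd p) = v1 p"] by (auto simp: joint_version_def)

text \<open>
 A curve in \<open>L\<^sup>2\<close> is a function of \<open>t\<close> with values in classes; integrals over space-time are computed through a
 jointly measurable representative.
\<close>
lemma Fubini_pairing:
 assumes v: "v \<in> C0_L2" "joint_version v v1" and k: "k \<in> borel_fun"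
  and kL: "\<And>t. (\<lambda>x. k (t, x)) \<in> L2" "\<And>t. L2_norm (\<lambda>x. k (t, x)) \<le> K t"
  and K: "integrable lborel (\<lambda>t. L2_norm (v t) * K t)"
  and m: "(\<lambda>t. pairing (v t) (\<lambda>x. k (t, x))) \<in> borel_fun"
 shows "integrable lborel (\<lambda>p. v1 p * k p)"
  "(LBINT p. v1 p * k p) = (LBINT t. pairing (v t) (\<lambda>x. k (t, x)))"
proof -
 note v1 = joint_versionD[OF v(2)]
 have [measurable]: "v1 \<in> borel_fun2" "k \<in> borel_fun2"
  using v1(1) k by (simp_all add: borel_prod)
 have sl: "AE t in lborel. integrable lborel (\<lambda>x. v1 (t, x) * k (t, x)) \<and> (LBINT x. v1 (t, x) * k (t, x)) = pairing (v t) (\<lambda>x. k (t, x))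
   \<and> (LBINT x. norm (v1 (t, x) * k (t, x))) \<le> L2_norm (v t) * K t"
  using v1(2)
 proof eventually_elim
  case (elim t)
  let ?f = "\<lambda>x. v t x * k (t, x)" and ?g = "\<lambda>x. v1 (t, x) * k (t, x)"
  have g: "?g \<in> borel_fun" by measurable
  have ae: "AE x in lborel. ?f x = ?g x" using elim by eventually_elim simp
  have f: "integrable lebesgue ?f" by (intro L2_mult_integrable C0_L2_D v(1) kL)
  note LV = LINT_version[OF g ae]
  have "(LBINT x. norm (?g x)) = (LINT x|lebesgue. norm (?g x))"
   using g by (intro integral_completion[symmetric]) auto
  also have "\<dots> = (LINT x|lebesgue. norm (?f x))"
   using ae LV(1) borel_lebesgue[OF g] by (intro integral_cong_AE) (auto simp: AE_lebesgue elim: eventually_mono)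
  also have "\<dots> \<le> L2_norm (v t) * L2_norm (\<lambda>x. k (t, x))" by (intro Cauchy_Schwarz_L2 C0_L2_D v(1) kL)
  also have "\<dots> \<le> L2_norm (v t) * K t" by (intro mult_left_mono kL L2_norm_nonneg)
  finally show ?case using f LV by (simp add: pairing_def)
 qed
 have int: "integrable (lborel \<Otimes>\<^sub>M lborel) (\<lambda>p. v1 p * k p)"
 proof (rule lborel_pair.Fubini_integrable)
  show "AE t in lborel. integrable lborel (\<lambda>x. v1 (t, x) * k (t, x))" using sl by (auto elim: eventually_mono)
  show "integrable lborel (\<lambda>t. LBINT x. norm (v1 (t, x) * k (t, x)))"
  proof (rule Bochner_Integration.integrable_bound[OF K])
   show "AE t in lborel. norm (LBINT x. norm (v1 (t, x) * k (t, x))) \<le> norm (L2_norm (v t) * K t)"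
    using sl
   proof eventually_elim
    case (elim t)
    have "norm (LBINT x. norm (v1 (t, x) * k (t, x))) = (LBINT x. norm (v1 (t, x) * k (t, x)))" by simp
    also have "\<dots> \<le> L2_norm (v t) * K t" using elim by blast
    also have "\<dots> \<le> norm (L2_norm (v t) * K t)" by simp
    finally show ?case .
   qed
  qed measurable
 qed measurable
 then show "integrable lborel (\<lambda>p. v1 p * k p)" by (simp add: lborel_prod)
 have "(LBINT p. v1 p * k p) = (LBINT t. LBINT x. v1 (t, x) * k (t, x))"
  using lborel_pair.integral_fst'[OF int] by (simp add: lborel_prod)
 also have "\<dots> = (LBINT t. pairing (v t) (\<lambda>x. k (t, x)))"
 proof (rule integral_cong_AE)
  show me: "(\<lambda>t. LBINT x. v1 (t, x) * k (t, x)) \<in> borel_measurable lborel" by measurable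
  show ae: "AE t in lborel. (LBINT x. v1 (t, x) * k (t, x)) = pairing (v t) (\<lambda>x. k (t, x))"
   using sl by (auto elim: eventually_mono)
  show "(\<lambda>t. pairing (v t) (\<lambda>x. k (t, x))) \<in> borel_measurable lborel" using m by simp
 qed
 finally show "(LBINT p. v1 p * k p) = (LBINT t. pairing (v t) (\<lambda>x. k (t, x)))" .
qed

section \<open>The weak wave equation tested along characteristics\<close>

abbreviation char_test :: "real \<Rightarrow> (real \<Rightarrow> complex) \<Rightarrow> (real \<Rightarrow> complex) \<Rightarrow> real \<times> real \<Rightarrow> complex" where
 "char_test c \<eta> \<psi> \<equiv> \<lambda>p. \<eta> (fst p) * \<psi> (snd p + c * fst p)"

lemma bounded_linear_char: "bounded_linear (\<lambda>p :: real \<times> real. snd p + c * fst p)"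
 by (intro bounded_linear_add bounded_linear_snd bounded_linear_mult_right[THEN bounded_linear_compose] bounded_linear_fst)

lemma char_test_has_derivative:
 assumes "smooth \<eta>" "smooth \<psi>"
 shows "(char_test c \<eta> \<psi> has_derivative
  (\<lambda>v. \<eta> (fst p) * ((snd v + c * fst v) *\<^sub>R ddx \<psi> (snd p + c * fst p))
   + (fst v *\<^sub>R ddx \<eta> (fst p)) * \<psi> (snd p + c * fst p))) (at p)"
 using has_derivative_mult[OF dir_deriv_compose_affine[OF bounded_linear_fst assms(1), of 0 p]
   dir_deriv_compose_affine[OF bounded_linear_char assms(2), of c 0 p]] by simp

lemma char_test_smooth: "smooth \<eta> \<Longrightarrow> smooth \<psi> \<Longrightarrow> smooth (char_test c \<eta> \<psi>)"
 using smooth_mult[OF smooth_compose_affine[OF bounded_linear_fst, of \<eta> 0] smooth_compose_affine[OF bounded_linear_char, of \<psi> c 0]] by simp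

lemma dir_deriv_add:
 "smooth f \<Longrightarrow> smooth g \<Longrightarrow> dir_deriv v (\<lambda>p. f p + g p) = (\<lambda>p. dir_deriv v f p + dir_deriv v g p)"
 by (intro ext dir_deriv_eq has_derivative_add smooth_has_derivative)

lemma dir_deriv_cmult: "smooth f \<Longrightarrow> dir_deriv v (\<lambda>p. k * f p) = (\<lambda>p. k * dir_deriv v f p)"
 by (intro ext dir_deriv_eq has_derivative_mult_right smooth_has_derivative)

lemma char_test_derivs:
 assumes "smooth \<eta>" "smooth \<psi>"
 shows "dir_deriv (1, 0) (char_test c \<eta> \<psi>) = (\<lambda>p. char_test c (ddx \<eta>) \<psi> p + of_real c * char_test c \<eta> (ddx \<psi>) p)"
  and "dir_deriv (0, 1) (char_test c \<eta> \<psi>) = char_test c \<eta> (ddx \<psi>)"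
 using dir_deriv_eq[OF char_test_has_derivative[OF assms], of _ c]
 by (simp_all add: fun_eq_iff scaleR_conv_of_real algebra_simps)

lemma char_test_second_derivs:
 assumes "smooth \<eta>" "smooth \<psi>"
 shows "D (1, 0) (D (1, 0) (char_test c \<eta> \<psi>)) p = - (char_test c (ddx (ddx \<eta>)) \<psi> p
   + 2 * of_real c * char_test c (ddx \<eta>) (ddx \<psi>) p + of_real (c\<^sup>2) * char_test c \<eta> (ddx (ddx \<psi>)) p)"
  and "D (0, 1) (D (0, 1) (char_test c \<eta> \<psi>)) p = - char_test c \<eta> (ddx (ddx \<psi>)) p"
proof -
 have s: "smooth (ddx \<eta>)" "smooth (ddx \<psi>)" using assms by (auto intro: smooth_dir_deriv)
 have s1: "smooth (dir_deriv (1, 0) (char_test c \<eta> \<psi>))" "smooth (dir_deriv (0, 1) (char_test c \<eta> \<psi>))"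
  by (intro smooth_dir_deriv char_test_smooth assms, simp add: Basis_prod_def)+
 have 1: "dir_deriv (1, 0) (dir_deriv (1, 0) (char_test c \<eta> \<psi>)) p = char_test c (ddx (ddx \<eta>)) \<psi> p
   + 2 * of_real c * char_test c (ddx \<eta>) (ddx \<psi>) p + of_real (c\<^sup>2) * char_test c \<eta> (ddx (ddx \<psi>)) p"
  unfolding char_test_derivs(1)[OF assms]
   dir_deriv_add[OF char_test_smooth[OF s(1) assms(2)] smooth_cmult[OF char_test_smooth[OF assms(1) s(2)]]]
   dir_deriv_cmult[OF char_test_smooth[OF assms(1) s(2)]] char_test_derivs(1)[OF s(1) assms(2)] char_test_derivs(1)[OF assms(1) s(2)]
  by (simp add: algebra_simps power2_eq_square)
 have 2: "dir_deriv (0, 1) (dir_deriv (0, 1) (char_test c \<eta> \<psi>)) p = char_test c \<eta> (ddx (ddx \<psi>)) p"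
  unfolding char_test_derivs(2)[OF assms] char_test_derivs(2)[OF assms(1) s(2)] ..
 show "D (1, 0) (D (1, 0) (char_test c \<eta> \<psi>)) p = - (char_test c (ddx (ddx \<eta>)) \<psi> p
   + 2 * of_real c * char_test c (ddx \<eta>) (ddx \<psi>) p + of_real (c\<^sup>2) * char_test c \<eta> (ddx (ddx \<psi>)) p)"
  unfolding D_def dir_deriv_cmult[OF s1(1)] 1[symmetric] by simp
 show "D (0, 1) (D (0, 1) (char_test c \<eta> \<psi>)) p = - char_test c \<eta> (ddx (ddx \<psi>)) p"
  unfolding D_def dir_deriv_cmult[OF s1(2)] 2[symmetric] by simp
qed

lemma char_test_test_functions:
 assumes "\<eta> \<in> \<D>" "\<psi> \<in> \<D>"
 shows "char_test c \<eta> \<psi> \<in> \<D>"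
proof (rule test_functionsI)
 show "smooth (char_test c \<eta> \<psi>)" by (intro char_test_smooth test_functionsD assms)
 show "compact ((\<lambda>p. (fst p, snd p - c * fst p)) ` (supp \<eta> \<times> supp \<psi>))"
  by (intro compact_continuous_image compact_Times test_functionsD assms continuous_intros)
 fix p assume "char_test c \<eta> \<psi> p \<noteq> 0"
 then have "(fst p, snd p + c * fst p) \<in> supp \<eta> \<times> supp \<psi>" using in_supp[of \<eta> "fst p"] in_supp[of \<psi> "snd p + c * fst p"] by auto
 then show "p \<in> (\<lambda>p. (fst p, snd p - c * fst p)) ` (supp \<eta> \<times> supp \<psi>)"
  by (rule rev_image_eqI) simp
qed

lemma Fubini_char_test:
 assumes v: "v \<in> C0_L2" "joint_version v v1" and \<eta>: "\<eta> \<in> \<D>" and \<psi>: "\<psi> \<in> \<D>"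
 shows "integrable lborel (\<lambda>p. v1 p * char_test c \<eta> \<psi> p)"
  "(LBINT p. v1 p * char_test c \<eta> \<psi> p) = (LBINT t. \<eta> t * pairing (v t) (\<lambda>x. \<psi> (x + c * t)))"
proof -
 have L: "(\<lambda>x. \<psi> (x + c * t)) \<in> L2" "L2_norm (\<lambda>x. \<psi> (x + c * t)) = L2_norm \<psi>" for t
  using L2_affine[OF test_L2[OF \<psi>], of 1 "c * t"] by (simp_all add: add.commute)
 have cp: "continuous_on UNIV (\<lambda>t. pairing (v t) (\<lambda>x. \<psi> (x + c * t)))"
  by (intro C0_L2_pairing_continuous v test_translation_C0 \<psi>)
 have cn: "continuous_on UNIV (\<lambda>t. of_real (L2_norm (v t)) :: complex)"
  by (intro continuous_intros C0_L2_norm_continuous v)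
 have "integrable lborel (\<lambda>t. norm (\<eta> t * of_real (L2_norm (v t))) * L2_norm \<psi>)"
  by (intro integrable_mult_left integrable_norm integrable_test_mult \<eta> cn)
 then have K: "integrable lborel (\<lambda>t. L2_norm (v t) * (norm (\<eta> t) * L2_norm \<psi>))"
  by (simp add: norm_mult L2_norm_nonneg mult_ac)
 have k: "char_test c \<eta> \<psi> \<in> borel_fun"
  by (intro smooth_borel char_test_smooth test_functionsD \<eta> \<psi>)
 have m: "(\<lambda>t. pairing (v t) (\<lambda>x. char_test c \<eta> \<psi> (t, x))) \<in> borel_fun"
  unfolding fst_conv snd_conv pairing_cmult
  by (intro borel_measurable_times test_borel[OF \<eta>] borel_measurable_continuous_onI[OF cp])
 have kL: "(\<lambda>x. char_test c \<eta> \<psi> (t, x)) \<in> L2" "L2_norm (\<lambda>x. char_test c \<eta> \<psi> (t, x)) \<le> norm (\<eta> t) * L2_norm \<psi>" for t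
  using L2_cmult[OF L(1), of "\<eta> t"] by (simp_all add: L(2))
 show "integrable lborel (\<lambda>p. v1 p * char_test c \<eta> \<psi> p)"
  by (rule Fubini_pairing(1)[OF v k kL K m])
 show "(LBINT p. v1 p * char_test c \<eta> \<psi> p) = (LBINT t. \<eta> t * pairing (v t) (\<lambda>x. \<psi> (x + c * t)))"
  using Fubini_pairing(2)[OF v k kL K m] by (simp add: pairing_cmult)
qed

text \<open>
 The curves \<open>u\<close>, \<open>ut\<close> are accompanied by Borel representatives \<open>u1\<close>, \<open>ut1\<close>, since integrals in
 time for fixed \<open>x\<close> make no sense for curves of classes.
\<close>
locale wave_setting =
 fixes R T0 \<gamma> :: real and a :: "real \<Rightarrow> real \<Rightarrow> complex" and g :: "real \<Rightarrow> complex"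
  and u ut :: "real \<Rightarrow> real \<Rightarrow> complex" and u1 ut1 :: "real \<times> real \<Rightarrow> complex"
 assumes R: "R > 0" and T0: "T0 > 0" and \<gamma>: "\<gamma> > 0"
  and a_smooth: "a \<in> Linf_Cc_smooth"
  and a_supp: "AE x in lebesgue. \<forall>t. (x, t) \<notin> {- R..R} \<times> {- T0..T0} \<longrightarrow> a x t = 0"
  and g: "g \<in> \<D>" and g_supp: "supp g \<subseteq> {R<..}"
  and curve: "C1_curve u ut"
  and u1: "joint_version u u1" and ut1: "joint_version ut ut1"
  and H1: "\<exists>w\<in>C0_L2. \<forall>t. weak_deriv (u t) (w t)"
  and weak: "\<And>\<phi>. \<phi> \<in> \<D> \<Longrightarrow>
     (LINT p|lebesgue. (case p of (t, x) \<Rightarrow>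
        u t x * D (1, 0) (D (1, 0) \<phi>) (t, x)
       - a x t * memory \<gamma> (\<lambda>t' x'. (1 / \<i>) * ut t' x') t x * \<phi> (t, x)
       - u t x * D (0, 1) (D (0, 1) \<phi>) (t, x))) = 0"
  and initial: "\<And>t. t < 0 \<Longrightarrow> AE x in lebesgue. u t x = g (t - x)"
begin

lemma g_zero: "y \<le> R \<Longrightarrow> g y = 0"
 using g_supp in_supp[of g y] by force

text \<open>
 The source of the wave equation is supported in \<open>{- R..R} \<times> {- T0..T0}\<close>; test functions of the form \<open>\<eta> t * \<psi> (x
 + c * t)\<close> that avoid this set see the free equation.
\<close>
lemma weak_characteristic:
 assumes c: "c\<^sup>2 = 1" and \<eta>: "\<eta> \<in> \<D>" and \<psi>: "\<psi> \<in> \<D>"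
  and disj: "\<And>t x. \<eta> t \<noteq> 0 \<Longrightarrow> x + c * t \<in> supp \<psi> \<Longrightarrow> (x, t) \<notin> {- R..R} \<times> {- T0..T0}"
 shows "(LBINT t. ddx (ddx \<eta>) t * pairing (u t) (\<lambda>x. \<psi> (x + c * t))
    + 2 * of_real c * (ddx \<eta> t * pairing (u t) (\<lambda>x. ddx \<psi> (x + c * t)))) = 0"
proof -
 let ?d = "ddx \<eta>" and ?d\<psi> = "ddx \<psi>"
 note V = C1_curveD[OF curve]
 have t: "?d \<in> \<D>" "?d\<psi> \<in> \<D>" "ddx ?d \<in> \<D>"
  by (intro test_dir_deriv \<eta> \<psi>)+
 let ?G = "\<lambda>p. u1 p * char_test c (ddx ?d) \<psi> p + 2 * of_real c * (u1 p * char_test c ?d ?d\<psi> p)"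
 let ?F = "\<lambda>p. case p of (t, x) \<Rightarrow>
        u t x * D (1, 0) (D (1, 0) (char_test c \<eta> \<psi>)) (t, x)
       - a x t * memory \<gamma> (\<lambda>t' x'. (1 / \<i>) * ut t' x') t x * char_test c \<eta> \<psi> (t, x)
       - u t x * D (0, 1) (D (0, 1) (char_test c \<eta> \<psi>)) (t, x)"
 have sm: "smooth \<eta>" "smooth \<psi>" using \<eta> \<psi> test_functionsD by auto
 note F1 = Fubini_char_test[OF V(1) u1 t(3) \<psi>, of c] and F2 = Fubini_char_test[OF V(1) u1 t(1) t(2), of c]
 have "AE p in lborel. \<forall>t. (snd p, t) \<notin> {- R..R} \<times> {- T0..T0} \<longrightarrow> a (snd (p :: real \<times> real)) t = 0"
  using a_supp unfolding AE_lebesgue by (rule AE_lborel_snd)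
 moreover have "AE p in lborel. u (fst p) (snd p) = u1 p" using u1 by (simp add: joint_version_def)
 ultimately have ae: "AE p in lborel. - ?F p = ?G p"
 proof eventually_elim
  case (elim p)
  obtain t x where p: "p = (t, x)" by (cases p)
  have "a x t * memory \<gamma> (\<lambda>t' x'. (1 / \<i>) * ut t' x') t x * char_test c \<eta> \<psi> (t, x) = 0"
  proof (cases "char_test c \<eta> \<psi> (t, x) = 0")
   case False
   then have "a x t = 0" using disj[of t x] in_supp[of \<psi> "x + c * t"] elim by (auto simp: p)
   then show ?thesis by simp
  qed simp
  then show ?case using elim(2) c by (simp add: p char_test_second_derivs[OF sm] algebra_simps)
 qed
 have gm: "?G \<in> borel_fun"
  using F1(1) F2(1) by (auto dest!: borel_measurable_integrable)
 have "0 = (LINT p|lebesgue. - ?F p)"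
  using weak[OF char_test_test_functions[OF \<eta> \<psi>, of c]] by (subst Bochner_Integration.integral_minus) simp
 also have "\<dots> = (LBINT p. ?G p)" by (rule LINT_version(3)[OF gm ae])
 also have "\<dots> = (LBINT p. u1 p * char_test c (ddx ?d) \<psi> p) + 2 * of_real c * (LBINT p. u1 p * char_test c ?d ?d\<psi> p)"
  using F1(1) F2(1) by simp
 also have "\<dots> = (LBINT t. ddx (ddx \<eta>) t * pairing (u t) (\<lambda>x. \<psi> (x + c * t)))
    + 2 * of_real c * (LBINT t. ddx \<eta> t * pairing (u t) (\<lambda>x. ddx \<psi> (x + c * t)))"
  unfolding F1(2) F2(2) ..
 also have "\<dots> = (LBINT t. ddx (ddx \<eta>) t * pairing (u t) (\<lambda>x. \<psi> (x + c * t))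
    + 2 * of_real c * (ddx \<eta> t * pairing (u t) (\<lambda>x. ddx \<psi> (x + c * t))))"
 proof -
  have "integrable lborel (\<lambda>t. ddx (ddx \<eta>) t * pairing (u t) (\<lambda>x. \<psi> (x + c * t)))"
   "integrable lborel (\<lambda>t. ddx \<eta> t * pairing (u t) (\<lambda>x. ddx \<psi> (x + c * t)))"
   by (intro integrable_test_mult t C0_L2_pairing_continuous V test_translation_C0 \<psi>)+
  then show ?thesis by simp
 qed
 finally show ?thesis by simp
qed

lemma right_profile:
 obtains h where "h \<in> borel_measurable lebesgue" "AE s in lebesgue. s < - R \<longrightarrow> h s = 0"
  "\<And>t. AE x in lebesgue. x > R \<longrightarrow> u t x = h (t - x)"
proof (rule outgoing_profile[OF curve])
 fix t :: real assume t: "t < 0"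
 show "AE x in lebesgue. x \<in> {R<..} \<longrightarrow> u t x = 0"
  using initial[OF t] by eventually_elim (use t R in \<open>auto intro!: g_zero\<close>)
next
 fix \<eta> \<psi> :: "real \<Rightarrow> complex"
 assume "\<eta> \<in> \<D>" "\<psi> \<in> \<D>" and d: "\<And>t x. \<eta> t \<noteq> 0 \<Longrightarrow> x + t \<in> supp \<psi> \<Longrightarrow> x > R"
 then show "(LBINT t. ddx (ddx \<eta>) t * pairing (u t) (\<lambda>x. \<psi> (x + 1 * t))
    + 2 * of_real 1 * (ddx \<eta> t * pairing (u t) (\<lambda>x. ddx \<psi> (x + 1 * t)))) = 0"
  by (intro weak_characteristic) fastforce+
qed (rule that)

text \<open>
 Reflection \<open>x \<mapsto> - x\<close> reduces this to \<open>outgoing_profile\<close>, applied after subtraction of the free wave \<open>g (t -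
 x)\<close>, which accounts for the past.
\<close>
lemma left_profile:
 obtains h where "h \<in> borel_measurable lebesgue" "AE s in lebesgue. s < - R \<longrightarrow> h s = 0"
  "\<And>t. AE x in lebesgue. x < - R \<longrightarrow> u t x = g (t - x) + h (x + t)"
proof -
 define v where "v t x = u t (- x) - g (x + 1 * t)" for t x
 define v' where "v' t x = ut t (- x) - of_real 1 * ddx g (x + 1 * t)" for t x
 have v: "C1_curve v v'"
  unfolding v_def[abs_def] v'_def[abs_def] by (intro C1_curve_diff C1_curve_reflect curve test_translation_C1 g)
 have past: "AE x in lebesgue. x \<in> {R<..} \<longrightarrow> v t x = 0" if "t < 0" for t
  using AE_lebesgue_affine[of "-1" _ 0, OF _ initial[OF that]] by (auto simp: v_def add.commute elim!: eventually_mono)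
 have w: "(LBINT t. ddx (ddx \<eta>) t * pairing (v t) (\<lambda>x. \<psi> (x + 1 * t))
    + 2 * of_real 1 * (ddx \<eta> t * pairing (v t) (\<lambda>x. ddx \<psi> (x + 1 * t)))) = 0"
  if \<eta>: "\<eta> \<in> \<D>" and \<psi>: "\<psi> \<in> \<D>" and d: "\<And>t x. \<eta> t \<noteq> 0 \<Longrightarrow> x + t \<in> supp \<psi> \<Longrightarrow> x > R" for \<eta> \<psi>
 proof -
  define \<phi> where "\<phi> y = \<psi> (- 1 * y + 0)" for y
  have \<phi>: "\<phi> \<in> \<D>" unfolding \<phi>_def[abs_def] by (rule test_affine[OF \<psi>]) simp
  have d\<phi>: "ddx \<phi> = (\<lambda>y. - ddx \<psi> (- y))"
   unfolding \<phi>_def[abs_def] dir_deriv_affine[OF test_functionsD(1)[OF \<psi>]] by simp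
  have supp\<phi>: "- y \<in> supp \<psi>" if "y \<in> supp \<phi>" for y
  proof -
   have "closed ((\<lambda>y. - y) -` supp \<psi>)"
    by (intro continuous_closed_vimage continuous_intros) (auto simp: supp_def)
   then have "supp \<phi> \<subseteq> (\<lambda>y. - y) -` supp \<psi>" by (intro supp_subset) (auto simp: \<phi>_def intro: in_supp)
   then show ?thesis using that by auto
  qed
  have 1: "(LBINT t. ddx (ddx \<eta>) t * pairing (u t) (\<lambda>x. \<phi> (x + (-1) * t))
    + 2 * of_real (-1) * (ddx \<eta> t * pairing (u t) (\<lambda>x. ddx \<phi> (x + (-1) * t)))) = 0"
  proof (rule weak_characteristic[OF _ \<eta> \<phi>])
   fix t x assume "\<eta> t \<noteq> 0" "x + (-1) * t \<in> supp \<phi>"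
   with d[of t "- x"] supp\<phi>[of "x + (-1) * t"] have "x < - R" by simp
   then show "(x, t) \<notin> {- R..R} \<times> {- T0..T0}" by simp
  qed simp
  note V = C1_curveD[OF curve]
  have gL: "(\<lambda>x. g (x + k)) \<in> L2" for k using test_L2[OF test_affine[OF g, of 1 k]] by simp
  have uL: "(\<lambda>x. u t (- x)) \<in> L2" for t using L2_affine(1)[OF V(3)[of t], of "-1" 0] by simp
  have tL: "(\<lambda>x. f (x + 1 * t)) \<in> L2" if "f \<in> \<D>" for f t using test_L2[OF test_affine[OF that, of 1 t]] by simp
  have p: "pairing (v t) (\<lambda>x. f (x + 1 * t)) = pairing (u t) (\<lambda>x. f (- (x + (-1) * t))) - pairing g f"
   if f: "f \<in> \<D>" for f t
  proof -
   have "pairing (v t) (\<lambda>x. f (x + 1 * t)) = pairing (\<lambda>x. u t (- x)) (\<lambda>x. f (x + 1 * t)) - pairing (\<lambda>x. g (x + 1 * t)) (\<lambda>x. f (x + 1 * t))"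
    unfolding v_def[abs_def] by (rule pairing_diff[OF uL tL[OF g] tL[OF f]])
   also have "pairing (\<lambda>x. u t (- x)) (\<lambda>x. f (x + 1 * t)) = pairing (u t) (\<lambda>x. f (- (x + (-1) * t)))"
    using pairing_affine[of "-1" "\<lambda>x. u t (- x)" "\<lambda>x. f (x + 1 * t)" 0] by (simp add: algebra_simps)
   also have "pairing (\<lambda>x. g (x + 1 * t)) (\<lambda>x. f (x + 1 * t)) = pairing g f"
    using pairing_affine[of 1 g f t] by (simp add: add.commute)
   finally show ?thesis .
  qed
  have c: "continuous_on UNIV (\<lambda>t. pairing (u t) (\<lambda>x. \<phi> (x + (-1) * t)))" "continuous_on UNIV (\<lambda>t. pairing (u t) (\<lambda>x. ddx \<phi> (x + (-1) * t)))"
   by (intro C0_L2_pairing_continuous V test_translation_C0 \<phi> test_dir_deriv)+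
  have td: "ddx \<eta> \<in> \<D>" by (rule test_dir_deriv[OF \<eta>])
  note i = integrable_test_mult[OF test_dir_deriv[OF td] c(1)] integrable_test_mult[OF td c(2)]
   integrable_test_mult[OF test_dir_deriv[OF td] continuous_on_const[of UNIV 1]] integrable_test_mult[OF td continuous_on_const[of UNIV 1]]
  have z: "(LBINT t. ddx f t) = 0" if "f \<in> \<D>" for f :: "real \<Rightarrow> complex"
   using test_integration_by_parts[OF that, of "\<lambda>_. 1" "\<lambda>_. 0"] by simp
  have "(LBINT t. ddx (ddx \<eta>) t * pairing (v t) (\<lambda>x. \<psi> (x + 1 * t))
    + 2 * of_real 1 * (ddx \<eta> t * pairing (v t) (\<lambda>x. ddx \<psi> (x + 1 * t)))) =
   (LBINT t. (ddx (ddx \<eta>) t * pairing (u t) (\<lambda>x. \<phi> (x + (-1) * t))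
    + 2 * of_real (-1) * (ddx \<eta> t * pairing (u t) (\<lambda>x. ddx \<phi> (x + (-1) * t))))
    - (ddx (ddx \<eta>) t * pairing g \<psi> + 2 * (ddx \<eta> t * pairing g (ddx \<psi>))))"
  proof (rule Bochner_Integration.integral_cong[OF refl])
   fix t
   have e1: "(\<lambda>x. \<phi> (x + (-1) * t)) = (\<lambda>x. \<psi> (- (x + (-1) * t)))" by (simp add: \<phi>_def)
   have e2: "pairing (u t) (\<lambda>x. ddx \<phi> (x + (-1) * t)) = - pairing (u t) (\<lambda>x. ddx \<psi> (- (x + (-1) * t)))"
    unfolding d\<phi> using pairing_cmult(2)[of "u t" "-1"] by simp
   show "ddx (ddx \<eta>) t * pairing (v t) (\<lambda>x. \<psi> (x + 1 * t))
    + 2 * of_real 1 * (ddx \<eta> t * pairing (v t) (\<lambda>x. ddx \<psi> (x + 1 * t))) =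
    ddx (ddx \<eta>) t * pairing (u t) (\<lambda>x. \<phi> (x + (-1) * t))
    + 2 * of_real (-1) * (ddx \<eta> t * pairing (u t) (\<lambda>x. ddx \<phi> (x + (-1) * t)))
    - (ddx (ddx \<eta>) t * pairing g \<psi> + 2 * (ddx \<eta> t * pairing g (ddx \<psi>)))"
    unfolding p[OF \<psi>] p[OF test_dir_deriv[OF \<psi>]] e2 unfolding e1 of_real_1 of_real_minus by algebra
  qed
  also have "\<dots> = 0 - (LBINT t. ddx (ddx \<eta>) t * pairing g \<psi> + 2 * (ddx \<eta> t * pairing g (ddx \<psi>)))"
   unfolding 1[symmetric] by (rule Bochner_Integration.integral_diff) (use i in simp_all)
  also have "\<dots> = 0" using i z[OF \<eta>] z[OF td] by simp
  finally show ?thesis .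
 qed
 obtain h where h: "h \<in> borel_measurable lebesgue" "AE s in lebesgue. s < - R \<longrightarrow> h s = 0"
  "\<And>t. AE x in lebesgue. x > R \<longrightarrow> v t x = h (t - x)"
  using outgoing_profile[OF v past w] by blast
 show ?thesis
 proof (rule that[OF h(1,2)])
  fix t
  show "AE x in lebesgue. x < - R \<longrightarrow> u t x = g (t - x) + h (x + t)"
   using AE_lebesgue_affine[of "-1" _ 0, OF _ h(3)[of t]] by (auto simp: v_def add.commute diff_eq_eq elim!: eventually_mono)
 qed
qed

text \<open>
 For \<open>t > T0\<close> the equation is free everywhere, and \<open>ut + c w\<close>, with \<open>w\<close> the space derivative and
 \<open>c\<close> one of \<open>1\<close>, \<open>- 1\<close>, is merely translated, so that its norm is constant. The time derivative is half the
 sum of these two functions.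
\<close>

lemma late_time_derivative_bound: "\<exists>C\<ge>0. \<forall>t\<ge>t0. L2_norm (ut t) \<le> C"
proof -
 note V = C1_curveD[OF curve]
 obtain w where w: "w \<in> C0_L2" "\<And>t. weak_deriv (u t) (w t)" using H1 by blast
 define z where "z c t x = ut t x + of_real c * w t x" for c t x
 have zL: "z c t \<in> L2" for c t unfolding z_def[abs_def] by (intro L2_add L2_cmult V C0_L2_D[OF w(1)])
 have cn: "L2_norm (z c s) = L2_norm (z c t)" if c: "c\<^sup>2 = 1" and st: "T0 < s" "T0 < t" for c s t
 proof -
  have sL: "(\<lambda>x. z c t (x + k)) \<in> L2" "L2_norm (\<lambda>x. z c t (x + k)) = L2_norm (z c t)" for t k
   using L2_affine[OF zL, of 1 c t k] by (simp_all add: add.commute)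
  have "AE x in lebesgue. x \<in> UNIV \<longrightarrow> z c s (x + - c * s) - z c t (x + - c * t) = 0"
  proof (rule fundamental_lemma_L2)
   fix \<psi> :: "real \<Rightarrow> complex" assume \<psi>: "\<psi> \<in> \<D>"
   define m where "m t = pairing (ut t) (\<lambda>x. \<psi> (x + c * t)) - of_real c * pairing (u t) (\<lambda>x. ddx \<psi> (x + c * t))" for t
   have "m s = m t" unfolding m_def
   proof (rule transport_constant(1)[OF curve \<psi>, of "{T0<..}"])
    fix \<eta> :: "real \<Rightarrow> complex" assume \<eta>: "\<eta> \<in> \<D>" "supp \<eta> \<subseteq> {T0<..}"
    show "(LBINT t. ddx (ddx \<eta>) t * pairing (u t) (\<lambda>x. \<psi> (x + c * t))
    + 2 * of_real c * (ddx \<eta> t * pairing (u t) (\<lambda>x. ddx \<psi> (x + c * t)))) = 0"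
     by (rule weak_characteristic[OF c \<eta>(1) \<psi>]) (use \<eta>(2) in_supp[of \<eta>] in fastforce)
   qed (use st in auto)
   moreover have "m t = pairing (\<lambda>x. z c t (x + - c * t)) \<psi>" for t
   proof -
    have \<psi>t: "(\<lambda>x. \<psi> (x + c * t)) \<in> \<D>" using test_affine[OF \<psi>, of 1 "c * t"] by simp
    have d: "ddx (\<lambda>x. \<psi> (x + c * t)) = (\<lambda>x. ddx \<psi> (x + c * t))"
     using dir_deriv_affine[OF test_functionsD(1)[OF \<psi>], of 1 "c * t"] by simp
    have "pairing (u t) (\<lambda>x. ddx \<psi> (x + c * t)) = - pairing (w t) (\<lambda>x. \<psi> (x + c * t))"
     using w(2)[of t] \<psi>t unfolding weak_deriv_def pairing_def d[symmetric] by blast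
    then have "m t = pairing (ut t) (\<lambda>x. \<psi> (x + c * t)) + pairing (\<lambda>x. of_real c * w t x) (\<lambda>x. \<psi> (x + c * t))"
     by (simp add: m_def pairing_cmult)
    also have "\<dots> = pairing (z c t) (\<lambda>x. \<psi> (x + c * t))"
     unfolding z_def[abs_def] by (intro pairing_add[symmetric] V L2_cmult C0_L2_D[OF w(1)] test_L2 \<psi>t)
    also have "\<dots> = pairing (\<lambda>x. z c t (x + - c * t)) \<psi>"
     using pairing_affine[of 1 "z c t" "\<lambda>x. \<psi> (x + c * t)" "- c * t"] by (simp add: add.commute)
    finally show ?thesis .
   qed
   ultimately show "pairing (\<lambda>x. z c s (x + - c * s) - z c t (x + - c * t)) \<psi> = 0"
    using pairing_diff[OF sL(1)[of s "- c * s"] sL(1)[of t "- c * t"] test_L2[OF \<psi>]] by simp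
  next
   show "(\<lambda>x. z c s (x + - c * s) - z c t (x + - c * t)) \<in> L2" by (intro L2_diff sL)
  qed simp
  then have "L2_norm (\<lambda>x. z c s (x + - c * s)) = L2_norm (\<lambda>x. z c t (x + - c * t))"
   by (intro L2_norm_cong L2_D(1) sL) (auto elim: eventually_mono)
  then show ?thesis unfolding sL(2) .
 qed
 have late: "L2_norm (ut t) \<le> L2_norm (z 1 (T0 + 1)) + L2_norm (z (-1) (T0 + 1))" if "T0 < t" for t
 proof -
  have "(\<lambda>x. 2 * ut t x) = (\<lambda>x. z 1 t x + z (-1) t x)" by (simp add: z_def)
  then have "2 * L2_norm (ut t) \<le> L2_norm (z 1 t) + L2_norm (z (-1) t)"
   using L2_cmult(2)[OF V(4), of 2 t] L2_add(2)[OF zL zL, of 1 t "-1" t] by simp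
  moreover have "L2_norm (z 1 t) = L2_norm (z 1 (T0 + 1))" "L2_norm (z (-1) t) = L2_norm (z (-1) (T0 + 1))"
   using that by (auto intro!: cn)
  ultimately show ?thesis using L2_norm_nonneg[of "ut t"] by linarith
 qed
 have "bounded ((\<lambda>t. L2_norm (ut t)) ` {t0..T0})"
  by (intro compact_imp_bounded compact_continuous_image C0_L2_norm_continuous V compact_Icc)
 then obtain B where B: "\<And>t. t \<in> {t0..T0} \<Longrightarrow> L2_norm (ut t) \<le> B"
  unfolding bounded_iff by (metis abs_ge_self imageI order_trans real_norm_def)
 let ?C = "max B 0 + (L2_norm (z 1 (T0 + 1)) + L2_norm (z (-1) (T0 + 1)))"
 have "L2_norm (ut t) \<le> ?C" if "t \<ge> t0" for t
  using late[of t] B[of t] that L2_norm_nonneg[of "z 1 (T0 + 1)"] L2_norm_nonneg[of "z (-1) (T0 + 1)"]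
  by (cases "t > T0") auto
 moreover have "?C \<ge> 0" using L2_norm_nonneg[of "z 1 (T0 + 1)"] L2_norm_nonneg[of "z (-1) (T0 + 1)"] by simp
 ultimately show ?thesis by blast
qed

text \<open>
 The bound on the time derivative is integrated by the mean value inequality.
\<close>
lemma linear_growth: "\<exists>B\<ge>0. \<forall>t\<ge>t0. L2_norm (u t) \<le> B * (1 + \<bar>t\<bar>) \<and> L2_norm (ut t) \<le> B * (1 + \<bar>t\<bar>)"
proof -
 note V = C1_curveD[OF curve]
 obtain C where C: "C \<ge> 0" "\<And>t. t \<ge> t0 \<Longrightarrow> L2_norm (ut t) \<le> C" using late_time_derivative_bound by blast
 let ?B = "L2_norm (u t0) + C * (1 + \<bar>t0\<bar>)"
 have B0: "?B \<ge> 0" using C(1) L2_norm_nonneg[of "u t0"] by simp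
 have CB: "C \<le> ?B" "L2_norm (u t0) \<le> ?B" using C(1) L2_norm_nonneg[of "u t0"] by (simp_all add: distrib_left)
 have "L2_norm (u t) \<le> ?B * (1 + \<bar>t\<bar>)" "L2_norm (ut t) \<le> ?B * (1 + \<bar>t\<bar>)" if t: "t \<ge> t0" for t
 proof -
  have "L2_norm (ut t) \<le> ?B" using C(2)[OF t] CB(1) by simp
  also have "\<dots> \<le> ?B * (1 + \<bar>t\<bar>)" using B0 by (simp add: distrib_left)
  finally show "L2_norm (ut t) \<le> ?B * (1 + \<bar>t\<bar>)" .
  have "L2_norm (u t) \<le> L2_norm (u t0) + L2_norm (\<lambda>x. u t x - u t0 x)" by (intro L2_norm_triangle_diff V)
  also have "\<dots> \<le> L2_norm (u t0) + C * (t - t0)"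
   by (intro add_left_mono C1_curve_mean_value[OF curve _ t] C)
  also have "C * (t - t0) \<le> C * (1 + \<bar>t0\<bar>) * (1 + \<bar>t\<bar>)"
  proof -
   have "t - t0 \<le> (1 + \<bar>t0\<bar>) * (1 + \<bar>t\<bar>)" by (simp add: algebra_simps) (smt (verit) mult_nonneg_nonneg abs_ge_zero)
   then show ?thesis using C(1) by (simp only: mult.assoc) (rule mult_left_mono)
  qed
  also have "L2_norm (u t0) \<le> L2_norm (u t0) * (1 + \<bar>t\<bar>)" using L2_norm_nonneg[of "u t0"] by (simp add: distrib_left)
  finally show "L2_norm (u t) \<le> ?B * (1 + \<bar>t\<bar>)" by (simp add: distrib_right)
 qed
 with B0 show ?thesis by blast
qed

end

section \<open>Fourier and Laplace transforms on the line\<close>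

lemma fourier_lborel: "h \<in> borel_fun \<Longrightarrow> fourier h z = (LBINT t. h t * osc z t)"
 unfolding fourier_def by (rule integral_completion) simp

lemma norm_exp_i: "norm (osc z t) = exp (- Im z * t)"
 by (simp add: norm_exp_eq_Re)

lemma integrable_inverse_square: "integrable lborel (\<lambda>x::real. 1 / (1 + x\<^sup>2))"
 using integrable_inverse_1_plus_square by (simp add: set_integrable_def einterval_def inverse_eq_divide)

lemma integral_derivative_0:
 fixes F :: "real \<Rightarrow> complex"
 assumes d: "\<And>x. (F has_vector_derivative f x) (at x)" and c: "continuous_on UNIV f" and i: "integrable lborel f"
  and l: "(F \<longlongrightarrow> 0) at_top" "(F \<longlongrightarrow> 0) at_bot"
 shows "(LBINT x. f x) = 0"
proof -
 have 1: "(LBINT x. indicator {-real n..real n} x *\<^sub>R f x) = F (real n) - F (- real n)" for n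
  by (rule integral_FTC_Icc) (auto intro: has_vector_derivative_at_within d continuous_on_subset[OF c])
 have "(\<lambda>n. LBINT x. indicat_real {-real n..real n} x *\<^sub>R f x) \<longlonglongrightarrow> (LBINT x. f x)"
 proof (rule integral_dominated_convergence[where w = "\<lambda>x. norm (f x)"])
  show "AE x in lborel. (\<lambda>n. indicat_real {-real n..real n} x *\<^sub>R f x) \<longlonglongrightarrow> f x"
  proof (rule AE_I2, rule tendsto_eventually)
   fix x :: real
   obtain N where "\<bar>x\<bar> \<le> real N" using real_arch_simple by blast
   then show "\<forall>\<^sub>F n in sequentially. indicat_real {-real n..real n} x *\<^sub>R f x = f x"
    by (intro eventually_mono[OF eventually_ge_at_top[of N]]) (auto simp: indicator_def)
  qed
 qed (use i in \<open>auto simp: indicator_def\<close>)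
 moreover have "(\<lambda>n. F (real n) - F (- real n)) \<longlonglongrightarrow> 0 - 0"
  by (intro tendsto_diff filterlim_compose[OF l(1)] filterlim_compose[OF l(2)] filterlim_real_sequentially
    filterlim_compose[OF filterlim_uminus_at_bot_at_top])
 ultimately show ?thesis unfolding 1 using LIMSEQ_unique by fastforce
qed

lemma exp_i_has_vector_derivative:
 "((\<lambda>t. osc z t) has_vector_derivative \<i> * z * osc z t) (at t)"
 by (rule has_vector_derivative_real_field) (auto intro!: derivative_eq_intros)

lemma fourier_deriv:
 fixes f :: "real \<Rightarrow> complex"
 assumes d: "\<And>x. (f has_vector_derivative f' x) (at x)" and c: "continuous_on UNIV f'"
  and i: "integrable lborel (\<lambda>t. f t * osc z t)" "integrable lborel (\<lambda>t. f' t * osc z t)"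
  and l: "((\<lambda>t. f t * osc z t) \<longlongrightarrow> 0) at_top" "((\<lambda>t. f t * osc z t) \<longlongrightarrow> 0) at_bot"
 shows "(LBINT t. f' t * osc z t) = - \<i> * z * (LBINT t. f t * osc z t)"
proof -
 have fc: "continuous_on UNIV f" using d by (auto intro!: continuous_at_imp_continuous_on has_vector_derivative_continuous)
 let ?F = "\<lambda>t. f t * (\<i> * z * osc z t) + f' t * osc z t"
 have eq: "(\<lambda>t. f t * (\<i> * z * osc z t)) = (\<lambda>t. (\<i> * z) * (f t * osc z t))" by (simp add: mult_ac)
 have i1: "integrable lborel (\<lambda>t. f t * (\<i> * z * osc z t))" unfolding eq by (intro integrable_mult_right i)
 have "(LBINT t. ?F t) = 0"
  by (rule integral_derivative_0[OF has_vector_derivative_mult[OF d exp_i_has_vector_derivative] _ _ l])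
   (auto intro!: continuous_intros fc c i1 i)
 then have "(LBINT t. f t * (\<i> * z * osc z t)) + (LBINT t. f' t * osc z t) = 0"
  using i1 i(2) by simp
 then show ?thesis unfolding eq by (simp add: add_eq_0_iff2)
qed

lemma test_integrable_exp: "f \<in> \<D> \<Longrightarrow> integrable lborel (\<lambda>t. f t * osc z t)"
 by (rule integrable_test_mult) (auto intro!: continuous_intros)

lemma fourier_test_deriv:
 assumes "f \<in> \<D>"
 shows "fourier (ddx f) z = - \<i> * z * fourier f z"
proof -
 note d = test_dir_deriv[OF assms]
 obtain M where M: "M > 0" "\<And>x. \<bar>x\<bar> > M \<Longrightarrow> f x = 0" using test_function_support[OF assms] by metis
 have "((\<lambda>t. f t * osc z t) \<longlongrightarrow> 0) at_top" 
  by (rule tendsto_eventually) (use eventually_gt_at_top[of M] in \<open>eventually_elim, use M in auto\<close>)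
 moreover have "((\<lambda>t. f t * osc z t) \<longlongrightarrow> 0) at_bot" 
  by (rule tendsto_eventually) (use eventually_gt_at_bot[of "-M"] eventually_le_at_bot[of "-M-1"] in \<open>eventually_elim, use M in auto\<close>)
 ultimately show ?thesis
  unfolding fourier_lborel[OF test_borel[OF assms]] fourier_lborel[OF test_borel[OF d]]
  by (intro fourier_deriv smooth_has_vector_derivative test_functionsD smooth_continuous assms d test_integrable_exp)
qed

lemma fourier_test_norm_bound:
 assumes f: "f \<in> \<D>" and C: "\<And>x. norm (f x) \<le> C" and S: "\<And>x. f x \<noteq> 0 \<Longrightarrow> x \<in> {a..b}"
  and E: "\<And>x. x \<in> {a..b} \<Longrightarrow> exp (- Im z * x) \<le> E" and ab: "a \<le> b"
 shows "norm (fourier f z) \<le> C * E * (b - a)"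
proof -
 have C0: "C \<ge> 0" using C norm_ge_zero order_trans by blast
 have "norm (fourier f z) \<le> (LBINT t. norm (f t * osc z t))"
  unfolding fourier_lborel[OF test_borel[OF f]] by (rule integral_norm_bound)
 also have "\<dots> \<le> (LBINT t. C * E * indicat_real {a..b} t)"
 proof (rule integral_mono)
  show "norm (f t * osc z t) \<le> C * E * indicat_real {a..b} t" for t
  proof (cases "t \<in> {a..b}")
   case True
   then show ?thesis using C[of t] E[of t] C0 by (simp add: norm_mult norm_exp_i mult_mono del: mult_minus_left)
  qed (use S[of t] in auto)
 qed (auto intro!: integrable_norm test_integrable_exp f integrable_mult_right integrable_real_indicator simp: emeasure_lborel_Icc_eq)
 also have "\<dots> = C * E * (b - a)" using ab by simp
 finally show ?thesis .
qed

text \<open>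
 Twice integrating by parts gives the factor \<open>1 / (1 + s\<^sup>2)\<close>, which is integrable. This makes convolution with the transform of
 \<open>a\<close> a bounded operator.
\<close>
lemma fourier_test_decay:
 assumes f: "f \<in> \<D>" and S: "\<And>x. x \<notin> {-M..M} \<Longrightarrow> f x = 0" and M: "M > 0"
  and C: "\<And>x. norm (f x) \<le> C0" "\<And>x. norm (ddx (ddx f) x) \<le> C2"
 shows "norm (fourier f (of_real s)) \<le> 2 * M * (C0 + C2) / (1 + s\<^sup>2)"
proof -
 let ?d = "ddx (ddx f)"
 have d: "?d \<in> \<D>" by (intro test_dir_deriv f)
 have sub: "supp f \<subseteq> {-M..M}" by (rule supp_subset) (use S in auto)
 have sub': "supp (ddx f) \<subseteq> {-M..M}" by (rule supp_subset) (use subsetD[OF sub dir_deriv_in_supp[of f]] in auto)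
 have dS: "x \<in> {-M..M}" if "?d x \<noteq> 0" for x using dir_deriv_in_supp[OF that] sub' by blast
 have 1: "norm (fourier f (of_real s)) \<le> C0 * 1 * (M - - M)"
  by (rule fourier_test_norm_bound[OF f C(1)]) (use S M in auto)
 have 2: "norm (fourier ?d (of_real s)) \<le> C2 * 1 * (M - - M)"
  by (rule fourier_test_norm_bound[OF d C(2)]) (use dS M in auto)
 have "fourier ?d (of_real s) = - (of_real s)\<^sup>2 * fourier f (of_real s)"
  by (simp add: fourier_test_deriv test_dir_deriv f power2_eq_square algebra_simps flip: of_real_mult)
 then have "s\<^sup>2 * norm (fourier f (of_real s)) = norm (fourier ?d (of_real s))" by (simp add: norm_mult norm_power)
 with 1 2 have "(1 + s\<^sup>2) * norm (fourier f (of_real s)) \<le> 2 * M * (C0 + C2)" by (simp add: algebra_simps)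
 then show ?thesis by (simp add: pos_le_divide_eq add_pos_nonneg mult.commute)
qed

lemma fourier_continuous_real:
 assumes f: "integrable lborel f"
 shows "continuous_on UNIV (\<lambda>s::real. fourier f (of_real s))"
proof (rule continuous_at_imp_continuous_on, rule ballI, unfold continuous_at_sequentially, intro allI impI)
 fix s and x :: "nat \<Rightarrow> real" assume x: "x \<longlonglongrightarrow> s"
 have [measurable]: "f \<in> borel_fun" using f by auto
 have "(\<lambda>n. LBINT t. f t * exp (\<i> * of_real (x n) * of_real t)) \<longlonglongrightarrow> (LBINT t. f t * exp (\<i> * of_real s * of_real t))"
 proof (rule integral_dominated_convergence[where w = "\<lambda>t. norm (f t)"])
  show "AE t in lborel. (\<lambda>n. f t * exp (\<i> * of_real (x n) * of_real t)) \<longlonglongrightarrow> f t * exp (\<i> * of_real s * of_real t)"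
   by (intro AE_I2 tendsto_intros x)
 qed (use f in \<open>auto simp: norm_mult norm_exp_eq_Re\<close>)
 then show "((\<lambda>s. fourier f (of_real s)) \<circ> x) \<longlonglongrightarrow> fourier f (of_real s)"
  by (simp add: fourier_lborel o_def)
qed

lemma test_integrable: "f \<in> \<D> \<Longrightarrow> integrable lborel (f :: real \<Rightarrow> complex)"
 using test_integrable_exp[of f 0] by simp

lemma fourier_test_integrable:
 assumes f: "f \<in> \<D>"
 shows "integrable lborel (\<lambda>s. fourier f (of_real s))"
proof -
 obtain M where M: "M > 0" "\<And>x. \<bar>x\<bar> > M \<Longrightarrow> f x = 0" using test_function_support[OF f] by metis
 obtain C0 where C0: "\<And>x. norm (f x) \<le> C0" using continuous_compact_supp_bounded[OF f] by metis
 obtain C2 where C2: "\<And>x. norm (ddx (ddx f) x) \<le> C2"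
  using continuous_compact_supp_bounded[OF test_dir_deriv[OF test_dir_deriv[OF f]]] by metis
 have S: "f x = 0" if "x \<notin> {-M..M}" for x using M(2)[of x] that by (auto simp: abs_le_iff not_le)
 have "0 \<le> C0" "0 \<le> C2" using C0 C2 norm_ge_zero order_trans by blast+
 then have *: "norm (fourier f (of_real s)) \<le> norm (2 * M * (C0 + C2) * (1 / (1 + s\<^sup>2)))" for s
  using fourier_test_decay[OF f S M(1) C0 C2, of s] M(1) by simp
 show ?thesis
  by (rule Bochner_Integration.integrable_bound[OF integrable_mult_right[OF integrable_inverse_square, of "2 * M * (C0 + C2)"]])
   (use * borel_measurable_continuous_onI[OF fourier_continuous_real[OF test_integrable[OF f]]] in auto)
qed

lemma gaussian_fourier: "(LBINT y. exp (\<i> * of_real (b * y)) * of_real (exp (- y\<^sup>2 / 2))) = of_real (sqrt (2 * pi) * exp (- b\<^sup>2 / 2))"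
proof -
 have "of_real (exp (- b\<^sup>2 / 2)) = char std_normal_distribution b" by (simp add: char_std_normal_distribution)
 also have "\<dots> = (LBINT y. std_normal_density y *\<^sub>R iexp (b * y))"
  unfolding char_def by (rule integral_density) auto
 also have "(\<lambda>y. std_normal_density y *\<^sub>R iexp (b * y)) = (\<lambda>y. of_real (1 / sqrt (2 * pi)) * (exp (\<i> * of_real (b * y)) * of_real (exp (- y\<^sup>2 / 2))))"
  by (simp add: std_normal_density_def scaleR_conv_of_real mult_ac fun_eq_iff)
 finally have "of_real (exp (- b\<^sup>2 / 2)) = of_real (1 / sqrt (2 * pi)) * (LBINT y. exp (\<i> * of_real (b * y)) * of_real (exp (- y\<^sup>2 / 2)))" by simp
 then show ?thesis by (simp add: field_simps)
qed

lemma gaussian_integrable: "integrable lborel (\<lambda>y::real. exp (- y\<^sup>2 / 2))"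
proof -
 have "integrable lborel (\<lambda>y. sqrt (2 * pi) * std_normal_density y)"
  by (intro integrable_mult_right) (simp add: integrable_normal_density)
 then show ?thesis by (simp add: std_normal_density_def)
qed

lemma gaussian_integral: "(LBINT y. of_real (exp (- y\<^sup>2 / 2)) :: complex) = of_real (sqrt (2 * pi))"
 using gaussian_fourier[of 0] by simp

text \<open>
 Gaussian regularisation: the inversion formula holds with a Gaussian factor, by Fubini and the transform of the Gaussian, and the factor is removed
 by dominated convergence.
\<close>
theorem fourier_inversion_test:
 assumes f: "f \<in> \<D>"
 shows "(LBINT s. fourier f (of_real s) * exp (- \<i> * of_real s * of_real t)) = of_real (2 * pi) * f t"
proof -
 obtain C where C: "C \<ge> 0" "\<And>x. norm (f x) \<le> C" using continuous_compact_supp_bounded[OF f] by metis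
 have [measurable]: "f \<in> borel_fun" using test_borel[OF f] .
 have [measurable]: "(\<lambda>s. fourier f (of_real s)) \<in> borel_fun"
  using fourier_test_integrable[OF f] by auto
 define G :: "nat \<Rightarrow> real \<Rightarrow> complex" where "G n s = of_real (exp (- (s / real (Suc n))\<^sup>2 / 2))" for n s
 have Gm [measurable]: "G n \<in> borel_fun" for n unfolding G_def[abs_def] by measurable
 have G1: "norm (G n s :: complex) \<le> 1" for n s by (simp add: G_def)
 have lim1: "(\<lambda>n. LBINT s. fourier f (of_real s) * exp (- \<i> * of_real s * of_real t) * G n s)
   \<longlonglongrightarrow> (LBINT s. fourier f (of_real s) * exp (- \<i> * of_real s * of_real t))"
 proof (rule integral_dominated_convergence[where w = "\<lambda>s. norm (fourier f (of_real s))"])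
  show "AE s in lborel. (\<lambda>n. fourier f (of_real s) * exp (- \<i> * of_real s * of_real t) * G n s)
    \<longlonglongrightarrow> fourier f (of_real s) * exp (- \<i> * of_real s * of_real t)"
  proof (rule AE_I2)
   fix s :: real
   have "(\<lambda>n. s * inverse (real (Suc n))) \<longlonglongrightarrow> s * 0" by (intro tendsto_intros LIMSEQ_inverse_real_of_nat)
   then have "(\<lambda>n. G n s) \<longlonglongrightarrow> of_real (exp (- (s * 0)\<^sup>2 / 2))"
    unfolding G_def divide_inverse[of s]
    by (intro tendsto_of_real tendsto_exp tendsto_divide tendsto_minus tendsto_power tendsto_const) simp_all
   then have "(\<lambda>n. G n s) \<longlonglongrightarrow> 1" by simp
   from tendsto_mult_left[OF this] show "(\<lambda>n. fourier f (of_real s) * exp (- \<i> * of_real s * of_real t) * G n s)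
    \<longlonglongrightarrow> fourier f (of_real s) * exp (- \<i> * of_real s * of_real t)" by fastforce
  qed
  show "AE s in lborel. norm (fourier f (of_real s) * exp (- \<i> * of_real s * of_real t) * G n s) \<le> norm (fourier f (of_real s))" for n
   by (intro AE_I2) (use G1 in \<open>simp add: norm_mult norm_exp_eq_Re mult_left_le\<close>)
 qed (use fourier_test_integrable[OF f] in auto)
 have eq: "(LBINT s. fourier f (of_real s) * exp (- \<i> * of_real s * of_real t) * G n s)
   = of_real (sqrt (2 * pi)) * (LBINT z. f (t + z / real (Suc n)) * of_real (exp (- z\<^sup>2 / 2)))" for n
 proof -
  let ?k = "real (Suc n)"
  let ?h = "\<lambda>s y. f y * exp (\<i> * of_real (s * (y - t))) * G n s"
  have Gi: "integrable lborel (\<lambda>s. exp (- (s / ?k)\<^sup>2 / 2))"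
   using lborel_integrable_real_affine[OF gaussian_integrable, of "1 / ?k" 0] by simp
  have int: "integrable (lborel \<Otimes>\<^sub>M lborel) (\<lambda>(s, y). ?h s y)"
  proof (rule lborel_pair.Fubini_integrable)
   have "(\<lambda>s. LBINT y. norm (case (s, y) of (s, y) \<Rightarrow> ?h s y)) = (\<lambda>s. (LBINT y. norm (f y)) * exp (- (s / ?k)\<^sup>2 / 2))"
    by (simp add: G_def norm_mult norm_exp_eq_Re)
   then show "integrable lborel (\<lambda>s. LBINT y. norm (case (s, y) of (s, y) \<Rightarrow> ?h s y))"
    using Gi by simp
   show "AE s in lborel. integrable lborel (\<lambda>y. case (s, y) of (s, y) \<Rightarrow> ?h s y)"
   proof (rule AE_I2)
    fix s
    have "integrable lborel (\<lambda>y. f y * exp (\<i> * of_real (s * (y - t))))"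
     by (intro integrable_test_mult f continuous_intros)
    then show "integrable lborel (\<lambda>y. case (s, y) of (s, y) \<Rightarrow> ?h s y)" by simp
   qed
  qed measurable
  have "(LBINT s. fourier f (of_real s) * exp (- \<i> * of_real s * of_real t) * G n s) = (LBINT s. LBINT y. ?h s y)"
  proof (rule Bochner_Integration.integral_cong[OF refl])
   fix s
   have "(LBINT y. ?h s y) = (LBINT y. (f y * exp (\<i> * of_real s * of_real y)) * (exp (- \<i> * of_real s * of_real t) * G n s))"
    by (intro Bochner_Integration.integral_cong refl) (simp add: right_diff_distrib exp_diff exp_minus field_simps)
   also have "\<dots> = fourier f (of_real s) * (exp (- \<i> * of_real s * of_real t) * G n s)"
    by (simp add: fourier_lborel)
   finally have e: "(LBINT y. ?h s y) = fourier f (of_real s) * (exp (- \<i> * of_real s * of_real t) * G n s)" .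
   show "fourier f (of_real s) * exp (- \<i> * of_real s * of_real t) * G n s = (LBINT y. ?h s y)"
    unfolding e by (rule mult.assoc)
  qed
  also have "\<dots> = (LBINT y. LBINT s. ?h s y)"
   by (rule lborel_pair.Fubini_integral[symmetric]) (rule int)
  also have "\<dots> = (LBINT y. f y * of_real (?k * sqrt (2 * pi) * exp (- (?k * (y - t))\<^sup>2 / 2)))"
  proof (rule Bochner_Integration.integral_cong[OF refl])
   fix y
   have "(LBINT s. exp (\<i> * of_real (s * (y - t))) * G n s) = \<bar>?k\<bar> *\<^sub>R (LBINT s. exp (\<i> * of_real ((0 + ?k * s) * (y - t))) * G n (0 + ?k * s))"
    by (rule lborel_integral_real_affine) simp
   also have "(\<lambda>s. exp (\<i> * of_real ((0 + ?k * s) * (y - t))) * G n (0 + ?k * s)) = (\<lambda>s. exp (\<i> * of_real ((?k * (y - t)) * s)) * of_real (exp (- s\<^sup>2 / 2)))"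
    by (simp add: G_def mult_ac del: of_nat_Suc)
   finally have "(LBINT s. exp (\<i> * of_real (s * (y - t))) * G n s) = of_real (?k * sqrt (2 * pi) * exp (- (?k * (y - t))\<^sup>2 / 2))"
    unfolding gaussian_fourier by (simp add: scaleR_conv_of_real del: of_nat_Suc)
   moreover have "(LBINT s. ?h s y) = f y * (LBINT s. exp (\<i> * of_real (s * (y - t))) * G n s)"
    by (simp add: mult.assoc)
   ultimately show "(LBINT s. ?h s y) = f y * of_real (?k * sqrt (2 * pi) * exp (- (?k * (y - t))\<^sup>2 / 2))" by simp
  qed
  also have "\<dots> = \<bar>1 / ?k\<bar> *\<^sub>R (LBINT z. f (t + 1 / ?k * z) * of_real (?k * sqrt (2 * pi) * exp (- (?k * (t + 1 / ?k * z - t))\<^sup>2 / 2)))"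
   by (rule lborel_integral_real_affine) simp
  also have "\<dots> = of_real (sqrt (2 * pi)) * (LBINT z. f (t + z / ?k) * of_real (exp (- z\<^sup>2 / 2)))"
  proof -
   have "(\<lambda>z. f (t + 1 / ?k * z) * of_real (?k * sqrt (2 * pi) * exp (- (?k * (t + 1 / ?k * z - t))\<^sup>2 / 2))) =
    (\<lambda>z. of_real (?k * sqrt (2 * pi)) * (f (t + z / ?k) * of_real (exp (- z\<^sup>2 / 2))))"
    by (simp add: fun_eq_iff mult_ac del: of_nat_Suc)
   then show ?thesis by (simp add: scaleR_conv_of_real del: of_nat_Suc)
  qed
  finally show ?thesis .
 qed
 have "(\<lambda>n. LBINT z. f (t + z / real (Suc n)) * of_real (exp (- z\<^sup>2 / 2))) \<longlonglongrightarrow> (LBINT z. f t * of_real (exp (- z\<^sup>2 / 2)))"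
 proof (rule integral_dominated_convergence[where w = "\<lambda>z. C * exp (- z\<^sup>2 / 2)"])
  show "AE z in lborel. (\<lambda>n. f (t + z / real (Suc n)) * of_real (exp (- z\<^sup>2 / 2))) \<longlonglongrightarrow> f t * of_real (exp (- z\<^sup>2 / 2))"
  proof (intro AE_I2 tendsto_mult_right)
   fix z
   have "(\<lambda>n. t + z / real (Suc n)) \<longlonglongrightarrow> t + z * 0"
    unfolding divide_inverse by (intro tendsto_intros LIMSEQ_inverse_real_of_nat)
   then show "(\<lambda>n. f (t + z / real (Suc n))) \<longlonglongrightarrow> f t"
    by (intro continuous_on_tendsto_compose[OF smooth_continuous[OF test_functionsD(1)[OF f], of UNIV]]) auto
  qed
  show "AE z in lborel. norm (f (t + z / real (Suc n)) * of_real (exp (- z\<^sup>2 / 2))) \<le> C * exp (- z\<^sup>2 / 2)" for n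
   using C by (intro AE_I2) (simp add: norm_mult mult_right_mono)
 qed (use gaussian_integrable in auto)
 then have "(\<lambda>n. of_real (sqrt (2 * pi)) * (LBINT z. f (t + z / real (Suc n)) * of_real (exp (- z\<^sup>2 / 2))))
   \<longlonglongrightarrow> of_real (sqrt (2 * pi)) * (f t * of_real (sqrt (2 * pi)))"
  unfolding gaussian_integral[symmetric] integral_mult_right_zero by (intro tendsto_mult_left)
 from LIMSEQ_unique[OF lim1[unfolded eq] this]
 show ?thesis by (simp add: mult_ac flip: of_real_mult)
qed

text \<open>
 The transform of a product with a test function is a convolution along the line \<open>Im z = \<sigma>\<close>: insert the inversion formula for
 \<open>f\<close> and exchange the integrals.
\<close>
lemma Laplace_product:
 assumes f: "f \<in> \<D>" and q: "q \<in> borel_fun" "integrable lborel (\<lambda>t. q t * osc z t)"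
 shows "(LBINT l. fourier f (of_real (Re z - l)) * fourier q (Complex l (Im z))) = of_real (2 * pi) * (LBINT t. f t * q t * osc z t)"
proof -
 have [measurable]: "f \<in> borel_fun" "q \<in> borel_fun" using test_borel[OF f] q by auto
 have fi: "integrable lborel (\<lambda>s. fourier f (of_real s))" by (rule fourier_test_integrable[OF f])
 have [measurable]: "(\<lambda>s. fourier f (of_real s)) \<in> borel_fun" using fi by auto
 have ex: "exp (\<i> * Complex l (Im z) * of_real t) = osc z t * exp (\<i> * of_real (l - Re z) * of_real t)" for l t
  unfolding mult_exp_exp by (rule arg_cong[of _ _ exp]) (simp add: complex_eq_iff algebra_simps)
 let ?h = "\<lambda>l t. fourier f (of_real (Re z - l)) * (q t * exp (\<i> * Complex l (Im z) * of_real t))"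
 have fr: "integrable lborel (\<lambda>l. fourier f (of_real (Re z - l)))"
  using lborel_integrable_real_affine[OF fi, of "-1" "Re z"] by simp
 have nq: "norm (q t * exp (\<i> * Complex l (Im z) * of_real t)) = norm (q t * osc z t)" for l t
  by (simp add: norm_mult norm_exp_i)
 have m: "(\<lambda>p. exp (\<i> * Complex (fst p) (Im z) * of_real (snd p))) \<in> borel_measurable (lborel \<Otimes>\<^sub>M lborel)"
  unfolding ex by measurable
 have int: "integrable (lborel \<Otimes>\<^sub>M lborel) (\<lambda>(l, t). ?h l t)"
 proof (rule lborel_pair.Fubini_integrable)
  have "(\<lambda>l. LBINT t. norm (case (l, t) of (l, t) \<Rightarrow> ?h l t)) = (\<lambda>l. norm (fourier f (of_real (Re z - l))) * (LBINT t. norm (q t * osc z t)))"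
   by (simp add: norm_mult norm_exp_i)
  then show "integrable lborel (\<lambda>l. LBINT t. norm (case (l, t) of (l, t) \<Rightarrow> ?h l t))"
   using fr by simp
  show "AE l in lborel. integrable lborel (\<lambda>t. case (l, t) of (l, t) \<Rightarrow> ?h l t)"
  proof (rule AE_I2)
   fix l
   have "integrable lborel (\<lambda>t. q t * exp (\<i> * Complex l (Im z) * of_real t))"
    by (rule Bochner_Integration.integrable_bound[OF q(2)]) (auto simp: norm_mult norm_exp_i ex)
   then show "integrable lborel (\<lambda>t. case (l, t) of (l, t) \<Rightarrow> ?h l t)" by simp
  qed
  show "(\<lambda>(l, t). ?h l t) \<in> borel_measurable (lborel \<Otimes>\<^sub>M lborel)"
   using m unfolding case_prod_beta by measurable
 qed
 have "(LBINT l. fourier f (of_real (Re z - l)) * fourier q (Complex l (Im z))) = (LBINT l. LBINT t. ?h l t)"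
  by (simp add: fourier_lborel)
 also have "\<dots> = (LBINT t. LBINT l. ?h l t)"
  by (rule lborel_pair.Fubini_integral[symmetric]) (rule int)
 also have "\<dots> = (LBINT t. (q t * osc z t) * (of_real (2 * pi) * f t))"
 proof (rule Bochner_Integration.integral_cong[OF refl])
  fix t
  have "(LBINT l. ?h l t) = (LBINT l. (q t * osc z t) * (fourier f (of_real (Re z - l)) * exp (\<i> * of_real (l - Re z) * of_real t)))"
   unfolding ex by (simp add: mult_ac)
  also have "\<dots> = (q t * osc z t) * (LBINT l. fourier f (of_real (Re z - l)) * exp (\<i> * of_real (l - Re z) * of_real t))"
   by (rule integral_mult_right_zero)
  also have "(LBINT l. fourier f (of_real (Re z - l)) * exp (\<i> * of_real (l - Re z) * of_real t)) = (LBINT s. fourier f (of_real s) * exp (- \<i> * of_real s * of_real t))"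
  proof -
   have "(\<lambda>l. fourier f (of_real (Re z - l)) * exp (\<i> * of_real (l - Re z) * of_real t)) =
    (\<lambda>l. fourier f (of_real (Re z + -1 * l)) * exp (- \<i> * of_real (Re z + -1 * l) * of_real t))"
    by (simp add: fun_eq_iff algebra_simps)
   then show ?thesis
    using lborel_integral_real_affine[of "-1" "\<lambda>s. fourier f (of_real s) * exp (- \<i> * of_real s * of_real t)" "Re z"] by simp
  qed
  also have "\<dots> = of_real (2 * pi) * f t" by (rule fourier_inversion_test[OF f])
  finally show "(LBINT l. ?h l t) = (q t * osc z t) * (of_real (2 * pi) * f t)" .
 qed
 also have "\<dots> = (LBINT t. of_real (2 * pi) * (f t * q t * osc z t))" by (simp add: mult_ac)
 also have "\<dots> = of_real (2 * pi) * (LBINT t. f t * q t * osc z t)" by (rule integral_mult_right_zero)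
 finally show ?thesis .
qed

section \<open>Laplace transforms of causal functions of moderate growth\<close>

text \<open>
 The weight admits functions of linear growth in an averaged sense.
\<close>
definition causal :: "real \<Rightarrow> (real \<Rightarrow> complex) \<Rightarrow> bool" where
 "causal c p \<longleftrightarrow> p \<in> borel_fun \<and> (AE t in lborel. t < c \<longrightarrow> p t = 0) \<and>
  integrable lborel (\<lambda>t. norm (p t) / wt t)"

lemma weight_pos: "0 < wt t" for t :: real
 by (intro zero_less_power add_pos_nonneg) simp_all

lemma exp_weight_bound:
 fixes \<sigma> c :: real
 assumes "\<sigma> > 0"
 obtains C where "C \<ge> 0" "\<And>t. t \<ge> c \<Longrightarrow> exp (- \<sigma> * t) * (1 + \<bar>t\<bar>) \<le> C / wt t"
proof -
 let ?f = "\<lambda>t::real. exp (- \<sigma> * t) * (1 + \<bar>t\<bar>) * wt t"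
 have "((\<lambda>t::real. exp (- \<sigma> * t) * (1 + t) * wt t) \<longlongrightarrow> 0) at_top"
  using assms by real_asymp
 then have "\<forall>\<^sub>F t in at_top. exp (- \<sigma> * t) * (1 + t) * wt t < 1" by (rule order_tendstoD) simp
 then obtain N0 where N0: "\<And>t. t \<ge> N0 \<Longrightarrow> exp (- \<sigma> * t) * (1 + t) * wt t < 1"
  unfolding eventually_at_top_linorder by blast
 define N where "N = max N0 0"
 have N: "?f t \<le> 1" if "t \<ge> N" for t using N0[of t] that by (simp add: N_def)
 have "compact (?f ` {c..N})" by (intro compact_continuous_image continuous_intros compact_Icc)
 then have "bounded (?f ` {c..N})" by (rule compact_imp_bounded)
 then obtain B where B: "\<And>t. t \<in> {c..N} \<Longrightarrow> norm (?f t) \<le> B" unfolding bounded_iff by blast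
 show ?thesis
 proof (rule that[of "max 1 B"])
  fix t assume "t \<ge> c"
  then have "?f t \<le> max 1 B"
   using N[of t] B[of t] by (cases "t \<ge> N") (auto intro: order_trans[OF abs_ge_self] simp: le_max_iff_disj)
  then show "exp (- \<sigma> * t) * (1 + \<bar>t\<bar>) \<le> max 1 B / wt t"
   by (subst pos_le_divide_eq[OF weight_pos])
 qed simp
qed

lemma causal_integrable_weight:
 assumes p: "causal c p" and \<sigma>: "\<sigma> > 0"
 shows "integrable lborel (\<lambda>t. norm (p t) * (exp (- \<sigma> * t) * (1 + \<bar>t\<bar>)))"
proof -
 obtain C where C: "C \<ge> 0" "\<And>t. t \<ge> c \<Longrightarrow> exp (- \<sigma> * t) * (1 + \<bar>t\<bar>) \<le> C / wt t"
  using exp_weight_bound[OF \<sigma>] by metis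
 have [measurable]: "p \<in> borel_fun" using p by (simp add: causal_def)
 have "integrable lborel (\<lambda>t. C * (norm (p t) / wt t))"
  using p unfolding causal_def by (intro integrable_mult_right) blast
 then show ?thesis
 proof (rule Bochner_Integration.integrable_bound)
  have "AE t in lborel. t < c \<longrightarrow> p t = 0" using p by (simp add: causal_def)
  then show "AE t in lborel. norm (norm (p t) * (exp (- \<sigma> * t) * (1 + \<bar>t\<bar>))) \<le> norm (C * (norm (p t) / wt t))"
  proof eventually_elim
   case (elim t)
   have "norm (norm (p t) * (exp (- \<sigma> * t) * (1 + \<bar>t\<bar>))) = norm (p t) * (exp (- \<sigma> * t) * (1 + \<bar>t\<bar>))" by simp
   also have "\<dots> \<le> norm (p t) * (C / wt t)"
    using elim mult_left_mono[OF C(2)[of t], of "norm (p t)"] by (cases "t < c") simp_all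
   finally show ?case using C(1) by (simp add: mult_ac)
  qed
 qed measurable
qed

lemma causal_integrable_norm:
 assumes p: "causal c p" and \<sigma>: "\<sigma> > 0"
 shows "integrable lborel (\<lambda>t. norm (p t) * exp (- \<sigma> * t))"
proof (rule Bochner_Integration.integrable_bound[OF causal_integrable_weight[OF p \<sigma>]])
 have [measurable]: "p \<in> borel_fun" using p by (simp add: causal_def)
 show "(\<lambda>t. norm (p t) * exp (- \<sigma> * t)) \<in> borel_measurable lborel" by measurable
qed (auto intro!: mult_left_mono simp: distrib_left)

lemma causal_integrable:
 assumes p: "causal c p" and z: "Im z > 0"
 shows "integrable lborel (\<lambda>t. p t * osc z t)"
proof (rule Bochner_Integration.integrable_bound[OF causal_integrable_norm[OF p z]])
 have [measurable]: "p \<in> borel_fun" using p by (simp add: causal_def)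
 show "(\<lambda>t. p t * osc z t) \<in> borel_measurable lborel" by measurable
qed (auto simp: norm_mult norm_exp_i)

lemma norm_exp_minus_1_le: "norm (exp w - 1) \<le> norm w * exp (norm w)" for w :: complex
proof -
 have "norm (exp w - exp 0) \<le> exp (norm w) * norm (w - 0)"
 proof (rule field_differentiable_bound[of "cball 0 (norm w)" exp exp])
  fix z :: complex assume "z \<in> cball 0 (norm w)"
  then show "norm (exp z) \<le> exp (norm w)"
   using complex_Re_le_cmod[of z] by (simp add: norm_exp_eq_Re)
 qed (auto intro!: derivative_eq_intros)
 then show ?thesis by (simp add: mult.commute)
qed

text \<open>
 The difference quotients of the exponential are dominated by \<open>\<bar>t\<bar> * exp (- \<sigma> * t)\<close>, which is bounded by the weight on
 a half line.
\<close>
lemma causal_fourier_holomorphic: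
 assumes p: "causal c p"
 shows "fourier p holomorphic_on upper_half"
proof (rule holomorphic_onI)
 fix z assume "z \<in> upper_half"
 then have z: "Im z > 0" by simp
 define \<sigma> where "\<sigma> = Im z / 2"
 have \<sigma>: "\<sigma> > 0" using z by (simp add: \<sigma>_def)
 have pm [measurable]: "p \<in> borel_fun" using p by (simp add: causal_def)
 define W where "W t = exp (\<sigma> * (2 * \<bar>c\<bar>)) * (norm (p t) * (exp (- \<sigma> * t) * (1 + \<bar>t\<bar>)))" for t
 have Wi: "integrable lborel W" unfolding W_def[abs_def] by (intro integrable_mult_right causal_integrable_weight[OF p \<sigma>])
 have lim: "((\<lambda>h. (fourier p (z + h) - fourier p z) / h) \<circ> X) \<longlonglongrightarrow> (LBINT t. p t * osc z t * (\<i> * of_real t))"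
  if X: "\<And>n. X n \<in> UNIV - {0}" "X \<longlonglongrightarrow> 0" for X
 proof -
  have "\<forall>\<^sub>F n in sequentially. dist (X n) 0 < min \<sigma> 1" using X(2) \<sigma> by (intro tendstoD) auto
  then obtain N where N: "\<And>n. n \<ge> N \<Longrightarrow> norm (X n) < \<sigma>" unfolding eventually_sequentially by fastforce
  define Y where "Y n = X (n + N)" for n
  have Y: "Y \<longlonglongrightarrow> 0" "\<And>n. norm (Y n) \<le> \<sigma>" "\<And>n. Y n \<noteq> 0"
   using X N LIMSEQ_ignore_initial_segment[OF X(2), of N] by (auto simp: Y_def[abs_def] intro!: less_imp_le)
  let ?q = "\<lambda>n t. p t * osc z t * ((exp (\<i> * Y n * of_real t) - 1) / Y n)"
  have "(\<lambda>n. LBINT t. ?q n t) \<longlonglongrightarrow> (LBINT t. p t * osc z t * (\<i> * of_real t))"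
  proof (rule integral_dominated_convergence[where w = W])
   show "AE t in lborel. (\<lambda>n. ?q n t) \<longlonglongrightarrow> p t * osc z t * (\<i> * of_real t)"
   proof (intro AE_I2 tendsto_mult_left)
    fix t :: real
    have "((\<lambda>h. osc h t) has_field_derivative \<i> * of_real t) (at 0)"
     by (auto intro!: derivative_eq_intros)
    then have "((\<lambda>h. (osc h t - 1) / h) \<longlongrightarrow> \<i> * of_real t) (at 0)"
     by (simp add: DERIV_def)
    then show "(\<lambda>n. (exp (\<i> * Y n * of_real t) - 1) / Y n) \<longlonglongrightarrow> \<i> * of_real t"
     using Y unfolding tendsto_at_iff_sequentially by (auto simp: o_def)
   qed
   have ae: "AE t in lborel. t < c \<longrightarrow> p t = 0" using p by (simp add: causal_def)
   show "AE t in lborel. norm (?q n t) \<le> W t" for n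
    using ae
   proof eventually_elim
    case (elim t)
    show ?case
    proof (cases "t < c")
     case False
     have 1: "norm ((exp (\<i> * Y n * of_real t) - 1) / Y n) \<le> \<bar>t\<bar> * exp (\<sigma> * \<bar>t\<bar>)"
     proof -
      have "norm ((exp (\<i> * Y n * of_real t) - 1) / Y n) \<le> (norm (Y n) * \<bar>t\<bar> * exp (norm (Y n) * \<bar>t\<bar>)) / norm (Y n)"
       using divide_right_mono[OF norm_exp_minus_1_le[of "\<i> * Y n * of_real t"], of "norm (Y n)"]
       by (simp only: norm_divide norm_mult norm_ii norm_of_real norm_ge_zero mult_1)
      also have "\<dots> = \<bar>t\<bar> * exp (norm (Y n) * \<bar>t\<bar>)" using Y(3)[of n] by simp
      also have "\<dots> \<le> \<bar>t\<bar> * exp (\<sigma> * \<bar>t\<bar>)" using Y(2)[of n] by (intro mult_left_mono) (auto intro: mult_right_mono)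
      finally show ?thesis .
     qed
     have "\<sigma> * \<bar>t\<bar> \<le> \<sigma> * (t + 2 * \<bar>c\<bar>)" using False \<sigma> by (intro mult_left_mono) auto
     then have 2: "exp (- Im z * t) * exp (\<sigma> * \<bar>t\<bar>) \<le> exp (\<sigma> * (2 * \<bar>c\<bar>)) * exp (- \<sigma> * t)"
      unfolding mult_exp_exp by (simp add: \<sigma>_def algebra_simps)
     have "norm (?q n t) \<le> norm (p t) * exp (- Im z * t) * (\<bar>t\<bar> * exp (\<sigma> * \<bar>t\<bar>))"
      unfolding norm_mult[of "p t * osc z t"] norm_mult[of "p t"] norm_exp_i by (intro mult_left_mono 1) auto
     also have "\<dots> = (exp (- Im z * t) * exp (\<sigma> * \<bar>t\<bar>)) * (norm (p t) * \<bar>t\<bar>)" by (simp add: mult_ac)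
     also have "\<dots> \<le> (exp (\<sigma> * (2 * \<bar>c\<bar>)) * exp (- \<sigma> * t)) * (norm (p t) * (1 + \<bar>t\<bar>))"
      by (intro mult_mono 2) (auto intro: mult_left_mono)
     also have "\<dots> = W t" by (simp add: W_def mult_ac)
     finally show ?thesis .
    qed (use elim in \<open>simp add: W_def\<close>)
   qed
  qed (use Wi in auto)
  also have "(\<lambda>n. LBINT t. ?q n t) = (\<lambda>n. (fourier p (z + Y n) - fourier p z) / Y n)"
  proof
   fix n
   have "Im (z + Y n) > 0" using Y(2)[of n] z abs_Im_le_cmod[of "Y n"] by (simp add: \<sigma>_def)
   note i = causal_integrable[OF p this] causal_integrable[OF p z]
   have "(fourier p (z + Y n) - fourier p z) / Y n = (LBINT t. (p t * exp (\<i> * (z + Y n) * of_real t) - p t * osc z t) / Y n)"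
    using i by (simp add: fourier_lborel pm)
   also have "\<dots> = (LBINT t. ?q n t)"
    by (intro Bochner_Integration.integral_cong refl) (simp add: distrib_left distrib_right exp_add algebra_simps diff_divide_distrib)
   finally show "(LBINT t. ?q n t) = (fourier p (z + Y n) - fourier p z) / Y n" ..
  qed
  finally have "(\<lambda>n. ((\<lambda>h. (fourier p (z + h) - fourier p z) / h) \<circ> X) (n + N)) \<longlonglongrightarrow> (LBINT t. p t * osc z t * (\<i> * of_real t))"
   by (simp only: Y_def o_def)
  then show ?thesis by (rule LIMSEQ_offset)
 qed
 then have "(fourier p has_field_derivative (LBINT t. p t * osc z t * (\<i> * of_real t))) (at z)"
  unfolding DERIV_def tendsto_at_iff_sequentially by blast
 then show "fourier p field_differentiable (at z within upper_half)"
  by (meson field_differentiable_at_within field_differentiable_def)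
qed

lemma schwartz_deriv_bound:
 assumes "\<phi> \<in> schwartz"
 obtains C where "C \<ge> 0" "\<And>x. norm ((ddx ^^ n) \<phi> x) \<le> C * (1 / (1 + x\<^sup>2))"
proof -
 let ?f = "(ddx ^^ n) \<phi>"
 have "bounded (range (\<lambda>x. of_real (x ^ k) * ?f x))" for k using assms by (simp add: schwartz_def)
 from this[of 0] this[of 2] obtain A B where AB: "\<And>x. norm (?f x) \<le> A" "\<And>x. norm (of_real (x ^ 2) * ?f x) \<le> B"
  unfolding bounded_iff by fastforce
 show ?thesis
 proof (rule that[of "A + B"])
  show "A + B \<ge> 0" using order_trans[OF norm_ge_zero AB(1)] order_trans[OF norm_ge_zero AB(2)] by simp
  fix x
  have "(1 + x\<^sup>2) * norm (?f x) \<le> A + B" using AB[of x] by (simp add: norm_mult norm_power distrib_right)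
  then show "norm (?f x) \<le> (A + B) * (1 / (1 + x\<^sup>2))" by (simp add: pos_le_divide_eq add_pos_nonneg mult.commute)
 qed
qed

lemma schwartz_smooth: "\<phi> \<in> schwartz \<Longrightarrow> smooth ((ddx ^^ n) \<phi>)"
 by (induction n) (auto simp: schwartz_def intro: smooth_dir_deriv)

lemma schwartz_integrable:
 assumes "\<phi> \<in> schwartz"
 shows "integrable lborel ((ddx ^^ n) \<phi>)"
proof -
 obtain C where C: "C \<ge> 0" "\<And>x. norm ((ddx ^^ n) \<phi> x) \<le> C * (1 / (1 + x\<^sup>2))" using schwartz_deriv_bound[OF assms] by metis
 show ?thesis
 proof (rule Bochner_Integration.integrable_bound[OF integrable_mult_right[OF integrable_inverse_square, of C]])
  show "(ddx ^^ n) \<phi> \<in> borel_measurable lborel" using smooth_borel[OF schwartz_smooth[OF assms]] by simp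
 qed (use C in \<open>auto intro!: AE_I2\<close>)
qed

lemma schwartz_fourier_deriv:
 assumes "\<phi> \<in> schwartz"
 shows "fourier ((ddx ^^ Suc n) \<phi>) (of_real s) = - \<i> * of_real s * fourier ((ddx ^^ n) \<phi>) (of_real s)"
proof -
 let ?f = "(ddx ^^ n) \<phi>" and ?f' = "(ddx ^^ Suc n) \<phi>"
 note sm = schwartz_smooth[OF assms]
 have d: "(?f has_vector_derivative ?f' x) (at x)" for x using smooth_has_vector_derivative[OF sm[of n]] by simp
 obtain C where C: "C \<ge> 0" "\<And>x. norm (?f x) \<le> C * (1 / (1 + x\<^sup>2))" using schwartz_deriv_bound[OF assms] by metis
 have n: "norm (exp (\<i> * of_real s * of_real t)) = 1" for t by (simp add: norm_exp_eq_Re)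
 have i: "integrable lborel (\<lambda>t. (ddx ^^ k) \<phi> t * exp (\<i> * of_real s * of_real t))" for k
 proof (rule Bochner_Integration.integrable_bound[OF schwartz_integrable[OF assms, of k]])
  have [measurable]: "(ddx ^^ k) \<phi> \<in> borel_fun" by (rule smooth_borel[OF sm])
  show "(\<lambda>t. (ddx ^^ k) \<phi> t * exp (\<i> * of_real s * of_real t)) \<in> borel_measurable lborel" by measurable
 qed (simp add: norm_mult n)
 have l: "((\<lambda>t. ?f t * exp (\<i> * of_real s * of_real t)) \<longlongrightarrow> 0) F" if "((\<lambda>x. C * (1 / (1 + x\<^sup>2))) \<longlongrightarrow> 0) F" for F
  by (rule Lim_null_comparison[OF _ that]) (use C(2) in \<open>simp add: norm_mult n\<close>)
 have l1: "((\<lambda>x::real. C * (1 / (1 + x\<^sup>2))) \<longlongrightarrow> 0) at_top" "((\<lambda>x::real. C * (1 / (1 + x\<^sup>2))) \<longlongrightarrow> 0) at_bot"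
  by real_asymp+
 show ?thesis
  unfolding fourier_lborel[OF smooth_borel[OF sm]]
  by (rule fourier_deriv[OF d smooth_continuous[OF sm] i i l[OF l1(1)] l[OF l1(2)]])
qed

text \<open>
 Four integrations by parts give the weight \<open>(1 + t\<^sup>2)\<^sup>2\<close>, which is what pairs with the growth allowed by
 \<open>causal\<close>.
\<close>
lemma schwartz_fourier_decay:
 assumes "\<phi> \<in> schwartz"
 obtains C where "C \<ge> 0" "\<And>t. norm (fourier \<phi> (of_real t)) \<le> C / wt t"
proof -
 have nf: "norm (fourier f (of_real t)) \<le> (LBINT x. norm (f x))" if "integrable lborel f" for f :: "real \<Rightarrow> complex" and t
 proof -
  have fm: "f \<in> borel_fun" using that by auto
  have "norm (fourier f (of_real t)) \<le> (LBINT x. norm (f x * exp (\<i> * of_real t * of_real x)))"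
   unfolding fourier_lborel[OF fm] by (rule integral_norm_bound)
  then show ?thesis by (simp add: norm_mult norm_exp_eq_Re)
 qed
 define A where "A = (LBINT x. norm (\<phi> x))"
 define B where "B = (LBINT x. norm ((ddx ^^ 4) \<phi> x))"
 have A: "norm (fourier \<phi> (of_real t)) \<le> A" for t
  using nf[OF schwartz_integrable[OF assms, of 0]] by (simp add: A_def)
 have "fourier ((ddx ^^ k) \<phi>) (of_real t) = (- \<i> * of_real t) ^ k * fourier \<phi> (of_real t)" for k t
  by (induction k) (simp_all only: schwartz_fourier_deriv[OF assms] funpow_0 power_0 mult_1 power_Suc mult.assoc)
 from this[of 4] have B: "t ^ 4 * norm (fourier \<phi> (of_real t)) \<le> B" for t
  using nf[OF schwartz_integrable[OF assms, of 4], of t] by (simp add: B_def norm_mult norm_power)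
 show ?thesis
 proof (rule that[of "2 * A + 2 * B"])
  show "2 * A + 2 * B \<ge> 0" by (simp add: A_def B_def)
  fix t :: real
  have "wt t \<le> 2 + 2 * t ^ 4" using sum_squares_bound[of 1 "t\<^sup>2"] by (simp add: power2_sum flip: power_mult)
  then have "wt t * norm (fourier \<phi> (of_real t)) \<le> (2 + 2 * t ^ 4) * norm (fourier \<phi> (of_real t))"
   by (rule mult_right_mono) simp
  also have "\<dots> \<le> 2 * A + 2 * B" using A[of t] B[of t] by (simp add: distrib_right)
  finally show "norm (fourier \<phi> (of_real t)) \<le> (2 * A + 2 * B) / wt t"
   by (subst pos_le_divide_eq[OF weight_pos]) (simp add: mult.commute)
 qed
qed

text \<open>
 Fubini moves the transform to the test function: the pairing of \<open>F (\<bullet> + \<i> \<sigma>)\<close> with \<open>\<phi>\<close> is the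
 integral of \<open>p t * exp (- \<sigma> * t)\<close> against the transform of \<open>\<phi>\<close>. Since \<open>p\<close> vanishes on a half
 line, the exponential is bounded for \<open>\<sigma> \<le> 1\<close> and dominated convergence applies.
\<close>
theorem causal_boundary_value:
 assumes p: "causal c p" and F: "\<And>z. Im z > 0 \<Longrightarrow> F z = fourier p z"
 shows "has_fourier_boundary_value p F"
 unfolding has_fourier_boundary_value_def
proof (intro ballI conjI allI impI)
 fix \<phi> assume \<phi>: "\<phi> \<in> schwartz"
 have pm [measurable]: "p \<in> borel_fun" using p by (simp add: causal_def)
 have \<phi>i: "integrable lborel \<phi>" using schwartz_integrable[OF \<phi>, of 0] by simp
 have [measurable]: "\<phi> \<in> borel_fun" using \<phi>i by auto
 have \<phi>c: "continuous_on UNIV (\<lambda>t. fourier \<phi> (of_real t))" by (rule fourier_continuous_real[OF \<phi>i])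
 have [measurable]: "(\<lambda>t. fourier \<phi> (of_real t)) \<in> borel_fun" by (rule borel_measurable_continuous_onI[OF \<phi>c])
 obtain C where C: "C \<ge> 0" "\<And>t. norm (fourier \<phi> (of_real t)) \<le> C / wt t" using schwartz_fourier_decay[OF \<phi>] by metis
 have pi: "integrable lborel (\<lambda>t. C * (norm (p t) / wt t))"
  using p unfolding causal_def by (intro integrable_mult_right) blast
 have nb: "norm (p t * fourier \<phi> (of_real t)) \<le> C * (norm (p t) / wt t)" for t
  using mult_left_mono[OF C(2)[of t], of "norm (p t)"] by (simp add: norm_mult mult_ac)
 have int1: "integrable lborel (\<lambda>t. p t * fourier \<phi> (of_real t))"
 proof (rule Bochner_Integration.integrable_bound[OF pi])
  show "AE t in lborel. norm (p t * fourier \<phi> (of_real t)) \<le> norm (C * (norm (p t) / wt t))"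
   using order_trans[OF nb abs_ge_self] by (intro AE_I2) (simp only: real_norm_def)
 qed measurable
 then show "integrable lebesgue (\<lambda>t. p t * fourier \<phi> (of_real t))"
  by (subst integrable_completion) auto
 have eq: "(LINT t|lebesgue. p t * fourier \<phi> (of_real t)) = (LBINT t. p t * fourier \<phi> (of_real t))"
  by (rule integral_completion) simp
 have Fc: "continuous_on UNIV (\<lambda>l. F (Complex l \<sigma>))" if "\<sigma> > 0" for \<sigma>
 proof -
  have "continuous_on UNIV (\<lambda>l. fourier p (Complex l \<sigma>))"
  proof (rule continuous_on_compose2[OF holomorphic_on_imp_continuous_on[OF causal_fourier_holomorphic[OF p]]])
   show "continuous_on UNIV (\<lambda>l. Complex l \<sigma>)" by (simp add: Complex_eq continuous_intros)
  qed (use that in auto)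
  then show ?thesis using F that by simp
 qed
 have Fm: "(\<lambda>l. F (Complex l \<sigma>)) \<in> borel_fun" if "\<sigma> > 0" for \<sigma>
  by (rule borel_measurable_continuous_onI[OF Fc[OF that]])
 have line: "integrable lborel (\<lambda>l. F (Complex l \<sigma>) * \<phi> l) \<and>
   (LBINT l. F (Complex l \<sigma>) * \<phi> l) = (LBINT t. p t * exp (- \<sigma> * t) * fourier \<phi> (of_real t))" if \<sigma>: "\<sigma> > 0" for \<sigma>
 proof -
  let ?h = "\<lambda>l t. p t * exp (\<i> * Complex l \<sigma> * of_real t) * \<phi> l"
  have ex: "exp (\<i> * Complex l \<sigma> * of_real t) = of_real (exp (- \<sigma> * t)) * exp (\<i> * of_real t * of_real l)" for l t
   unfolding exp_of_real[symmetric] mult_exp_exp by (rule arg_cong[of _ _ exp]) (simp add: complex_eq_iff)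
  have m: "(\<lambda>(l, t). ?h l t) \<in> borel_measurable (lborel \<Otimes>\<^sub>M lborel)"
   unfolding ex case_prod_beta by measurable
  have int: "integrable (lborel \<Otimes>\<^sub>M lborel) (\<lambda>(l, t). ?h l t)"
  proof (rule lborel_pair.Fubini_integrable[OF m])
   have "(\<lambda>l. LBINT t. norm (case (l, t) of (l, t) \<Rightarrow> ?h l t)) = (\<lambda>l. (LBINT t. norm (p t) * exp (- \<sigma> * t)) * norm (\<phi> l))"
    by (simp add: norm_mult norm_exp_i)
   then show "integrable lborel (\<lambda>l. LBINT t. norm (case (l, t) of (l, t) \<Rightarrow> ?h l t))" using \<phi>i by simp
   show "AE l in lborel. integrable lborel (\<lambda>t. case (l, t) of (l, t) \<Rightarrow> ?h l t)"
    using causal_integrable[OF p] \<sigma> by simp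
  qed
  have F1: "F (Complex l \<sigma>) * \<phi> l = (LBINT t. ?h l t)" for l
   using F[of "Complex l \<sigma>"] \<sigma> by (simp add: fourier_lborel)
  have "integrable lborel (\<lambda>l. LBINT t. (case (l, t) of (l, t) \<Rightarrow> ?h l t))"
   by (rule lborel_pair.integrable_fst'[OF int])
  then have 1: "integrable lborel (\<lambda>l. F (Complex l \<sigma>) * \<phi> l)" by (simp add: F1)
  have "(LBINT l. F (Complex l \<sigma>) * \<phi> l) = (LBINT t. LBINT l. ?h l t)"
   unfolding F1 by (rule lborel_pair.Fubini_integral[symmetric]) (rule int)
  also have "\<dots> = (LBINT t. p t * exp (- \<sigma> * t) * fourier \<phi> (of_real t))"
  proof (rule Bochner_Integration.integral_cong[OF refl])
   fix t
   have "(LBINT l. ?h l t) = (LBINT l. (p t * of_real (exp (- \<sigma> * t))) * (\<phi> l * exp (\<i> * of_real t * of_real l)))"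
    unfolding ex by (simp add: mult_ac)
   also have "\<dots> = (p t * of_real (exp (- \<sigma> * t))) * fourier \<phi> (of_real t)"
    by (simp add: fourier_lborel)
   finally show "(LBINT l. ?h l t) = p t * exp (- \<sigma> * t) * fourier \<phi> (of_real t)" .
  qed
  finally show ?thesis using 1 by blast
 qed
 show "integrable lebesgue (\<lambda>l. F (Complex l \<sigma>) * \<phi> l)" if "\<sigma> > 0" for \<sigma>
  using line[OF that] Fm[OF that] by (subst integrable_completion) auto
 have lim: "((\<lambda>\<sigma>. LINT l|lebesgue. F (Complex l \<sigma>) * \<phi> l) \<circ> X) \<longlonglongrightarrow> (LINT t|lebesgue. p t * fourier \<phi> (of_real t))"
  if X: "\<And>n. X n \<in> {0<..} - {0}" "X \<longlonglongrightarrow> 0" for X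
 proof -
  have X0: "X n > 0" for n using X(1)[of n] by simp
  have "Bseq X" using X(2) by (intro convergent_imp_Bseq convergentI)
  then obtain K where K: "\<And>n. norm (X n) \<le> K" unfolding Bseq_def by blast
  have "((\<lambda>\<sigma>. LINT l|lebesgue. F (Complex l \<sigma>) * \<phi> l) \<circ> X) = (\<lambda>n. LBINT t. p t * exp (- X n * t) * fourier \<phi> (of_real t))"
  proof
   fix n
   have "(LINT l|lebesgue. F (Complex l (X n)) * \<phi> l) = (LBINT l. F (Complex l (X n)) * \<phi> l)"
    by (rule integral_completion) (use Fm[OF X0[of n]] in measurable)
   then show "((\<lambda>\<sigma>. LINT l|lebesgue. F (Complex l \<sigma>) * \<phi> l) \<circ> X) n = (LBINT t. p t * exp (- X n * t) * fourier \<phi> (of_real t))"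
    using line[OF X0[of n]] by simp
  qed
  moreover have "(\<lambda>n. LBINT t. p t * exp (- X n * t) * fourier \<phi> (of_real t)) \<longlonglongrightarrow> (LBINT t. p t * fourier \<phi> (of_real t))"
  proof (rule integral_dominated_convergence[where w = "\<lambda>t. exp (K * \<bar>c\<bar>) * (C * (norm (p t) / wt t))"])
   show "AE t in lborel. (\<lambda>n. p t * of_real (exp (- X n * t)) * fourier \<phi> (of_real t)) \<longlonglongrightarrow> p t * fourier \<phi> (of_real t)"
   proof (rule AE_I2)
    fix t
    have "(\<lambda>n. p t * of_real (exp (- X n * t)) * fourier \<phi> (of_real t)) \<longlonglongrightarrow> p t * of_real (exp (- 0 * t)) * fourier \<phi> (of_real t)"
     by (intro tendsto_intros X)
    then show "(\<lambda>n. p t * of_real (exp (- X n * t)) * fourier \<phi> (of_real t)) \<longlonglongrightarrow> p t * fourier \<phi> (of_real t)" by simp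
   qed
   have ae: "AE t in lborel. t < c \<longrightarrow> p t = 0" using p by (simp add: causal_def)
   show "AE t in lborel. norm (p t * of_real (exp (- X n * t)) * fourier \<phi> (of_real t)) \<le> exp (K * \<bar>c\<bar>) * (C * (norm (p t) / wt t))" for n
    using ae
   proof eventually_elim
    case (elim t)
    show ?case
    proof (cases "t < c")
     case False
     have "- X n * t \<le> X n * \<bar>c\<bar>" using False X0[of n] mult_left_mono[of "- t" "\<bar>c\<bar>" "X n"] by simp
     also have "\<dots> \<le> K * \<bar>c\<bar>" using K[of n] X0[of n] by (intro mult_right_mono) auto
     finally have "exp (- X n * t) \<le> exp (K * \<bar>c\<bar>)" by simp
     then have "exp (- X n * t) * norm (p t * fourier \<phi> (of_real t)) \<le> exp (K * \<bar>c\<bar>) * (C * (norm (p t) / wt t))"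
      using nb[of t] by (intro mult_mono) auto
     then show ?thesis by (simp add: norm_mult mult_ac)
    qed (use elim in simp)
   qed
  next
   show "integrable lborel (\<lambda>t. exp (K * \<bar>c\<bar>) * (C * (norm (p t) / wt t)))"
    by (rule integrable_mult_right[OF pi])
  qed measurable
  ultimately show ?thesis unfolding eq by simp
 qed
 then show "((\<lambda>\<sigma>. LINT l|lebesgue. F (Complex l \<sigma>) * \<phi> l) \<longlongrightarrow> (LINT t|lebesgue. p t * fourier \<phi> (of_real t))) (at_right 0)"
  unfolding tendsto_at_iff_sequentially by blast
qed

section \<open>Laplace transform in time of a curve of square integrable functions\<close>

lemma weight_le: "1 / wt t \<le> 1 / (1 + t\<^sup>2)" for t :: real
proof -
 have "1 + t\<^sup>2 \<le> wt t" by (rule self_le_power) auto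
 moreover have "0 < wt t * (1 + t\<^sup>2)" by (intro mult_pos_pos weight_pos add_pos_nonneg) simp_all
 ultimately show ?thesis by (intro divide_left_mono) auto
qed

lemma integrable_weight: "integrable lborel (\<lambda>t::real. 1 / wt t)"
 by (rule Bochner_Integration.integrable_bound[OF integrable_inverse_square]) (use weight_le in auto)

lemma causal_Laplace_bound:
 fixes \<sigma> c :: real
 assumes "\<sigma> > 0"
 obtains C where "C \<ge> 0" "\<And>p z. causal c p \<Longrightarrow> Im z = \<sigma> \<Longrightarrow> norm (fourier p z) \<le> C * (LBINT t. norm (p t) / wt t)"
  "\<And>p. causal c p \<Longrightarrow> (LBINT t. norm (p t) * exp (- \<sigma> * t)) \<le> C * (LBINT t. norm (p t) / wt t)"
proof -
 obtain C where C: "C \<ge> 0" "\<And>t. t \<ge> c \<Longrightarrow> exp (- \<sigma> * t) * (1 + \<bar>t\<bar>) \<le> C / wt t"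
  using exp_weight_bound[OF assms] by metis
 have 2: "(LBINT t. norm (p t) * exp (- \<sigma> * t)) \<le> C * (LBINT t. norm (p t) / wt t)" if p: "causal c p" for p
 proof -
  have i: "integrable lborel (\<lambda>t. C * (norm (p t) / wt t))"
   using p unfolding causal_def by (intro integrable_mult_right) blast
  have ae: "AE t in lborel. t < c \<longrightarrow> p t = 0" using p by (simp add: causal_def)
  have "(LBINT t. norm (p t) * exp (- \<sigma> * t)) \<le> (LBINT t. C * (norm (p t) / wt t))"
  proof (rule integral_mono_AE[OF causal_integrable_norm[OF p assms] i])
   show "AE t in lborel. norm (p t) * exp (- \<sigma> * t) \<le> C * (norm (p t) / wt t)"
    using ae
   proof eventually_elim
    case (elim t)
    show ?case
    proof (cases "t < c")
     case False
     have "exp (- \<sigma> * t) \<le> exp (- \<sigma> * t) * (1 + \<bar>t\<bar>)" by (simp add: distrib_left)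
     also have "\<dots> \<le> C / wt t" using C(2)[of t] False by simp
     finally show ?thesis using mult_left_mono[of "exp (- \<sigma> * t)" "C / wt t" "norm (p t)"] by (simp add: mult_ac)
    qed (use elim in simp)
   qed
  qed
  also have "\<dots> = C * (LBINT t. norm (p t) / wt t)" by (rule integral_mult_right_zero)
  finally show ?thesis .
 qed
 show ?thesis
 proof (rule that[OF C(1) _ 2])
  fix p z assume p: "causal c p" and z: "Im z = \<sigma>"
  have pm: "p \<in> borel_fun" using p by (simp add: causal_def)
  have "norm (fourier p z) \<le> (LBINT t. norm (p t * osc z t))"
   unfolding fourier_lborel[OF pm] by (rule integral_norm_bound)
  also have "\<dots> = (LBINT t. norm (p t) * exp (- \<sigma> * t))" by (simp only: norm_mult norm_exp_i z)
  also note 2[OF p]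
  finally show "norm (fourier p z) \<le> C * (LBINT t. norm (p t) / wt t)" .
 qed
qed

locale growing_curve =
 fixes v :: "real \<Rightarrow> real \<Rightarrow> complex" and v1 :: "real \<times> real \<Rightarrow> complex" and M B :: real
 assumes v: "v \<in> C0_L2" and v1: "joint_version v v1" and M: "M > 0" and B: "B \<ge> 0"
  and growth: "\<And>t. t \<ge> - M \<Longrightarrow> L2_norm (v t) \<le> B * (1 + \<bar>t\<bar>)"
  and past: "\<And>t. t < - M \<Longrightarrow> AE x in lebesgue. x \<in> {- M..M} \<longrightarrow> v t x = 0"
begin

lemma v1_borel [measurable]: "v1 \<in> borel_fun2"
 using joint_versionD(1)[OF v1] by (simp add: borel_prod)

definition weighted_norm :: "real \<Rightarrow> real" where
 "weighted_norm x = (LBINT t. norm (v1 (t, x)) / wt t)"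

lemma weighted_norm_nonneg: "0 \<le> weighted_norm x"
 by (simp add: weighted_norm_def)

lemma weighted_norm_borel [measurable]: "weighted_norm \<in> borel_fun"
 unfolding weighted_norm_def[abs_def] by measurable

lemma transform_borel: "(\<lambda>x. fourier (\<lambda>t. v1 (t, x)) z) \<in> borel_fun"
proof -
 have "(\<lambda>x. fourier (\<lambda>t. v1 (t, x)) z) = (\<lambda>x. LBINT t. v1 (t, x) * osc z t)"
  by (rule ext, rule fourier_lborel) measurable
 also have "\<dots> \<in> borel_fun" by measurable
 finally show ?thesis .
qed

lemma AE_past: "AE x in lborel. x \<in> {- M..M} \<longrightarrow> (AE t in lborel. t < - M \<longrightarrow> v1 (t, x) = 0)"
proof -
 have "AE t in lborel. AE x in lborel. t < - M \<longrightarrow> x \<in> {- M..M} \<longrightarrow> v1 (t, x) = 0"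
  using joint_versionD(2)[OF v1]
 proof eventually_elim
  case (elim t)
  show ?case
  proof (cases "t < - M")
   case True
   from past[OF this] elim show ?thesis unfolding AE_lebesgue by eventually_elim simp
  qed simp
 qed
 then have "AE p in lborel. fst p < - M \<longrightarrow> snd p \<in> {- M..M} \<longrightarrow> v1 p = 0"
 proof (intro AE_lborel_pairI)
  have "Measurable.pred (borel \<Otimes>\<^sub>M borel) (\<lambda>p. fst p < - M \<longrightarrow> snd p \<in> {- M..M} \<longrightarrow> v1 p = 0)" by measurable
  then show "{p. fst p < - M \<longrightarrow> snd p \<in> {- M..M} \<longrightarrow> v1 p = 0} \<in> sets borel"
   by (simp add: pred_def borel_prod space_pair_measure)
 qed simp
 from AE_lborel_pairD(2)[OF this] show ?thesis by eventually_elim auto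
qed

text \<open>
 Weighting by \<open>1 / (1 + t\<^sup>2)\<^sup>2\<close> makes the linearly growing norms square integrable in time, so that for almost every
 \<open>x\<close> the function of time lies in a weighted \<open>L\<^sup>2\<close> space.
\<close>
lemma energy_finite: "(NN x. (NN t. ennreal ((norm (v1 (t, x)))\<^sup>2 * (indicator {-M..} t / wt t)))) < \<infinity>"
proof -
 have "(NN x. (NN t. ennreal ((norm (v1 (t, x)))\<^sup>2 * (indicator {-M..} t / wt t)))) =
  (NN t. (NN x. ennreal ((norm (v1 (t, x)))\<^sup>2 * (indicator {-M..} t / wt t))))"
  by (rule lborel_pair.Fubini') measurable
 also have "\<dots> \<le> (NN t. ennreal (2 * B\<^sup>2 * (1 / (1 + t\<^sup>2))))"
 proof (rule nn_integral_mono_AE)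
  show "AE t in lborel. (NN x. ennreal ((norm (v1 (t, x)))\<^sup>2 * (indicator {-M..} t / wt t))) \<le> ennreal (2 * B\<^sup>2 * (1 / (1 + t\<^sup>2)))"
   using joint_versionD(2)[OF v1]
  proof eventually_elim
   case (elim t)
   show ?case
   proof (cases "t \<ge> - M")
    case True
    have "(NN x. ennreal ((norm (v1 (t, x)))\<^sup>2)) = (NN x. ennreal ((norm (v t x))\<^sup>2))"
     by (rule nn_integral_cong_AE) (use elim in \<open>auto elim: eventually_mono\<close>)
    also have "\<dots> = ennreal ((L2_norm (v t))\<^sup>2)"
     using L2_nn_integral[OF C0_L2_D(1)[OF v]] by (simp add: nn_integral_completion)
    also have "\<dots> \<le> ennreal ((B * (1 + \<bar>t\<bar>))\<^sup>2)"
     by (intro ennreal_leI power_mono growth True L2_norm_nonneg)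
    finally have 1: "(NN x. ennreal ((norm (v1 (t, x)))\<^sup>2)) \<le> ennreal ((B * (1 + \<bar>t\<bar>))\<^sup>2)" .
    have "(1 + \<bar>t\<bar>)\<^sup>2 \<le> 2 * (1 + t\<^sup>2)" using sum_squares_bound[of 1 "\<bar>t\<bar>"] by (simp add: power2_sum)
    then have "(B * (1 + \<bar>t\<bar>))\<^sup>2 \<le> B\<^sup>2 * (2 * (1 + t\<^sup>2))" by (simp add: power_mult_distrib mult_left_mono)
    then have "(B * (1 + \<bar>t\<bar>))\<^sup>2 * (1 / wt t) \<le> B\<^sup>2 * (2 * (1 + t\<^sup>2)) * (1 / wt t)" by (rule mult_right_mono) simp
    also have "\<dots> = 2 * B\<^sup>2 * (1 / (1 + t\<^sup>2))"
    proof -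
     have "b * (2 * q) * (1 / q\<^sup>2) = 2 * b * (1 / q)" if "q \<noteq> 0" for b q :: real
      using that by (simp add: power2_eq_square)
     moreover have "1 + t\<^sup>2 \<noteq> 0" using add_pos_nonneg[of 1 "t\<^sup>2"] by auto
     ultimately show ?thesis by blast
    qed
    finally have 2: "(B * (1 + \<bar>t\<bar>))\<^sup>2 * (1 / wt t) \<le> 2 * B\<^sup>2 * (1 / (1 + t\<^sup>2))" .
    have "(NN x. ennreal ((norm (v1 (t, x)))\<^sup>2 * (indicator {-M..} t / wt t))) = (NN x. ennreal ((norm (v1 (t, x)))\<^sup>2) * ennreal (1 / wt t))"
     using True by (simp add: ennreal_mult'[symmetric])
    also have "\<dots> = (NN x. ennreal ((norm (v1 (t, x)))\<^sup>2)) * ennreal (1 / wt t)"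
     by (rule nn_integral_multc) measurable
    also have "\<dots> \<le> ennreal ((B * (1 + \<bar>t\<bar>))\<^sup>2) * ennreal (1 / wt t)"
     by (rule mult_right_mono[OF 1]) simp
    also have "\<dots> = ennreal ((B * (1 + \<bar>t\<bar>))\<^sup>2 * (1 / wt t))" by (rule ennreal_mult'[symmetric]) simp
    also have "\<dots> \<le> ennreal (2 * B\<^sup>2 * (1 / (1 + t\<^sup>2)))" by (rule ennreal_leI[OF 2])
    finally show ?thesis .
   qed simp
  qed
 qed
 also have "\<dots> = ennreal (LBINT t. 2 * B\<^sup>2 * (1 / (1 + t\<^sup>2)))"
  by (rule nn_integral_eq_integral) (auto intro!: integrable_mult_right integrable_inverse_square AE_I2 simp del: times_divide_eq_right)
 also have "\<dots> < \<infinity>" by simp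
 finally show ?thesis .
qed

lemma AE_causal: "AE x in lborel. x \<in> {- M..M} \<longrightarrow> causal (- M) (\<lambda>t. v1 (t, x))"
 and weighted_norm_L2: "integrable lborel (\<lambda>x. indicat_real {- M..M} x * (weighted_norm x)\<^sup>2)"
proof -
 define Q where "Q x = (NN t. ennreal ((norm (v1 (t, x)))\<^sup>2 * (indicator {-M..} t / wt t)))" for x
 define W where "W = (LBINT t. 1 / wt t :: real)"
 have W0: "W \<ge> 0" by (simp add: W_def)
 have Qm [measurable]: "Q \<in> borel_fun" unfolding Q_def[abs_def] by measurable
 have Qf: "(NN x. Q x) < \<infinity>" using energy_finite by (simp add: Q_def)
 then have "AE x in lborel. Q x \<noteq> \<infinity>" by (intro nn_integral_PInf_AE) auto
 with AE_past have ae: "AE x in lborel. x \<in> {- M..M} \<longrightarrow> causal (- M) (\<lambda>t. v1 (t, x)) \<and> ennreal ((weighted_norm x)\<^sup>2) \<le> Q x * ennreal W"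
 proof eventually_elim
  case (elim x)
  show ?case
  proof
   assume "x \<in> {- M..M}"
   with elim have z: "AE t in lborel. t < - M \<longrightarrow> v1 (t, x) = 0" by blast
   let ?w = "\<lambda>t. sqrt (1 / wt t)"
   let ?I = "NN t. ennreal (norm (v1 (t, x)) / wt t)"
   have Ie: "?I = (NN t. ennreal (norm (v1 (t, x)) * ?w t * indicator {-M..} t) * ennreal (?w t))"
   proof (rule nn_integral_cong_AE)
    show "AE t in lborel. ennreal (norm (v1 (t, x)) / wt t) = ennreal (norm (v1 (t, x)) * ?w t * indicator {-M..} t) * ennreal (?w t)"
     using z
    proof eventually_elim
     case (elim t)
     have "?w t * ?w t = 1 / wt t" by (subst real_sqrt_mult_self) simp
     then have "norm (v1 (t, x)) * ?w t * ?w t = norm (v1 (t, x)) / wt t" by (simp only: mult.assoc) simp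
     then show ?case using elim by (cases "t < - M") (simp_all add: ennreal_mult'[symmetric] del: real_sqrt_divide)
    qed
   qed
   have "?I\<^sup>2 \<le> (NN t. (ennreal (norm (v1 (t, x)) * ?w t * indicator {-M..} t))\<^sup>2) * (NN t. (ennreal (?w t))\<^sup>2)"
    unfolding Ie by (rule Cauchy_Schwarz_nn_integral) measurable
   also have "(NN t. (ennreal (?w t))\<^sup>2) = (NN t. ennreal (1 / wt t))"
    by (simp add: ennreal_power del: real_sqrt_divide)
   also have "\<dots> = ennreal W" unfolding W_def by (rule nn_integral_eq_integral[OF integrable_weight]) simp
   also have "(NN t. (ennreal (norm (v1 (t, x)) * ?w t * indicator {-M..} t))\<^sup>2) = Q x"
    unfolding Q_def
    by (intro nn_integral_cong) (simp add: ennreal_power power_mult_distrib indicator_def del: real_sqrt_divide)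
   finally have le: "?I\<^sup>2 \<le> Q x * ennreal W" .
   also have "\<dots> < \<infinity>" using elim by (auto simp: ennreal_mult_less_top less_top)
   finally have "?I \<noteq> \<infinity>" by (auto simp: power2_eq_square ennreal_mult_less_top)
   then have int: "integrable lborel (\<lambda>t. norm (v1 (t, x)) / wt t)"
    by (intro integrableI_bounded) (auto simp: less_top)
   have "?I = ennreal (weighted_norm x)" unfolding weighted_norm_def by (rule nn_integral_eq_integral[OF int]) simp
   then have "?I\<^sup>2 = ennreal ((weighted_norm x)\<^sup>2)" by (simp add: ennreal_power weighted_norm_nonneg)
   with le int z show "causal (- M) (\<lambda>t. v1 (t, x)) \<and> ennreal ((weighted_norm x)\<^sup>2) \<le> Q x * ennreal W"
    by (simp add: causal_def)
  qed
 qed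
 then show "AE x in lborel. x \<in> {- M..M} \<longrightarrow> causal (- M) (\<lambda>t. v1 (t, x))" by eventually_elim auto
 show "integrable lborel (\<lambda>x. indicat_real {- M..M} x * (weighted_norm x)\<^sup>2)"
 proof (rule integrableI_bounded)
  have "(NN x. enorm (indicat_real {- M..M} x * (weighted_norm x)\<^sup>2)) \<le> (NN x. Q x * ennreal W)"
   by (rule nn_integral_mono_AE) (use ae in \<open>eventually_elim, auto simp: indicator_def\<close>)
  also have "\<dots> = (NN x. Q x) * ennreal W" by (rule nn_integral_multc) measurable
  also have "\<dots> < \<infinity>" using Qf by (simp add: ennreal_mult_less_top)
  finally show "(NN x. enorm (indicat_real {- M..M} x * (weighted_norm x)\<^sup>2)) < \<infinity>" .
 qed measurable
qed

lemma Laplace_pairing: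
 assumes \<psi>: "\<psi> \<in> \<D>" "supp \<psi> \<subseteq> {- M..M}" and z: "Im z > 0"
 shows "integrable lborel (\<lambda>t. pairing (v t) \<psi> * osc z t)"
  and "integrable lborel (\<lambda>x. fourier (\<lambda>t. v1 (t, x)) z * \<psi> x)"
  and "(LBINT x. fourier (\<lambda>t. v1 (t, x)) z * \<psi> x) = (LBINT t. pairing (v t) \<psi> * osc z t)"
  and "((\<lambda>t. pairing (v t) \<psi> * osc z t) \<longlongrightarrow> 0) at_top"
  and "((\<lambda>t. pairing (v t) \<psi> * osc z t) \<longlongrightarrow> 0) at_bot"
  and "integrable lborel (\<lambda>p. v1 p * (indicator {-M..} (fst p) * exp (\<i> * z * of_real (fst p)) * \<psi> (snd p)))"
proof -
 have [measurable]: "\<psi> \<in> borel_fun" by (rule test_borel[OF \<psi>(1)])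
 note \<psi>L = test_L2[OF \<psi>(1)]
 obtain C where C: "C \<ge> 0" "\<And>t. t \<ge> - M \<Longrightarrow> exp (- Im z * t) * (1 + \<bar>t\<bar>) \<le> C / wt t"
  using exp_weight_bound[OF z] by metis
 let ?k = "\<lambda>p :: real \<times> real. indicator {-M..} (fst p) * exp (\<i> * z * of_real (fst p)) * \<psi> (snd p)"
 let ?K = "\<lambda>t. indicat_real {-M..} t * exp (- Im z * t) * L2_norm \<psi>"
 have pz: "pairing (v t) \<psi> = 0" if "t < - M" for t
  by (rule pairing_eq_0_disjoint[OF past[OF that]]) (rule subsetD[OF \<psi>(2) in_supp])
 have vm [measurable]: "(\<lambda>t. L2_norm (v t)) \<in> borel_fun"
  by (intro borel_measurable_continuous_onI C0_L2_norm_continuous v)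
 have pc: "continuous_on UNIV (\<lambda>t. pairing (v t) \<psi>)"
  using C0_L2_pairing_continuous[OF v C1_curveD(1)[OF C1_curve_const[OF \<psi>L]]] .
 have pm [measurable]: "(\<lambda>t. pairing (v t) \<psi>) \<in> borel_fun"
  by (rule borel_measurable_continuous_onI[OF pc])
 have bound: "L2_norm (v t) * ?K t \<le> (B * C * L2_norm \<psi>) * (1 / wt t)" for t
 proof (cases "t \<ge> - M")
  case True
  have "L2_norm (v t) * (exp (- Im z * t) * L2_norm \<psi>) \<le> (B * (1 + \<bar>t\<bar>)) * (exp (- Im z * t) * L2_norm \<psi>)"
   by (intro mult_right_mono growth True mult_nonneg_nonneg L2_norm_nonneg) simp
  also have "\<dots> = (B * L2_norm \<psi>) * (exp (- Im z * t) * (1 + \<bar>t\<bar>))" by (simp add: mult_ac)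
  also have "\<dots> \<le> (B * L2_norm \<psi>) * (C / wt t)"
   by (intro mult_left_mono C(2) True mult_nonneg_nonneg B L2_norm_nonneg)
  finally show ?thesis using True by (simp add: mult_ac)
 qed (use B C(1) L2_norm_nonneg[of \<psi>] in simp)
 have K: "integrable lborel (\<lambda>t. L2_norm (v t) * ?K t)"
 proof (rule Bochner_Integration.integrable_bound[OF integrable_mult_right[OF integrable_weight, of "B * C * L2_norm \<psi>"]])
  show "AE t in lborel. norm (L2_norm (v t) * ?K t) \<le> norm ((B * C * L2_norm \<psi>) * (1 / wt t))"
  proof (rule AE_I2)
   fix t
   have "0 \<le> L2_norm (v t) * ?K t" by (intro mult_nonneg_nonneg L2_norm_nonneg) auto
   then show "norm (L2_norm (v t) * ?K t) \<le> norm ((B * C * L2_norm \<psi>) * (1 / wt t))"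
    using bound[of t] by (metis abs_ge_self abs_of_nonneg order_trans real_norm_def)
  qed
 qed measurable
 have ks: "(\<lambda>x. ?k (t, x)) = (\<lambda>x. (indicator {-M..} t * osc z t) * \<psi> x)" for t by simp
 have kL: "(\<lambda>x. ?k (t, x)) \<in> L2" "L2_norm (\<lambda>x. ?k (t, x)) \<le> ?K t" for t
  unfolding ks L2_cmult(2)[OF \<psi>L] by (rule L2_cmult(1)[OF \<psi>L]) (simp add: norm_mult norm_exp_i indicator_def)
 have kp: "pairing (v t) (\<lambda>x. ?k (t, x)) = pairing (v t) \<psi> * osc z t" for t
  unfolding ks pairing_cmult using pz[of t] by (cases "t < - M") auto
 have km: "?k \<in> borel_fun" unfolding borel_prod[symmetric] by measurable
 have mm: "(\<lambda>t. pairing (v t) (\<lambda>x. ?k (t, x))) \<in> borel_fun" unfolding kp by measurable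
 note F = Fubini_pairing[OF v v1 km kL K mm]
 show "integrable lborel (\<lambda>p. v1 p * ?k p)" by (rule F(1))
 have int: "integrable (lborel \<Otimes>\<^sub>M lborel) (\<lambda>(t, x). v1 (t, x) * ?k (t, x))"
  using F(1) by (simp add: lborel_prod case_prod_unfold)
 have inner: "AE x in lborel. (LBINT t. v1 (t, x) * ?k (t, x)) = fourier (\<lambda>t. v1 (t, x)) z * \<psi> x"
  using AE_past
 proof eventually_elim
  case (elim x)
  show ?case
  proof (cases "x \<in> {- M..M}")
   case True
   with elim have "AE t in lborel. t < - M \<longrightarrow> v1 (t, x) = 0" by blast
   then have "(LBINT t. v1 (t, x) * ?k (t, x)) = (LBINT t. v1 (t, x) * osc z t * \<psi> x)"
    by (intro integral_cong_AE) (auto elim!: eventually_mono simp: indicator_def)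
   then show ?thesis by (subst fourier_lborel) auto
  next
   case False
   then have "\<psi> x = 0" using subsetD[OF \<psi>(2) in_supp] by blast
   then show ?thesis by simp
  qed
 qed
 have snd: "integrable lborel (\<lambda>x. LBINT t. v1 (t, x) * ?k (t, x))"
  using lborel_pair.integrable_snd[OF int] .
 have fm: "(\<lambda>x. fourier (\<lambda>t. v1 (t, x)) z * \<psi> x) \<in> borel_fun" using transform_borel by measurable
 show "integrable lborel (\<lambda>x. fourier (\<lambda>t. v1 (t, x)) z * \<psi> x)"
  by (rule integrable_cong_AE_imp[OF snd]) (use fm inner in \<open>auto elim: eventually_mono\<close>)
 have "(LBINT x. fourier (\<lambda>t. v1 (t, x)) z * \<psi> x) = (LBINT x. LBINT t. v1 (t, x) * ?k (t, x))"
  by (rule integral_cong_AE) (use fm snd inner in \<open>auto elim: eventually_mono\<close>)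
 also have "\<dots> = (LBINT t. LBINT x. v1 (t, x) * ?k (t, x))"
  by (rule lborel_pair.Fubini_integral) (rule int)
 also have "\<dots> = (LBINT p. v1 p * ?k p)"
  using lborel_pair.integral_fst'[of "\<lambda>p. v1 p * ?k p"] F(1) by (simp add: lborel_prod)
 also have "\<dots> = (LBINT t. pairing (v t) \<psi> * osc z t)" unfolding F(2) kp ..
 finally show "(LBINT x. fourier (\<lambda>t. v1 (t, x)) z * \<psi> x) = (LBINT t. pairing (v t) \<psi> * osc z t)" .
 have nb: "norm (pairing (v t) \<psi> * osc z t) \<le> norm ((B * C * L2_norm \<psi>) * (1 / wt t))" for t
 proof -
  have "norm (pairing (v t) \<psi> * osc z t) \<le> L2_norm (v t) * ?K t"
  proof (cases "t < - M")
   case False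
   then show ?thesis using mult_right_mono[OF pairing_bound[OF C0_L2_D(1)[OF v, of t] \<psi>L], of "exp (- Im z * t)"]
    by (simp add: norm_mult norm_exp_i mult_ac)
  qed (simp add: pz)
  also note bound[of t]
  also note abs_ge_self
  finally show ?thesis unfolding real_norm_def .
 qed
 show "integrable lborel (\<lambda>t. pairing (v t) \<psi> * osc z t)"
  by (rule Bochner_Integration.integrable_bound[OF integrable_mult_right[OF integrable_weight, of "B * C * L2_norm \<psi>"]])
   (use nb in \<open>auto simp del: times_divide_eq_right norm_mult\<close>)
 have l0: "((\<lambda>t::real. 1 / wt t) \<longlongrightarrow> 0) at_top" "((\<lambda>t::real. 1 / wt t) \<longlongrightarrow> 0) at_bot"
  by real_asymp+
 have l: "((\<lambda>t::real. norm (A * (1 / wt t))) \<longlongrightarrow> 0) at_top" "((\<lambda>t::real. norm (A * (1 / wt t))) \<longlongrightarrow> 0) at_bot" for A :: real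
  by (intro tendsto_norm_zero tendsto_mult_right_zero l0)+
 show "((\<lambda>t. pairing (v t) \<psi> * osc z t) \<longlongrightarrow> 0) at_top"
  "((\<lambda>t. pairing (v t) \<psi> * osc z t) \<longlongrightarrow> 0) at_bot"
  by (rule Lim_null_comparison[OF always_eventually l(1)], use nb in blast)
   (rule Lim_null_comparison[OF always_eventually l(2)], use nb in blast)
qed

lemma weighted_norm_integrable: "integrable lborel (\<lambda>x. indicat_real {- M..M} x * weighted_norm x)"
proof -
 have "integrable lborel (\<lambda>x. indicat_real {- M..M} x * (weighted_norm x)\<^sup>2 + indicat_real {- M..M} x)"
  by (intro Bochner_Integration.integrable_add weighted_norm_L2 integrable_real_indicator) (auto simp: emeasure_lborel_Icc_eq)
 then show ?thesis
 proof (rule Bochner_Integration.integrable_bound)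
  show "AE x in lborel. norm (indicat_real {- M..M} x * weighted_norm x) \<le> norm (indicat_real {- M..M} x * (weighted_norm x)\<^sup>2 + indicat_real {- M..M} x)"
  proof (rule AE_I2)
   fix x
   have "weighted_norm x \<le> (weighted_norm x)\<^sup>2 + 1" using sum_squares_bound[of 1 "weighted_norm x"] weighted_norm_nonneg[of x] by simp
   then show "norm (indicat_real {- M..M} x * weighted_norm x) \<le> norm (indicat_real {- M..M} x * (weighted_norm x)\<^sup>2 + indicat_real {- M..M} x)"
    using weighted_norm_nonneg[of x] by (simp add: indicator_def)
  qed
 qed measurable
qed

end

section \<open>Caratheodory functions\<close>

text \<open>
 A function that is continuous in one variable is determined by its values at rational points, and is the limit of step functions in that variable;
 so countably many null sets have to be removed.
\<close>
lemma Caratheodory_version: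
 fixes F :: "real \<Rightarrow> real \<Rightarrow> complex"
 assumes m: "\<And>t. (\<lambda>x. F x t) \<in> borel_measurable lebesgue" and c: "AE x in lborel. continuous_on UNIV (F x)"
 obtains F1 where "F1 \<in> borel_fun" "AE x in lborel. \<forall>t. F x t = F1 (x, t)"
proof -
 have "\<exists>b. \<forall>t. b t \<in> borel_fun \<and> (AE x in lborel. F x t = b t x)"
  using borel_version[OF m] by (intro choice allI) blast
 then obtain b where b: "\<And>t. b t \<in> borel_fun" "\<And>t. AE x in lborel. F x t = b t x" by blast
 have "AE x in lborel. continuous_on UNIV (F x) \<and> (\<forall>r::rat. F x (of_rat r) = b (of_rat r) x)"
  using c b(2) by (simp add: AE_all_countable)
 then obtain N where N: "{x. \<not> (continuous_on UNIV (F x) \<and> (\<forall>r::rat. F x (of_rat r) = b (of_rat r) x))} \<subseteq> N" "N \<in> null_sets lborel"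
  unfolding eventually_ae_filter space_lborel space_borel by (elim bexE) (rule_tac that, auto)
 have Nm [measurable]: "N \<in> sets borel" using N(2) by (auto simp: null_sets_def)
 define rr where "rr n t = real_of_rat (of_int \<lfloor>real (Suc n) * t\<rfloor> / of_nat (Suc n))" for n :: nat and t
 have rr_eq: "rr n t = real_of_int \<lfloor>real (Suc n) * t\<rfloor> / real (Suc n)" for n t
  by (simp add: rr_def of_rat_divide del: of_nat_Suc)
 have rr_lim: "(\<lambda>n. rr n t) \<longlonglongrightarrow> t" for t
 proof (rule tendsto_sandwich)
  show "\<forall>\<^sub>F n in sequentially. t - inverse (real (Suc n)) \<le> rr n t"
  proof (rule always_eventually, rule allI)
   fix n
   have "real (Suc n) * t - 1 \<le> real_of_int \<lfloor>real (Suc n) * t\<rfloor>" by linarith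
   then have "(real (Suc n) * t - 1) / real (Suc n) \<le> rr n t" unfolding rr_eq by (rule divide_right_mono) simp
   moreover have "(real (Suc n) * t - 1) / real (Suc n) = t - inverse (real (Suc n))" by (simp add: field_simps)
   ultimately show "t - inverse (real (Suc n)) \<le> rr n t" by simp
  qed
  show "\<forall>\<^sub>F n in sequentially. rr n t \<le> t"
  proof (rule always_eventually, rule allI)
   fix n
   have "real_of_int \<lfloor>real (Suc n) * t\<rfloor> \<le> real (Suc n) * t" by linarith
   then have "rr n t \<le> (real (Suc n) * t) / real (Suc n)" unfolding rr_eq by (rule divide_right_mono) simp
   then show "rr n t \<le> t" by simp
  qed
  show "(\<lambda>n. t - inverse (real (Suc n))) \<longlonglongrightarrow> t"
   using tendsto_diff[OF tendsto_const LIMSEQ_inverse_real_of_nat, of t] by simp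
 qed simp
 define Fn where "Fn n p = indicator (- N) (fst p) * b (rr n (snd p)) (fst p)" for n and p :: "real \<times> real"
 have Fnm: "Fn n \<in> borel_fun2" for n
 proof -
  let ?f = "\<lambda>(k::int) (p::real \<times> real). indicator (- N) (fst p) * b (real_of_rat (of_int k / of_nat (Suc n))) (fst p)"
  have "(\<lambda>p. ?f \<lfloor>real (Suc n) * snd p\<rfloor> p) \<in> borel_fun2"
  proof (rule measurable_compose_countable[where f = ?f])
   fix k
   have [measurable]: "b (real_of_rat (of_int k / of_nat (Suc n))) \<in> borel_fun" by (rule b)
   show "?f k \<in> borel_fun2" by measurable
  qed measurable
  then show ?thesis by (simp add: Fn_def[abs_def] rr_def)
 qed
 have good: "(\<lambda>n. Fn n (x, t)) \<longlonglongrightarrow> F x t" if "x \<notin> N" for x t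
 proof -
  have x: "continuous_on UNIV (F x)" "\<And>r::rat. F x (of_rat r) = b (of_rat r) x" using N(1) that by blast+
  have "Fn n (x, t) = F x (rr n t)" for n using that x(2) by (simp add: Fn_def rr_def)
  moreover have "(\<lambda>n. F x (rr n t)) \<longlonglongrightarrow> F x t"
   by (rule continuous_on_tendsto_compose[OF x(1) rr_lim]) auto
  ultimately show ?thesis by simp
 qed
 have conv: "\<exists>L. (\<lambda>n. Fn n p) \<longlonglongrightarrow> L" for p
  using good[of "fst p" "snd p"] by (cases "fst p \<in> N") (auto simp: Fn_def)
 show ?thesis
 proof (rule that[of "\<lambda>p. lim (\<lambda>n. Fn n p)"])
  have "(\<lambda>p. lim (\<lambda>n. Fn n p)) \<in> borel_fun2"
   by (rule borel_measurable_lim_metric[OF Fnm])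
  then show "(\<lambda>p. lim (\<lambda>n. Fn n p)) \<in> borel_fun" by (simp add: borel_prod)
  have "AE x in lborel. x \<notin> N" by (rule AE_not_in[OF N(2)])
  then show "AE x in lborel. \<forall>t. F x t = lim (\<lambda>n. Fn n (x, t))"
  proof eventually_elim
   case (elim x)
   from good[OF elim] show ?case by (intro allI limI[symmetric])
  qed
 qed
qed

section \<open>The memory kernel\<close>

lemma exp_half_line:
 fixes w :: complex
 assumes w: "Re w > 0"
 shows "integrable lborel (\<lambda>t. indicat_real {s..} t *\<^sub>R exp (- w * of_real (t - s)))"
  and "(LBINT t. indicat_real {s..} t *\<^sub>R exp (- w * of_real (t - s))) = 1 / w"
  and "(LBINT t. indicat_real {s..} t * exp (- Re w * (t - s))) = 1 / Re w"
proof -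
 have D: "((\<lambda>t. - exp (- Re w * (t - s)) / Re w) has_real_derivative exp (- Re w * (t - s))) (at t)" for t
  using w by (auto intro!: derivative_eq_intros)
 have lim: "((\<lambda>t. - exp (- Re w * (t - s)) / Re w) \<longlongrightarrow> 0) at_top" using w by real_asymp
 have nn: "(NN t. ennreal (exp (- Re w * (t - s))) * indicator {s..} t) = ennreal (0 - - exp (- Re w * (s - s)) / Re w)"
  by (rule nn_integral_FTC_atLeast[OF _ D _ lim]) auto
 have nn': "(NN t. ennreal (indicat_real {s..} t * exp (- Re w * (t - s)))) = ennreal (1 / Re w)"
 proof -
  have "(NN t. ennreal (indicat_real {s..} t * exp (- Re w * (t - s)))) = (NN t. ennreal (exp (- Re w * (t - s))) * indicator {s..} t)"
   by (intro nn_integral_cong) (auto simp: indicator_def)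
  then show ?thesis unfolding nn by simp
 qed
 have ir: "integrable lborel (\<lambda>t. indicat_real {s..} t * exp (- Re w * (t - s)))"
  by (rule integrableI_nonneg) (use nn' in \<open>auto simp: less_top\<close>)
 show "(LBINT t. indicat_real {s..} t * exp (- Re w * (t - s))) = 1 / Re w"
  by (rule integral_eq_nn_integral[THEN trans]) (use nn' w in auto)
 have n: "norm (indicat_real {s..} t *\<^sub>R exp (- w * of_real (t - s))) = indicat_real {s..} t * exp (- Re w * (t - s))" for t
  by (simp add: norm_exp_eq_Re)
 show i: "integrable lborel (\<lambda>t. indicat_real {s..} t *\<^sub>R exp (- w * of_real (t - s)))"
  by (rule Bochner_Integration.integrable_bound[OF ir]) (simp_all add: n)
 have w0: "w \<noteq> 0" using w by auto
 have D': "((\<lambda>t. - exp (- w * of_real (t - s)) / w) has_vector_derivative exp (- w * of_real (t - s))) (at t)" for t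
 proof -
  have "((\<lambda>t. - exp (- w * (t - of_real s)) / w) has_field_derivative exp (- w * (of_real t - of_real s))) (at (of_real t))"
   using w0 by (auto intro!: derivative_eq_intros)
  from has_vector_derivative_real_field[OF this] show ?thesis by simp
 qed
 have fin: "(LBINT t. indicator {s..s + real n} t *\<^sub>R exp (- w * of_real (t - s))) = - exp (- w * of_real (s + real n - s)) / w - - exp (- w * of_real (s - s)) / w" for n
  by (rule integral_FTC_Icc[OF _ has_vector_derivative_at_within[OF D']]) (auto intro!: continuous_intros)
 have "(\<lambda>n. LBINT t. indicat_real {s..s + real n} t *\<^sub>R exp (- w * of_real (t - s))) \<longlonglongrightarrow> (LBINT t. indicat_real {s..} t *\<^sub>R exp (- w * of_real (t - s)))"
 proof (rule integral_dominated_convergence[where w = "\<lambda>t. indicat_real {s..} t * exp (- Re w * (t - s))"])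
  show "AE t in lborel. (\<lambda>n. indicat_real {s..s + real n} t *\<^sub>R exp (- w * of_real (t - s))) \<longlonglongrightarrow> indicat_real {s..} t *\<^sub>R exp (- w * of_real (t - s))"
  proof (rule AE_I2, rule tendsto_eventually)
   fix t :: real
   obtain K where "t - s \<le> real K" using real_arch_simple by blast
   then show "\<forall>\<^sub>F n in sequentially. indicat_real {s..s + real n} t *\<^sub>R exp (- w * of_real (t - s)) = indicat_real {s..} t *\<^sub>R exp (- w * of_real (t - s))"
    by (intro eventually_mono[OF eventually_ge_at_top[of K]]) (auto simp: indicator_def)
  qed
  show "AE t in lborel. norm (indicat_real {s..s + real n} t *\<^sub>R exp (- w * of_real (t - s))) \<le> indicat_real {s..} t * exp (- Re w * (t - s))" for n
   by (rule AE_I2) (auto simp: indicator_def norm_exp_eq_Re)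
 qed (use ir in auto)
 moreover have "(\<lambda>n. - exp (- w * of_real (s + real n - s)) / w - - exp (- w * of_real (s - s)) / w) \<longlonglongrightarrow> 0 - - 1 / w"
 proof (intro tendsto_diff)
  show "(\<lambda>n. - exp (- w * of_real (s + real n - s)) / w) \<longlonglongrightarrow> 0"
  proof (rule Lim_null_comparison[OF always_eventually])
   show "\<forall>n. norm (- exp (- w * of_real (s + real n - s)) / w) \<le> exp (- Re w * real n) / norm w"
    by (auto simp: norm_divide norm_exp_eq_Re)
   have "(\<lambda>n. exp (- r * real n)) \<longlonglongrightarrow> 0" if "r > 0" for r :: real using that by real_asymp
   from tendsto_divide_zero[OF this[OF w]] show "(\<lambda>n. exp (- Re w * real n) / norm w) \<longlonglongrightarrow> 0" .
  qed
 qed simp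
 ultimately show "(LBINT t. indicat_real {s..} t *\<^sub>R exp (- w * of_real (t - s))) = 1 / w"
  unfolding fin using LIMSEQ_unique by fastforce
qed

definition memory_convolution :: "real \<Rightarrow> (real \<Rightarrow> complex) \<Rightarrow> real \<Rightarrow> complex" where
 "memory_convolution \<gamma> p t = (LBINT s. indicat_real {..t} s *\<^sub>R (of_real (exp (- \<gamma> * (t - s))) * ((1 / \<i>) * p s)))"

text \<open>
 The memory term is convolution with \<open>exp (- \<gamma> * t)\<close> on the half line, whose transform is \<open>1 / (\<gamma> - \<i> *
 z)\<close>.
\<close>
lemma memory_convolution_transform:
 assumes p: "causal c p" and z: "Im z > 0" and \<gamma>: "\<gamma> > 0"
 shows "memory_convolution \<gamma> p \<in> borel_fun"
  and "integrable lborel (\<lambda>t. memory_convolution \<gamma> p t * osc z t)"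
  and "fourier (memory_convolution \<gamma> p) z = (1 / \<i>) * fourier p z / (of_real \<gamma> - \<i> * z)"
  and "(LBINT t. norm (memory_convolution \<gamma> p t * osc z t)) \<le> (1 / (\<gamma> + Im z)) * (LBINT t. norm (p t) * exp (- Im z * t))"
proof -
 have pm [measurable]: "p \<in> borel_fun" using p by (simp add: causal_def)
 define h where "h s t = indicat_real {..t} s *\<^sub>R (of_real (exp (- \<gamma> * (t - s))) * ((1 / \<i>) * p s)) * osc z t" for s t
 define w where "w = of_real \<gamma> - \<i> * z"
 have w: "Re w > 0" "Re w = \<gamma> + Im z" using z \<gamma> by (simp_all add: w_def)
 have h_eq: "h s t = ((1 / \<i>) * p s * osc z s) * (indicat_real {s..} t *\<^sub>R exp (- w * of_real (t - s)))" for s t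
 proof -
  have e: "of_real (exp (- \<gamma> * (t - s))) * osc z t = osc z s * exp (- w * of_real (t - s))"
   unfolding exp_of_real[symmetric] mult_exp_exp by (rule arg_cong[of _ _ exp]) (simp add: w_def algebra_simps)
  have "indicat_real {..t} s = indicat_real {s..} t" by (simp add: indicator_def)
  then have "h s t = (1 / \<i>) * p s * (indicat_real {s..} t *\<^sub>R (of_real (exp (- \<gamma> * (t - s))) * osc z t))"
   by (simp add: h_def scaleR_conv_of_real mult_ac)
  then show ?thesis unfolding e by (simp add: scaleR_conv_of_real mult_ac)
 qed
 have nh: "norm (h s t) = norm (p s) * exp (- Im z * s) * (indicat_real {s..} t * exp (- Re w * (t - s)))" for s t
  unfolding h_eq by (simp add: norm_mult norm_divide norm_exp_i norm_exp_eq_Re)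
 have [measurable]: "(\<lambda>(s, t). h s t) \<in> borel_fun2"
 proof -
  have "(\<lambda>(s, t). h s t) = (\<lambda>q. of_real (if fst q \<le> snd q then 1 else 0) * (of_real (exp (- \<gamma> * (snd q - fst q))) * ((1 / \<i>) * p (fst q))) * exp (\<i> * z * of_real (snd q)))"
   by (auto simp: h_def fun_eq_iff indicator_def)
  also have "\<dots> \<in> borel_fun2" by measurable
  finally show ?thesis .
 qed
 have int: "integrable (lborel \<Otimes>\<^sub>M lborel) (\<lambda>(s, t). h s t)"
 proof (rule lborel_pair.Fubini_integrable)
  have "(\<lambda>s. LBINT t. norm (case (s, t) of (s, t) \<Rightarrow> h s t)) = (\<lambda>s. norm (p s) * exp (- Im z * s) * (1 / Re w))"
   using exp_half_line(3)[OF w(1)] by (simp add: nh)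
  then show "integrable lborel (\<lambda>s. LBINT t. norm (case (s, t) of (s, t) \<Rightarrow> h s t))"
   using causal_integrable_norm[OF p z] by simp
  show "AE s in lborel. integrable lborel (\<lambda>t. case (s, t) of (s, t) \<Rightarrow> h s t)"
   unfolding prod.case h_eq by (intro AE_I2 integrable_mult_right exp_half_line(1)[OF w(1)])
 qed measurable
 have m: "memory_convolution \<gamma> p t * osc z t = (LBINT s. h s t)" for t
  unfolding memory_convolution_def h_def by (rule integral_mult_left_zero[symmetric])
 show mm [measurable]: "memory_convolution \<gamma> p \<in> borel_fun"
 proof -
  have "memory_convolution \<gamma> p = (\<lambda>t. LBINT s. of_real (if s \<le> t then 1 else 0) * (of_real (exp (- \<gamma> * (t - s))) * ((1 / \<i>) * p s)))"
   unfolding memory_convolution_def[abs_def] by (intro ext Bochner_Integration.integral_cong refl) (simp add: indicator_def)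
  also have "\<dots> \<in> borel_fun" by measurable
  finally show ?thesis .
 qed
 show "integrable lborel (\<lambda>t. memory_convolution \<gamma> p t * osc z t)"
  using lborel_pair.integrable_snd[OF int] by (simp add: m)
 have "fourier (memory_convolution \<gamma> p) z = (LBINT t. LBINT s. h s t)"
  by (simp add: fourier_lborel mm m)
 also have "\<dots> = (LBINT s. LBINT t. h s t)" by (rule lborel_pair.Fubini_integral) (rule int)
 also have "\<dots> = (LBINT s. (p s * osc z s) * ((1 / \<i>) * (1 / w)))"
  unfolding h_eq integral_mult_right_zero exp_half_line(2)[OF w(1)] by (simp add: mult_ac)
 also have "\<dots> = fourier p z * ((1 / \<i>) * (1 / w))"
  unfolding fourier_lborel[OF pm] by (rule integral_mult_left_zero)
 finally show "fourier (memory_convolution \<gamma> p) z = (1 / \<i>) * fourier p z / (of_real \<gamma> - \<i> * z)"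
  by (simp add: w_def)
 have "(LBINT t. norm (memory_convolution \<gamma> p t * osc z t)) \<le> (LBINT t. LBINT s. norm (h s t))"
  unfolding m
 proof (rule integral_mono)
  have intn: "integrable (lborel \<Otimes>\<^sub>M lborel) (\<lambda>(s, t). norm (h s t))" using integrable_norm[OF int] by (simp only: case_prod_unfold)
  show "integrable lborel (\<lambda>t. norm (LBINT s. h s t))" using lborel_pair.integrable_snd[OF int] by (rule integrable_norm)
  show "integrable lborel (\<lambda>t. LBINT s. norm (h s t))" using lborel_pair.integrable_snd[OF intn] .
 qed (rule integral_norm_bound)
 also have "\<dots> = (LBINT s. LBINT t. norm (h s t))"
 proof (rule lborel_pair.Fubini_integral)
  show "integrable (lborel \<Otimes>\<^sub>M lborel) (\<lambda>(s, t). norm (h s t))" using integrable_norm[OF int] by (simp only: case_prod_unfold)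
 qed
 also have "\<dots> = (LBINT s. norm (p s) * exp (- Im z * s) * (1 / Re w))"
  using exp_half_line(3)[OF w(1)] by (simp add: nh)
 finally show "(LBINT t. norm (memory_convolution \<gamma> p t * osc z t)) \<le> (1 / (\<gamma> + Im z)) * (LBINT t. norm (p t) * exp (- Im z * t))"
  by (simp add: w(2))
qed

section \<open>The Laplace transform of the solution and the coefficient\<close>

context growing_curve
begin

lemma transform_bound:
 assumes "\<sigma> > 0"
 obtains C where "C \<ge> 0" "AE x in lborel. x \<in> {- M..M} \<longrightarrow> (\<forall>z. Im z = \<sigma> \<longrightarrow> norm (fourier (\<lambda>t. v1 (t, x)) z) \<le> C * weighted_norm x)"
  "AE x in lborel. x \<in> {- M..M} \<longrightarrow> (LBINT t. norm (v1 (t, x)) * exp (- \<sigma> * t)) \<le> C * weighted_norm x"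
proof (rule causal_Laplace_bound[OF assms, where c = "- M"])
 fix C
 assume C: "C \<ge> 0" "\<And>p z. causal (- M) p \<Longrightarrow> Im z = \<sigma> \<Longrightarrow> norm (fourier p z) \<le> C * (LBINT t. norm (p t) / wt t)"
  "\<And>p. causal (- M) p \<Longrightarrow> (LBINT t. norm (p t) * exp (- \<sigma> * t)) \<le> C * (LBINT t. norm (p t) / wt t)"
 show ?thesis
 proof (rule that[OF C(1)])
  show "AE x in lborel. x \<in> {- M..M} \<longrightarrow> (\<forall>z. Im z = \<sigma> \<longrightarrow> norm (fourier (\<lambda>t. v1 (t, x)) z) \<le> C * weighted_norm x)"
   using AE_causal by eventually_elim (use C(2) in \<open>simp add: weighted_norm_def\<close>)
  show "AE x in lborel. x \<in> {- M..M} \<longrightarrow> (LBINT t. norm (v1 (t, x)) * exp (- \<sigma> * t)) \<le> C * weighted_norm x"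
   using AE_causal by eventually_elim (use C(3) in \<open>simp add: weighted_norm_def\<close>)
 qed
qed

lemma transform_integrable:
 assumes "Im z > 0"
 shows "set_integrable lborel {- M..M} (\<lambda>x. fourier (\<lambda>t. v1 (t, x)) z)"
proof -
 obtain C where C: "C \<ge> 0" "AE x in lborel. x \<in> {- M..M} \<longrightarrow> (\<forall>w. Im w = Im z \<longrightarrow> norm (fourier (\<lambda>t. v1 (t, x)) w) \<le> C * weighted_norm x)"
  using transform_bound[OF assms] by blast
 show ?thesis unfolding set_integrable_def
 proof (rule Bochner_Integration.integrable_bound[OF integrable_mult_right[OF weighted_norm_integrable, of C]])
  show "AE x in lborel. norm (indicat_real {- M..M} x *\<^sub>R fourier (\<lambda>t. v1 (t, x)) z) \<le> norm (C * (indicat_real {- M..M} x * weighted_norm x))"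
   using C(2) by eventually_elim (use C(1) weighted_norm_nonneg in \<open>auto simp: indicator_def abs_mult\<close>)
  show "(\<lambda>x. indicat_real {- M..M} x *\<^sub>R fourier (\<lambda>t. v1 (t, x)) z) \<in> borel_measurable lborel"
   using transform_borel[of z] by measurable
 qed
qed

end

lemma continuous_eq_on_rationals:
 fixes f g :: "real \<Rightarrow> complex"
 assumes "continuous_on UNIV f" "continuous_on UNIV g" "\<And>r::rat. f (of_rat r) = g (of_rat r)"
 shows "f x = g x"
proof (rule ccontr)
 assume "f x \<noteq> g x"
 have "open {x. f x \<noteq> g x}" by (intro open_Collect_neq assms)
 with \<open>f x \<noteq> g x\<close> obtain e where e: "e > 0" "ball x e \<subseteq> {x. f x \<noteq> g x}" unfolding open_contains_ball by blast
 obtain r where "x < of_rat r" "of_rat r < x + e" using of_rat_dense[of x "x + e"] e(1) by auto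
 then have "of_rat r \<in> ball x e" by (simp add: dist_real_def)
 with e(2) assms(3)[of r] show False by blast
qed

lemma causal_line_continuous:
 assumes "causal c p" "\<sigma> > 0"
 shows "continuous_on UNIV (\<lambda>l. fourier p (Complex l \<sigma>))"
proof (rule continuous_on_compose2[OF holomorphic_on_imp_continuous_on[OF causal_fourier_holomorphic[OF assms(1)]]])
 show "continuous_on UNIV (\<lambda>l. Complex l \<sigma>)" by (simp add: Complex_eq continuous_intros)
qed (use assms(2) in auto)

lemma fourier_line_borel:
 assumes [measurable]: "q \<in> borel_fun"
 shows "(\<lambda>l. fourier q (Complex l \<sigma>)) \<in> borel_fun"
proof -
 have ex: "exp (\<i> * Complex l \<sigma> * of_real t) = of_real (exp (- \<sigma> * t)) * exp (\<i> * of_real t * of_real l)" for l t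
  unfolding exp_of_real[symmetric] mult_exp_exp by (rule arg_cong[of _ _ exp]) (simp add: complex_eq_iff)
 have "(\<lambda>l. fourier q (Complex l \<sigma>)) = (\<lambda>l. LBINT t. q t * (of_real (exp (- \<sigma> * t)) * exp (\<i> * of_real t * of_real l)))"
  by (intro ext) (simp only: fourier_lborel[OF assms] ex)
 also have "\<dots> \<in> borel_fun" by measurable
 finally show ?thesis .
qed

context wave_setting
begin

lemma past_u:
 assumes "M > 0" "t < - M"
 shows "AE x in lebesgue. x \<in> {- M..M} \<longrightarrow> u t x = 0"
proof -
 have "t < 0" using assms by simp
 from initial[OF this] show ?thesis
  by eventually_elim (use assms R in \<open>auto intro!: g_zero\<close>)
qed

lemma past_ut: "M > 0 \<Longrightarrow> t < - M \<Longrightarrow> AE x in lebesgue. x \<in> {- M..M} \<longrightarrow> ut t x = 0"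
 by (rule C1_curve_vanishing_past(2)[OF curve _ past_u]) auto

lemma growing:
 assumes M: "M > 0"
 obtains B where "growing_curve u u1 M B" "growing_curve ut ut1 M B"
proof -
 obtain B where B: "B \<ge> 0" "\<And>t. t \<ge> - M \<Longrightarrow> L2_norm (u t) \<le> B * (1 + \<bar>t\<bar>)" "\<And>t. t \<ge> - M \<Longrightarrow> L2_norm (ut t) \<le> B * (1 + \<bar>t\<bar>)"
  using linear_growth[of "- M"] by blast
 show ?thesis
  by (rule that[of B]; unfold_locales; (intro C1_curveD[OF curve] u1 ut1 M B past_u past_ut | assumption)+)
qed

definition U :: "real \<Rightarrow> complex \<Rightarrow> complex" where "U x z = fourier (\<lambda>t. u1 (t, x)) z"

definition Ut :: "real \<Rightarrow> complex \<Rightarrow> complex" where "Ut x z = fourier (\<lambda>t. ut1 (t, x)) z"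

text \<open>
 Integration by parts in time, tested in \<open>x\<close>; the boundary terms vanish because the growth is linear and the past is zero.
\<close>
lemma transform_relation:
 assumes M: "M > 0" and z: "Im z > 0"
 shows "AE x in lborel. x \<in> {- M<..<M} \<longrightarrow> Ut x z = - \<i> * z * U x z"
proof -
 obtain B where "growing_curve u u1 M B" "growing_curve ut ut1 M B" using growing[OF M] by blast
 then interpret gu: growing_curve u u1 M B + gt: growing_curve ut ut1 M B by auto
 have Ub: "(\<lambda>x. U x z) \<in> borel_fun" "(\<lambda>x. Ut x z) \<in> borel_fun"
  unfolding U_def Ut_def by (rule gu.transform_borel gt.transform_borel)+
 let ?f = "\<lambda>x. Ut x z + \<i> * z * U x z"
 have fb: "?f \<in> borel_fun" using Ub by measurable
 have "AE x in lebesgue. x \<in> {- M<..<M} \<longrightarrow> ?f x = 0"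
 proof (rule fundamental_lemma)
  fix a b :: real assume ab: "{a..b} \<subseteq> {- M<..<M}"
  have "set_integrable lborel {- M..M} (\<lambda>x. \<i> * z * U x z)"
   using gu.transform_integrable[OF z] unfolding U_def by (rule set_integrable_mult_right)
  then have "set_integrable lborel {- M..M} ?f"
   using gt.transform_integrable[OF z] unfolding Ut_def by (intro set_integral_add)
  then have "set_integrable lborel {a..b} ?f" by (rule set_integrable_subset) (use ab in auto)
  then show "set_integrable lebesgue {a..b} ?f"
   unfolding set_integrable_def by (subst integrable_completion) (use fb in measurable)
 next
  fix \<psi> :: "real \<Rightarrow> complex" assume \<psi>: "\<psi> \<in> \<D>" "supp \<psi> \<subseteq> {- M<..<M}"
  have \<psi>0: "supp \<psi> \<subseteq> {- M..M}" using \<psi>(2) by force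
  note Lu = gu.Laplace_pairing[OF \<psi>(1) \<psi>0 z] and Lt = gt.Laplace_pairing[OF \<psi>(1) \<psi>0 z]
  have d: "((\<lambda>t. pairing (u t) \<psi>) has_vector_derivative pairing (ut t) \<psi>) (at t)" for t
   using pairing_has_vector_derivative[OF curve C1_curve_const[OF test_L2[OF \<psi>(1)]], of t] by (simp add: pairing_def)
  have c: "continuous_on UNIV (\<lambda>t. pairing (ut t) \<psi>)"
   using C0_L2_pairing_continuous[OF C1_curveD(2)[OF curve] C1_curveD(1)[OF C1_curve_const[OF test_L2[OF \<psi>(1)]]]] .
  have "(LBINT t. pairing (ut t) \<psi> * osc z t) = - \<i> * z * (LBINT t. pairing (u t) \<psi> * osc z t)"
   by (rule fourier_deriv[OF d c Lu(1) Lt(1) Lu(4) Lu(5)])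
  then have "(LBINT x. Ut x z * \<psi> x) = - \<i> * z * (LBINT x. U x z * \<psi> x)"
   unfolding U_def Ut_def Lu(3) Lt(3) .
  moreover have "(LBINT x. ?f x * \<psi> x) = (LBINT x. Ut x z * \<psi> x) + \<i> * z * (LBINT x. U x z * \<psi> x)"
   using Lu(2) Lt(2) unfolding U_def[symmetric] Ut_def[symmetric] by (simp add: distrib_right mult.assoc)
  ultimately have "(LBINT x. ?f x * \<psi> x) = 0" by simp
  then show "(LINT x|lebesgue. ?f x * \<psi> x) = 0"
   by (subst integral_completion) (use fb test_borel[OF \<psi>(1)] in measurable)
 qed simp
 then show ?thesis unfolding AE_lebesgue by eventually_elim (auto simp: add_eq_0_iff)
qed

text \<open>
 The exceptional null set of \<open>x\<close> depends on \<open>z\<close>. Both sides are continuous along the line, so rational points of the line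
 suffice and one null set serves all \<open>z\<close>.
\<close>
lemma AE_transform_relation_line:
 assumes M: "M > 0" and \<sigma>: "\<sigma> > 0"
 shows "AE x in lborel. x \<in> {- M<..<M} \<longrightarrow> causal (- M) (\<lambda>t. u1 (t, x)) \<and> causal (- M) (\<lambda>t. ut1 (t, x)) \<and>
  (\<forall>z. Im z = \<sigma> \<longrightarrow> Ut x z = - \<i> * z * U x z)"
proof -
 obtain B where "growing_curve u u1 M B" "growing_curve ut ut1 M B" using growing[OF M] by blast
 then interpret gu: growing_curve u u1 M B + gt: growing_curve ut ut1 M B by auto
 have "AE x in lborel. \<forall>r::rat. x \<in> {- M<..<M} \<longrightarrow> Ut x (Complex (of_rat r) \<sigma>) = - \<i> * Complex (of_rat r) \<sigma> * U x (Complex (of_rat r) \<sigma>)"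
  unfolding AE_all_countable by (intro allI transform_relation M) (simp add: \<sigma>)
 with gu.AE_causal gt.AE_causal show ?thesis
 proof eventually_elim
  case (elim x)
  show ?case
  proof
   assume x: "x \<in> {- M<..<M}"
   with elim have c: "causal (- M) (\<lambda>t. u1 (t, x))" "causal (- M) (\<lambda>t. ut1 (t, x))" by auto
   have "Ut x (Complex l \<sigma>) = - \<i> * Complex l \<sigma> * U x (Complex l \<sigma>)" for l
   proof (rule continuous_eq_on_rationals[where f = "\<lambda>l. Ut x (Complex l \<sigma>)" and g = "\<lambda>l. - \<i> * Complex l \<sigma> * U x (Complex l \<sigma>)"])
    show "continuous_on UNIV (\<lambda>l. Ut x (Complex l \<sigma>))" unfolding Ut_def by (rule causal_line_continuous[OF c(2) \<sigma>])
    have "continuous_on UNIV (\<lambda>l. U x (Complex l \<sigma>))" unfolding U_def by (rule causal_line_continuous[OF c(1) \<sigma>])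
    then show "continuous_on UNIV (\<lambda>l. - \<i> * Complex l \<sigma> * U x (Complex l \<sigma>))"
     unfolding Complex_eq by (intro continuous_intros)
   qed (use elim x in blast)
   from this[of "Re z" for z] have "\<forall>z. Im z = \<sigma> \<longrightarrow> Ut x z = - \<i> * z * U x z" by (metis complex_surj)
   with c show "causal (- M) (\<lambda>t. u1 (t, x)) \<and> causal (- M) (\<lambda>t. ut1 (t, x)) \<and> (\<forall>z. Im z = \<sigma> \<longrightarrow> Ut x z = - \<i> * z * U x z)" by blast
  qed
 qed
qed

lemma a_regular:
 obtains C0 C2 where "C0 \<ge> 0" "C2 \<ge> 0" "AE x in lborel. a x \<in> \<D> \<and> (\<forall>t. (x, t) \<notin> {- R..R} \<times> {- T0..T0} \<longrightarrow> a x t = 0)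
  \<and> (\<forall>t. norm (a x t) \<le> C0) \<and> (\<forall>t. norm (ddx (ddx (a x)) t) \<le> C2)"
proof -
 have A: "AE x in lborel. a x \<in> \<D>" "\<And>n. \<exists>C. AE x in lborel. \<forall>t. norm ((ddx ^^ n) (a x) t) \<le> C"
  using a_smooth unfolding Linf_Cc_smooth_def AE_lebesgue by blast+
 obtain C0 where C0: "AE x in lborel. \<forall>t. norm ((ddx ^^ 0) (a x) t) \<le> C0" using A(2) by blast
 obtain C2 where C2: "AE x in lborel. \<forall>t. norm ((ddx ^^ 2) (a x) t) \<le> C2" using A(2) by blast
 show ?thesis
 proof (rule that[of "max C0 0" "max C2 0"])
  show "AE x in lborel. a x \<in> \<D> \<and> (\<forall>t. (x, t) \<notin> {- R..R} \<times> {- T0..T0} \<longrightarrow> a x t = 0)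
  \<and> (\<forall>t. norm (a x t) \<le> max C0 0) \<and> (\<forall>t. norm (ddx (ddx (a x)) t) \<le> max C2 0)"
   using A(1) a_supp[unfolded AE_lebesgue] C0 C2 by eventually_elim (auto simp: eval_nat_numeral le_max_iff_disj)
 qed simp_all
qed

lemma a_version:
 obtains a1 where "a1 \<in> borel_fun" "AE x in lborel. \<forall>t. a x t = a1 (x, t)"
proof (rule Caratheodory_version)
 show "(\<lambda>x. a x t) \<in> borel_measurable lebesgue" for t using a_smooth by (simp add: Linf_Cc_smooth_def)
 have "AE x in lborel. a x \<in> \<D>" using a_smooth by (simp add: Linf_Cc_smooth_def AE_lebesgue)
 then show "AE x in lborel. continuous_on UNIV (a x)"
  by eventually_elim (intro smooth_continuous test_functionsD)
qed (rule that)

end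

section \<open>The Laplace transform of the solution solves the stationary problem\<close>

lemma dir_deriv_mult_real:
 fixes f h :: "real \<Rightarrow> complex"
 assumes "smooth f" "smooth h"
 shows "ddx (\<lambda>t. f t * h t) = (\<lambda>t. f t * ddx h t + ddx f t * h t)"
 by (intro ext dir_deriv_1_eq has_vector_derivative_mult smooth_has_vector_derivative assms)

lemma dir_deriv_exp: "ddx (\<lambda>t. osc z t) = (\<lambda>t. \<i> * z * osc z t)"
 by (intro ext dir_deriv_1_eq exp_i_has_vector_derivative)

lemma fourier_zero: "fourier (\<lambda>_. 0) z = 0"
 by (simp add: fourier_def)

locale wave_version = wave_setting +
 fixes a1 :: "real \<times> real \<Rightarrow> complex"
 assumes a1: "a1 \<in> borel_fun" and a1_eq: "AE x in lborel. \<forall>t. a x t = a1 (x, t)"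
begin

lemma a1_borel [measurable]: "a1 \<in> borel_fun2"
 using a1 by (simp add: borel_prod)

lemma ut1_borel [measurable]: "ut1 \<in> borel_fun2"
 using joint_versionD(1)[OF ut1] by (simp add: borel_prod)

lemma memory_version:
 "AE x in lborel. \<forall>t. memory \<gamma> (\<lambda>t' x'. (1 / \<i>) * ut t' x') t x = memory_convolution \<gamma> (\<lambda>s. ut1 (s, x)) t"
 using joint_versionD(3)[OF ut1]
proof eventually_elim
 case (elim x)
 show ?case
 proof
  fix t
  have "(\<lambda>s. indicat_real {..t} s *\<^sub>R (of_real (exp (- \<gamma> * (t - s))) * ((1 / \<i>) * ut1 (s, x)))) \<in> borel_fun" by measurable
  moreover have "AE s in lborel. indicat_real {..t} s *\<^sub>R (of_real (exp (- \<gamma> * (t - s))) * ((1 / \<i>) * ut s x))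
    = indicat_real {..t} s *\<^sub>R (of_real (exp (- \<gamma> * (t - s))) * ((1 / \<i>) * ut1 (s, x)))"
   using elim by eventually_elim simp
  ultimately show "memory \<gamma> (\<lambda>t' x'. (1 / \<i>) * ut t' x') t x = memory_convolution \<gamma> (\<lambda>s. ut1 (s, x)) t"
   unfolding memory_def memory_convolution_def set_lebesgue_integral_def by (rule LINT_version(3))
 qed
qed

definition S1 :: "real \<times> real \<Rightarrow> complex" where
 "S1 p = a1 (snd p, fst p) * memory_convolution \<gamma> (\<lambda>s. ut1 (s, snd p)) (fst p)"

lemma S1_borel [measurable]: "S1 \<in> borel_fun2"
proof -
 have "(\<lambda>p. memory_convolution \<gamma> (\<lambda>s. ut1 (s, snd p)) (fst p)) =
  (\<lambda>p. LBINT s. of_real (if s \<le> fst p then 1 else 0) * (of_real (exp (- \<gamma> * (fst p - s))) * ((1 / \<i>) * ut1 (s, snd p))))"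
  unfolding memory_convolution_def by (intro ext Bochner_Integration.integral_cong refl) (simp add: indicator_def)
 also have "\<dots> \<in> borel_fun2" by measurable
 finally have [measurable]: "(\<lambda>p. memory_convolution \<gamma> (\<lambda>s. ut1 (s, snd p)) (fst p)) \<in> borel_fun2" .
 show ?thesis unfolding S1_def[abs_def] by measurable
qed

definition S_hat :: "real \<Rightarrow> complex \<Rightarrow> complex" where
 "S_hat x z = (LBINT t. S1 (t, x) * osc z t)"

text \<open>
 By \<open>memory_convolution_transform\<close> and \<open>transform_relation\<close> the memory term has transform \<open>- \<i> * z / (z + \<i> *
 \<gamma>) * U x z\<close>, and by \<open>Laplace_product\<close> multiplication with \<open>a x\<close> becomes the convolution in the definition of
 \<open>A_op\<close>.
\<close>
lemma A_transform:
 assumes \<sigma>: "\<sigma> > 0"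
 shows "AE x in lborel. \<forall>z. Im z = \<sigma> \<longrightarrow> A_op a \<gamma> U x z = S_hat x z"
proof -
 have M: "R + 1 > 0" using R by simp
 obtain C0 C2 where reg: "AE x in lborel. a x \<in> \<D> \<and> (\<forall>t. (x, t) \<notin> {- R..R} \<times> {- T0..T0} \<longrightarrow> a x t = 0)
  \<and> (\<forall>t. norm (a x t) \<le> C0) \<and> (\<forall>t. norm (ddx (ddx (a x)) t) \<le> C2)"
  by (rule a_regular) (rule that)
 from reg AE_transform_relation_line[OF M \<sigma>] a1_eq show ?thesis
 proof eventually_elim
  case (elim x)
  show ?case
  proof (cases "x \<in> {- R..R}")
   case False
   then have "a x = (\<lambda>_. 0)" using elim(1) by (auto simp: fun_eq_iff)
   moreover from this have "S1 (t, x) = 0" for t using elim(3) by (simp add: S1_def fun_eq_iff)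
   ultimately show ?thesis by (simp add: A_op_def a_D_omega_def fourier_zero S_hat_def)
  next
   case True
   then have c: "causal (- (R + 1)) (\<lambda>t. u1 (t, x))" "causal (- (R + 1)) (\<lambda>t. ut1 (t, x))"
    and rel: "\<And>z. Im z = \<sigma> \<Longrightarrow> Ut x z = - \<i> * z * U x z" using elim(2) by auto
   have at: "a x \<in> \<D>" using elim by blast
   define q where "q = memory_convolution \<gamma> (\<lambda>s. ut1 (s, x))"
   show ?thesis
   proof (intro allI impI)
    fix z assume z: "Im z = \<sigma>"
    then have z0: "Im z > 0" using \<sigma> by simp
    note mc = memory_convolution_transform[OF c(2) z0 \<gamma>]
    have qm: "q \<in> borel_fun" unfolding q_def by (rule mc(1))
    have V: "fourier q w = - \<i> * (w / (w + \<i> * of_real \<gamma>) * U x w)" if w: "Im w = \<sigma>" for w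
    proof -
     have w0: "Im w > 0" using w \<sigma> by simp
     have n1: "w + \<i> * of_real \<gamma> \<noteq> 0" using w0 \<gamma> by (auto simp: complex_eq_iff)
     have ratio: "(1 / \<i>) * (- \<i> * w * v) / (- \<i> * d) = - \<i> * (w / d * v)" if "d \<noteq> 0" for v d :: complex
      using that by (simp add: field_simps)
     have n2: "of_real \<gamma> - \<i> * w = - \<i> * (w + \<i> * of_real \<gamma>)" by (simp add: algebra_simps)
     have "fourier q w = (1 / \<i>) * Ut x w / (of_real \<gamma> - \<i> * w)"
      unfolding q_def Ut_def by (rule memory_convolution_transform(3)[OF c(2) w0 \<gamma>])
     also have "\<dots> = - \<i> * (w / (w + \<i> * of_real \<gamma>) * U x w)"
      unfolding rel[OF w] n2 by (rule ratio[OF n1])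
     finally show ?thesis .
    qed
    have "A_op a \<gamma> U x z = 1 / (2 * of_real pi) * (- \<i> * (LINT l|lebesgue. fourier (a x) (of_real (Re z - l)) * (Complex l (Im z) / (Complex l (Im z) + \<i> * of_real \<gamma>) * U x (Complex l (Im z)))))"
     by (simp add: A_op_def a_D_omega_def)
    also have "- \<i> * (LINT l|lebesgue. fourier (a x) (of_real (Re z - l)) * (Complex l (Im z) / (Complex l (Im z) + \<i> * of_real \<gamma>) * U x (Complex l (Im z))))
     = (LINT l|lebesgue. - \<i> * (fourier (a x) (of_real (Re z - l)) * (Complex l (Im z) / (Complex l (Im z) + \<i> * of_real \<gamma>) * U x (Complex l (Im z)))))"
     by (rule integral_mult_right_zero[symmetric])
    also have "\<dots> = (LINT l|lebesgue. fourier (a x) (of_real (Re z - l)) * fourier q (Complex l (Im z)))"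
     using V z by (intro Bochner_Integration.integral_cong refl) (simp add: mult_ac)
    also have "\<dots> = (LBINT l. fourier (a x) (of_real (Re z - l)) * fourier q (Complex l (Im z)))"
    proof (rule integral_completion)
     have [measurable]: "(\<lambda>s. fourier (a x) (of_real s)) \<in> borel_fun" using fourier_test_integrable[OF at] by auto
     have [measurable]: "(\<lambda>l. fourier q (Complex l (Im z))) \<in> borel_fun" by (rule fourier_line_borel[OF qm])
     have "(\<lambda>l. fourier (a x) (of_real (Re z - l))) \<in> borel_fun"
      by (rule measurable_compose[of "\<lambda>l. Re z - l" borel borel "\<lambda>s. fourier (a x) (of_real s)"]) measurable
     then show "(\<lambda>l. fourier (a x) (of_real (Re z - l)) * fourier q (Complex l (Im z))) \<in> borel_measurable lborel" by measurable
    qed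
    also have "\<dots> = of_real (2 * pi) * (LBINT t. a x t * q t * osc z t)"
     by (rule Laplace_product[OF at qm]) (use mc(2) in \<open>simp add: q_def\<close>)
    finally have "A_op a \<gamma> U x z = (LBINT t. a x t * q t * osc z t)" by simp
    then show "A_op a \<gamma> U x z = S_hat x z" using elim(3) by (simp add: S_hat_def S1_def q_def)
   qed
  qed
 qed
qed

lemma source_integrable:
 assumes \<psi>: "\<psi> \<in> \<D>" and z: "Im z > 0"
 shows "integrable (lborel \<Otimes>\<^sub>M lborel) (\<lambda>(x, t). S1 (t, x) * osc z t * \<psi> x)"
proof -
 obtain M0 where M0: "M0 > 0" "supp \<psi> \<subseteq> {- M0..M0}" using test_function_support[OF \<psi>] by metis
 obtain Cp where Cp: "Cp \<ge> 0" "\<And>x. norm (\<psi> x) \<le> Cp" using continuous_compact_supp_bounded[OF \<psi>] by metis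
 define M where "M = M0 + R + 1"
 have M: "M > 0" using M0 R by (simp add: M_def)
 obtain B where "growing_curve u u1 M B" "growing_curve ut ut1 M B" using growing[OF M] by blast
 then interpret gt: growing_curve ut ut1 M B by auto
 have [measurable]: "\<psi> \<in> borel_fun" by (rule test_borel[OF \<psi>])
 obtain C0 C2 where reg: "C0 \<ge> 0" "AE x in lborel. a x \<in> \<D> \<and> (\<forall>t. (x, t) \<notin> {- R..R} \<times> {- T0..T0} \<longrightarrow> a x t = 0)
  \<and> (\<forall>t. norm (a x t) \<le> C0) \<and> (\<forall>t. norm (ddx (ddx (a x)) t) \<le> C2)"
  by (rule a_regular) (rule that)
 obtain C where C: "C \<ge> 0" "AE x in lborel. x \<in> {- M..M} \<longrightarrow> (LBINT t. norm (ut1 (t, x)) * exp (- Im z * t)) \<le> C * gt.weighted_norm x"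
  by (rule gt.transform_bound[OF z]) blast
 define K where "K = C0 * (1 / (\<gamma> + Im z)) * C * Cp"
 have bound: "AE x in lborel. integrable lborel (\<lambda>t. S1 (t, x) * osc z t * \<psi> x) \<and>
   (LBINT t. norm (S1 (t, x) * osc z t * \<psi> x)) \<le> K * (indicat_real {- M..M} x * gt.weighted_norm x)"
  using reg(2) a1_eq gt.AE_causal C(2)
 proof eventually_elim
  case (elim x)
  show ?case
  proof (cases "x \<in> {- M..M}")
   case False
   then have "\<psi> x = 0" using M0(2) R in_supp[of \<psi> x] by (force simp: M_def)
   then show ?thesis using False by simp
  next
   case True
   let ?q = "memory_convolution \<gamma> (\<lambda>s. ut1 (s, x))"
   have c: "causal (- M) (\<lambda>t. ut1 (t, x))" using elim True by blast
   note mc = memory_convolution_transform[OF c z \<gamma>]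
   have [measurable]: "?q \<in> borel_fun" by (rule mc(1))
   have nb: "norm (S1 (t, x) * osc z t * \<psi> x) \<le> (C0 * Cp) * norm (?q t * osc z t)" for t
   proof -
    have a: "norm (a1 (x, t)) \<le> C0" using elim(1,2) by metis
    have "norm (S1 (t, x) * osc z t * \<psi> x) = (norm (a1 (x, t)) * norm (\<psi> x)) * norm (?q t * osc z t)"
     by (simp add: S1_def norm_mult mult_ac)
    also have "\<dots> \<le> (C0 * Cp) * norm (?q t * osc z t)"
     by (intro mult_right_mono mult_mono a Cp reg) auto
    finally show ?thesis .
   qed
   have qi: "integrable lborel (\<lambda>t. (C0 * Cp) * norm (?q t * osc z t))"
    by (intro integrable_mult_right integrable_norm mc(2))
   have i: "integrable lborel (\<lambda>t. S1 (t, x) * osc z t * \<psi> x)"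
    by (rule Bochner_Integration.integrable_bound[OF qi], measurable) (use nb reg(1) Cp(1) in \<open>auto simp: abs_mult intro!: AE_I2 order_trans[OF nb]\<close>)
   have "(LBINT t. norm (S1 (t, x) * osc z t * \<psi> x)) \<le> (LBINT t. (C0 * Cp) * norm (?q t * osc z t))"
    by (rule integral_mono[OF integrable_norm[OF i] qi nb])
   also have "\<dots> = (C0 * Cp) * (LBINT t. norm (?q t * osc z t))" by (rule integral_mult_right_zero)
   also have "\<dots> \<le> (C0 * Cp) * ((1 / (\<gamma> + Im z)) * (LBINT t. norm (ut1 (t, x)) * exp (- Im z * t)))"
    by (intro mult_left_mono mc(4) mult_nonneg_nonneg reg Cp)
   also have "\<dots> \<le> (C0 * Cp) * ((1 / (\<gamma> + Im z)) * (C * gt.weighted_norm x))"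
    using elim(4) True \<gamma> z by (intro mult_left_mono mult_nonneg_nonneg reg Cp) auto
   also have "\<dots> = K * (indicat_real {- M..M} x * gt.weighted_norm x)" using True by (simp add: K_def mult_ac)
   finally show ?thesis using i by blast
  qed
 qed
 have m [measurable]: "(\<lambda>(x, t). S1 (t, x) * osc z t * \<psi> x) \<in> borel_measurable (lborel \<Otimes>\<^sub>M lborel)" by measurable
 show ?thesis
 proof (rule lborel_pair.Fubini_integrable[OF m])
  show "AE x in lborel. integrable lborel (\<lambda>t. case (x, t) of (x, t) \<Rightarrow> S1 (t, x) * osc z t * \<psi> x)"
   using bound by eventually_elim simp
  show "integrable lborel (\<lambda>x. LBINT t. norm (case (x, t) of (x, t) \<Rightarrow> S1 (t, x) * osc z t * \<psi> x))"
  proof (rule Bochner_Integration.integrable_bound[OF integrable_mult_right[OF gt.weighted_norm_integrable, of K]])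
   show "AE x in lborel. norm (LBINT t. norm (case (x, t) of (x, t) \<Rightarrow> S1 (t, x) * osc z t * \<psi> x)) \<le> norm (K * (indicat_real {- M..M} x * gt.weighted_norm x))"
    using bound
   proof eventually_elim
    case (elim x)
    have "norm (LBINT t. norm (S1 (t, x) * osc z t * \<psi> x)) = (LBINT t. norm (S1 (t, x) * osc z t * \<psi> x))" by simp
    also have "\<dots> \<le> K * (indicat_real {- M..M} x * gt.weighted_norm x)" using elim by blast
    also note abs_ge_self
    finally show ?case by simp
   qed
  qed measurable
 qed
qed

lemma weak_product:
 assumes \<eta>: "\<eta> \<in> \<D>" and \<psi>: "\<psi> \<in> \<D>"
 shows "- (LBINT t. ddx (ddx \<eta>) t * pairing (u t) \<psi>) - (LBINT t. \<eta> t * (LBINT x. S1 (t, x) * \<psi> x))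
  + (LBINT t. \<eta> t * pairing (u t) (ddx (ddx \<psi>))) = 0"
proof -
 let ?d\<eta> = "ddx (ddx \<eta>)" and ?d\<psi> = "ddx (ddx \<psi>)"
 note V = C1_curveD[OF curve]
 have t: "?d\<eta> \<in> \<D>" "?d\<psi> \<in> \<D>" by (intro test_dir_deriv \<eta> \<psi>)+
 have sm: "smooth \<eta>" "smooth \<psi>" using \<eta> \<psi> test_functionsD by auto
 note F1 = Fubini_char_test[OF V(1) u1 t(1) \<psi>, of 0] and F2 = Fubini_char_test[OF V(1) u1 \<eta> t(2), of 0]
 have [measurable]: "\<eta> \<in> borel_fun" "\<psi> \<in> borel_fun" by (intro test_borel \<eta> \<psi>)+
 (* source_integrable is applied at z = \<i>, and the factor exp (- t) is absorbed into the test function *)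
 let ?e = "\<lambda>t. exp (\<i> * \<i> * of_real t)"
 have Si: "integrable lborel (\<lambda>p. S1 p * char_test 0 \<eta> \<psi> p)"
 proof -
  have "integrable (lborel \<Otimes>\<^sub>M lborel) (\<lambda>(t, x). case (x, t) of (x, t) \<Rightarrow> S1 (t, x) * ?e t * \<psi> x)"
   using lborel_pair.integrable_product_swap[OF source_integrable[OF \<psi>, of \<i>]] by (simp add: case_prod_unfold)
  then have i: "integrable lborel (\<lambda>p. S1 p * ?e (fst p) * \<psi> (snd p))" by (simp add: lborel_prod case_prod_unfold)
  define \<theta> where "\<theta> t = exp (- (\<i> * \<i>) * of_real t) * \<eta> t" for t
  have \<theta>: "\<theta> \<in> \<D>" unfolding \<theta>_def[abs_def] by (rule test_mult[OF \<eta> smooth_exp])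
  obtain C where C: "C \<ge> 0" "\<And>t. norm (\<theta> t) \<le> C" using continuous_compact_supp_bounded[OF \<theta>] by metis
  have e: "S1 p * char_test 0 \<eta> \<psi> p = \<theta> (fst p) * (S1 p * ?e (fst p) * \<psi> (snd p))" for p
  proof -
   have "exp (- (\<i> * \<i>) * of_real (fst p)) * ?e (fst p) = 1" unfolding mult_exp_exp by simp
   then have "\<theta> (fst p) * ?e (fst p) = \<eta> (fst p)" by (simp add: \<theta>_def mult_ac)
   then have "\<theta> (fst p) * (S1 p * ?e (fst p) * \<psi> (snd p)) = S1 p * (\<eta> (fst p) * \<psi> (snd p))" by (metis mult.assoc mult.commute)
   from this[symmetric] show ?thesis by (simp only: mult_zero_left add_0_right)
  qed
  show ?thesis unfolding e
  proof (rule Bochner_Integration.integrable_bound[OF integrable_mult_right[OF integrable_norm[OF i], of C]])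
   have "(\<lambda>p. \<theta> (fst p) * (S1 p * ?e (fst p) * \<psi> (snd p))) \<in> borel_fun2"
    unfolding e[symmetric] by measurable
   then show "(\<lambda>p. \<theta> (fst p) * (S1 p * ?e (fst p) * \<psi> (snd p))) \<in> borel_measurable lborel" by (simp add: borel_prod)
   show "AE p in lborel. norm (\<theta> (fst p) * (S1 p * ?e (fst p) * \<psi> (snd p))) \<le> norm (C * norm (S1 p * ?e (fst p) * \<psi> (snd p)))"
   proof (rule AE_I2)
    fix p
    have "norm (\<theta> (fst p) * (S1 p * ?e (fst p) * \<psi> (snd p))) \<le> C * norm (S1 p * ?e (fst p) * \<psi> (snd p))"
     unfolding norm_mult[of "\<theta> (fst p)"] by (rule mult_right_mono[OF C(2)]) simp
    also note abs_ge_self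
    finally show "norm (\<theta> (fst p) * (S1 p * ?e (fst p) * \<psi> (snd p))) \<le> norm (C * norm (S1 p * ?e (fst p) * \<psi> (snd p)))" unfolding real_norm_def .
   qed
  qed
 qed
 have SF: "(LBINT p. S1 p * char_test 0 \<eta> \<psi> p) = (LBINT t. \<eta> t * (LBINT x. S1 (t, x) * \<psi> x))"
 proof -
  have "(LBINT p. S1 p * char_test 0 \<eta> \<psi> p) = (LBINT t. LBINT x. S1 (t, x) * char_test 0 \<eta> \<psi> (t, x))"
   using lborel_pair.integral_fst'[of "\<lambda>p. S1 p * char_test 0 \<eta> \<psi> p"] Si by (simp add: lborel_prod)
  also have "\<dots> = (LBINT t. LBINT x. \<eta> t * (S1 (t, x) * \<psi> x))" by (simp add: mult_ac)
  also have "\<dots> = (LBINT t. \<eta> t * (LBINT x. S1 (t, x) * \<psi> x))" by (simp only: integral_mult_right_zero)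
  finally show ?thesis .
 qed
 let ?G = "\<lambda>p. - (u1 p * char_test 0 ?d\<eta> \<psi> p) - S1 p * char_test 0 \<eta> \<psi> p + u1 p * char_test 0 \<eta> ?d\<psi> p"
 let ?F = "\<lambda>p. case p of (t, x) \<Rightarrow>
        u t x * D (1, 0) (D (1, 0) (char_test 0 \<eta> \<psi>)) (t, x)
       - a x t * memory \<gamma> (\<lambda>t' x'. (1 / \<i>) * ut t' x') t x * char_test 0 \<eta> \<psi> (t, x)
       - u t x * D (0, 1) (D (0, 1) (char_test 0 \<eta> \<psi>)) (t, x)"
 have "AE p in lborel. u (fst p) (snd p) = u1 p" using u1 by (simp add: joint_version_def)
 with AE_lborel_snd[OF a1_eq] AE_lborel_snd[OF memory_version] have ae: "AE p in lborel. ?F p = ?G p"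
 proof eventually_elim
  case (elim p)
  obtain t x where p: "p = (t, x)" by (cases p)
  have "a x t * memory \<gamma> (\<lambda>t' x'. (1 / \<i>) * ut t' x') t x = S1 (t, x)" using elim by (simp add: p S1_def)
  then show ?case using elim(3) by (simp add: p char_test_second_derivs[OF sm, of 0, simplified])
 qed
 have gm: "?G \<in> borel_fun"
  using F1(1) F2(1) Si by (auto dest!: borel_measurable_integrable)
 have "0 = (LINT p|lebesgue. ?F p)" using weak[OF char_test_test_functions[OF \<eta> \<psi>, of 0]] by simp
 also have "\<dots> = (LBINT p. ?G p)" by (rule LINT_version(3)[OF gm ae])
 also have "\<dots> = - (LBINT p. u1 p * char_test 0 ?d\<eta> \<psi> p) - (LBINT p. S1 p * char_test 0 \<eta> \<psi> p) + (LBINT p. u1 p * char_test 0 \<eta> ?d\<psi> p)"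
  using F1(1) F2(1) Si by (subst Bochner_Integration.integral_add) (auto simp del: mult_zero_left)
 finally show ?thesis unfolding F1(2) F2(2) SF by simp
qed

text \<open>
 The weak equation holds for \<open>\<eta> t * \<psi> x\<close> with \<open>\<eta>\<close> a test function. Cutting off \<open>exp (\<i> * z *
 t)\<close> and passing to the limit, which the decay for \<open>Im z > 0\<close> allows, gives the equation for the transforms.
\<close>
lemma stationary_weak:
 assumes \<psi>: "\<psi> \<in> \<D>" and z: "Im z > 0"
 shows "integrable lborel (\<lambda>x. U x z * \<psi> x)" "integrable lborel (\<lambda>x. S_hat x z * \<psi> x)"
  and "z\<^sup>2 * (LBINT x. U x z * \<psi> x) - (LBINT x. S_hat x z * \<psi> x) + (LBINT x. U x z * ddx (ddx \<psi>) x) = 0"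
proof -
 let ?d\<psi> = "ddx (ddx \<psi>)"
 have d\<psi>: "?d\<psi> \<in> \<D>" by (intro test_dir_deriv \<psi>)
 obtain M where M: "M > 0" "supp \<psi> \<subseteq> {- M..M}" using test_function_support[OF \<psi>] by metis
 have M': "supp ?d\<psi> \<subseteq> {- M..M}"
 proof (rule supp_subset)
  fix x assume "?d\<psi> x \<noteq> 0"
  then have "x \<in> supp (ddx \<psi>)" by (rule dir_deriv_in_supp)
  moreover have "supp (ddx \<psi>) \<subseteq> {- M..M}" by (rule supp_subset) (use subsetD[OF M(2) dir_deriv_in_supp[of \<psi>]] in auto)
  ultimately show "x \<in> {- M..M}" by blast
 qed simp
 obtain B where "growing_curve u u1 M B" using growing[OF M(1)] by blast
 then interpret gu: growing_curve u u1 M B .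
 define P where "P t = pairing (u t) \<psi> * osc z t" for t
 define Q where "Q t = pairing (u t) ?d\<psi> * osc z t" for t
 define s where "s t = (LBINT x. S1 (t, x) * \<psi> x) * osc z t" for t
 note Lu = gu.Laplace_pairing[OF \<psi> M(2) z] and Ld = gu.Laplace_pairing[OF d\<psi> M' z]
 have Pi: "integrable lborel P" and Qi: "integrable lborel Q" using Lu(1) Ld(1) by (simp_all add: P_def[abs_def] Q_def[abs_def])
 have PU: "(LBINT t. P t) = (LBINT x. U x z * \<psi> x)" "(LBINT t. Q t) = (LBINT x. U x z * ?d\<psi> x)"
  using Lu(3) Ld(3) by (simp_all add: P_def Q_def U_def)
 show "integrable lborel (\<lambda>x. U x z * \<psi> x)" using Lu(2) by (simp add: U_def)
 note Sint = source_integrable[OF \<psi> z]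
 have s_eq: "s t = (LBINT x. S1 (t, x) * osc z t * \<psi> x)" for t
  unfolding s_def integral_mult_left_zero[symmetric] by (intro Bochner_Integration.integral_cong refl) (simp add: mult_ac)
 have si: "integrable lborel s"
  using lborel_pair.integrable_snd[OF Sint] unfolding s_eq[abs_def] .
 have inner: "(LBINT t. S1 (t, x) * osc z t * \<psi> x) = S_hat x z * \<psi> x" for x
  unfolding S_hat_def by (rule integral_mult_left_zero)
 show "integrable lborel (\<lambda>x. S_hat x z * \<psi> x)"
  using lborel_pair.integrable_fst'[OF Sint] by (simp only: prod.case inner)
 have sS: "(LBINT t. s t) = (LBINT x. S_hat x z * \<psi> x)"
 proof -
  have "(LBINT x. S_hat x z * \<psi> x) = (LBINT x. LBINT t. S1 (t, x) * osc z t * \<psi> x)" by (simp only: inner)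
  also have "\<dots> = (LBINT t. LBINT x. S1 (t, x) * osc z t * \<psi> x)"
   by (rule lborel_pair.Fubini_integral[symmetric]) (rule Sint)
  also have "\<dots> = (LBINT t. s t)"
   by (simp only: s_eq)
  finally show ?thesis ..
 qed
 define \<theta> where "\<theta> = bump 1 (- 2) 2"
 have \<theta>t: "\<theta> \<in> \<D>" unfolding \<theta>_def by (rule bump_test) simp
 have \<theta>1: "\<theta> y = 1" if "\<bar>y\<bar> \<le> 1" for y using that by (auto simp: \<theta>_def bump_def smooth_step_1)
 let ?d = "ddx \<theta>" and ?dd = "ddx (ddx \<theta>)"
 obtain K1 where K1: "\<And>x. norm (?d x) \<le> K1" using continuous_compact_supp_bounded[OF test_dir_deriv[OF \<theta>t]] by metis
 obtain K2 where K2: "\<And>x. norm (?dd x) \<le> K2" using continuous_compact_supp_bounded[OF test_dir_deriv[OF test_dir_deriv[OF \<theta>t]]] by metis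
 have K0: "norm (\<theta> x) \<le> 1" for x unfolding \<theta>_def by (rule norm_bump)
 have [measurable]: "\<theta> \<in> borel_fun" "?d \<in> borel_fun" "?dd \<in> borel_fun"
  by (intro test_borel test_dir_deriv \<theta>t)+
 define k where "k n = 1 / real (Suc n)" for n
 have k: "0 < k n" "k n \<le> 1" for n by (auto simp: k_def)
 have klim: "k \<longlonglongrightarrow> 0" unfolding k_def[abs_def] using LIMSEQ_inverse_real_of_nat by (simp add: inverse_eq_divide)
 define A where "A n t = of_real (k n ^ 2) * ?dd (k n * t) + 2 * \<i> * z * (of_real (k n) * ?d (k n * t)) - z\<^sup>2 * \<theta> (k n * t)" for n t
 have Am [measurable]: "A n \<in> borel_fun" for n unfolding A_def[abs_def] by measurable
 have Ab: "norm (A n t) \<le> K2 + 2 * norm z * K1 + (norm z)\<^sup>2" for n t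
 proof -
  have K10: "K1 \<ge> 0" and K20: "K2 \<ge> 0" using K1 K2 norm_ge_zero order_trans by blast+
  have "norm (A n t) \<le> norm (of_real (k n ^ 2) * ?dd (k n * t)) + norm (2 * \<i> * z * (of_real (k n) * ?d (k n * t))) + norm (z\<^sup>2 * \<theta> (k n * t))"
   unfolding A_def by (rule order_trans[OF norm_triangle_ineq4 add_right_mono[OF norm_triangle_ineq]])
  also have "norm (of_real (k n ^ 2) * ?dd (k n * t)) \<le> 1 * K2"
   unfolding norm_mult using k[of n] by (intro mult_mono K2) (auto simp: power_le_one norm_power)
  also have "norm (2 * \<i> * z * (of_real (k n) * ?d (k n * t))) \<le> 2 * norm z * (1 * K1)"
   unfolding norm_mult using k[of n] K10 by (intro mult_mono K1) auto
  also have "norm (z\<^sup>2 * \<theta> (k n * t)) \<le> (norm z)\<^sup>2 * 1"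
   unfolding norm_mult norm_power by (intro mult_left_mono K0) auto
  finally show ?thesis by simp
 qed
 have Alim: "(\<lambda>n. A n t) \<longlonglongrightarrow> - z\<^sup>2" for t
 proof -
  have b0: "(\<lambda>n. of_real (k n) * h (k n * t)) \<longlonglongrightarrow> 0" if "\<And>x. norm (h x) \<le> C" for h :: "real \<Rightarrow> complex" and C
  proof (rule Lim_null_comparison[OF always_eventually])
   show "\<forall>n. norm (of_real (k n) * h (k n * t)) \<le> k n * C"
    using that k by (simp add: norm_mult abs_of_pos mult_left_mono less_imp_le)
   show "(\<lambda>n. k n * C) \<longlonglongrightarrow> 0" using tendsto_mult_left_zero[OF klim] .
  qed
  have 1: "(\<lambda>n. of_real (k n ^ 2) * ?dd (k n * t)) \<longlonglongrightarrow> 0"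
   using tendsto_mult[OF tendsto_of_real[OF klim] b0[OF K2]] by (simp add: power2_eq_square mult.assoc)
  have 2: "(\<lambda>n. 2 * \<i> * z * (of_real (k n) * ?d (k n * t))) \<longlonglongrightarrow> 0"
   using tendsto_mult_right_zero[OF b0[OF K1]] .
  have 3: "(\<lambda>n. \<theta> (k n * t)) \<longlonglongrightarrow> 1"
  proof (rule tendsto_eventually)
   have "(\<lambda>n. k n * t) \<longlonglongrightarrow> 0" using tendsto_mult_left_zero[OF klim] .
   then have "\<forall>\<^sub>F n in sequentially. dist (k n * t) 0 < 1" by (rule tendstoD) simp
   then show "\<forall>\<^sub>F n in sequentially. \<theta> (k n * t) = 1" by eventually_elim (intro \<theta>1, simp)
  qed
  have "(\<lambda>n. A n t) \<longlonglongrightarrow> 0 + 0 - z\<^sup>2 * 1"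
   unfolding A_def by (intro tendsto_diff tendsto_add tendsto_mult_left 1 2 3)
  then show ?thesis by simp
 qed
 have eq: "- (LBINT t. A n t * P t) - (LBINT t. \<theta> (k n * t) * s t) + (LBINT t. \<theta> (k n * t) * Q t) = 0" for n
 proof -
  let ?\<theta> = "\<lambda>t. \<theta> (k n * t + 0)"
  have th: "?\<theta> \<in> \<D>" by (rule test_affine[OF \<theta>t]) (use k[of n] in simp)
  define \<eta> where "\<eta> t = osc z t * ?\<theta> t" for t
  have \<eta>: "\<eta> \<in> \<D>" unfolding \<eta>_def[abs_def] by (rule test_mult[OF th smooth_exp])
  have se: "smooth (\<lambda>t. osc z t)" by (rule smooth_exp)
  have sth: "smooth ?\<theta>" "smooth (\<lambda>t. ?d (k n * t + 0))" "smooth \<theta>" "smooth ?d"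
   by (intro smooth_affine test_functionsD test_dir_deriv \<theta>t)+
  have d1: "ddx \<eta> = (\<lambda>t. osc z t * (of_real (k n) * ?d (k n * t + 0)) + (\<i> * z) * (osc z t * ?\<theta> t))"
   unfolding \<eta>_def[abs_def] dir_deriv_mult_real[OF se sth(1)] dir_deriv_affine[OF sth(3)] dir_deriv_exp by (simp add: mult.assoc)
  have d2: "ddx (ddx \<eta>) = (\<lambda>t. A n t * osc z t)"
  proof -
   have sd: "smooth (\<lambda>t. of_real (k n) * ?d (k n * t + 0))" by (intro smooth_cmult sth)
   have "ddx (ddx \<eta>) = (\<lambda>t. (osc z t * (of_real (k n) * (of_real (k n) * ?dd (k n * t + 0))) + \<i> * z * osc z t * (of_real (k n) * ?d (k n * t + 0)))
     + (\<i> * z) * (osc z t * (of_real (k n) * ?d (k n * t + 0)) + \<i> * z * osc z t * ?\<theta> t))"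
    unfolding d1 dir_deriv_add[OF smooth_mult[OF se sd] smooth_cmult[OF smooth_mult[OF se sth(1)]]] dir_deriv_cmult[OF smooth_mult[OF se sth(1)]]
     dir_deriv_mult_real[OF se sd] dir_deriv_mult_real[OF se sth(1)] dir_deriv_cmult[OF sth(2)] dir_deriv_affine[OF sth(3)] dir_deriv_affine[OF sth(4)] dir_deriv_exp ..
   then show ?thesis by (simp add: A_def algebra_simps power2_eq_square fun_eq_iff)
  qed
  show ?thesis using weak_product[OF \<eta> \<psi>] unfolding d2 by (simp add: P_def Q_def s_def \<eta>_def mult_ac)
 qed
 have Pm: "P \<in> borel_fun" "s \<in> borel_fun" "Q \<in> borel_fun" using Pi si Qi by auto
 have L1: "(\<lambda>n. LBINT t. A n t * P t) \<longlonglongrightarrow> (LBINT t. - z\<^sup>2 * P t)"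
 proof (rule integral_dominated_convergence[where w = "\<lambda>t. (K2 + 2 * norm z * K1 + (norm z)\<^sup>2) * norm (P t)"])
  show "AE t in lborel. (\<lambda>n. A n t * P t) \<longlonglongrightarrow> - z\<^sup>2 * P t" by (intro AE_I2 tendsto_mult_right Alim)
  show "AE t in lborel. norm (A n t * P t) \<le> (K2 + 2 * norm z * K1 + (norm z)\<^sup>2) * norm (P t)" for n
   unfolding norm_mult by (intro AE_I2 mult_right_mono Ab) simp
 qed (use Pi Pm Am in \<open>auto intro!: integrable_mult_right\<close>)
 have L2: "(\<lambda>n. LBINT t. \<theta> (k n * t) * h t) \<longlonglongrightarrow> (LBINT t. h t)" if h: "integrable lborel h" for h
 proof (rule integral_dominated_convergence[where w = "\<lambda>t. norm (h t)"])
  have [measurable]: "h \<in> borel_fun" using h by auto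
  show "(\<lambda>t. \<theta> (k n * t) * h t) \<in> borel_measurable lborel" "h \<in> borel_measurable lborel" for n by measurable
  show "AE t in lborel. (\<lambda>n. \<theta> (k n * t) * h t) \<longlonglongrightarrow> h t"
  proof (intro AE_I2 tendsto_eventually)
   fix t
   have "(\<lambda>n. k n * t) \<longlonglongrightarrow> 0" using tendsto_mult_left_zero[OF klim] .
   then have "\<forall>\<^sub>F n in sequentially. dist (k n * t) 0 < 1" by (rule tendstoD) simp
   then show "\<forall>\<^sub>F n in sequentially. \<theta> (k n * t) * h t = h t" by eventually_elim (simp add: \<theta>1)
  qed
  show "AE t in lborel. norm (\<theta> (k n * t) * h t) \<le> norm (h t)" for n
   unfolding norm_mult by (intro AE_I2 mult_left_le_one_le K0) auto
 qed (use h in auto)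
 have "(\<lambda>n. - (LBINT t. A n t * P t) - (LBINT t. \<theta> (k n * t) * s t) + (LBINT t. \<theta> (k n * t) * Q t)) \<longlonglongrightarrow>
  - (LBINT t. - z\<^sup>2 * P t) - (LBINT t. s t) + (LBINT t. Q t)"
  by (intro tendsto_intros L1 L2 si Qi)
 then have "- (LBINT t. - z\<^sup>2 * P t) - (LBINT t. s t) + (LBINT t. Q t) = 0"
  unfolding eq by (simp add: LIMSEQ_const_iff)
 then show "z\<^sup>2 * (LBINT x. U x z * \<psi> x) - (LBINT x. S_hat x z * \<psi> x) + (LBINT x. U x z * ?d\<psi> x) = 0"
  unfolding integral_mult_right_zero PU sS by simp
qed

end

section \<open>The outgoing resolvent of the free stationary operator\<close>

text \<open>
 Young's inequality for the convolution of \<open>L\<^sup>1\<close> with \<open>L\<^sup>2\<close>: Cauchy-Schwarz with the splitting \<open>B = sqrt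
 B * sqrt B\<close>, then Tonelli.
\<close>
lemma Young_nn:
 fixes B :: "real \<Rightarrow> real" and f :: "real \<Rightarrow> ennreal"
 assumes [measurable]: "B \<in> borel_fun" "f \<in> borel_fun" and B0: "\<And>x. 0 \<le> B x"
 shows "(NN l. (NN m. ennreal (B (l - m)) * f m)\<^sup>2) \<le> (NN x. ennreal (B x))\<^sup>2 * (NN m. (f m)\<^sup>2)"
proof -
 let ?N = "NN x. ennreal (B x)"
 have N1: "(NN m. ennreal (B (l - m))) = ?N" for l
  using nn_integral_real_affine[of "\<lambda>x. ennreal (B x)" "-1" l] by simp
 have N2: "(NN l. ennreal (B (l - m))) = ?N" for m
  using nn_integral_real_affine[of "\<lambda>x. ennreal (B x)" "1" "- m"] by (simp add: add.commute)
 have pt: "(NN m. ennreal (B (l - m)) * f m)\<^sup>2 \<le> ?N * (NN m. ennreal (B (l - m)) * (f m)\<^sup>2)" for l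
 proof -
  have s: "ennreal (sqrt (B y)) * ennreal (sqrt (B y)) = ennreal (B y)" for y
   using B0 by (simp add: ennreal_mult'[symmetric])
  have "(NN m. ennreal (B (l - m)) * f m) = (NN m. ennreal (sqrt (B (l - m))) * (ennreal (sqrt (B (l - m))) * f m))"
   by (simp only: mult.assoc[symmetric] s)
  then have "(NN m. ennreal (B (l - m)) * f m)\<^sup>2 \<le> (NN m. (ennreal (sqrt (B (l - m))))\<^sup>2) * (NN m. (ennreal (sqrt (B (l - m))) * f m)\<^sup>2)"
   by (simp only:) (rule Cauchy_Schwarz_nn_integral, measurable)
  also have "(NN m. (ennreal (sqrt (B (l - m))))\<^sup>2) = ?N" by (simp only: power2_eq_square s N1)
  also have "(NN m. (ennreal (sqrt (B (l - m))) * f m)\<^sup>2) = (NN m. ennreal (B (l - m)) * (f m)\<^sup>2)"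
  proof (rule nn_integral_cong)
   fix m
   have "(ennreal (sqrt (B (l - m))) * f m)\<^sup>2 = (ennreal (sqrt (B (l - m))) * ennreal (sqrt (B (l - m)))) * (f m)\<^sup>2"
    by (simp only: power2_eq_square mult_ac)
   then show "(ennreal (sqrt (B (l - m))) * f m)\<^sup>2 = ennreal (B (l - m)) * (f m)\<^sup>2" by (simp only: s)
  qed
  finally show ?thesis .
 qed
 have "(NN l. (NN m. ennreal (B (l - m)) * f m)\<^sup>2) \<le> (NN l. ?N * (NN m. ennreal (B (l - m)) * (f m)\<^sup>2))"
  by (intro nn_integral_mono pt)
 also have "\<dots> = ?N * (NN l. (NN m. ennreal (B (l - m)) * (f m)\<^sup>2))"
  by (rule nn_integral_cmult) measurable
 also have "(NN l. (NN m. ennreal (B (l - m)) * (f m)\<^sup>2)) = (NN m. (NN l. ennreal (B (l - m)) * (f m)\<^sup>2))"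
  by (rule lborel_pair.Fubini') measurable
 also have "\<dots> = (NN m. ?N * (f m)\<^sup>2)"
 proof (rule nn_integral_cong)
  fix m
  have "(NN l. ennreal (B (l - m)) * (f m)\<^sup>2) = (NN l. ennreal (B (l - m))) * (f m)\<^sup>2"
   by (rule nn_integral_multc) measurable
  then show "(NN l. ennreal (B (l - m)) * (f m)\<^sup>2) = ?N * (f m)\<^sup>2" unfolding N2 .
 qed
 also have "\<dots> = ?N * (NN m. (f m)\<^sup>2)" by (rule nn_integral_cmult) measurable
 finally show ?thesis by (simp add: power2_eq_square mult.assoc)
qed

lemma test_antiderivative:
 fixes f :: "real \<Rightarrow> complex"
 assumes f: "f \<in> \<D>"
 defines "F \<equiv> \<lambda>x. LBINT y. indicat_real {..x} y *\<^sub>R f y"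
 shows "(F has_vector_derivative f x) (at x)"
proof -
 obtain M where M: "M > 0" "\<And>x. \<bar>x\<bar> > M \<Longrightarrow> f x = 0" using test_function_support[OF f] by metis
 have fc: "continuous_on S f" for S by (rule smooth_continuous[OF test_functionsD(1)[OF f]])
 define c where "c = min (- M) x - 1"
 have c: "c < x" "c < - M" by (auto simp: c_def)
 have "((\<lambda>u. integral {c..u} f) has_vector_derivative f x) (at x within {c..x+1})"
  by (rule integral_has_vector_derivative[OF fc]) (use c in auto)
 then have d: "((\<lambda>u. integral {c..u} f) has_vector_derivative f x) (at x)"
  using at_within_Icc_at[of c x "x+1"] c by simp
 have eq: "F u = integral {c..u} f" if "u \<ge> c" for u
 proof -
  have "(LBINT y. indicat_real {c..u} y *\<^sub>R f y) = integral {c..u} f"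
   using set_borel_integral_eq_integral(2)[of "{c..u}" f] borel_integrable_compact[OF compact_Icc fc]
   by (simp add: set_integrable_def set_lebesgue_integral_def)
  moreover have "(\<lambda>y. indicat_real {..u} y *\<^sub>R f y) = (\<lambda>y. indicat_real {c..u} y *\<^sub>R f y)"
  proof
   fix y show "indicat_real {..u} y *\<^sub>R f y = indicat_real {c..u} y *\<^sub>R f y"
    using M(2)[of y] c by (cases "y < c") (auto simp: indicator_def)
  qed
  ultimately show ?thesis by (simp add: F_def)
 qed
 show ?thesis by (rule has_vector_derivative_transform_within_open[OF d, of "{c<..}"]) (use c eq in auto)
qed

lemma integrable_exp_abs:
 assumes "s > 0"
 shows "integrable lborel (\<lambda>x::real. exp (- s * \<bar>x\<bar>))" "(LBINT x. exp (- s * \<bar>x\<bar>)) = 2 / s"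
proof -
 have h: "integrable lborel (\<lambda>x. indicat_real {0..} x * exp (- s * x))" "(LBINT x. indicat_real {0..} x * exp (- s * x)) = 1 / s"
 proof -
  have s: "Re (of_real s) > 0" using assms by simp
  show "(LBINT x. indicat_real {0..} x * exp (- s * x)) = 1 / s" using exp_half_line(3)[OF s, of 0] by simp
  have "integrable lborel (\<lambda>x. norm (indicat_real {0..} x *\<^sub>R exp (- of_real s * of_real (x - 0)) :: complex))"
   by (rule integrable_norm[OF exp_half_line(1)[OF s]])
  then show "integrable lborel (\<lambda>x. indicat_real {0..} x * exp (- s * x))" by (simp add: norm_exp_eq_Re)
 qed
 have r: "integrable lborel (\<lambda>x. indicat_real {0..} (- x) * exp (- s * (- x)))" "(LBINT x. indicat_real {0..} (- x) * exp (- s * (- x))) = 1 / s"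
  using lborel_integrable_real_affine[OF h(1), of "-1" 0] lborel_integral_real_affine[of "-1" "\<lambda>x. indicat_real {0..} x * exp (- s * x)" 0] h(2) by simp_all
 have ae: "AE x in lborel. exp (- s * \<bar>x\<bar>) = indicat_real {0..} x * exp (- s * x) + indicat_real {0..} (- x) * exp (- s * (- x))"
  using AE_lborel_singleton[of 0] by eventually_elim (auto simp: indicator_def)
 have i: "integrable lborel (\<lambda>x. indicat_real {0..} x * exp (- s * x) + indicat_real {0..} (- x) * exp (- s * (- x)))"
  by (intro Bochner_Integration.integrable_add h r)
 show "integrable lborel (\<lambda>x::real. exp (- s * \<bar>x\<bar>))"
  by (rule integrable_cong_AE_imp[OF i]) (use ae in auto)
 have "(LBINT x. exp (- s * \<bar>x\<bar>)) = (LBINT x. indicat_real {0..} x * exp (- s * x) + indicat_real {0..} (- x) * exp (- s * (- x)))"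
  by (rule integral_cong_AE) (use ae in auto)
 also have "\<dots> = 1 / s + 1 / s" using h r by (subst Bochner_Integration.integral_add) auto
 finally show "(LBINT x. exp (- s * \<bar>x\<bar>)) = 2 / s" by simp
qed

text \<open>
 The outgoing fundamental solution of \<open>\<partial>\<^sub>x\<^sup>2 + z\<^sup>2\<close>; it decays exponentially for \<open>Im z > 0\<close>.
\<close>
definition green :: "complex \<Rightarrow> real \<Rightarrow> complex" where
 "green z x = exp (\<i> * z * of_real \<bar>x\<bar>) / (2 * \<i> * z)"

lemma norm_green: "norm (green z x) = exp (- Im z * \<bar>x\<bar>) / (2 * norm z)"
 by (simp add: green_def norm_divide norm_mult norm_exp_i)

lemma green_borel [measurable]: "green z \<in> borel_fun"
 unfolding green_def[abs_def] by measurable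

text \<open>
 The outgoing Green function applied to a test function gives a smooth, exponentially decaying solution of \<open>\<phi>'' + z\<^sup>2 \<phi> =
 \<psi>\<close>. The parts \<open>E1\<close> and \<open>E2\<close> are the waves travelling to the right and to the left; each solves a first order
 equation.
\<close>
lemma green_test:
 assumes \<psi>: "\<psi> \<in> \<D>" and z: "Im z > 0"
 obtains \<phi> C where "smooth \<phi>" "\<And>x. ddx (ddx \<phi>) x = \<psi> x - z\<^sup>2 * \<phi> x"
  "\<And>x. \<phi> x = (LBINT y. green z (x - y) * \<psi> y)"
  "C \<ge> 0" "\<And>x. norm (\<phi> x) \<le> C * exp (- Im z * \<bar>x\<bar>)" "\<And>x. norm (ddx \<phi> x) \<le> C * exp (- Im z * \<bar>x\<bar>)"
proof -
 have z0: "z \<noteq> 0" using z by auto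
 obtain M where M: "M > 0" "\<And>x. \<bar>x\<bar> > M \<Longrightarrow> \<psi> x = 0" using test_function_support[OF \<psi>] by metis
 have [measurable]: "\<psi> \<in> borel_fun" by (rule test_borel[OF \<psi>])
 let ?p = "\<lambda>y. osc z y * \<psi> y" and ?m = "\<lambda>y. exp (- (\<i> * z) * of_real y) * \<psi> y"
 have pt: "?p \<in> \<D>" and mt: "?m \<in> \<D>" by (intro test_mult[OF \<psi> smooth_exp])+
 define I1 where "I1 x = (LBINT y. indicat_real {..x} y *\<^sub>R ?m y)" for x
 define J where "J x = (LBINT y. indicat_real {..x} y *\<^sub>R ?p y)" for x
 define I2 where "I2 x = (LBINT y. ?p y) - J x" for x
 have d1: "(I1 has_vector_derivative ?m x) (at x)" for x unfolding I1_def[abs_def] by (rule test_antiderivative[OF mt])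
 have dJ: "(J has_vector_derivative ?p x) (at x)" for x unfolding J_def[abs_def] by (rule test_antiderivative[OF pt])
 have d2: "(I2 has_vector_derivative - ?p x) (at x)" for x
  unfolding I2_def[abs_def] using has_vector_derivative_diff[OF has_vector_derivative_const dJ] by simp
 have s1: "smooth I1" by (rule smooth_antiderivative[OF d1 test_functionsD(1)[OF mt]])
 have sJ: "smooth J" by (rule smooth_antiderivative[OF dJ test_functionsD(1)[OF pt]])
 have s2: "smooth I2" unfolding I2_def[abs_def] by (intro smooth_diff smooth_const sJ)
 define E1 where "E1 x = osc z x * I1 x" for x
 define E2 where "E2 x = exp (- (\<i> * z) * of_real x) * I2 x" for x
 have sE: "smooth E1" "smooth E2" unfolding E1_def[abs_def] E2_def[abs_def] by (intro smooth_mult smooth_exp s1 s2)+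
 have ee: "osc z x * exp (- (\<i> * z) * of_real x) = 1" for x :: real
  unfolding mult_exp_exp by simp
 have dE1: "(E1 has_vector_derivative \<i> * z * E1 x + \<psi> x) (at x)" for x
 proof -
  have "(E1 has_vector_derivative osc z x * ?m x + \<i> * z * osc z x * I1 x) (at x)"
   unfolding E1_def[abs_def] by (rule has_vector_derivative_mult[OF exp_i_has_vector_derivative d1])
  moreover have "osc z x * ?m x = \<psi> x" using ee[of x] by (simp only: mult.assoc[symmetric]) simp
  moreover have "\<psi> x + \<i> * z * osc z x * I1 x = \<i> * z * E1 x + \<psi> x" by (simp add: E1_def)
  ultimately show ?thesis by (simp only:)
 qed
 have dE2: "(E2 has_vector_derivative - (\<i> * z) * E2 x - \<psi> x) (at x)" for x
 proof -
  have "(E2 has_vector_derivative exp (\<i> * (- z) * of_real x) * (- ?p x) + \<i> * (- z) * exp (\<i> * (- z) * of_real x) * I2 x) (at x)"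
   unfolding E2_def[abs_def] using has_vector_derivative_mult[OF exp_i_has_vector_derivative[of "- z" x] d2] by simp
  moreover have "exp (\<i> * (- z) * of_real x) * (- ?p x) = - \<psi> x"
  proof -
   have e: "exp (\<i> * (- z) * of_real x) * osc z x = 1" unfolding mult_exp_exp by simp
   have "exp (\<i> * (- z) * of_real x) * (- ?p x) = - ((exp (\<i> * (- z) * of_real x) * osc z x) * \<psi> x)"
    by (simp only: mult_minus_right mult.assoc)
   also have "\<dots> = - \<psi> x" by (simp only: e mult_1_left)
   finally show ?thesis .
  qed
  moreover have "- \<psi> x + \<i> * (- z) * exp (\<i> * (- z) * of_real x) * I2 x = - (\<i> * z) * E2 x - \<psi> x" by (simp add: E2_def)
  ultimately show ?thesis by (simp only:)
 qed
 define \<phi> where "\<phi> x = (1 / (2 * \<i> * z)) * (E1 x + E2 x)" for x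
 have s\<phi>: "smooth \<phi>" unfolding \<phi>_def[abs_def] by (intro smooth_cmult smooth_add sE)
 have d\<phi>: "ddx \<phi> = (\<lambda>x. (1 / 2) * (E1 x - E2 x))"
 proof
  fix x
  have "(\<phi> has_vector_derivative (1 / (2 * \<i> * z)) * ((\<i> * z * E1 x + \<psi> x) + (- (\<i> * z) * E2 x - \<psi> x))) (at x)"
   unfolding \<phi>_def[abs_def] by (intro has_vector_derivative_mult_right has_vector_derivative_add dE1 dE2)
  then have "ddx \<phi> x = (1 / (2 * \<i> * z)) * ((\<i> * z * E1 x + \<psi> x) + (- (\<i> * z) * E2 x - \<psi> x))" by (rule dir_deriv_1_eq)
  also have "(\<i> * z * E1 x + \<psi> x) + (- (\<i> * z) * E2 x - \<psi> x) = (\<i> * z) * (E1 x - E2 x)" by (simp add: algebra_simps)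
  finally show "ddx \<phi> x = (1 / 2) * (E1 x - E2 x)" using z0 by simp
 qed
 have dd\<phi>: "ddx (ddx \<phi>) x = \<psi> x - z\<^sup>2 * \<phi> x" for x
 proof -
  have "((\<lambda>x. (1 / 2) * (E1 x - E2 x)) has_vector_derivative (1 / 2) * ((\<i> * z * E1 x + \<psi> x) - (- (\<i> * z) * E2 x - \<psi> x))) (at x)"
   by (intro has_vector_derivative_mult_right has_vector_derivative_diff dE1 dE2)
  then have "ddx (ddx \<phi>) x = (1 / 2) * ((\<i> * z * E1 x + \<psi> x) - (- (\<i> * z) * E2 x - \<psi> x))" unfolding d\<phi> by (rule dir_deriv_1_eq)
  also have "\<dots> = \<psi> x + (\<i> * z / 2) * (E1 x + E2 x)" by (simp add: field_simps)
  also have "(\<i> * z / 2) * (E1 x + E2 x) = - (z\<^sup>2 * \<phi> x)"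
  proof -
   have "\<i> * z / 2 = - (z\<^sup>2) * (1 / (2 * \<i> * z))" using z0 by (simp add: field_simps power2_eq_square)
   then show ?thesis unfolding \<phi>_def by (simp only:) (simp add: mult.assoc)
  qed
  finally show ?thesis by simp
 qed
 have pi: "integrable lborel ?p" and mi: "integrable lborel ?m" by (intro test_integrable pt mt)+
 have rep1: "E1 x = (LBINT y. indicat_real {..x} y *\<^sub>R (exp (\<i> * z * of_real (x - y)) * \<psi> y))" for x
 proof -
  have "E1 x = (LBINT y. osc z x * (indicat_real {..x} y *\<^sub>R ?m y))" unfolding E1_def I1_def by (rule integral_mult_right_zero[symmetric])
  also have "\<dots> = (LBINT y. indicat_real {..x} y *\<^sub>R (exp (\<i> * z * of_real (x - y)) * \<psi> y))"
  proof (intro Bochner_Integration.integral_cong refl)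
   fix y
   have "osc z x * exp (- (\<i> * z) * of_real y) = exp (\<i> * z * of_real (x - y))"
    unfolding mult_exp_exp by (rule arg_cong[of _ _ exp]) (simp add: algebra_simps)
   then show "osc z x * (indicat_real {..x} y *\<^sub>R ?m y) = indicat_real {..x} y *\<^sub>R (exp (\<i> * z * of_real (x - y)) * \<psi> y)"
    by (simp only: mult_scaleR_right mult.assoc[symmetric])
  qed
  finally show ?thesis .
 qed
 have rep2: "E2 x = (LBINT y. indicat_real {x<..} y *\<^sub>R (exp (\<i> * z * of_real (y - x)) * \<psi> y))" for x
 proof -
  have ip: "integrable lborel (\<lambda>y. indicat_real {..x} y *\<^sub>R ?p y)" by (rule integrable_mult_indicator[OF _ pi]) simp
  have "I2 x = (LBINT y. ?p y - indicat_real {..x} y *\<^sub>R ?p y)" unfolding I2_def J_def by (rule Bochner_Integration.integral_diff[symmetric, OF pi ip])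
  also have "\<dots> = (LBINT y. indicat_real {x<..} y *\<^sub>R ?p y)" by (intro Bochner_Integration.integral_cong refl) (simp add: indicator_def)
  finally have "E2 x = (LBINT y. exp (- (\<i> * z) * of_real x) * (indicat_real {x<..} y *\<^sub>R ?p y))" unfolding E2_def by (simp only: integral_mult_right_zero)
  also have "\<dots> = (LBINT y. indicat_real {x<..} y *\<^sub>R (exp (\<i> * z * of_real (y - x)) * \<psi> y))"
  proof (intro Bochner_Integration.integral_cong refl)
   fix y
   have "exp (- (\<i> * z) * of_real x) * osc z y = exp (\<i> * z * of_real (y - x))"
    unfolding mult_exp_exp by (rule arg_cong[of _ _ exp]) (simp add: algebra_simps)
   then show "exp (- (\<i> * z) * of_real x) * (indicat_real {x<..} y *\<^sub>R ?p y) = indicat_real {x<..} y *\<^sub>R (exp (\<i> * z * of_real (y - x)) * \<psi> y)"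
    by (simp only: mult_scaleR_right mult.assoc[symmetric])
  qed
  finally show ?thesis .
 qed
 define W where "W = exp (Im z * M) * (LBINT y. norm (\<psi> y))"
 have W0: "W \<ge> 0" by (simp add: W_def)
 have \<psi>n: "integrable lborel (\<lambda>y. norm (\<psi> y))" by (intro integrable_norm test_integrable \<psi>)
 have kb: "exp (- Im z * \<bar>x - y\<bar>) * norm (\<psi> y) \<le> exp (Im z * M) * exp (- Im z * \<bar>x\<bar>) * norm (\<psi> y)" for x y
 proof (cases "\<bar>y\<bar> \<le> M")
  case True
  then have "Im z * (\<bar>x\<bar> - M) \<le> Im z * \<bar>x - y\<bar>" using z by (intro mult_left_mono) auto
  then have "exp (- Im z * \<bar>x - y\<bar>) \<le> exp (Im z * M) * exp (- Im z * \<bar>x\<bar>)" unfolding mult_exp_exp by (simp add: algebra_simps)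
  then show ?thesis by (rule mult_right_mono) simp
 qed (use M(2) in simp)
 have key: "norm (LBINT y. indicat_real S y *\<^sub>R (exp (\<i> * z * of_real \<bar>x - y\<bar>) * \<psi> y)) \<le> W * exp (- Im z * \<bar>x\<bar>)"
  and keyi: "integrable lborel (\<lambda>y. indicat_real S y *\<^sub>R (exp (\<i> * z * of_real \<bar>x - y\<bar>) * \<psi> y))"
  if [measurable]: "S \<in> sets borel" for S x
 proof -
  let ?h = "\<lambda>y. indicat_real S y *\<^sub>R (exp (\<i> * z * of_real \<bar>x - y\<bar>) * \<psi> y)"
  have b: "norm (?h y) \<le> exp (Im z * M) * exp (- Im z * \<bar>x\<bar>) * norm (\<psi> y)" for y
   using kb[of x y] by (cases "y \<in> S") (simp_all add: norm_mult norm_exp_i)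
  have bi: "integrable lborel (\<lambda>y. exp (Im z * M) * exp (- Im z * \<bar>x\<bar>) * norm (\<psi> y))" by (intro integrable_mult_right \<psi>n)
  show i: "integrable lborel ?h"
   by (rule Bochner_Integration.integrable_bound[OF bi]) (use b in \<open>auto intro!: AE_I2 order_trans[OF b]\<close>)
  have "norm (LBINT y. ?h y) \<le> (LBINT y. norm (?h y))" by (rule integral_norm_bound)
  also have "\<dots> \<le> (LBINT y. exp (Im z * M) * exp (- Im z * \<bar>x\<bar>) * norm (\<psi> y))"
   by (rule integral_mono[OF integrable_norm[OF i] bi b])
  also have "\<dots> = W * exp (- Im z * \<bar>x\<bar>)" by (simp add: W_def)
  finally show "norm (LBINT y. ?h y) \<le> W * exp (- Im z * \<bar>x\<bar>)" .
 qed
 have r1: "E1 x = (LBINT y. indicat_real {..x} y *\<^sub>R (exp (\<i> * z * of_real \<bar>x - y\<bar>) * \<psi> y))" for x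
  unfolding rep1
 proof (intro Bochner_Integration.integral_cong refl)
  fix y show "indicat_real {..x} y *\<^sub>R (exp (\<i> * z * of_real (x - y)) * \<psi> y) = indicat_real {..x} y *\<^sub>R (exp (\<i> * z * of_real \<bar>x - y\<bar>) * \<psi> y)"
   by (cases "y \<le> x") simp_all
 qed
 have r2: "E2 x = (LBINT y. indicat_real {x<..} y *\<^sub>R (exp (\<i> * z * of_real \<bar>x - y\<bar>) * \<psi> y))" for x
  unfolding rep2
 proof (intro Bochner_Integration.integral_cong refl)
  fix y show "indicat_real {x<..} y *\<^sub>R (exp (\<i> * z * of_real (y - x)) * \<psi> y) = indicat_real {x<..} y *\<^sub>R (exp (\<i> * z * of_real \<bar>x - y\<bar>) * \<psi> y)"
   by (cases "x < y") (simp_all add: abs_of_neg)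
 qed
 have En: "norm (E1 x) \<le> W * exp (- Im z * \<bar>x\<bar>)" "norm (E2 x) \<le> W * exp (- Im z * \<bar>x\<bar>)" for x
  unfolding r1 r2 by (rule key; simp)+
 have rep: "\<phi> x = (LBINT y. green z (x - y) * \<psi> y)" for x
 proof -
  have "E1 x + E2 x = (LBINT y. indicat_real {..x} y *\<^sub>R (exp (\<i> * z * of_real \<bar>x - y\<bar>) * \<psi> y) + indicat_real {x<..} y *\<^sub>R (exp (\<i> * z * of_real \<bar>x - y\<bar>) * \<psi> y))"
   unfolding r1 r2 by (rule Bochner_Integration.integral_add[symmetric]) (rule keyi; simp)+
  also have "\<dots> = (LBINT y. exp (\<i> * z * of_real \<bar>x - y\<bar>) * \<psi> y)" by (intro Bochner_Integration.integral_cong refl) (simp add: indicator_def)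
  finally have "\<phi> x = (LBINT y. (1 / (2 * \<i> * z)) * (exp (\<i> * z * of_real \<bar>x - y\<bar>) * \<psi> y))" unfolding \<phi>_def by (simp only: integral_mult_right_zero)
  then show ?thesis by (simp add: green_def)
 qed
 define C where "C = W / norm z + W"
 show ?thesis
 proof (rule that[OF s\<phi> dd\<phi> rep])
  show "C \<ge> 0" using W0 by (simp add: C_def)
  have e0: "0 \<le> exp (- Im z * \<bar>x\<bar>)" for x by simp
  show "norm (\<phi> x) \<le> C * exp (- Im z * \<bar>x\<bar>)" for x
  proof -
   have "norm (\<phi> x) = (1 / (2 * norm z)) * norm (E1 x + E2 x)" by (simp add: \<phi>_def norm_mult norm_divide)
   also have "\<dots> \<le> (1 / (2 * norm z)) * (2 * (W * exp (- Im z * \<bar>x\<bar>)))"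
    using norm_triangle_le[OF add_mono[OF En, of x x]] by (intro mult_left_mono) auto
   also have "\<dots> = (W / norm z) * exp (- Im z * \<bar>x\<bar>)" by simp
   also have "\<dots> \<le> C * exp (- Im z * \<bar>x\<bar>)" using W0 by (intro mult_right_mono) (auto simp: C_def)
   finally show ?thesis .
  qed
  show "norm (ddx \<phi> x) \<le> C * exp (- Im z * \<bar>x\<bar>)" for x
  proof -
   have "norm (ddx \<phi> x) = (1 / 2) * norm (E1 x - E2 x)" unfolding d\<phi> by (simp add: norm_divide)
   also have "\<dots> \<le> (1 / 2) * (2 * (W * exp (- Im z * \<bar>x\<bar>)))"
    using order_trans[OF norm_triangle_ineq4 add_mono[OF En, of x x]] by (intro mult_left_mono) auto
   also have "\<dots> \<le> C * exp (- Im z * \<bar>x\<bar>)"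
    using W0 by (simp add: C_def mult_right_mono)
   finally show ?thesis .
  qed
 qed
qed

section \<open>Uniqueness for the stationary problem in the upper half plane\<close>

text \<open>
 The equation is tested with the solution \<open>\<phi>\<close> of \<open>green_test\<close>, and the Green function is then moved to
 \<open>F\<close> by Fubini. The function \<open>\<phi>\<close> is not compactly supported, so it is cut off at scale \<open>1 / k n\<close>; the
 commutator terms carry a factor \<open>k n\<close> and vanish in the limit, because \<open>Y\<close> is square integrable and \<open>\<phi>\<close>
 decays exponentially.
\<close>
lemma green_representation:
 fixes Y F :: "real \<Rightarrow> complex"
 assumes [measurable]: "Y \<in> borel_fun" and Y2: "Y \<in> L2" and F: "integrable lborel F" and z: "Im z > 0"
  and weak: "\<And>\<psi>. \<psi> \<in> \<D> \<Longrightarrow>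
   z\<^sup>2 * (LBINT x. Y x * \<psi> x) + (LBINT x. Y x * ddx (ddx \<psi>) x) = (LBINT x. F x * \<psi> x)"
 shows "AE y in lborel. Y y = (LBINT x. green z (x - y) * F x)"
proof -
 have z0: "norm z > 0" using z by auto
 have [measurable]: "F \<in> borel_fun" using F by auto
 define G where "G y = (LBINT x. green z (x - y) * F x)" for y
 have gb: "norm (green z t) \<le> 1 / (2 * norm z)" for t
  unfolding norm_green using z0 z by (intro divide_right_mono) auto
 have G_borel [measurable]: "G \<in> borel_fun" unfolding G_def[abs_def] by measurable
 have Fn: "integrable lborel (\<lambda>x. norm (F x))" by (rule integrable_norm[OF F])
 have Gi: "norm (G y) \<le> 1 / (2 * norm z) * (LBINT x. norm (F x))" for y
 proof -
  have b: "norm (green z (x - y) * F x) \<le> 1 / (2 * norm z) * norm (F x)" for x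
   unfolding norm_mult by (rule mult_right_mono[OF gb]) simp
  have bi: "integrable lborel (\<lambda>x. 1 / (2 * norm z) * norm (F x))" by (intro integrable_mult_right Fn)
  have i: "integrable lborel (\<lambda>x. green z (x - y) * F x)"
   by (rule Bochner_Integration.integrable_bound[OF bi]) (use b in \<open>auto intro!: AE_I2 order_trans[OF b]\<close>)
  have "norm (G y) \<le> (LBINT x. norm (green z (x - y) * F x))" unfolding G_def by (rule integral_norm_bound)
  also have "\<dots> \<le> (LBINT x. 1 / (2 * norm z) * norm (F x))" by (rule integral_mono[OF integrable_norm[OF i] bi b])
  finally show ?thesis by simp
 qed
 have Yt: "integrable lborel (\<lambda>x. Y x * h x)" if "h \<in> L2" "h \<in> borel_fun" for h
  using L2_mult_integrable[OF Y2 that(1)] that(2) by (subst (asm) integrable_completion) auto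
 have main: "(LBINT y. Y y * \<psi> y) = (LBINT y. G y * \<psi> y)" if \<psi>: "\<psi> \<in> \<D>" for \<psi>
 proof -
  have [measurable]: "\<psi> \<in> borel_fun" by (rule test_borel[OF \<psi>])
  have \<psi>n: "integrable lborel (\<lambda>y. norm (\<psi> y))" by (intro integrable_norm test_integrable \<psi>)
  obtain \<phi> C where \<phi>: "smooth \<phi>" "\<And>x. ddx (ddx \<phi>) x = \<psi> x - z\<^sup>2 * \<phi> x"
   "\<And>x. \<phi> x = (LBINT y. green z (x - y) * \<psi> y)"
   "C \<ge> 0" "\<And>x. norm (\<phi> x) \<le> C * exp (- Im z * \<bar>x\<bar>)" "\<And>x. norm (ddx \<phi> x) \<le> C * exp (- Im z * \<bar>x\<bar>)"
   by (rule green_test[OF \<psi> z]) (rule that)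
  have [measurable]: "\<phi> \<in> borel_fun" "ddx \<phi> \<in> borel_fun"
   by (auto intro!: smooth_borel \<phi> smooth_dir_deriv)
  (* a cutoff with value 1 at 0; its dilates t0 n tend to 1 *)
  let ?\<theta> = "bump 1 (- 2) 2"
  have \<theta>: "?\<theta> \<in> \<D>" by (rule bump_test) simp
  note \<theta>s = test_functionsD(1)[OF \<theta>]
  have \<theta>': "ddx ?\<theta> \<in> \<D>" "ddx (ddx ?\<theta>) \<in> \<D>" by (intro test_dir_deriv \<theta>)+
  have [measurable]: "?\<theta> \<in> borel_fun" "ddx ?\<theta> \<in> borel_fun" "ddx (ddx ?\<theta>) \<in> borel_fun"
   by (intro test_borel \<theta> \<theta>')+
  obtain M1 where M1: "M1 \<ge> 0" "\<And>x. norm (ddx ?\<theta> x) \<le> M1" by (rule continuous_compact_supp_bounded[OF \<theta>'(1)]) (rule that)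
  obtain M2 where M2: "M2 \<ge> 0" "\<And>x. norm (ddx (ddx ?\<theta>) x) \<le> M2" by (rule continuous_compact_supp_bounded[OF \<theta>'(2)]) (rule that)
  define k where "k n = inverse (real (Suc n))" for n
  have k: "0 < k n" "k n \<le> 1" for n by (auto simp: k_def inverse_le_1_iff)
  have k0: "k \<longlonglongrightarrow> 0" unfolding k_def[abs_def] by (rule LIMSEQ_inverse_real_of_nat)
  define t0 where "t0 n x = ?\<theta> (k n * x + 0)" for n x
  define t1 where "t1 n x = of_real (k n) * ddx ?\<theta> (k n * x + 0)" for n x
  define t2 where "t2 n x = of_real (k n) * (of_real (k n) * ddx (ddx ?\<theta>) (k n * x + 0))" for n x
  have d0: "ddx (t0 n) = t1 n" for n unfolding t0_def[abs_def] t1_def[abs_def] by (rule dir_deriv_affine[OF \<theta>s])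
  have tt: "(\<lambda>x. ddx ?\<theta> (k n * x + 0)) \<in> \<D>" for n by (rule test_affine[OF \<theta>'(1)]) (use k(1)[of n] in simp)
  have d1: "ddx (t1 n) = t2 n" for n unfolding t1_def[abs_def] t2_def[abs_def]
   by (subst dir_deriv_cmult[OF test_functionsD(1)[OF tt]]) (simp only: dir_deriv_affine[OF test_functionsD(1)[OF \<theta>'(1)]])
  have t0t: "t0 n \<in> \<D>" for n unfolding t0_def[abs_def] by (rule test_affine[OF \<theta>]) (use k(1)[of n] in simp)
  have ts: "smooth (t0 n)" "smooth (t1 n)" for n
   using test_functionsD(1)[OF t0t] test_functionsD(1)[OF test_dir_deriv[OF t0t]] by (simp_all add: d0)
  have s\<phi>': "smooth (ddx \<phi>)" by (rule smooth_dir_deriv[OF \<phi>(1)]) simp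
  define \<phi>n where "\<phi>n n x = \<phi> x * t0 n x" for n x
  have \<phi>nt: "\<phi>n n \<in> \<D>" for n unfolding \<phi>n_def[abs_def] by (rule test_mult[OF t0t \<phi>(1)])
  have dd: "ddx (ddx (\<phi>n n)) x = (\<phi> x * t2 n x + ddx \<phi> x * t1 n x) + (ddx \<phi> x * t1 n x + (\<psi> x - z\<^sup>2 * \<phi> x) * t0 n x)" for n x
  proof -
   have "ddx (\<phi>n n) = (\<lambda>x. \<phi> x * t1 n x + ddx \<phi> x * t0 n x)"
    unfolding \<phi>n_def[abs_def] dir_deriv_mult_real[OF \<phi>(1) ts(1)] d0 ..
   then show ?thesis
    by (simp only: dir_deriv_add[OF smooth_mult[OF \<phi>(1) ts(2)] smooth_mult[OF s\<phi>' ts(1)]] dir_deriv_mult_real[OF \<phi>(1) ts(2)] dir_deriv_mult_real[OF s\<phi>' ts(1)] d0 d1 \<phi>(2))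
  qed
  define r where "r n x = \<psi> x * t0 n x + 2 * (ddx \<phi> x * t1 n x) + \<phi> x * t2 n x" for n x
  have r: "z\<^sup>2 * \<phi>n n x + ddx (ddx (\<phi>n n)) x = r n x" for n x
   unfolding dd r_def \<phi>n_def by (simp add: algebra_simps)
  have [measurable]: "t0 n \<in> borel_fun" "t1 n \<in> borel_fun" "t2 n \<in> borel_fun" for n
   unfolding t0_def[abs_def] t1_def[abs_def] t2_def[abs_def] by measurable
  have [measurable]: "r n \<in> borel_fun" "\<phi>n n \<in> borel_fun" for n unfolding r_def[abs_def] \<phi>n_def[abs_def] by measurable
  have weak_n: "(LBINT x. Y x * r n x) = (LBINT x. F x * \<phi>n n x)" for n
  proof -
   have i: "integrable lborel (\<lambda>x. Y x * \<phi>n n x)" "integrable lborel (\<lambda>x. Y x * ddx (ddx (\<phi>n n)) x)"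
    by (intro Yt test_L2 test_borel test_dir_deriv \<phi>nt)+
   have "(LBINT x. Y x * r n x) = (LBINT x. z\<^sup>2 * (Y x * \<phi>n n x) + Y x * ddx (ddx (\<phi>n n)) x)"
    unfolding r[symmetric] by (simp add: algebra_simps)
   also have "\<dots> = z\<^sup>2 * (LBINT x. Y x * \<phi>n n x) + (LBINT x. Y x * ddx (ddx (\<phi>n n)) x)"
    using i by simp
   finally show ?thesis using weak[OF \<phi>nt] by simp
  qed
  let ?e = "\<lambda>x. exp (- Im z * \<bar>x\<bar>)"
  have eL2: "(\<lambda>x. complex_of_real (?e x)) \<in> L2"
  proof -
   have "integrable lborel (\<lambda>x. (norm (complex_of_real (?e x)))\<^sup>2)"
    using integrable_exp_abs(1)[of "2 * Im z"] z by (simp add: power2_eq_square mult_exp_exp mult.assoc)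
   moreover have "(\<lambda>x. complex_of_real (?e x)) \<in> borel_fun" by measurable
   ultimately show ?thesis unfolding L2_def by (simp add: integrable_completion borel_lebesgue del: of_real_exp norm_of_real)
  qed
  have ei: "integrable lborel (\<lambda>x. norm (Y x) * ?e x)"
   using integrable_norm[OF Yt[OF eL2]] by (simp add: norm_mult)
  have \<psi>i: "integrable lborel (\<lambda>x. norm (Y x * \<psi> x))" by (intro integrable_norm Yt test_L2 test_borel \<psi>)
  have t_b: "norm (t0 n x) \<le> 1" "norm (t1 n x) \<le> k n * M1" "norm (t2 n x) \<le> k n * M2" for n x
  proof -
   show "norm (t0 n x) \<le> 1" unfolding t0_def by (rule norm_bump)
   show "norm (t1 n x) \<le> k n * M1" unfolding t1_def norm_mult using k(1)[of n] M1 by (simp add: mult_left_mono)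
   have "norm (t2 n x) = k n * (k n * norm (ddx (ddx ?\<theta>) (k n * x + 0)))" unfolding t2_def norm_mult using k(1)[of n] by simp
   also have "\<dots> \<le> k n * (1 * M2)" using k[of n] M2 by (intro mult_left_mono mult_mono) auto
   finally show "norm (t2 n x) \<le> k n * M2" by simp
  qed
  have lim0: "(\<lambda>n. t0 n x) \<longlonglongrightarrow> 1" for x
  proof -
   have "(\<lambda>n. ?\<theta> (k n * x + 0)) \<longlonglongrightarrow> ?\<theta> (0 * x + 0)"
    by (rule isCont_tendsto_compose[OF _ tendsto_add[OF tendsto_mult[OF k0 tendsto_const] tendsto_const]])
     (use smooth_continuous[OF \<theta>s, of UNIV] in \<open>simp add: continuous_on_eq_continuous_at\<close>)
   moreover have "?\<theta> (0 * x + 0) = 1" by (simp add: bump_def smooth_step_1)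
   ultimately show ?thesis by (simp add: t0_def)
  qed
  have lim1: "(\<lambda>n. t1 n x) \<longlonglongrightarrow> 0" "(\<lambda>n. t2 n x) \<longlonglongrightarrow> 0" for x
  proof -
   have l: "(\<lambda>n. k n * c) \<longlonglongrightarrow> 0" for c using tendsto_mult[OF k0 tendsto_const, of c] by simp
   show "(\<lambda>n. t1 n x) \<longlonglongrightarrow> 0" by (rule Lim_null_comparison[OF _ l[of M1]]) (use t_b(2) in simp)
   show "(\<lambda>n. t2 n x) \<longlonglongrightarrow> 0" by (rule Lim_null_comparison[OF _ l[of M2]]) (use t_b(3) in simp)
  qed
  have L1: "(\<lambda>n. LBINT x. Y x * r n x) \<longlonglongrightarrow> (LBINT x. Y x * \<psi> x)"
  proof (rule integral_dominated_convergence[where w="\<lambda>x. norm (Y x * \<psi> x) + (2 * C * M1 + C * M2) * (norm (Y x) * ?e x)"])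
   show "integrable lborel (\<lambda>x. norm (Y x * \<psi> x) + (2 * C * M1 + C * M2) * (norm (Y x) * ?e x))"
    by (intro Bochner_Integration.integrable_add integrable_mult_right \<psi>i ei)
   have "(\<lambda>n. Y x * r n x) \<longlonglongrightarrow> Y x * (\<psi> x * 1 + 2 * (ddx \<phi> x * 0) + \<phi> x * 0)" for x
    unfolding r_def by (intro tendsto_intros lim0 lim1)
   then show "AE x in lborel. (\<lambda>n. Y x * r n x) \<longlonglongrightarrow> Y x * \<psi> x" by simp
   fix n
   have "norm (Y x * r n x) \<le> norm (Y x * \<psi> x) + (2 * C * M1 + C * M2) * (norm (Y x) * ?e x)" for x
   proof -
    have b1: "norm (t1 n x) \<le> M1" using t_b(2)[of n x] k[of n] mult_right_mono[of "k n" 1 M1] M1 by simp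
    have b2: "norm (t2 n x) \<le> M2" using t_b(3)[of n x] k[of n] mult_right_mono[of "k n" 1 M2] M2 by simp
    have c1: "norm (\<psi> x * t0 n x) \<le> norm (\<psi> x)" using mult_left_mono[OF t_b(1)[of n x], of "norm (\<psi> x)"] by (simp add: norm_mult)
    have c2: "norm (2 * (ddx \<phi> x * t1 n x)) \<le> 2 * ((C * ?e x) * M1)"
     unfolding norm_mult using \<phi>(4) by (simp only: norm_numeral) (intro mult_left_mono mult_mono \<phi>(6) b1; simp)
    have c3: "norm (\<phi> x * t2 n x) \<le> (C * ?e x) * M2"
     unfolding norm_mult using \<phi>(4) by (intro mult_mono \<phi>(5) b2) auto
    have "norm (r n x) \<le> norm (\<psi> x) + 2 * ((C * ?e x) * M1) + (C * ?e x) * M2"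
     unfolding r_def by (intro norm_triangle_le add_mono c1 c2 c3)
    then have "norm (Y x) * norm (r n x) \<le> norm (Y x) * (norm (\<psi> x) + 2 * ((C * ?e x) * M1) + (C * ?e x) * M2)" by (rule mult_left_mono) simp
    then show ?thesis by (simp add: norm_mult algebra_simps)
   qed
   then show "AE x in lborel. norm (Y x * r n x) \<le> norm (Y x * \<psi> x) + (2 * C * M1 + C * M2) * (norm (Y x) * ?e x)" by simp
  qed measurable
  have L2': "(\<lambda>n. LBINT x. F x * \<phi>n n x) \<longlonglongrightarrow> (LBINT x. F x * \<phi> x)"
  proof (rule integral_dominated_convergence[where w="\<lambda>x. C * norm (F x)"])
   show "integrable lborel (\<lambda>x. C * norm (F x))" by (intro integrable_mult_right Fn)
   have "(\<lambda>n. F x * \<phi>n n x) \<longlonglongrightarrow> F x * (\<phi> x * 1)" for x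
    unfolding \<phi>n_def by (intro tendsto_intros lim0)
   then show "AE x in lborel. (\<lambda>n. F x * \<phi>n n x) \<longlonglongrightarrow> F x * \<phi> x" by simp
   fix n
   have "norm (F x * \<phi>n n x) \<le> C * norm (F x)" for x
   proof -
    have "norm (\<phi> x) \<le> C * 1" using \<phi>(4) z by (intro order_trans[OF \<phi>(5)] mult_left_mono) auto
    then have "norm (\<phi>n n x) \<le> (C * 1) * 1" unfolding \<phi>n_def norm_mult using \<phi>(4) by (intro mult_mono t_b) auto
    then show ?thesis using mult_left_mono[of "norm (\<phi>n n x)" C "norm (F x)"] by (simp add: norm_mult mult.commute)
   qed
   then show "AE x in lborel. norm (F x * \<phi>n n x) \<le> C * norm (F x)" by simp
  qed measurable
  have e1: "(LBINT y. Y y * \<psi> y) = (LBINT x. F x * \<phi> x)"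
   using LIMSEQ_unique[OF L1] L2' unfolding weak_n by auto
  let ?f = "\<lambda>(x, y). green z (x - y) * F x * \<psi> y"
  have i2: "integrable (lborel \<Otimes>\<^sub>M lborel) ?f"
  proof -
   have "integrable (lborel \<Otimes>\<^sub>M lborel) (\<lambda>(x, y). (1 / (2 * norm z)) * (norm (F x) * norm (\<psi> y)))"
   proof (rule lborel_pair.Fubini_integrable)
    show "integrable lborel (\<lambda>x. LBINT y. norm (case (x, y) of (x, y) \<Rightarrow> (1 / (2 * norm z)) * (norm (F x) * norm (\<psi> y))))"
     by (simp add: abs_mult Fn)
    show "AE x in lborel. integrable lborel (\<lambda>y. case (x, y) of (x, y) \<Rightarrow> (1 / (2 * norm z)) * (norm (F x) * norm (\<psi> y)))"
     using \<psi>n by simp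
   qed measurable
   then show ?thesis
   proof (rule Bochner_Integration.integrable_bound)
    show "AE p in lborel \<Otimes>\<^sub>M lborel. norm (?f p) \<le> norm (case p of (x, y) \<Rightarrow> (1 / (2 * norm z)) * (norm (F x) * norm (\<psi> y)))"
    proof (rule AE_I2)
     fix p :: "real \<times> real"
     have "norm (green z (fst p - snd p)) * (norm (F (fst p)) * norm (\<psi> (snd p))) \<le> 1 / (2 * norm z) * (norm (F (fst p)) * norm (\<psi> (snd p)))"
      by (rule mult_right_mono[OF gb]) simp
     then show "norm (?f p) \<le> norm (case p of (x, y) \<Rightarrow> (1 / (2 * norm z)) * (norm (F x) * norm (\<psi> y)))"
      by (simp add: case_prod_unfold norm_mult mult.assoc)
    qed
   qed measurable
  qed
  have "(LBINT x. F x * \<phi> x) = (LBINT x. LBINT y. green z (x - y) * F x * \<psi> y)"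
   unfolding \<phi>(3) integral_mult_right_zero[symmetric] by (simp add: mult_ac)
  also have "\<dots> = (LBINT y. LBINT x. green z (x - y) * F x * \<psi> y)"
   using lborel_pair.Fubini_integral[OF i2] by simp
  also have "\<dots> = (LBINT y. G y * \<psi> y)" unfolding G_def integral_mult_left_zero ..
  finally show ?thesis using e1 by simp
 qed
 have loc: "set_integrable lborel {c..d} Y" "set_integrable lborel {c..d} G" for c d
 proof -
  have "(indicator {c..d} :: real \<Rightarrow> complex) \<in> L2"
  proof (cases "c \<le> d")
   case True
   then show ?thesis by (intro indicator_L2(1)) auto
  next
   case False
   then have "(indicator {c..d} :: real \<Rightarrow> complex) = (\<lambda>_. 0)" by (auto simp: fun_eq_iff indicator_def)
   then show ?thesis by (simp add: L2_def)
  qed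
  from Yt[OF this] show "set_integrable lborel {c..d} Y"
   unfolding set_integrable_def by (simp add: scaleR_conv_of_real mult.commute of_real_indicator)
  show "set_integrable lborel {c..d} G"
   unfolding set_integrable_def
   by (rule integrableI_bounded_set_indicator[where B="1 / (2 * norm z) * (LBINT x. norm (F x))"])
    (simp, simp, cases "c \<le> d", simp, simp, intro AE_I2 impI Gi)
 qed
 have "AE x in lebesgue. x \<in> UNIV \<longrightarrow> Y x - G x = 0"
 proof (rule fundamental_lemma[OF open_UNIV])
  fix c d :: real
  have "set_integrable lborel {c..d} (\<lambda>x. Y x - G x)" by (rule set_integral_diff(1)[OF loc])
  then show "set_integrable lebesgue {c..d} (\<lambda>x. Y x - G x)"
   unfolding set_integrable_def by (subst integrable_completion) auto
 next
  fix \<psi> :: "real \<Rightarrow> complex" assume \<psi>: "\<psi> \<in> \<D>"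
  have [measurable]: "\<psi> \<in> borel_fun" by (rule test_borel[OF \<psi>])
  have "integrable lborel (\<lambda>x. G x * \<psi> x)"
  proof (rule Bochner_Integration.integrable_bound)
   show "integrable lborel (\<lambda>x. (1 / (2 * norm z) * (LBINT x. norm (F x))) * norm (\<psi> x))"
    by (intro integrable_mult_right integrable_norm test_integrable \<psi>)
   show "AE x in lborel. norm (G x * \<psi> x) \<le> norm ((1 / (2 * norm z) * (LBINT x. norm (F x))) * norm (\<psi> x))"
   proof (rule AE_I2)
    fix x
    have "norm (G x * \<psi> x) \<le> (1 / (2 * norm z) * (LBINT x. norm (F x))) * norm (\<psi> x)"
     unfolding norm_mult by (rule mult_right_mono[OF Gi]) simp
    then show "norm (G x * \<psi> x) \<le> norm ((1 / (2 * norm z) * (LBINT x. norm (F x))) * norm (\<psi> x))"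
     by (metis abs_ge_self order_trans real_norm_def)
   qed
  qed measurable
  moreover have "integrable lborel (\<lambda>x. Y x * \<psi> x)" by (intro Yt test_L2 test_borel \<psi>)
  ultimately have "(LBINT x. (Y x - G x) * \<psi> x) = 0" using main[OF \<psi>] by (simp add: left_diff_distrib)
  then show "(LINT x|lebesgue. (Y x - G x) * \<psi> x) = 0" by (subst integral_completion) auto
 qed
 then show ?thesis unfolding AE_lebesgue by (simp add: G_def)
qed

text \<open>
 Energy \<open>E\<close> on \<open>{- R..R}\<close>: the source is bounded by the convolution of \<open>Z\<close> with \<open>B\<close> in the
 frequency, and \<open>Z\<close> by the convolution of the source with a kernel of norm \<open>1 / \<sigma>\<^sup>2\<close> in \<open>x\<close>. Two
 applications of Young's inequality give \<open>E \<le> (K / \<sigma>\<^sup>2)\<^sup>2 * E\<close>, with a factor smaller than 1.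
\<close>
lemma stationary_uniqueness:
 fixes Z F :: "real \<times> real \<Rightarrow> complex" and B :: "real \<Rightarrow> real"
 assumes [measurable]: "Z \<in> borel_fun2" "F \<in> borel_fun2" "B \<in> borel_fun"
  and B0: "\<And>x. 0 \<le> B x" and BK: "(NN x. ennreal (B x)) \<le> ennreal K" and K: "0 \<le> K" "K < \<sigma>\<^sup>2" and \<sigma>: "\<sigma> > 0"
  and E: "(NN l. NN x. indicator {- R..R} x * (enorm (Z (x, l)))\<^sup>2) < \<infinity>"
  and Z2: "AE l in lborel. (\<lambda>x. Z (x, l)) \<in> L2"
  and FB: "AE l in lborel. AE x in lborel. enorm (F (x, l)) \<le> indicator {- R..R} x * (NN m. ennreal (B (l - m)) * enorm (Z (x, m)))"
  and weak: "AE l in lborel. integrable lborel (\<lambda>x. F (x, l)) \<longrightarrow> (\<forall>\<psi>\<in>\<D>. (Complex l \<sigma>)\<^sup>2 * (LBINT x. Z (x, l) * \<psi> x) + (LBINT x. Z (x, l) * ddx (ddx \<psi>) x)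
   = (LBINT x. F (x, l) * \<psi> x))"
 shows "AE l in lborel. AE x in lborel. Z (x, l) = 0"
proof -
 let ?i = "indicator {- R..R} :: real \<Rightarrow> ennreal"
 let ?I = "\<lambda>x l. NN m. ennreal (B (l - m)) * enorm (Z (x, m))"
 define E0 where "E0 = (NN l. NN x. ?i x * (enorm (Z (x, l)))\<^sup>2)"
 have ii: "(?i x * c)\<^sup>2 = ?i x * c\<^sup>2" for x c by (auto simp: indicator_def)
 have F2: "(NN l. NN x. (enorm (F (x, l)))\<^sup>2) \<le> (ennreal K)\<^sup>2 * E0"
 proof -
  have "(NN l. NN x. (enorm (F (x, l)))\<^sup>2) \<le> (NN l. NN x. ?i x * (?I x l)\<^sup>2)"
  proof (rule nn_integral_mono_AE)
   show "AE l in lborel. (NN x. (enorm (F (x, l)))\<^sup>2) \<le> (NN x. ?i x * (?I x l)\<^sup>2)"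
    using FB
   proof eventually_elim
    case (elim l)
    show ?case
     by (rule nn_integral_mono_AE) (use elim in \<open>eventually_elim, subst ii[symmetric], intro power_mono; simp\<close>)
   qed
  qed
  also have "\<dots> = (NN x. NN l. ?i x * (?I x l)\<^sup>2)"
   by (rule lborel_pair.Fubini'[symmetric]) measurable
  also have "\<dots> \<le> (NN x. (ennreal K)\<^sup>2 * (NN m. ?i x * (enorm (Z (x, m)))\<^sup>2))"
  proof (rule nn_integral_mono)
   fix x
   have "(NN l. (?I x l)\<^sup>2) \<le> (NN x. ennreal (B x))\<^sup>2 * (NN m. (enorm (Z (x, m)))\<^sup>2)"
    by (rule Young_nn) (use B0 in measurable)
   also have "\<dots> \<le> (ennreal K)\<^sup>2 * (NN m. (enorm (Z (x, m)))\<^sup>2)"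
    by (intro mult_right_mono power_mono BK) auto
   finally have "?i x * (NN l. (?I x l)\<^sup>2) \<le> ?i x * ((ennreal K)\<^sup>2 * (NN m. (enorm (Z (x, m)))\<^sup>2))"
    by (rule mult_left_mono) simp
   then show "(NN l. ?i x * (?I x l)\<^sup>2) \<le> (ennreal K)\<^sup>2 * (NN m. ?i x * (enorm (Z (x, m)))\<^sup>2)"
    by (simp add: nn_integral_cmult mult.left_commute)
  qed
  also have "\<dots> = (ennreal K)\<^sup>2 * (NN x. (NN m. ?i x * (enorm (Z (x, m)))\<^sup>2))"
   by (rule nn_integral_cmult) measurable
  also have "(NN x. (NN m. ?i x * (enorm (Z (x, m)))\<^sup>2)) = E0"
   unfolding E0_def by (rule lborel_pair.Fubini') measurable
  finally show ?thesis .
 qed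
 obtain e where e: "E0 = ennreal e" "e \<ge> 0" using E unfolding E0_def[symmetric] by (cases E0) auto
 have F2_fin: "AE l in lborel. (NN x. (enorm (F (x, l)))\<^sup>2) \<noteq> \<infinity>"
 proof (rule nn_integral_PInf_AE)
  show "(NN l. NN x. (enorm (F (x, l)))\<^sup>2) \<noteq> \<infinity>"
   using F2 unfolding e by (auto simp: ennreal_power K ennreal_mult[symmetric] e(2) top_unique)
 qed measurable
 define kk where "kk t = exp (- \<sigma> * \<bar>t\<bar>) / (2 * \<sigma>)" for t
 have kk0: "kk t \<ge> 0" for t using \<sigma> by (simp add: kk_def)
 have [measurable]: "kk \<in> borel_fun" unfolding kk_def[abs_def] by measurable
 have kki: "(NN t. ennreal (kk t)) = ennreal (1 / \<sigma>\<^sup>2)"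
 proof -
  have "(NN t. ennreal (kk t)) = ennreal (LBINT t. kk t)"
   by (rule nn_integral_eq_integral) (use kk0 integrable_exp_abs(1)[OF \<sigma>] in \<open>auto simp: kk_def[abs_def]\<close>)
  also have "(LBINT t. kk t) = (2 / \<sigma>) / (2 * \<sigma>)"
   unfolding kk_def integral_divide_zero integrable_exp_abs(2)[OF \<sigma>] ..
  finally show ?thesis by (simp add: power2_eq_square)
 qed
 have Zb: "AE l in lborel. (NN y. (enorm (Z (y, l)))\<^sup>2) \<le> (ennreal (1 / \<sigma>\<^sup>2))\<^sup>2 * (NN x. (enorm (F (x, l)))\<^sup>2)"
  using Z2 FB weak F2_fin
 proof eventually_elim
  case (elim l)
  let ?z = "Complex l \<sigma>"
  have z: "Im ?z > 0" using \<sigma> by simp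
  have zn: "\<sigma> \<le> norm ?z" using abs_Im_le_cmod[of ?z] \<sigma> by simp
  have Fi: "integrable lborel (\<lambda>x. F (x, l))"
  proof (rule integrableI_bounded)
   have ae: "AE x in lborel. enorm (F (x, l)) = ?i x * enorm (F (x, l))"
    using elim(2) by eventually_elim (auto simp: indicator_def)
   have "(NN x. enorm (F (x, l))) = (NN x. ?i x * enorm (F (x, l)))"
    by (rule nn_integral_cong_AE[OF ae])
   also have "\<dots> \<le> (NN x. ?i x + (enorm (F (x, l)))\<^sup>2)"
   proof (rule nn_integral_mono)
    fix x
    have r: "r \<le> 1 + r\<^sup>2" if "0 \<le> r" for r :: real using zero_le_power2[of "r - 1"] that by (simp add: power2_diff)
    have "enorm (F (x, l)) \<le> ennreal (1 + (norm (F (x, l)))\<^sup>2)" by (rule ennreal_leI[OF r]) simp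
    also have "\<dots> = 1 + (enorm (F (x, l)))\<^sup>2" by (simp add: ennreal_power)
    finally show "?i x * enorm (F (x, l)) \<le> ?i x + (enorm (F (x, l)))\<^sup>2" by (auto simp: indicator_def)
   qed
   also have "\<dots> = emeasure lborel {- R..R} + (NN x. (enorm (F (x, l)))\<^sup>2)"
    by (subst nn_integral_add) auto
   also have "\<dots> < \<infinity>" using elim(4) by (cases "- R \<le> R") (auto simp: less_top)
   finally show "(NN x. enorm (F (x, l))) < \<infinity>" .
  qed measurable
  have rep: "AE y in lborel. Z (y, l) = (LBINT x. green ?z (x - y) * F (x, l))"
   by (rule green_representation[OF _ elim(1) Fi z]) (use elim(3) Fi in auto)
  have pt: "AE y in lborel. enorm (Z (y, l)) \<le> (NN x. ennreal (kk (y - x)) * enorm (F (x, l)))"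
   using rep
  proof eventually_elim
   case (elim y)
   have "enorm (Z (y, l)) \<le> (NN x. enorm (green ?z (x - y) * F (x, l)))"
    unfolding elim by (rule integral_norm_bound_ennreal)
     (rule Bochner_Integration.integrable_bound[OF integrable_mult_right[OF integrable_norm[OF Fi], of "1 / (2 * norm ?z)"]],
      use \<sigma> zn in \<open>auto intro!: AE_I2 mult_left_le_one_le divide_right_mono simp: norm_mult norm_green abs_mult\<close>)
   also have "\<dots> \<le> (NN x. ennreal (kk (y - x)) * enorm (F (x, l)))"
   proof (rule nn_integral_mono)
    fix x
    have "norm (green ?z (x - y)) \<le> kk (y - x)"
     unfolding norm_green kk_def using zn \<sigma> by (simp add: abs_minus_commute frac_le)
    then have "norm (green ?z (x - y) * F (x, l)) \<le> kk (y - x) * norm (F (x, l))" unfolding norm_mult by (rule mult_right_mono) simp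
    then show "enorm (green ?z (x - y) * F (x, l)) \<le> ennreal (kk (y - x)) * enorm (F (x, l))"
     using kk0 by (simp add: ennreal_mult[symmetric] ennreal_leI)
   qed
   finally show ?case .
  qed
  have "(NN y. (enorm (Z (y, l)))\<^sup>2) \<le> (NN y. (NN x. ennreal (kk (y - x)) * enorm (F (x, l)))\<^sup>2)"
   by (rule nn_integral_mono_AE) (use pt in \<open>eventually_elim, intro power_mono; simp\<close>)
  also have "\<dots> \<le> (NN t. ennreal (kk t))\<^sup>2 * (NN x. (enorm (F (x, l)))\<^sup>2)"
   by (rule Young_nn) (use kk0 in measurable)
  finally show ?case unfolding kki .
 qed
 let ?W = "NN l. NN y. (enorm (Z (y, l)))\<^sup>2"
 have "?W \<le> (NN l. (ennreal (1 / \<sigma>\<^sup>2))\<^sup>2 * (NN x. (enorm (F (x, l)))\<^sup>2))"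
  by (rule nn_integral_mono_AE[OF Zb])
 also have "\<dots> = (ennreal (1 / \<sigma>\<^sup>2))\<^sup>2 * (NN l. (NN x. (enorm (F (x, l)))\<^sup>2))"
  by (rule nn_integral_cmult) measurable
 also have "\<dots> \<le> (ennreal (1 / \<sigma>\<^sup>2))\<^sup>2 * ((ennreal K)\<^sup>2 * E0)" by (intro mult_left_mono F2) simp
 also have "\<dots> = ennreal ((K / \<sigma>\<^sup>2)\<^sup>2 * e)"
  unfolding e(1) using K e(2) by (simp add: ennreal_power ennreal_mult[symmetric] power_divide)
 finally have W: "?W \<le> ennreal ((K / \<sigma>\<^sup>2)\<^sup>2 * e)" .
 have "E0 \<le> ?W" unfolding E0_def by (intro nn_integral_mono) (auto simp: indicator_def)
 then have "ennreal e \<le> ennreal ((K / \<sigma>\<^sup>2)\<^sup>2 * e)" using W e(1) by auto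
 then have le: "e \<le> (K / \<sigma>\<^sup>2)\<^sup>2 * e" by (subst (asm) ennreal_le_iff) (use e in auto)
 have "(K / \<sigma>\<^sup>2)\<^sup>2 < 1" by (rule power_less_one_iff[THEN iffD2]) (use K \<sigma> in auto)
 then have "e = 0" using le e(2) mult_strict_right_mono[of "(K / \<sigma>\<^sup>2)\<^sup>2" 1 e] by (cases "e = 0") auto
 then have "?W = 0" using W by simp
 then have "AE l in lborel. (NN y. (enorm (Z (y, l)))\<^sup>2) = 0"
  by (subst (asm) nn_integral_0_iff_AE) auto
 then show ?thesis
 proof eventually_elim
  case (elim l)
  then have "AE y in lborel. (enorm (Z (y, l)))\<^sup>2 = 0" by (subst (asm) nn_integral_0_iff_AE) auto
  then show ?case by eventually_elim simp
 qed
qed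

section \<open>Transforms of the incoming and outgoing waves\<close>

lemma AE_lborel_interval_ex:
 fixes c d :: real
 assumes "AE x in lborel. P x" "c < d"
 obtains x where "c < x" "x < d" "P x"
proof (rule ccontr)
 assume n: "\<not> thesis"
 have "AE x in lborel. x \<notin> {c<..<d}" using assms(1) by eventually_elim (use that n in auto)
 then have "emeasure lborel {c<..<d} = 0" 
  by (subst (asm) AE_iff_measurable[of "{c<..<d}"]) auto
 with assms(2) show False by simp
qed

lemma fourier_cong_AE:
 assumes [measurable]: "p \<in> borel_fun" "q \<in> borel_fun" and "AE t in lborel. p t = q t"
 shows "fourier p z = fourier q z"
 unfolding fourier_lborel[OF assms(1)] fourier_lborel[OF assms(2)]
 by (rule integral_cong_AE) (use assms(3) in auto)

lemma fourier_shift: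
 assumes p: "p \<in> borel_fun"
 shows "fourier (\<lambda>t. p (t - s)) z = osc z s * fourier p z"
proof -
 note [measurable] = p
 have "fourier (\<lambda>t. p (t - s)) z = (LBINT t. p (t - s) * osc z t)" by (rule fourier_lborel) measurable
 also have "\<dots> = (LBINT t. p t * exp (\<i> * z * of_real (s + t)))"
  using lborel_integral_real_affine[of 1 "\<lambda>t. p (t - s) * osc z t" s] by simp
 also have "\<dots> = (LBINT t. osc z s * (p t * osc z t))"
  by (simp add: distrib_left exp_add mult_ac)
 finally show ?thesis unfolding fourier_lborel[OF p] by simp
qed

lemma causal_cong:
 assumes p: "causal c p" and [measurable]: "q \<in> borel_fun" and eq: "AE t in lborel. p t = q t"
 shows "causal c q"
proof -
 have [measurable]: "p \<in> borel_fun" using p by (simp add: causal_def)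
 have "AE t in lborel. t < c \<longrightarrow> p t = 0" using p by (simp add: causal_def)
 with eq have "AE t in lborel. t < c \<longrightarrow> q t = 0" by eventually_elim simp
 moreover have "integrable lborel (\<lambda>t. norm (q t) / wt t)"
  by (rule integrable_cong_AE_imp[of _ "\<lambda>t. norm (p t) / wt t"]) (use p eq in \<open>auto simp: causal_def\<close>)
 ultimately show ?thesis by (simp add: causal_def)
qed

lemma causal_shift:
 assumes p: "causal c p"
 shows "causal (c + s) (\<lambda>t. p (t - s))"
proof -
 have [measurable]: "p \<in> borel_fun" using p by (simp add: causal_def)
 have z: "AE t in lebesgue. t < c \<longrightarrow> p t = 0" using p by (simp add: causal_def AE_lebesgue)
 have z': "AE t in lborel. t < c + s \<longrightarrow> p (t - s) = 0"
  using AE_lebesgue_affine[OF _ z, of 1 "- s"] unfolding AE_lebesgue by (simp add: algebra_simps)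
 have i: "integrable lborel (\<lambda>t. norm (p t) / wt t)" using p by (simp add: causal_def)
 have w: "1 / (1 + (t + s)\<^sup>2)\<^sup>2 \<le> (2 * (1 + s\<^sup>2))\<^sup>2 * (1 / wt t)" for t
 proof -
  have "t\<^sup>2 \<le> 2 * (t + s)\<^sup>2 + 2 * s\<^sup>2" using zero_le_power2[of "t + 2 * s"] by (simp add: power2_eq_square algebra_simps)
  also have "1 + (2 * (t + s)\<^sup>2 + 2 * s\<^sup>2) \<le> 2 * (1 + s\<^sup>2) * (1 + (t + s)\<^sup>2)"
   using mult_nonneg_nonneg[OF zero_le_power2[of s] zero_le_power2[of "t + s"]] by (simp add: algebra_simps)
  finally have "1 + t\<^sup>2 \<le> 2 * (1 + s\<^sup>2) * (1 + (t + s)\<^sup>2)" by simp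
  then have "wt t \<le> (2 * (1 + s\<^sup>2) * (1 + (t + s)\<^sup>2))\<^sup>2" by (rule power_mono) (simp add: add_nonneg_nonneg)
  then have "wt t \<le> (2 * (1 + s\<^sup>2))\<^sup>2 * (1 + (t + s)\<^sup>2)\<^sup>2" by (simp only: power_mult_distrib)
  then show ?thesis using weight_pos[of t] weight_pos[of "t + s"] by (simp add: field_simps)
 qed
 have "integrable lborel (\<lambda>t. norm (p t) / (1 + (t + s)\<^sup>2)\<^sup>2)"
 proof (rule Bochner_Integration.integrable_bound[OF integrable_mult_right[OF i, of "(2 * (1 + s\<^sup>2))\<^sup>2"]])
  show "AE t in lborel. norm (norm (p t) / (1 + (t + s)\<^sup>2)\<^sup>2) \<le> norm ((2 * (1 + s\<^sup>2))\<^sup>2 * (norm (p t) / wt t))"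
  proof (rule AE_I2)
   fix t
   show "norm (norm (p t) / (1 + (t + s)\<^sup>2)\<^sup>2) \<le> norm ((2 * (1 + s\<^sup>2))\<^sup>2 * (norm (p t) / wt t))"
    using mult_left_mono[OF w[of t] norm_ge_zero[of "p t"]] by (simp add: abs_mult mult_ac)
  qed
 qed measurable
 from lborel_integrable_real_affine[OF this, of 1 "- s"]
 have "integrable lborel (\<lambda>t. norm (p (t - s)) / wt t)" by (simp add: algebra_simps)
 then show ?thesis using z' by (simp add: causal_def)
qed

lemma causal_mono: "causal c p \<Longrightarrow> d \<le> c \<Longrightarrow> causal d p"
 unfolding causal_def by (auto elim!: eventually_mono)

lemma causal_diff:
 assumes "causal c p" "causal c q"
 shows "causal c (\<lambda>t. p t - q t)"
proof -
 have [measurable]: "p \<in> borel_fun" "q \<in> borel_fun" using assms by (auto simp: causal_def)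
 have "integrable lborel (\<lambda>t. norm (p t) / wt t + norm (q t) / wt t)"
  using assms by (auto simp: causal_def)
 then have "integrable lborel (\<lambda>t. norm (p t - q t) / wt t)"
 proof (rule Bochner_Integration.integrable_bound)
  show "AE t in lborel. norm (norm (p t - q t) / wt t) \<le> norm (norm (p t) / wt t + norm (q t) / wt t)"
  proof (rule AE_I2)
   fix t :: real
   have "norm (p t - q t) / wt t \<le> (norm (p t) + norm (q t)) / wt t"
    by (intro divide_right_mono norm_triangle_ineq4) simp
   then show "norm (norm (p t - q t) / wt t) \<le> norm (norm (p t) / wt t + norm (q t) / wt t)"
    by (simp add: add_divide_distrib)
  qed
 qed measurable
 moreover have "AE t in lborel. t < c \<longrightarrow> p t = 0" "AE t in lborel. t < c \<longrightarrow> q t = 0" using assms by (auto simp: causal_def)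
 then have "AE t in lborel. t < c \<longrightarrow> p t - q t = 0" by eventually_elim simp
 ultimately show ?thesis by (simp add: causal_def)
qed

lemma causal_test:
 assumes g: "g \<in> \<D>" and z: "\<And>t. t < c \<Longrightarrow> g t = 0"
 shows "causal c g"
proof -
 have [measurable]: "g \<in> borel_fun" by (rule test_borel[OF g])
 have "integrable lborel (\<lambda>t. norm (g t) / wt t)"
 proof (rule Bochner_Integration.integrable_bound[OF integrable_norm[OF test_integrable[OF g]]])
  have w: "1 / wt t \<le> 1" for t :: real by (rule order_trans[OF weight_le[of t]]) (simp add: divide_le_eq add_pos_nonneg)
  have "norm (g t) / wt t \<le> norm (g t)" for t
   using mult_left_mono[OF w[of t], of "norm (g t)"] by simp
  then show "AE t in lborel. norm (norm (g t) / wt t) \<le> norm (norm (g t))" by simp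
 qed measurable
 then show ?thesis using z by (simp add: causal_def)
qed

text \<open>
 The support of \<open>g\<close> to the right of \<open>R\<close> gives the factor \<open>exp (- \<sigma> * R)\<close>, and two derivatives give
 square integrability of \<open>(z + \<i>) * fourier g z\<close> on lines.
\<close>
lemma fourier_test_mult_H:
 assumes g: "g \<in> \<D>" and z: "\<And>t. t \<le> R \<Longrightarrow> g t = 0"
 shows "fourier g \<in> mult_H (\<lambda>\<omega>. 1 / (\<omega> + \<i>)) (- R)"
proof -
 have hol: "fourier g holomorphic_on upper_half"
  by (rule causal_fourier_holomorphic[OF causal_test[OF g, of R]]) (use z in auto)
 have [measurable]: "g \<in> borel_fun" by (rule test_borel[OF g])
 obtain M0 where M0: "M0 > 0" "\<And>x. \<bar>x\<bar> > M0 \<Longrightarrow> g x = 0" using test_function_support[OF g] by metis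
 let ?g1 = "ddx g" and ?g2 = "ddx (ddx g)"
 have g1: "?g1 \<in> \<D>" and g2: "?g2 \<in> \<D>" by (intro test_dir_deriv g)+
 define b where "b = max (R + 1) M0"
 have gS: "g x \<noteq> 0 \<Longrightarrow> x \<in> {R..b}" for x using z[of x] M0(2)[of x] by (cases "x \<le> R"; cases "\<bar>x\<bar> > M0") (auto simp: b_def)
 have dS: "ddx f x \<noteq> 0 \<Longrightarrow> x \<in> {R..b}" if "f \<in> \<D>" "\<And>x. f x \<noteq> 0 \<Longrightarrow> x \<in> {R..b}" for f x
 proof -
  assume nz: "ddx f x \<noteq> 0"
  have "supp f \<subseteq> {R..b}" unfolding supp_def by (rule closure_minimal) (use that(2) in auto)
  moreover have "x \<in> supp f" using dir_deriv_in_supp nz by metis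
  ultimately show ?thesis by auto
 qed
 obtain C0 where C0: "C0 \<ge> 0" "\<And>x. norm (g x) \<le> C0" by (rule continuous_compact_supp_bounded[OF g]) (rule that)
 obtain C1 where C1: "C1 \<ge> 0" "\<And>x. norm (?g1 x) \<le> C1" by (rule continuous_compact_supp_bounded[OF g1]) (rule that)
 obtain C2 where C2: "C2 \<ge> 0" "\<And>x. norm (?g2 x) \<le> C2" by (rule continuous_compact_supp_bounded[OF g2]) (rule that)
 have R_b: "R \<le> b" by (simp add: b_def)
 define K where "K = (C0 + 2 * C1 + C2) * (b - R)"
 define h where "h w = (w + \<i>) * fourier g w" for w
 have pt: "exp (2 * \<sigma> * R) * (norm (h (Complex l \<sigma>)))\<^sup>2 \<le> K\<^sup>2 * (1 / (1 + l\<^sup>2))" if \<sigma>: "\<sigma> > 0" for l \<sigma>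
 proof -
  let ?w = "Complex l \<sigma>" and ?E = "exp (- \<sigma> * R)"
  have E: "exp (- Im ?w * x) \<le> ?E" if "x \<in> {R..b}" for x using that \<sigma> by simp
  have b0: "norm (fourier g ?w) \<le> C0 * ?E * (b - R)" by (rule fourier_test_norm_bound[OF g C0(2) gS E R_b])
  have b1: "norm (fourier ?g1 ?w) \<le> C1 * ?E * (b - R)" by (rule fourier_test_norm_bound[OF g1 C1(2) dS[OF g gS] E R_b])
  have b2: "norm (fourier ?g2 ?w) \<le> C2 * ?E * (b - R)" by (rule fourier_test_norm_bound[OF g2 C2(2) dS[OF g1 dS[OF g gS]] E R_b])
  have e1: "norm (fourier ?g1 ?w) = norm (?w * fourier g ?w)" by (simp add: fourier_test_deriv[OF g] norm_mult)
  have e2: "norm (fourier ?g2 ?w) = norm (?w * (?w * fourier g ?w))" by (simp add: fourier_test_deriv[OF g] fourier_test_deriv[OF g1] norm_mult)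
  have hh: "h ?w = ?w * fourier g ?w + \<i> * fourier g ?w" by (simp add: h_def distrib_right)
  have h1: "norm (h ?w) \<le> (C0 + C1) * ?E * (b - R)"
   using norm_triangle_ineq[of "?w * fourier g ?w" "\<i> * fourier g ?w"] b0 b1 unfolding hh e1 by (simp add: norm_mult algebra_simps)
  have "norm (?w * h ?w) \<le> (C1 + C2) * ?E * (b - R)"
   using norm_triangle_ineq[of "?w * (?w * fourier g ?w)" "\<i> * (?w * fourier g ?w)"] b1 b2 unfolding hh e1 e2
   by (simp add: norm_mult algebra_simps)
  moreover have "\<bar>l\<bar> * norm (h ?w) \<le> norm (?w * h ?w)" unfolding norm_mult using abs_Re_le_cmod[of ?w] by (intro mult_right_mono) auto
  ultimately have "norm (h ?w) + \<bar>l\<bar> * norm (h ?w) \<le> K * ?E" using h1 unfolding K_def by (simp add: algebra_simps)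
  then have "((1 + \<bar>l\<bar>) * norm (h ?w))\<^sup>2 \<le> (K * ?E)\<^sup>2" by (intro power_mono) (auto simp: algebra_simps)
  moreover have "(1 + l\<^sup>2) * (norm (h ?w))\<^sup>2 \<le> ((1 + \<bar>l\<bar>) * norm (h ?w))\<^sup>2"
   unfolding power_mult_distrib by (intro mult_right_mono) (auto simp: power2_sum)
  ultimately have "(1 + l\<^sup>2) * (norm (h ?w))\<^sup>2 \<le> K\<^sup>2 * ?E\<^sup>2" by (simp add: power_mult_distrib)
  then have "exp (2 * \<sigma> * R) * ((1 + l\<^sup>2) * (norm (h ?w))\<^sup>2) \<le> exp (2 * \<sigma> * R) * (K\<^sup>2 * ?E\<^sup>2)" by (rule mult_left_mono) simp
  also have "\<dots> = K\<^sup>2 * (exp (2 * \<sigma> * R) * ?E\<^sup>2)" by simp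
  also have "exp (2 * \<sigma> * R) * ?E\<^sup>2 = 1" unfolding power2_eq_square mult_exp_exp by simp
  finally have "(1 + l\<^sup>2) * (exp (2 * \<sigma> * R) * (norm (h ?w))\<^sup>2) \<le> K\<^sup>2" by (simp add: mult_ac)
  then show ?thesis by (simp add: field_simps add_pos_nonneg)
 qed
 have "h \<in> H (- R)"
 proof -
  have "h holomorphic_on upper_half" unfolding h_def[abs_def] by (intro holomorphic_intros hol)
  moreover have "H_norm_sq (- R) h < \<infinity>"
  proof -
   let ?L = "\<integral>\<^sup>+l. ennreal (K\<^sup>2 * (1 / (1 + l\<^sup>2))) \<partial>lebesgue"
   have "H_norm_sq (- R) h \<le> ?L"
    unfolding H_norm_sq_def
   proof (rule SUP_least)
    fix \<sigma> :: real assume "\<sigma> \<in> {0<..}"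
    then have \<sigma>: "\<sigma> > 0" by simp
    have cont: "continuous_on UNIV (\<lambda>l. fourier g (Complex l \<sigma>))"
     by (rule causal_line_continuous[OF causal_test[OF g, of R] \<sigma>]) (use z in auto)
    have "(\<lambda>l. h (Complex l \<sigma>)) \<in> borel_fun"
     unfolding h_def complex_eq by (intro borel_measurable_continuous_onI continuous_intros) (use cont in \<open>simp add: complex_eq\<close>)
    then have m: "(\<lambda>l. h (Complex l \<sigma>)) \<in> borel_measurable lebesgue" by (rule borel_lebesgue)
    have "ennreal (exp (- 2 * \<sigma> * - R)) * (\<integral>\<^sup>+l. ennreal ((norm (h (Complex l \<sigma>)))\<^sup>2) \<partial>lebesgue)
     = (\<integral>\<^sup>+l. ennreal (exp (- 2 * \<sigma> * - R)) * ennreal ((norm (h (Complex l \<sigma>)))\<^sup>2) \<partial>lebesgue)"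
     by (rule nn_integral_cmult[symmetric]) (use m in measurable)
    also have "\<dots> \<le> ?L"
     by (intro nn_integral_mono) (use pt[OF \<sigma>] in \<open>simp add: ennreal_mult[symmetric] ennreal_leI\<close>)
    finally show "ennreal (exp (- 2 * \<sigma> * - R)) * (\<integral>\<^sup>+l. ennreal ((norm (h (Complex l \<sigma>)))\<^sup>2) \<partial>lebesgue) \<le> ?L" .
   qed
   also have "?L = ennreal (LBINT l. K\<^sup>2 * (1 / (1 + l\<^sup>2)))"
    unfolding nn_integral_completion
    by (rule nn_integral_eq_integral) (use integrable_mult_right[OF integrable_inverse_square, of "K\<^sup>2"] in \<open>auto simp: add_nonneg_nonneg\<close>)
   finally show ?thesis by (auto simp: less_top[symmetric] top_unique)
  qed
  ultimately show ?thesis by (simp add: H_def)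
 qed
 moreover have "fourier g w = 1 / (w + \<i>) * h w" if "w \<in> upper_half" for w
 proof -
  have "w + \<i> \<noteq> 0" using that by (auto simp: complex_eq_iff)
  then show ?thesis by (simp add: h_def)
 qed
 ultimately show ?thesis unfolding mult_H_def by blast
qed

context wave_setting
begin

lemma profile_swap:
 fixes k :: "real \<Rightarrow> real \<Rightarrow> complex"
 assumes [measurable]: "(\<lambda>p. k (fst p) (snd p)) \<in> borel_fun2" "S \<in> sets borel"
  and eq: "\<And>t. AE x in lborel. x \<in> S \<longrightarrow> u t x = k t x"
 shows "AE x in lborel. x \<in> S \<longrightarrow> (AE t in lborel. u1 (t, x) = k t x)"
proof -
 have [measurable]: "u1 \<in> borel_fun2" using joint_versionD(1)[OF u1] by (simp add: borel_prod)
 have "AE p in lborel. snd p \<in> S \<longrightarrow> u1 p = k (fst p) (snd p)"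
 proof (rule AE_lborel_pairI)
  have "Measurable.pred (borel \<Otimes>\<^sub>M borel) (\<lambda>p. snd p \<in> S \<longrightarrow> u1 p = k (fst p) (snd p))" by measurable
  then show "{p. snd p \<in> S \<longrightarrow> u1 p = k (fst p) (snd p)} \<in> sets borel" unfolding borel_prod pred_def by simp
  show "AE t in lborel. AE x in lborel. snd (t, x) \<in> S \<longrightarrow> u1 (t, x) = k (fst (t, x)) (snd (t, x))"
   using joint_versionD(2)[OF u1]
  proof eventually_elim
   case (elim t)
   with eq[of t] show ?case by eventually_elim auto
  qed
 qed
 from AE_lborel_pairD(2)[OF this] show ?thesis
  by eventually_elim (auto elim: eventually_mono)
qed

text \<open>
 Passing from the identity for every \<open>t\<close> to one for almost every \<open>x\<close>. That the profile is causal is seen at a single point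
 \<open>x0\<close> slightly to the right of \<open>R\<close>, where the profile is a time translate of the solution.
\<close>
lemma right_transform:
 obtains h where "causal (- R) h" "\<And>t. AE x in lebesgue. x > R \<longrightarrow> u t x = h (t - x)"
  "AE x in lborel. x > R \<longrightarrow> (\<forall>z. U x z = fourier h z * osc z x)"
proof -
 obtain h0 where h0: "h0 \<in> borel_measurable lebesgue" "AE s in lebesgue. s < - R \<longrightarrow> h0 s = 0"
  "\<And>t. AE x in lebesgue. x > R \<longrightarrow> u t x = h0 (t - x)" by (rule right_profile) (rule that)
 obtain h where h: "h \<in> borel_fun" "AE s in lborel. h0 s = h s" using borel_version[OF h0(1)] by (elim bexE) (rule that)
 note [measurable] = h(1)
 have eq: "AE x in lebesgue. x > R \<longrightarrow> u t x = h (t - x)" for t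
  using h0(3)[of t] AE_lebesgue_affine[of "-1" "\<lambda>s. h0 s = h s" t] h(2)[folded AE_lebesgue] by (auto elim!: eventually_elim2)
 have sw: "AE x in lborel. x \<in> {R<..} \<longrightarrow> (AE t in lborel. u1 (t, x) = h (t - x))"
  by (rule profile_swap[of "\<lambda>t x. h (t - x)"]) (use eq[unfolded AE_lebesgue] in auto)
 have [measurable]: "u1 \<in> borel_fun2" using joint_versionD(1)[OF u1] by (simp add: borel_prod)
 obtain x0 where x0: "R < x0" "x0 < R + 1" "AE t in lborel. u1 (t, x0) = h (t - x0)" "causal (- (R + 1)) (\<lambda>t. u1 (t, x0))"
 proof -
  have M: "R + 1 > 0" using R by simp
  have "AE x in lborel. (x \<in> {R<..} \<longrightarrow> (AE t in lborel. u1 (t, x) = h (t - x))) \<and> (x \<in> {- (R + 1)<..<R + 1} \<longrightarrow> causal (- (R + 1)) (\<lambda>t. u1 (t, x)))"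
   using sw AE_transform_relation_line[OF M zero_less_one] by eventually_elim auto
  from AE_lborel_interval_ex[OF this, of R "R + 1"] obtain x where "R < x" "x < R + 1"
   "(x \<in> {R<..} \<longrightarrow> (AE t in lborel. u1 (t, x) = h (t - x))) \<and> (x \<in> {- (R + 1)<..<R + 1} \<longrightarrow> causal (- (R + 1)) (\<lambda>t. u1 (t, x)))"
   by auto
  then show ?thesis using that[of x] R by auto
 qed
 have "causal (- (R + 1)) (\<lambda>t. h (t - x0))" by (rule causal_cong[OF x0(4) _ x0(3)]) measurable
 from causal_shift[OF this, of "- x0"] have "causal (- (R + 1) - x0) h" by simp
 moreover have "AE s in lborel. s < - R \<longrightarrow> h s = 0" using h0(2)[unfolded AE_lebesgue] h(2) by eventually_elim simp
 ultimately have c: "causal (- R) h" by (simp add: causal_def)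
 have "AE x in lborel. x > R \<longrightarrow> (\<forall>z. U x z = fourier h z * osc z x)"
  using sw
 proof eventually_elim
  case (elim x)
  show ?case
  proof (intro impI allI)
   fix z assume "x > R"
   with elim have "AE t in lborel. u1 (t, x) = h (t - x)" by simp
   then have "U x z = fourier (\<lambda>t. h (t - x)) z" unfolding U_def by (intro fourier_cong_AE) measurable
   then show "U x z = fourier h z * osc z x" by (simp add: fourier_shift[OF h(1)] mult.commute)
  qed
 qed
 then show ?thesis by (rule that[OF c eq])
qed

lemma left_transform:
 obtains h where "causal (- R) h" "\<And>t. AE x in lebesgue. x < - R \<longrightarrow> u t x = g (t - x) + h (x + t)"
  "AE x in lborel. x < - R \<longrightarrow> (\<forall>z. Im z > 0 \<longrightarrow> U x z = fourier g z * osc z x + fourier h z * exp (- \<i> * z * of_real x))"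
proof -
 obtain h0 where h0: "h0 \<in> borel_measurable lebesgue" "AE s in lebesgue. s < - R \<longrightarrow> h0 s = 0"
  "\<And>t. AE x in lebesgue. x < - R \<longrightarrow> u t x = g (t - x) + h0 (x + t)" by (rule left_profile) (rule that)
 obtain h where h: "h \<in> borel_fun" "AE s in lborel. h0 s = h s" using borel_version[OF h0(1)] by (elim bexE) (rule that)
 note [measurable] = h(1) test_borel[OF g]
 have eq: "AE x in lebesgue. x < - R \<longrightarrow> u t x = g (t - x) + h (x + t)" for t
  using h0(3)[of t] AE_lebesgue_affine[of 1 "\<lambda>s. h0 s = h s" t] h(2)[folded AE_lebesgue] by (auto elim!: eventually_elim2 simp: add.commute)
 have sw: "AE x in lborel. x \<in> {..<- R} \<longrightarrow> (AE t in lborel. u1 (t, x) = g (t - x) + h (x + t))"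
  by (rule profile_swap[of "\<lambda>t x. g (t - x) + h (x + t)"]) (use eq[unfolded AE_lebesgue] in auto)
 have [measurable]: "u1 \<in> borel_fun2" using joint_versionD(1)[OF u1] by (simp add: borel_prod)
 have gc: "causal R g" by (rule causal_test[OF g]) (use g_zero in auto)
 obtain x0 where x0: "- (R + 1) < x0" "x0 < - R" "AE t in lborel. u1 (t, x0) = g (t - x0) + h (x0 + t)" "causal (- (R + 1)) (\<lambda>t. u1 (t, x0))"
 proof -
  have M: "R + 1 > 0" using R by simp
  have "AE x in lborel. (x \<in> {..<- R} \<longrightarrow> (AE t in lborel. u1 (t, x) = g (t - x) + h (x + t))) \<and> (x \<in> {- (R + 1)<..<R + 1} \<longrightarrow> causal (- (R + 1)) (\<lambda>t. u1 (t, x)))"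
   using sw AE_transform_relation_line[OF M zero_less_one] by eventually_elim auto
  from AE_lborel_interval_ex[OF this, of "- (R + 1)" "- R"] obtain x where "- (R + 1) < x" "x < - R"
   "(x \<in> {..<- R} \<longrightarrow> (AE t in lborel. u1 (t, x) = g (t - x) + h (x + t))) \<and> (x \<in> {- (R + 1)<..<R + 1} \<longrightarrow> causal (- (R + 1)) (\<lambda>t. u1 (t, x)))"
   by auto
  then show ?thesis using that[of x] R by auto
 qed
 have "causal (- (R + 1)) (\<lambda>t. g (t - x0))" by (rule causal_mono[OF causal_shift[OF gc, of x0]]) (use x0 R in auto)
 from causal_diff[OF x0(4) this] have "causal (- (R + 1)) (\<lambda>t. h (x0 + t))"
  by (rule causal_cong) (use x0(3) in \<open>auto elim: eventually_mono\<close>)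
 from causal_shift[OF this, of x0] have "causal (- (R + 1) + x0) h" by simp
 moreover have "AE s in lborel. s < - R \<longrightarrow> h s = 0" using h0(2)[unfolded AE_lebesgue] h(2) by eventually_elim simp
 ultimately have c: "causal (- R) h" by (simp add: causal_def)
 have "AE x in lborel. x < - R \<longrightarrow> (\<forall>z. Im z > 0 \<longrightarrow> U x z = fourier g z * osc z x + fourier h z * exp (- \<i> * z * of_real x))"
  using sw
 proof eventually_elim
  case (elim x)
  show ?case
  proof (intro impI allI)
   fix z :: complex assume "x < - R" and z: "Im z > 0"
   with elim have ae: "AE t in lborel. u1 (t, x) = g (t - x) + h (t - (- x))" by (auto simp: add.commute)
   have "U x z = fourier (\<lambda>t. g (t - x) + h (t - (- x))) z" unfolding U_def by (rule fourier_cong_AE[OF _ _ ae]) measurable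
   also have "\<dots> = (LBINT t. g (t - x) * osc z t + h (t - (- x)) * osc z t)"
    by (subst fourier_lborel) (auto simp: distrib_right)
   also have "\<dots> = (LBINT t. g (t - x) * osc z t) + (LBINT t. h (t - (- x)) * osc z t)"
    by (intro Bochner_Integration.integral_add causal_integrable[OF causal_shift[OF gc] z] causal_integrable[OF causal_shift[OF c] z])
   also have "\<dots> = fourier (\<lambda>t. g (t - x)) z + fourier (\<lambda>t. h (t - (- x))) z"
    by (subst (1 2) fourier_lborel) auto
   finally show "U x z = fourier g z * osc z x + fourier h z * exp (- \<i> * z * of_real x)"
    unfolding fourier_shift[OF test_borel[OF g]] fourier_shift[OF h(1)] by (simp add: mult.commute)
  qed
 qed
 then show ?thesis by (rule that[OF c eq])
qed

end

section \<open>Comparison with the scattering solution\<close>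

lemma L2I:
 assumes [measurable]: "f \<in> borel_fun" and fin: "(NN x. (enorm (f x))\<^sup>2) < \<infinity>"
 shows "f \<in> L2"
proof -
 have "integrable lborel (\<lambda>x. (norm (f x))\<^sup>2)"
  by (rule integrableI_bounded) (use fin in \<open>simp_all add: ennreal_power\<close>)
 then show ?thesis by (simp add: L2_def borel_lebesgue integrable_completion)
qed

lemma continuous_AE_0:
 fixes f :: "real \<Rightarrow> complex"
 assumes f: "continuous_on UNIV f" and ae: "AE x in lborel. f x = 0"
 shows "f x = 0"
proof (rule ccontr)
 assume "f x \<noteq> 0"
 moreover have "open (f -` (- {0}))" by (rule open_vimage[OF _ f]) auto
 ultimately obtain e where e: "e > 0" "ball x e \<subseteq> f -` (- {0})" by (metis ComplI open_contains_ball singletonD vimageI2)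
 obtain y where y: "x < y" "y < x + e" "f y = 0" using AE_lborel_interval_ex[OF ae, of x "x + e"] e(1) by auto
 then have "y \<in> ball x e" by (simp add: dist_real_def)
 with e(2) y(3) show False by auto
qed

lemma inverse_norm_line_bound:
 assumes "\<sigma> > 0"
 shows "1 / (norm (Complex l \<sigma>))\<^sup>2 \<le> (1 + 1 / \<sigma>\<^sup>2) * (1 / (1 + l\<^sup>2))"
proof -
 have "1 + l\<^sup>2 \<le> (1 + 1 / \<sigma>\<^sup>2) * (l\<^sup>2 + \<sigma>\<^sup>2)" using assms by (simp add: field_simps)
 moreover have "(norm (Complex l \<sigma>))\<^sup>2 = l\<^sup>2 + \<sigma>\<^sup>2" by (simp add: cmod_def)
 moreover have "0 < l\<^sup>2 + \<sigma>\<^sup>2" "0 < 1 + l\<^sup>2" using assms by (auto simp: add_nonneg_pos add_pos_nonneg)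
 ultimately show ?thesis by (simp add: divide_le_eq le_divide_eq mult.commute)
qed

lemma inverse_square_nn: "(NN l. ennreal (c * (1 / (1 + l\<^sup>2)))) < \<infinity>" if "c \<ge> 0" for c :: real
proof -
 have "(NN l. ennreal (c * (1 / (1 + l\<^sup>2)))) = ennreal (LBINT l. c * (1 / (1 + l\<^sup>2)))"
  by (rule nn_integral_eq_integral) (use integrable_mult_right[OF integrable_inverse_square, of c] that in \<open>auto simp: add_nonneg_nonneg\<close>)
 then show ?thesis by simp
qed

text \<open>
 A jointly measurable representative on the line is needed for Tonelli. Multiplication with a cutoff that equals 1 on \<open>{- R..R}\<close> makes
 the norm of \<open>HH\<close> available.
\<close>
lemma mult_HH_inf_loc_line:
 assumes V: "V \<in> mult_HH_inf_loc (\<lambda>\<omega>. 1 / \<omega>)" and \<sigma>: "\<sigma> > 0"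
 obtains V1 where "V1 \<in> borel_fun2"
  "AE x in lborel. x \<in> {- R..R} \<longrightarrow> (\<forall>l. V x (Complex l \<sigma>) = V1 (x, l))"
  "(NN l. NN x. (enorm (V1 (x, l)))\<^sup>2) < \<infinity>"
proof -
 obtain h where h: "h \<in> HH_inf_loc" "\<And>x w. w \<in> upper_half \<Longrightarrow> V x w = 1 / w * h x w"
  using V unfolding mult_HH_inf_loc_def by blast
 define \<eta> where "\<eta> = bump 1 (- R - 1) (R + 1)"
 have \<eta>: "\<eta> \<in> \<D>" unfolding \<eta>_def by (rule bump_test) simp
 have \<eta>1: "\<eta> x = 1" if "x \<in> {- R..R}" for x using that by (simp add: \<eta>_def bump_def smooth_step_1)
 from h(1) \<eta> obtain \<alpha> where \<alpha>: "(\<lambda>x w. \<eta> x * h x w) \<in> HH \<alpha>" unfolding HH_inf_loc_def HH_inf_def by blast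
 let ?z = "\<lambda>l. Complex l \<sigma>"
 have m: "(\<lambda>x. \<eta> x * h x (?z l)) \<in> borel_measurable lebesgue" for l using \<alpha> \<sigma> by (simp add: HH_def)
 have "h x holomorphic_on upper_half" for x using h(1) by (simp add: HH_inf_loc_def)
 then have hc: "continuous_on upper_half (h x)" for x by (rule holomorphic_on_imp_continuous_on)
 have c: "continuous_on UNIV (\<lambda>l. \<eta> x * h x (?z l))" for x
  by (intro continuous_intros continuous_on_compose2[OF hc]) (use \<sigma> in \<open>auto simp: Complex_eq intro!: continuous_intros\<close>)
 obtain H1 where H1: "H1 \<in> borel_fun" "AE x in lborel. \<forall>l. \<eta> x * h x (?z l) = H1 (x, l)"
  by (rule Caratheodory_version[of "\<lambda>x l. \<eta> x * h x (?z l)", OF m]) (use c that in auto)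
 have [measurable]: "H1 \<in> borel_fun2" using H1(1) by (simp add: borel_prod)
 have zb: "?z \<in> borel_fun" unfolding Complex_eq by measurable
 note [measurable] = zb
 define V1 where "V1 p = 1 / ?z (snd p) * H1 p" for p
 have V1m: "V1 \<in> borel_fun2" unfolding V1_def[abs_def] by measurable
 have fin: "(NN l. NN x. (enorm (H1 (x, l)))\<^sup>2) < \<infinity>"
 proof -
  let ?X = "\<integral>\<^sup>+l. (\<integral>\<^sup>+x. ennreal ((norm (\<eta> x * h x (?z l)))\<^sup>2) \<partial>lebesgue) \<partial>lebesgue"
  let ?t = "\<lambda>s. ennreal (exp (- 2 * s * \<alpha>)) * (\<integral>\<^sup>+l. (\<integral>\<^sup>+x. ennreal ((norm (\<eta> x * h x (Complex l s)))\<^sup>2) \<partial>lebesgue) \<partial>lebesgue)"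
  have "?t \<sigma> \<le> (SUP s\<in>{0<..}. ?t s)" by (rule SUP_upper) (use \<sigma> in simp)
  also have "\<dots> < \<infinity>" using \<alpha> by (simp add: HH_def)
  finally have "?t \<sigma> < \<infinity>" .
  then have X: "?X < \<infinity>" by (auto simp: ennreal_mult_less_top)
  have "?X = (NN l. NN x. (enorm (H1 (x, l)))\<^sup>2)"
   unfolding nn_integral_completion
  proof (rule nn_integral_cong, rule nn_integral_cong_AE)
   fix l
   show "AE x in lborel. ennreal ((norm (\<eta> x * h x (?z l)))\<^sup>2) = (enorm (H1 (x, l)))\<^sup>2"
    using H1(2) by eventually_elim (simp add: ennreal_power)
  qed
  with X show ?thesis by simp
 qed
 have V1b: "(enorm (V1 (x, l)))\<^sup>2 \<le> ennreal (1 / \<sigma>\<^sup>2) * (enorm (H1 (x, l)))\<^sup>2" for x l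
 proof -
  have zn: "\<sigma> \<le> norm (?z l)" using abs_Im_le_cmod[of "?z l"] \<sigma> by simp
  have "(norm (V1 (x, l)))\<^sup>2 = 1 / (norm (?z l))\<^sup>2 * (norm (H1 (x, l)))\<^sup>2" by (simp add: V1_def norm_divide power_divide)
  also have "\<dots> \<le> 1 / \<sigma>\<^sup>2 * (norm (H1 (x, l)))\<^sup>2"
   using zn \<sigma> by (intro mult_right_mono frac_le power_mono) auto
  finally show ?thesis by (simp add: ennreal_power ennreal_mult[symmetric] ennreal_leI)
 qed
 have "(NN l. NN x. (enorm (V1 (x, l)))\<^sup>2) \<le> (NN l. NN x. ennreal (1 / \<sigma>\<^sup>2) * (enorm (H1 (x, l)))\<^sup>2)"
  by (intro nn_integral_mono V1b)
 also have "\<dots> = ennreal (1 / \<sigma>\<^sup>2) * (NN l. NN x. (enorm (H1 (x, l)))\<^sup>2)"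
  by (subst nn_integral_cmult[symmetric], measurable) (subst nn_integral_cmult, auto)
 also have "\<dots> < \<infinity>" using fin by (simp add: ennreal_mult_less_top)
 finally have "(NN l. NN x. (enorm (V1 (x, l)))\<^sup>2) < \<infinity>" .
 moreover have "AE x in lborel. x \<in> {- R..R} \<longrightarrow> (\<forall>l. V x (?z l) = V1 (x, l))"
  using H1(2) by eventually_elim (use \<sigma> \<eta>1 in \<open>auto simp: h(2) V1_def\<close>)
 ultimately show ?thesis using that V1m by blast
qed

context wave_version
begin

definition a_hat :: "real \<times> real \<Rightarrow> complex" where
 "a_hat p = (LBINT t. a1 (fst p, t) * exp (\<i> * of_real (snd p) * of_real t))"

lemma a_hat_borel [measurable]: "a_hat \<in> borel_fun2"
 unfolding a_hat_def[abs_def] by measurable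

lemma a_hat_bound:
 obtains C where "C \<ge> 0" "AE x in lborel. \<forall>s. fourier (a x) (of_real s) = a_hat (x, s) \<and> norm (a_hat (x, s)) \<le> indicator {- R..R} x * (C * (1 / (1 + s\<^sup>2)))"
proof -
 obtain C0 C2 where C: "C0 \<ge> 0" "C2 \<ge> 0" and reg: "AE x in lborel. a x \<in> \<D> \<and> (\<forall>t. (x, t) \<notin> {- R..R} \<times> {- T0..T0} \<longrightarrow> a x t = 0)
  \<and> (\<forall>t. norm (a x t) \<le> C0) \<and> (\<forall>t. norm (ddx (ddx (a x)) t) \<le> C2)"
  by (rule a_regular) (rule that)
 show ?thesis
 proof (rule that[of "2 * T0 * (C0 + C2)"])
  show "0 \<le> 2 * T0 * (C0 + C2)" using C T0 by simp
  show "AE x in lborel. \<forall>s. fourier (a x) (of_real s) = a_hat (x, s) \<and> norm (a_hat (x, s)) \<le> indicator {- R..R} x * (2 * T0 * (C0 + C2) * (1 / (1 + s\<^sup>2)))"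
   using reg a1_eq
  proof eventually_elim
   case (elim x)
   have ax: "a x = (\<lambda>t. a1 (x, t))" using elim(2) by auto
   have eq: "fourier (a x) (of_real s) = a_hat (x, s)" for s
    unfolding ax a_hat_def by (subst fourier_lborel) auto
   have "norm (a_hat (x, s)) \<le> indicator {- R..R} x * (2 * T0 * (C0 + C2) * (1 / (1 + s\<^sup>2)))" for s
   proof (cases "x \<in> {- R..R}")
    case True
    have "norm (fourier (a x) (of_real s)) \<le> 2 * T0 * (C0 + C2) / (1 + s\<^sup>2)"
     by (rule fourier_test_decay[OF _ _ T0]) (use elim(1) in auto)
    then show ?thesis using True by (simp add: eq)
   next
    case False
    then have "a x = (\<lambda>_. 0)" using elim(1) by auto
    then show ?thesis unfolding eq[symmetric] using False by (simp add: fourier_zero)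
   qed
   with eq show ?case by auto
  qed
 qed
qed

text \<open>
 The time derivative has a bounded transform, and dividing it by \<open>- \<i> * z\<close> yields the decay that makes \<open>U\<close> square
 integrable along the line.
\<close>
lemma U_line_bound:
 assumes \<sigma>: "\<sigma> > 0"
 obtains w where "w \<in> borel_fun" "\<And>x. 0 \<le> w x" "(NN x. ennreal (indicator {- R..R} x * (w x)\<^sup>2)) < \<infinity>"
  "AE x in lborel. x \<in> {- R..R} \<longrightarrow> (\<forall>l. norm (U x (Complex l \<sigma>)) \<le> w x / norm (Complex l \<sigma>))"
proof -
 have M: "R + 1 > 0" using R by simp
 obtain B where "growing_curve ut ut1 (R + 1) B" by (rule growing[OF M]) (rule that)
 then interpret gt: growing_curve ut ut1 "R + 1" B .
 obtain C where C: "C \<ge> 0" "AE x in lborel. x \<in> {- (R + 1)..R + 1} \<longrightarrow> (\<forall>z. Im z = \<sigma> \<longrightarrow> norm (fourier (\<lambda>t. ut1 (t, x)) z) \<le> C * gt.weighted_norm x)"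
  by (rule gt.transform_bound[OF \<sigma>]) (rule that)
 show ?thesis
 proof (rule that[of "\<lambda>x. C * gt.weighted_norm x"])
  show "(\<lambda>x. C * gt.weighted_norm x) \<in> borel_fun" by measurable
  show "0 \<le> C * gt.weighted_norm x" for x using C(1) gt.weighted_norm_nonneg by simp
  have i: "integrable lborel (\<lambda>x. C\<^sup>2 * (indicator {- (R + 1)..R + 1} x * (gt.weighted_norm x)\<^sup>2))"
   by (intro integrable_mult_right gt.weighted_norm_L2)
  have "(NN x. ennreal (indicator {- R..R} x * (C * gt.weighted_norm x)\<^sup>2))
   \<le> (NN x. ennreal (C\<^sup>2 * (indicator {- (R + 1)..R + 1} x * (gt.weighted_norm x)\<^sup>2)))"
   by (intro nn_integral_mono ennreal_leI) (auto simp: indicator_def power_mult_distrib)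
  also have "\<dots> = ennreal (LBINT x. C\<^sup>2 * (indicator {- (R + 1)..R + 1} x * (gt.weighted_norm x)\<^sup>2))"
   by (rule nn_integral_eq_integral[OF i]) simp
  finally show "(NN x. ennreal (indicator {- R..R} x * (C * gt.weighted_norm x)\<^sup>2)) < \<infinity>"
   by (rule order_le_less_trans) simp
  show "AE x in lborel. x \<in> {- R..R} \<longrightarrow> (\<forall>l. norm (U x (Complex l \<sigma>)) \<le> C * gt.weighted_norm x / norm (Complex l \<sigma>))"
   using C(2) AE_transform_relation_line[OF M \<sigma>]
  proof eventually_elim
   case (elim x)
   show ?case
   proof (intro impI allI)
    fix l assume x: "x \<in> {- R..R}"
    let ?z = "Complex l \<sigma>"
    have zn: "norm ?z > 0" using \<sigma> by (simp add: complex_eq_iff)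
    have "Ut x ?z = - \<i> * ?z * U x ?z" using elim(2) x by auto
    then have "norm ?z * norm (U x ?z) = norm (Ut x ?z)" by (simp add: norm_mult)
    also have "\<dots> \<le> C * gt.weighted_norm x" unfolding Ut_def using elim(1) x by auto
    finally show "norm (U x ?z) \<le> C * gt.weighted_norm x / norm ?z" using zn by (simp add: le_divide_eq mult.commute)
   qed
  qed
 qed
qed

end

text \<open>
 The transform \<open>U\<close> of the solution of the wave equation side by side with a scattering solution \<open>V\<close> that has the same
 incoming wave.
\<close>
locale wave_scattering = wave_version +
 fixes r \<tau> :: "complex \<Rightarrow> complex" and hR hT :: "real \<Rightarrow> complex" and V :: "real \<Rightarrow> complex \<Rightarrow> complex"
 assumes r_holo: "r holomorphic_on upper_half" and \<tau>_holo: "\<tau> holomorphic_on upper_half"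
  and scat: "scattering_solution R a \<gamma> (fourier g) r \<tau> V"
  and hR: "causal (- R) hR" and hT: "causal (- R) hT"
  and right: "AE x in lborel. x > R \<longrightarrow> (\<forall>z. U x z = fourier hT z * osc z x)"
  and left: "AE x in lborel. x < - R \<longrightarrow> (\<forall>z. Im z > 0 \<longrightarrow> U x z = fourier g z * osc z x + fourier hR z * exp (- \<i> * z * of_real x))"

context wave_scattering
begin

lemma line_continuous:
 assumes "\<sigma> > 0"
 shows "continuous_on UNIV (\<lambda>l. r (Complex l \<sigma>) - fourier hR (Complex l \<sigma>))" "continuous_on UNIV (\<lambda>l. \<tau> (Complex l \<sigma>) - fourier hT (Complex l \<sigma>))"
proof -
 have c: "continuous_on upper_half r" "continuous_on upper_half \<tau>" using r_holo \<tau>_holo by (auto intro: holomorphic_on_imp_continuous_on)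
 have z: "continuous_on UNIV (\<lambda>l. Complex l \<sigma>)" unfolding Complex_eq by (intro continuous_intros)
 show "continuous_on UNIV (\<lambda>l. r (Complex l \<sigma>) - fourier hR (Complex l \<sigma>))"
  by (intro continuous_intros continuous_on_compose2[OF c(1) z] causal_line_continuous[OF hR assms]) (use assms in auto)
 show "continuous_on UNIV (\<lambda>l. \<tau> (Complex l \<sigma>) - fourier hT (Complex l \<sigma>))"
  by (intro continuous_intros continuous_on_compose2[OF c(2) z] causal_line_continuous[OF hT assms]) (use assms in auto)
qed

text \<open>
 The incoming waves cancel outside \<open>{- R..R}\<close>, so that the difference is there a multiple of an exponential that decays as
 \<open>\<bar>x\<bar>\<close> grows.
\<close>
lemma line_difference:
 assumes \<sigma>: "\<sigma> > 0"
 obtains Z where "Z \<in> borel_fun2"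
  "AE x in lborel. \<forall>l. V x (Complex l \<sigma>) = Z (x, l) + U x (Complex l \<sigma>)"
  "(NN l. NN x. indicator {- R..R} x * (enorm (Z (x, l)))\<^sup>2) < \<infinity>"
  "AE l in lborel. (\<lambda>x. Z (x, l)) \<in> L2"
  "AE x in lborel. x \<in> {- R..R} \<longrightarrow> (\<lambda>l. Z (x, l)) \<in> L2 \<and> (\<lambda>l. U x (Complex l \<sigma>)) \<in> L2 \<inter> borel_fun"
  "\<And>x l. x < - R \<Longrightarrow> Z (x, l) = (r (Complex l \<sigma>) - fourier hR (Complex l \<sigma>)) * exp (- \<i> * Complex l \<sigma> * of_real x)"
  "\<And>x l. x > R \<Longrightarrow> Z (x, l) = (\<tau> (Complex l \<sigma>) - fourier hT (Complex l \<sigma>)) * exp (\<i> * Complex l \<sigma> * of_real x)"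
proof -
 define z where "z l = Complex l \<sigma>" for l
 have z[simp]: "Im (z l) = \<sigma>" "Re (z l) = l" for l by (simp_all add: z_def)
 have zp: "norm (z l) > 0" for l using \<sigma> by (simp add: z_def complex_eq_iff)
 have z_borel [measurable]: "z \<in> borel_fun" unfolding z_def[abs_def] Complex_eq by measurable
 have [measurable]: "u1 \<in> borel_fun2" using joint_versionD(1)[OF u1] by (simp add: borel_prod)
 obtain w where w: "w \<in> borel_fun" "\<And>x. 0 \<le> w x" "(NN x. ennreal (indicator {- R..R} x * (w x)\<^sup>2)) < \<infinity>"
  "AE x in lborel. x \<in> {- R..R} \<longrightarrow> (\<forall>l. norm (U x (z l)) \<le> w x / norm (z l))"
  by (rule U_line_bound[OF \<sigma>, folded z_def]) (rule that)
 have Vloc: "V \<in> mult_HH_inf_loc (\<lambda>\<omega>. 1 / \<omega>)" using scat by (simp add: scattering_solution_def)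
 obtain V1 where V1: "V1 \<in> borel_fun2"
  "AE x in lborel. x \<in> {- R..R} \<longrightarrow> (\<forall>l. V x (z l) = V1 (x, l))"
  "(NN l. NN x. (enorm (V1 (x, l)))\<^sup>2) < \<infinity>"
  by (rule mult_HH_inf_loc_line[OF Vloc \<sigma>, of R, folded z_def]) (rule that)
 note [measurable] = w(1) V1(1)
 define \<rho> where "\<rho> l = r (z l) - fourier hR (z l)" for l
 define \<theta> where "\<theta> l = \<tau> (z l) - fourier hT (z l)" for l
 have [measurable]: "\<rho> \<in> borel_fun" "\<theta> \<in> borel_fun"
  unfolding \<rho>_def[abs_def] \<theta>_def[abs_def] z_def by (intro borel_measurable_continuous_onI line_continuous[OF \<sigma>])+
 define LU where "LU p = (LBINT t. u1 (t, fst p) * exp (\<i> * z (snd p) * of_real t))" for p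
 have [measurable]: "LU \<in> borel_fun2" unfolding LU_def[abs_def] by measurable
 have LU: "U x (z l) = LU (x, l)" for x l unfolding U_def LU_def by (subst fourier_lborel) auto
 define Z where "Z p = (if fst p < - R then \<rho> (snd p) * exp (- \<i> * z (snd p) * of_real (fst p))
  else if fst p > R then \<theta> (snd p) * exp (\<i> * z (snd p) * of_real (fst p)) else V1 p - LU p)" for p
 have Zm [measurable]: "Z \<in> borel_fun2" unfolding Z_def[abs_def] by measurable
 have sc: "AE x in lborel. \<forall>\<omega>\<in>upper_half.
    (x < - R \<longrightarrow> V x \<omega> = fourier g \<omega> * exp (\<i> * \<omega> * of_real x) + r \<omega> * exp (- \<i> * \<omega> * of_real x)) \<and>
    (x > R \<longrightarrow> V x \<omega> = \<tau> \<omega> * exp (\<i> * \<omega> * of_real x))"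
  using scat unfolding scattering_solution_def AE_lebesgue by blast
 have Zeq: "AE x in lborel. \<forall>l. V x (z l) = Z (x, l) + U x (z l)"
  using sc V1(2) left right
 proof eventually_elim
  case (elim x)
  have zu: "z l \<in> upper_half" for l using \<sigma> by simp
  consider "x < - R" | "x > R" | "x \<in> {- R..R}" by force
  then show ?case
  proof cases
   case 1
   then have "U x (z l) = fourier g (z l) * exp (\<i> * z l * of_real x) + fourier hR (z l) * exp (- \<i> * z l * of_real x)" for l using elim(3) \<sigma> by simp
   moreover have "V x (z l) = fourier g (z l) * exp (\<i> * z l * of_real x) + r (z l) * exp (- \<i> * z l * of_real x)" for l using elim(1) zu 1 by blast
   ultimately show ?thesis using 1 by (simp add: Z_def \<rho>_def left_diff_distrib)
  next
   case 2
   then have "U x (z l) = fourier hT (z l) * exp (\<i> * z l * of_real x)" for l using elim(4) by simp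
   moreover have "V x (z l) = \<tau> (z l) * exp (\<i> * z l * of_real x)" for l using elim(1) zu 2 by blast
   ultimately show ?thesis using 2 R by (simp add: Z_def \<theta>_def left_diff_distrib)
  next
   case 3
   then show ?thesis using elim(2) by (simp add: Z_def LU)
  qed
 qed
 define Q where "Q = 2 * (1 + 1 / \<sigma>\<^sup>2)"
 have Q: "Q \<ge> 0" by (simp add: Q_def)
 have Ub: "AE x in lborel. \<forall>l. x \<in> {- R..R} \<longrightarrow> 2 * (norm (U x (z l)))\<^sup>2 \<le> (Q * (1 / (1 + l\<^sup>2))) * (w x)\<^sup>2"
  using w(4)
 proof eventually_elim
  case (elim x)
  show ?case
  proof (intro allI impI)
   fix l assume "x \<in> {- R..R}"
   then have "(norm (U x (z l)))\<^sup>2 \<le> (w x / norm (z l))\<^sup>2" using elim by (intro power_mono) auto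
   also have "\<dots> = (1 / (norm (z l))\<^sup>2) * (w x)\<^sup>2" by (simp add: power_divide)
   also have "\<dots> \<le> ((1 + 1 / \<sigma>\<^sup>2) * (1 / (1 + l\<^sup>2))) * (w x)\<^sup>2"
    unfolding z_def by (rule mult_right_mono[OF inverse_norm_line_bound[OF \<sigma>]]) simp
   finally have "2 * (norm (U x (z l)))\<^sup>2 \<le> 2 * (((1 + 1 / \<sigma>\<^sup>2) * (1 / (1 + l\<^sup>2))) * (w x)\<^sup>2)" by (rule mult_left_mono) simp
   then show "2 * (norm (U x (z l)))\<^sup>2 \<le> (Q * (1 / (1 + l\<^sup>2))) * (w x)\<^sup>2" unfolding Q_def by (simp only: mult.assoc)
  qed
 qed
 let ?i = "indicator {- R..R} :: real \<Rightarrow> ennreal"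
 let ?W = "NN x. ennreal (indicator {- R..R} x * (w x)\<^sup>2)"
 have pt: "AE x in lborel. \<forall>l. ?i x * (enorm (Z (x, l)))\<^sup>2 \<le> 2 * (enorm (V1 (x, l)))\<^sup>2 + ennreal (Q * (1 / (1 + l\<^sup>2))) * ennreal (indicator {- R..R} x * (w x)\<^sup>2)"
  using Ub
 proof eventually_elim
  case (elim x)
  show ?case
  proof
   fix l
   show "?i x * (enorm (Z (x, l)))\<^sup>2 \<le> 2 * (enorm (V1 (x, l)))\<^sup>2 + ennreal (Q * (1 / (1 + l\<^sup>2))) * ennreal (indicator {- R..R} x * (w x)\<^sup>2)"
   proof (cases "x \<in> {- R..R}")
    case True
    have "norm (Z (x, l)) \<le> norm (V1 (x, l)) + norm (U x (z l))" using True unfolding LU by (simp add: Z_def norm_triangle_ineq4)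
    then have "(norm (Z (x, l)))\<^sup>2 \<le> (norm (V1 (x, l)) + norm (U x (z l)))\<^sup>2" by (rule power_mono) simp
    also have "\<dots> \<le> 2 * (norm (V1 (x, l)))\<^sup>2 + 2 * (norm (U x (z l)))\<^sup>2"
     using zero_le_power2[of "norm (V1 (x, l)) - norm (U x (z l))"] by (simp add: power2_eq_square algebra_simps)
    also have "\<dots> \<le> 2 * (norm (V1 (x, l)))\<^sup>2 + (Q * (1 / (1 + l\<^sup>2))) * (w x)\<^sup>2" using elim True by simp
    finally have "ennreal ((norm (Z (x, l)))\<^sup>2) \<le> ennreal (2 * (norm (V1 (x, l)))\<^sup>2 + (Q * (1 / (1 + l\<^sup>2))) * (w x)\<^sup>2)" by (rule ennreal_leI)
    also have "\<dots> = 2 * ennreal ((norm (V1 (x, l)))\<^sup>2) + ennreal (Q * (1 / (1 + l\<^sup>2))) * ennreal ((w x)\<^sup>2)"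
    proof -
     have q: "0 \<le> Q * (1 / (1 + l\<^sup>2))" using Q by (simp add: add_nonneg_nonneg)
     have "ennreal (2 * (norm (V1 (x, l)))\<^sup>2 + (Q * (1 / (1 + l\<^sup>2))) * (w x)\<^sup>2) = ennreal (2 * (norm (V1 (x, l)))\<^sup>2) + ennreal ((Q * (1 / (1 + l\<^sup>2))) * (w x)\<^sup>2)"
      by (rule ennreal_plus) (use mult_nonneg_nonneg[OF q zero_le_power2[of "w x"]] in auto)
     also have "ennreal (2 * (norm (V1 (x, l)))\<^sup>2) = 2 * ennreal ((norm (V1 (x, l)))\<^sup>2)" by (simp add: ennreal_mult)
     also have "ennreal ((Q * (1 / (1 + l\<^sup>2))) * (w x)\<^sup>2) = ennreal (Q * (1 / (1 + l\<^sup>2))) * ennreal ((w x)\<^sup>2)"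
      by (rule ennreal_mult[OF q zero_le_power2])
     finally show ?thesis .
    qed
    finally show ?thesis using True by (simp add: ennreal_power)
   qed simp
  qed
 qed
 have E: "(NN l. NN x. ?i x * (enorm (Z (x, l)))\<^sup>2) < \<infinity>"
 proof -
  have "(NN l. NN x. ?i x * (enorm (Z (x, l)))\<^sup>2)
   \<le> (NN l. NN x. 2 * (enorm (V1 (x, l)))\<^sup>2 + ennreal (Q * (1 / (1 + l\<^sup>2))) * ennreal (indicator {- R..R} x * (w x)\<^sup>2))"
   by (intro nn_integral_mono nn_integral_mono_AE) (use pt in \<open>auto elim: eventually_mono\<close>)
  also have "\<dots> = (NN l. 2 * (NN x. (enorm (V1 (x, l)))\<^sup>2) + ennreal (Q * (1 / (1 + l\<^sup>2))) * ?W)"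
   by (intro nn_integral_cong) (subst nn_integral_add, measurable, subst nn_integral_cmult, measurable, subst nn_integral_cmult, measurable)
  also have "\<dots> = 2 * (NN l. (NN x. (enorm (V1 (x, l)))\<^sup>2)) + (NN l. ennreal (Q * (1 / (1 + l\<^sup>2)))) * ?W"
   by (subst nn_integral_add, measurable, subst nn_integral_cmult, measurable, subst nn_integral_multc, measurable)
  also have "\<dots> < \<infinity>" using V1(3) w(3) inverse_square_nn[OF Q] by (simp add: ennreal_mult_less_top)
  finally show ?thesis .
 qed
 have L2x: "AE l in lborel. (\<lambda>x. Z (x, l)) \<in> L2"
 proof -
  have "AE l in lborel. (NN x. ?i x * (enorm (Z (x, l)))\<^sup>2) \<noteq> \<infinity>"
   by (rule nn_integral_PInf_AE) (use E in auto)
  then show ?thesis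
  proof eventually_elim
   case (elim l)
   show ?case
   proof (rule L2I)
    define c where "c = (norm (\<rho> l))\<^sup>2 + (norm (\<theta> l))\<^sup>2"
    have i: "integrable lborel (\<lambda>x. c * exp (- (2 * \<sigma>) * \<bar>x\<bar>))" by (intro integrable_mult_right integrable_exp_abs) (use \<sigma> in simp)
    have b: "(enorm (Z (x, l)))\<^sup>2 \<le> ?i x * (enorm (Z (x, l)))\<^sup>2 + ennreal (c * exp (- (2 * \<sigma>) * \<bar>x\<bar>))" for x
    proof (cases "x \<in> {- R..R}")
     case False
     have e2: "(exp y)\<^sup>2 = exp (2 * y)" for y :: real by (simp add: power2_eq_square mult_exp_exp)
     have n: "norm (exp (- \<i> * z l * of_real x)) = exp (\<sigma> * x)" "norm (exp (\<i> * z l * of_real x)) = exp (- \<sigma> * x)"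
      by (simp_all add: norm_exp_eq_Re)
     have "(norm (Z (x, l)))\<^sup>2 \<le> c * exp (- (2 * \<sigma>) * \<bar>x\<bar>)"
     proof (cases "x < - R")
      case True
      then have "(norm (Z (x, l)))\<^sup>2 = (norm (\<rho> l))\<^sup>2 * exp (- (2 * \<sigma>) * \<bar>x\<bar>)"
       using R by (simp add: Z_def norm_mult n[simplified] power_mult_distrib e2)
      then show ?thesis by (simp add: c_def)
     next
      case f: False
      with False have "x > R" by auto
      then have "(norm (Z (x, l)))\<^sup>2 = (norm (\<theta> l))\<^sup>2 * exp (- (2 * \<sigma>) * \<bar>x\<bar>)"
       using R by (simp add: Z_def norm_mult n[simplified] power_mult_distrib e2)
      then show ?thesis by (simp add: c_def)
     qed
     then show ?thesis using False by (simp add: ennreal_power ennreal_leI)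
    qed simp
    have "(NN x. (enorm (Z (x, l)))\<^sup>2) \<le> (NN x. ?i x * (enorm (Z (x, l)))\<^sup>2 + ennreal (c * exp (- (2 * \<sigma>) * \<bar>x\<bar>)))"
     by (rule nn_integral_mono[OF b])
    also have "\<dots> = (NN x. ?i x * (enorm (Z (x, l)))\<^sup>2) + (NN x. ennreal (c * exp (- (2 * \<sigma>) * \<bar>x\<bar>)))"
     by (rule nn_integral_add) measurable
    also have "(NN x. ennreal (c * exp (- (2 * \<sigma>) * \<bar>x\<bar>))) = ennreal (LBINT x. c * exp (- (2 * \<sigma>) * \<bar>x\<bar>))"
     by (rule nn_integral_eq_integral[OF i]) (simp add: c_def)
    finally show "(NN x. (enorm (Z (x, l)))\<^sup>2) < \<infinity>"
     by (rule order_le_less_trans) (use elim in \<open>simp add: less_top\<close>)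
   qed measurable
  qed
 qed
 have L2l: "AE x in lborel. x \<in> {- R..R} \<longrightarrow> (\<lambda>l. Z (x, l)) \<in> L2 \<and> (\<lambda>l. U x (z l)) \<in> L2 \<inter> borel_fun"
 proof -
  have "(NN l. NN x. ?i x * (enorm (Z (x, l)))\<^sup>2) = (NN x. NN l. ?i x * (enorm (Z (x, l)))\<^sup>2)"
   by (rule lborel_pair.Fubini'[symmetric]) measurable
  with E have "(NN x. NN l. ?i x * (enorm (Z (x, l)))\<^sup>2) \<noteq> \<infinity>" by simp
  then have "AE x in lborel. (NN l. ?i x * (enorm (Z (x, l)))\<^sup>2) \<noteq> \<infinity>"
   by (rule nn_integral_PInf_AE[rotated]) measurable
  then show ?thesis using Ub
  proof eventually_elim
   case (elim x)
   show ?case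
   proof (intro impI conjI IntI)
    assume x: "x \<in> {- R..R}"
    show "(\<lambda>l. Z (x, l)) \<in> L2" by (rule L2I) (use elim(1) x in \<open>simp_all add: less_top\<close>)
    show "(\<lambda>l. U x (z l)) \<in> borel_fun" unfolding LU by measurable
    have "(NN l. (enorm (U x (z l)))\<^sup>2) \<le> (NN l. ennreal ((Q * (w x)\<^sup>2) * (1 / (1 + l\<^sup>2))))"
    proof (rule nn_integral_mono)
     fix l
     have "(norm (U x (z l)))\<^sup>2 \<le> 2 * (norm (U x (z l)))\<^sup>2" by simp
     also have "\<dots> \<le> (Q * (1 / (1 + l\<^sup>2))) * (w x)\<^sup>2" using elim(2) x by blast
     finally show "(enorm (U x (z l)))\<^sup>2 \<le> ennreal ((Q * (w x)\<^sup>2) * (1 / (1 + l\<^sup>2)))"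
      by (simp add: ennreal_power ennreal_leI)
    qed
    also have "\<dots> < \<infinity>" by (rule inverse_square_nn) (use Q in simp)
    finally show "(\<lambda>l. U x (z l)) \<in> L2" unfolding LU by (rule L2I[rotated]) measurable
   qed
  qed
 qed
 show ?thesis
  by (rule that[OF Zm Zeq[unfolded z_def] E L2x L2l[unfolded z_def]]) (use R in \<open>simp_all add: Z_def \<rho>_def \<theta>_def z_def\<close>)
qed

text \<open>
 By linearity \<open>A V - A U = A Z\<close>, and the transform of \<open>a x\<close> decays like \<open>C / (1 + s\<^sup>2)\<close>; the factor
 \<open>z / (z + \<i> * \<gamma>)\<close> is at most 1 in modulus because \<open>\<gamma> > 0\<close>.
\<close>
lemma A_difference:
 assumes \<sigma>: "\<sigma> > 0" and C: "C \<ge> 0"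
  and a: "AE x in lborel. \<forall>s. fourier (a x) (of_real s) = a_hat (x, s) \<and> norm (a_hat (x, s)) \<le> indicator {- R..R} x * (C * (1 / (1 + s\<^sup>2)))"
  and Z [measurable]: "Z \<in> borel_fun2"
  and VZ: "AE x in lborel. \<forall>l. V x (Complex l \<sigma>) = Z (x, l) + U x (Complex l \<sigma>)"
  and L2: "AE x in lborel. x \<in> {- R..R} \<longrightarrow> (\<lambda>l. Z (x, l)) \<in> L2 \<and> (\<lambda>l. U x (Complex l \<sigma>)) \<in> L2 \<inter> borel_fun"
 obtains F where "F \<in> borel_fun2"
  "AE x in lborel. \<forall>l. A_op a \<gamma> V x (Complex l \<sigma>) = F (x, l) + S_hat x (Complex l \<sigma>)"
  "AE x in lborel. \<forall>l. enorm (F (x, l)) \<le> indicator {- R..R} x * (NN m. ennreal (C / (2 * pi) * (1 / (1 + (l - m)\<^sup>2))) * enorm (Z (x, m)))"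
proof -
 define z where "z l = Complex l \<sigma>" for l
 have z[simp]: "Im (z l) = \<sigma>" "Re (z l) = l" for l by (simp_all add: z_def)
 have z_borel [measurable]: "z \<in> borel_fun" unfolding z_def[abs_def] Complex_eq by measurable
 define q where "q m = z m / (z m + \<i> * of_real \<gamma>)" for m
 have [measurable]: "q \<in> borel_fun" unfolding q_def[abs_def] by measurable
 have qb: "norm (q m) \<le> 1" for m
 proof -
  have "(norm (z m))\<^sup>2 \<le> (norm (z m + \<i> * of_real \<gamma>))\<^sup>2"
   using \<sigma> \<gamma> by (simp add: cmod_power2 power_mono)
  then have "norm (z m) \<le> norm (z m + \<i> * of_real \<gamma>)" by (rule power2_le_imp_le) simp
  then show ?thesis by (simp add: q_def norm_divide divide_le_eq_1)
 qed
 define \<kappa> where "\<kappa> x l m = a_hat (x, l - m) * q m" for x l m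
 have \<kappa>_borel [measurable]: "\<kappa> x l \<in> borel_fun" for x l unfolding \<kappa>_def[abs_def] by measurable
 define F where "F p = - \<i> * (1 / (2 * of_real pi) * (LBINT m. a_hat (fst p, snd p - m) * q m * Z (fst p, m)))" for p
 have Fm: "F \<in> borel_fun2" unfolding F_def[abs_def] by measurable
 have FF: "F (x, l) = - \<i> * (1 / (2 * of_real pi) * (LBINT m. \<kappa> x l m * Z (x, m)))" for x l
  by (simp add: F_def \<kappa>_def)
 have \<kappa>_L2: "\<kappa> x l \<in> L2" if b: "\<And>s. norm (a_hat (x, s)) \<le> C * (1 / (1 + s\<^sup>2))" for x l
 proof (rule L2I[OF \<kappa>_borel])
  have "(NN m. (enorm (\<kappa> x l m))\<^sup>2) \<le> (NN m. ennreal (C\<^sup>2 * (1 / (1 + (l + - 1 * m)\<^sup>2))))"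
  proof (rule nn_integral_mono)
   fix m
   have "norm (\<kappa> x l m) \<le> C * (1 / (1 + (l - m)\<^sup>2)) * 1" unfolding \<kappa>_def norm_mult using C by (intro mult_mono b qb) auto
   then have "(norm (\<kappa> x l m))\<^sup>2 \<le> (C * (1 / (1 + (l - m)\<^sup>2)))\<^sup>2" by (intro power_mono) auto
   also have "\<dots> = C\<^sup>2 * (1 / (1 + (l - m)\<^sup>2)\<^sup>2)" by (simp add: power_divide)
   also have "\<dots> \<le> C\<^sup>2 * (1 / (1 + (l - m)\<^sup>2))" by (intro mult_left_mono weight_le) simp
   finally show "(enorm (\<kappa> x l m))\<^sup>2 \<le> ennreal (C\<^sup>2 * (1 / (1 + (l + - 1 * m)\<^sup>2)))" by (simp add: ennreal_power ennreal_leI)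
  qed
  also have "\<dots> = (NN m. ennreal (C\<^sup>2 * (1 / (1 + m\<^sup>2))))"
   using nn_integral_real_affine[of "\<lambda>m. ennreal (C\<^sup>2 * (1 / (1 + m\<^sup>2)))" "- 1" l] by simp
  also have "\<dots> < \<infinity>" by (rule inverse_square_nn) simp
  finally show "(NN m. (enorm (\<kappa> x l m))\<^sup>2) < \<infinity>" .
 qed
 have int: "AE x in lborel. \<forall>l. integrable lborel (\<lambda>m. \<kappa> x l m * Z (x, m)) \<and> integrable lborel (\<lambda>m. \<kappa> x l m * U x (z m))
  \<and> (\<lambda>m. \<kappa> x l m * U x (z m)) \<in> borel_fun"
  using a L2[folded z_def]
 proof eventually_elim
  case (elim x)
  show ?case
  proof (cases "x \<in> {- R..R}")
   case True
   then have b: "norm (a_hat (x, s)) \<le> C * (1 / (1 + s\<^sup>2))" for s using elim(1) by simp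
   have m: "(\<lambda>m. U x (z m)) \<in> borel_fun" using elim(2) True by simp
   note [measurable] = m
   have "integrable lebesgue (\<lambda>m. \<kappa> x l m * Z (x, m))" "integrable lebesgue (\<lambda>m. \<kappa> x l m * U x (z m))" for l
    using elim(2) True by (auto intro!: L2_mult_integrable \<kappa>_L2 b)
   then show ?thesis by (simp add: integrable_completion)
  next
   case False
   then have "a_hat (x, s) = 0" for s using elim(1) by simp
   then show ?thesis by (simp add: \<kappa>_def)
  qed
 qed
 have Aform: "A_op a \<gamma> X x (z l) = - \<i> * (1 / (2 * of_real pi) * (LBINT m. \<kappa> x l m * X x (z m)))"
  if fa: "\<And>s. fourier (a x) (of_real s) = a_hat (x, s)" and m: "(\<lambda>m. \<kappa> x l m * X x (z m)) \<in> borel_fun" for X x l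
 proof -
  have "(LINT m|lebesgue. \<kappa> x l m * X x (z m)) = (LBINT m. \<kappa> x l m * X x (z m))"
   by (rule integral_completion) (use m in simp)
  moreover have "(\<lambda>m. fourier (a x) (of_real (l - m)) * (Complex m \<sigma> / (Complex m \<sigma> + \<i> * of_real \<gamma>) * X x (Complex m \<sigma>))) = (\<lambda>m. \<kappa> x l m * X x (z m))"
   unfolding fa \<kappa>_def q_def z_def by (simp add: fun_eq_iff mult.assoc)
  ultimately show ?thesis unfolding A_op_def a_D_omega_def z by simp
 qed
 have FA: "AE x in lborel. \<forall>l. A_op a \<gamma> V x (z l) = F (x, l) + S_hat x (z l)"
  using a int VZ[folded z_def] A_transform[OF \<sigma>]
 proof eventually_elim
  case (elim x)
  show ?case
  proof
   fix l
   have fa: "fourier (a x) (of_real s) = a_hat (x, s)" for s using elim(1) by blast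
   have i: "integrable lborel (\<lambda>m. \<kappa> x l m * Z (x, m))" "integrable lborel (\<lambda>m. \<kappa> x l m * U x (z m))"
    and m: "(\<lambda>m. \<kappa> x l m * U x (z m)) \<in> borel_fun" using elim(2) by auto
   have e: "(\<lambda>m. \<kappa> x l m * V x (z m)) = (\<lambda>m. \<kappa> x l m * Z (x, m) + \<kappa> x l m * U x (z m))"
    using elim(3) by (simp add: fun_eq_iff distrib_left)
   have mV: "(\<lambda>m. \<kappa> x l m * V x (z m)) \<in> borel_fun" unfolding e using m by measurable
   have "A_op a \<gamma> V x (z l) = - \<i> * (1 / (2 * of_real pi) * ((LBINT m. \<kappa> x l m * Z (x, m)) + (LBINT m. \<kappa> x l m * U x (z m))))"
    unfolding Aform[where X=V and x=x and l=l, OF fa mV] e by (subst Bochner_Integration.integral_add[OF i]) simp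
   also have "\<dots> = F (x, l) + A_op a \<gamma> U x (z l)" unfolding Aform[where X=U and x=x and l=l, OF fa m] FF by (simp add: distrib_left)
   also have "A_op a \<gamma> U x (z l) = S_hat x (z l)" using elim(4) by simp
   finally show "A_op a \<gamma> V x (z l) = F (x, l) + S_hat x (z l)" .
  qed
 qed
 have FB: "AE x in lborel. \<forall>l. enorm (F (x, l)) \<le> indicator {- R..R} x * (NN m. ennreal (C / (2 * pi) * (1 / (1 + (l - m)\<^sup>2))) * enorm (Z (x, m)))"
  using a int
 proof eventually_elim
  case (elim x)
  show ?case
  proof
   fix l
   let ?b = "\<lambda>m. C / (2 * pi) * (1 / (1 + (l - m)\<^sup>2))"
   have i: "integrable lborel (\<lambda>m. \<kappa> x l m * Z (x, m))" using elim(2) by auto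
   have F': "F (x, l) = (LBINT m. (- \<i> / (2 * of_real pi)) * (\<kappa> x l m * Z (x, m)))" unfolding FF by simp
   have "enorm (F (x, l)) \<le> (NN m. enorm ((- \<i> / (2 * of_real pi)) * (\<kappa> x l m * Z (x, m))))"
    unfolding F' by (rule integral_norm_bound_ennreal) (rule integrable_mult_right[OF i])
   also have "\<dots> \<le> (NN m. indicator {- R..R} x * (ennreal (?b m) * enorm (Z (x, m))))"
   proof (rule nn_integral_mono)
    fix m
    have "norm (\<kappa> x l m) \<le> (indicator {- R..R} x * (C * (1 / (1 + (l - m)\<^sup>2)))) * 1"
     unfolding \<kappa>_def norm_mult using elim(1) C by (intro mult_mono qb) auto
    then have "1 / (2 * pi) * (norm (\<kappa> x l m) * norm (Z (x, m))) \<le> 1 / (2 * pi) * ((indicator {- R..R} x * (C * (1 / (1 + (l - m)\<^sup>2)))) * 1 * norm (Z (x, m)))"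
     by (intro mult_left_mono mult_right_mono) auto
    then have "norm ((- \<i> / (2 * of_real pi)) * (\<kappa> x l m * Z (x, m))) \<le> indicator {- R..R} x * (?b m * norm (Z (x, m)))"
     by (simp add: norm_mult norm_divide mult_ac)
    then have "enorm ((- \<i> / (2 * of_real pi)) * (\<kappa> x l m * Z (x, m))) \<le> ennreal (indicator {- R..R} x * (?b m * norm (Z (x, m))))" by (rule ennreal_leI)
    also have "\<dots> = indicator {- R..R} x * (ennreal (?b m) * enorm (Z (x, m)))"
    proof -
     have b0: "0 \<le> ?b m" using C by (simp add: add_nonneg_nonneg)
     show ?thesis
     proof (cases "x \<in> {- R..R}")
      case True
      then show ?thesis by (simp only: indicator_simps mult_1 ennreal_mult[OF b0 norm_ge_zero])
     next
      case False
      then have "(indicator {- R..R} x :: ennreal) = 0" "indicat_real {- R..R} x = 0" by (rule indicator_simps)+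
      then show ?thesis by (simp only: mult_zero_left ennreal_0)
     qed
    qed
    finally show "enorm ((- \<i> / (2 * of_real pi)) * (\<kappa> x l m * Z (x, m))) \<le> indicator {- R..R} x * (ennreal (?b m) * enorm (Z (x, m)))" .
   qed
   also have "\<dots> = indicator {- R..R} x * (NN m. ennreal (?b m) * enorm (Z (x, m)))"
    by (rule nn_integral_cmult) measurable
   finally show "enorm (F (x, l)) \<le> indicator {- R..R} x * (NN m. ennreal (?b m) * enorm (Z (x, m)))" .
  qed
 qed
 show ?thesis by (rule that[OF Fm FA[unfolded z_def] FB])
qed

end

context wave_scattering
begin

text \<open>
 Outside \<open>{- R..R}\<close> the difference is an exponential with coefficient \<open>r - fourier hR\<close> or \<open>\<tau> - fourier
 hT\<close>. It vanishes for almost every point of the line, hence by continuity for every point.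
\<close>
lemma line_agreement:
 assumes \<sigma>: "\<sigma> > 0" and C: "C \<ge> 0" and large: "(C / (2 * pi)) * (LBINT s. 1 / (1 + s\<^sup>2)) < \<sigma>\<^sup>2"
  and a: "AE x in lborel. \<forall>s. fourier (a x) (of_real s) = a_hat (x, s) \<and> norm (a_hat (x, s)) \<le> indicator {- R..R} x * (C * (1 / (1 + s\<^sup>2)))"
 shows "r (Complex l \<sigma>) = fourier hR (Complex l \<sigma>)" "\<tau> (Complex l \<sigma>) = fourier hT (Complex l \<sigma>)"
proof -
 define z where "z l = Complex l \<sigma>" for l
 have zu: "z l \<in> upper_half" "Im (z l) > 0" for l using \<sigma> by (simp_all add: z_def)
 obtain Z where Z: "Z \<in> borel_fun2"
  "AE x in lborel. \<forall>l. V x (z l) = Z (x, l) + U x (z l)"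
  "(NN l. NN x. indicator {- R..R} x * (enorm (Z (x, l)))\<^sup>2) < \<infinity>"
  "AE l in lborel. (\<lambda>x. Z (x, l)) \<in> L2"
  "AE x in lborel. x \<in> {- R..R} \<longrightarrow> (\<lambda>l. Z (x, l)) \<in> L2 \<and> (\<lambda>l. U x (z l)) \<in> L2 \<inter> borel_fun"
  "\<And>x l. x < - R \<Longrightarrow> Z (x, l) = (r (z l) - fourier hR (z l)) * exp (- \<i> * z l * of_real x)"
  "\<And>x l. x > R \<Longrightarrow> Z (x, l) = (\<tau> (z l) - fourier hT (z l)) * exp (\<i> * z l * of_real x)"
  by (rule line_difference[OF \<sigma>, folded z_def]) (rule that)
 note [measurable] = Z(1)
 obtain F where F: "F \<in> borel_fun2"
  "AE x in lborel. \<forall>l. A_op a \<gamma> V x (z l) = F (x, l) + S_hat x (z l)"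
  "AE x in lborel. \<forall>l. enorm (F (x, l)) \<le> indicator {- R..R} x * (NN m. ennreal (C / (2 * pi) * (1 / (1 + (l - m)\<^sup>2))) * enorm (Z (x, m)))"
  by (rule A_difference[OF \<sigma> C a Z(1), folded z_def, OF Z(2) Z(5)]) (rule that)
 note [measurable] = F(1)
 let ?K = "(C / (2 * pi)) * (LBINT s. 1 / (1 + s\<^sup>2))"
 have BK: "(NN s. ennreal (C / (2 * pi) * (1 / (1 + s\<^sup>2)))) \<le> ennreal ?K"
 proof -
  have "(NN s. ennreal (C / (2 * pi) * (1 / (1 + s\<^sup>2)))) = ennreal (LBINT s. C / (2 * pi) * (1 / (1 + s\<^sup>2)))"
   by (rule nn_integral_eq_integral[OF integrable_mult_right[OF integrable_inverse_square]]) (use C in \<open>auto simp: add_nonneg_nonneg\<close>)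
  also have "(LBINT s. C / (2 * pi) * (1 / (1 + s\<^sup>2))) = ?K" by (rule integral_mult_right_zero)
  finally show ?thesis by (rule eq_refl)
 qed
 have K0: "0 \<le> ?K" using C by (intro mult_nonneg_nonneg Bochner_Integration.integral_nonneg) (auto simp: add_nonneg_nonneg)
 have P: "P_null a \<gamma> V" using scat by (simp add: scattering_solution_def)
 have weak: "AE l in lborel. integrable lborel (\<lambda>x. F (x, l)) \<longrightarrow> (\<forall>\<psi>\<in>\<D>.
  (Complex l \<sigma>)\<^sup>2 * (LBINT x. Z (x, l) * \<psi> x) + (LBINT x. Z (x, l) * ddx (ddx \<psi>) x) = (LBINT x. F (x, l) * \<psi> x))"
  using Z(4) unfolding z_def[symmetric]
 proof eventually_elim
  case (elim l)
  show ?case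
  proof (intro impI ballI)
   fix \<psi> :: "real \<Rightarrow> complex"
   assume Fi: "integrable lborel (\<lambda>x. F (x, l))" and \<psi>: "\<psi> \<in> \<D>"
   let ?dd = "ddx (ddx \<psi>)"
   have dd: "?dd \<in> \<D>" by (intro test_dir_deriv \<psi>)
   have DD: "D 1 (D 1 \<psi>) x = - ?dd x" for x
   proof -
    have "D 1 (D 1 \<psi>) = (\<lambda>p. (1 / \<i>) * ((1 / \<i>) * ?dd p))"
     unfolding D_def using dir_deriv_cmult[OF test_functionsD(1)[OF test_dir_deriv[OF \<psi>]], of 1 "1 / \<i>"] by simp
    then show ?thesis by simp
   qed
   have Zi: "integrable lborel (\<lambda>x. Z (x, l) * h x)" if h: "h \<in> \<D>" for h
   proof -
    have [measurable]: "h \<in> borel_fun" by (rule test_borel[OF h])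
    have "integrable lebesgue (\<lambda>x. Z (x, l) * h x)" by (rule L2_mult_integrable[OF elim test_L2[OF h]])
    then show ?thesis by (subst (asm) integrable_completion) auto
   qed
   have F\<psi>: "integrable lborel (\<lambda>x. F (x, l) * \<psi> x)"
   proof -
    have [measurable]: "\<psi> \<in> borel_fun" by (rule test_borel[OF \<psi>])
    obtain c where c: "c \<ge> 0" "\<And>x. norm (\<psi> x) \<le> c" by (rule continuous_compact_supp_bounded[OF \<psi>]) (rule that)
    show ?thesis
     by (rule Bochner_Integration.integrable_bound[OF integrable_mult_right[OF integrable_norm[OF Fi], of c]])
      (use c in \<open>auto intro!: AE_I2 mult_right_mono simp: norm_mult abs_mult mult.commute[of "norm (F _)"]\<close>)
   qed
   note Si = stationary_weak[OF \<psi> zu(2)] and Sd = stationary_weak(1)[OF dd zu(2)]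
   define G1 where "G1 x = F (x, l) * \<psi> x - Z (x, l) * ?dd x - (z l)\<^sup>2 * (Z (x, l) * \<psi> x)" for x
   define G2 where "G2 x = S_hat x (z l) * \<psi> x - U x (z l) * ?dd x - (z l)\<^sup>2 * (U x (z l) * \<psi> x)" for x
   have G1: "integrable lborel G1" unfolding G1_def[abs_def]
    by (intro Bochner_Integration.integrable_diff integrable_mult_right F\<psi> Zi dd \<psi>)
   have G2: "integrable lborel G2" unfolding G2_def[abs_def]
    by (intro Bochner_Integration.integrable_diff integrable_mult_right Si(1,2) Sd)
   have I1: "(LBINT x. G1 x) = (LBINT x. F (x, l) * \<psi> x) - (LBINT x. Z (x, l) * ?dd x) - (z l)\<^sup>2 * (LBINT x. Z (x, l) * \<psi> x)"
    unfolding G1_def using F\<psi> Zi[OF dd] Zi[OF \<psi>] by simp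
   have I2: "(LBINT x. G2 x) = (LBINT x. S_hat x (z l) * \<psi> x) - (LBINT x. U x (z l) * ?dd x) - (z l)\<^sup>2 * (LBINT x. U x (z l) * \<psi> x)"
    unfolding G2_def using Si(1,2) Sd by simp
   have eq: "AE x in lborel. V x (z l) * D 1 (D 1 \<psi>) x - (z l)\<^sup>2 * V x (z l) * \<psi> x + A_op a \<gamma> V x (z l) * \<psi> x = G1 x + G2 x"
    using Z(2) F(2)
   proof eventually_elim
    case (elim x)
    then have "V x (z l) = Z (x, l) + U x (z l)" "A_op a \<gamma> V x (z l) = F (x, l) + S_hat x (z l)" by auto
    then show ?case unfolding DD G1_def G2_def by (simp add: algebra_simps)
   qed
   have "(LINT x|lebesgue. V x (z l) * D 1 (D 1 \<psi>) x - (z l)\<^sup>2 * V x (z l) * \<psi> x + A_op a \<gamma> V x (z l) * \<psi> x) = (LBINT x. G1 x + G2 x)"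
    by (rule LINT_version(3)[OF _ eq]) (use G1 G2 in auto)
   moreover have "(LINT x|lebesgue. V x (z l) * D 1 (D 1 \<psi>) x - (z l)\<^sup>2 * V x (z l) * \<psi> x + A_op a \<gamma> V x (z l) * \<psi> x) = 0"
    using P zu(1) \<psi> unfolding P_null_def by blast
   ultimately have "(LBINT x. G1 x) + (LBINT x. G2 x) = 0" using G1 G2 by simp
   moreover have "(LBINT x. G2 x) = 0" unfolding I2 using Si(3)[of l] by (simp add: algebra_simps)
   ultimately have "(LBINT x. G1 x) = 0" by simp
   then show "(z l)\<^sup>2 * (LBINT x. Z (x, l) * \<psi> x) + (LBINT x. Z (x, l) * ?dd x) = (LBINT x. F (x, l) * \<psi> x)"
    unfolding I1 by (simp add: algebra_simps)
  qed
 qed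
 have FB: "AE l in lborel. AE x in lborel. enorm (F (x, l)) \<le> indicator {- R..R} x * (NN m. ennreal (C / (2 * pi) * (1 / (1 + (l - m)\<^sup>2))) * enorm (Z (x, m)))"
  by (rule AE_I2) (use F(3) in \<open>auto elim: eventually_mono\<close>)
 have zero: "AE l in lborel. AE x in lborel. Z (x, l) = 0"
  by (rule stationary_uniqueness[of Z F "\<lambda>s. C / (2 * pi) * (1 / (1 + s\<^sup>2))" ?K \<sigma> R, OF Z(1) F(1) _ _ BK K0 large \<sigma> Z(3,4) FB weak])
   (use C in \<open>auto simp: add_nonneg_nonneg\<close>)
 have "AE l in lborel. r (z l) - fourier hR (z l) = 0 \<and> \<tau> (z l) - fourier hT (z l) = 0"
  using zero
 proof eventually_elim
  case (elim l)
  obtain x where "R < x" "x < R + 1" "Z (x, l) = 0" by (rule AE_lborel_interval_ex[OF elim, of R "R + 1"]) (use that in auto)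
  then have "\<tau> (z l) - fourier hT (z l) = 0" using Z(7)[of x l] by simp
  moreover obtain y where "- (R + 1) < y" "y < - R" "Z (y, l) = 0" by (rule AE_lborel_interval_ex[OF elim, of "- (R + 1)" "- R"]) (use that in auto)
  then have "r (z l) - fourier hR (z l) = 0" using Z(6)[of y l] by simp
  ultimately show ?case by simp
 qed
 then have ae: "AE l in lborel. r (Complex l \<sigma>) - fourier hR (Complex l \<sigma>) = 0" "AE l in lborel. \<tau> (Complex l \<sigma>) - fourier hT (Complex l \<sigma>) = 0"
  by (auto elim: eventually_mono simp: z_def)
 show "r (Complex l \<sigma>) = fourier hR (Complex l \<sigma>)" using continuous_AE_0[OF line_continuous(1)[OF \<sigma>] ae(1), of l] by simp
 show "\<tau> (Complex l \<sigma>) = fourier hT (Complex l \<sigma>)" using continuous_AE_0[OF line_continuous(2)[OF \<sigma>] ae(2), of l] by simp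
qed

text \<open>
 The two sides are holomorphic in the upper half plane and agree where \<open>Im z\<close> is large.
\<close>
lemma scattering_data_are_transforms:
 assumes z: "Im z > 0"
 shows "r z = fourier hR z" "\<tau> z = fourier hT z"
proof -
 obtain C where C: "C \<ge> 0" and a: "AE x in lborel. \<forall>s. fourier (a x) (of_real s) = a_hat (x, s) \<and> norm (a_hat (x, s)) \<le> indicator {- R..R} x * (C * (1 / (1 + s\<^sup>2)))"
  by (rule a_hat_bound) (rule that)
 define K where "K = (C / (2 * pi)) * (LBINT s. 1 / (1 + s\<^sup>2))"
 (* any \<sigma> beyond \<sigma>0 makes the perturbation a contraction *)
 define \<sigma>0 where "\<sigma>0 = 1 + \<bar>K\<bar>"
 have big: "K < \<sigma>\<^sup>2" "\<sigma> > 0" if "\<sigma> > \<sigma>0" for \<sigma>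
 proof -
  show "\<sigma> > 0" using that by (simp add: \<sigma>0_def)
  have "\<bar>K\<bar> < \<sigma> * 1" using that by (simp add: \<sigma>0_def)
  also have "\<dots> \<le> \<sigma> * \<sigma>" using that by (intro mult_left_mono) (auto simp: \<sigma>0_def)
  finally show "K < \<sigma>\<^sup>2" by (simp add: power2_eq_square)
 qed
 have eq: "r w = fourier hR w" "\<tau> w = fourier hT w" if "w \<in> {w. Im w > \<sigma>0}" for w
  using line_agreement[OF big(2) C big(1)[unfolded K_def] a, of "Im w" "Re w"] that by simp_all
 have o: "open {w. Im w > \<sigma>0}" "open upper_half" by (rule open_halfspace_Im_gt)+
 have ne: "{w. Im w > \<sigma>0} \<noteq> {}" by (auto intro!: exI[of _ "Complex 0 (\<sigma>0 + 1)"])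
 have con: "connected upper_half" by (rule convex_connected[OF convex_halfspace_Im_gt])
 have sub: "{w. Im w > \<sigma>0} \<subseteq> upper_half" by (auto simp: \<sigma>0_def)
 show "r z = fourier hR z"
  by (rule analytic_continuation_open[OF o ne con sub r_holo causal_fourier_holomorphic[OF hR] eq(1)]) (use z in auto)
 show "\<tau> z = fourier hT z"
  by (rule analytic_continuation_open[OF o ne con sub \<tau>_holo causal_fourier_holomorphic[OF hT] eq(2)]) (use z in auto)
qed

end

section \<open>Transmission and reflection of the incoming wave\<close>

lemma mult_H_holomorphic:
 assumes "f \<in> mult_H (\<lambda>\<omega>. 1 / \<omega>) \<alpha>"
 shows "f holomorphic_on upper_half"
proof -
 obtain h where h: "h holomorphic_on upper_half" "\<And>w. w \<in> upper_half \<Longrightarrow> f w = 1 / w * h w"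
  using assms unfolding mult_H_def H_def by blast
 have "(\<lambda>w. 1 / w * h w) holomorphic_on upper_half" by (intro holomorphic_intros h(1)) auto
 then show ?thesis by (rule holomorphic_transform) (simp add: h(2))
qed

theorem theorem2:
 fixes R T\<^sub>0 \<gamma> :: real
  and a :: "real \<Rightarrow> real \<Rightarrow> complex"
  and g :: "real \<Rightarrow> complex"
  and u :: "real \<Rightarrow> real \<Rightarrow> complex"
  and T Rp :: "(complex \<Rightarrow> complex) \<Rightarrow> complex \<Rightarrow> complex"
 assumes "R > 0" and "T\<^sub>0 > 0" and "\<gamma> > 0"
  and "a \<in> Linf_Cc_smooth"
  and "AE x in lebesgue. \<forall>t. (x, t) \<notin> {- R..R} \<times> {- T\<^sub>0..T\<^sub>0} \<longrightarrow> a x t = 0"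
  and "g \<in> test_functions" and "supp g \<subseteq> {R<..}"
  and "wave_solution a \<gamma> u"
  and "\<forall>t<0. AE x in lebesgue. u t x = g (t - x)"
  and "scattering_operators R a \<gamma> T Rp"
 shows "\<exists>\<R>g \<T>g.
     has_fourier_boundary_value \<R>g (Rp (fourier g)) \<and>
     has_fourier_boundary_value \<T>g (T (fourier g)) \<and>
     (\<forall>t. AE x in lebesgue.
       (x < - R \<longrightarrow> u t x = g (t - x) + \<R>g (x + t)) \<and>
       (x > R \<longrightarrow> u t x = \<T>g (t - x)))"
proof -
 have wave: "(\<lambda>(t, x). u t x) \<in> borel_measurable lebesgue" "u \<in> C0_H1" using assms(8) by (auto simp: wave_solution_def)
 obtain ut where ut: "(\<lambda>(t, x). ut t x) \<in> borel_measurable lebesgue" "ut \<in> C0_L2" "has_L2_time_deriv u ut"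
  and weak: "\<And>\<phi>. \<phi> \<in> test_functions \<Longrightarrow> (LINT p|lebesgue. (case p of (t, x) \<Rightarrow>
        u t x * D (1, 0) (D (1, 0) \<phi>) (t, x)
       - a x t * memory \<gamma> (\<lambda>t' x'. (1 / \<i>) * ut t' x') t x * \<phi> (t, x)
       - u t x * D (0, 1) (D (0, 1) \<phi>) (t, x))) = 0"
  using assms(8) unfolding wave_solution_def by blast
 obtain u1 where u1: "joint_version u u1" by (rule joint_version_exists[OF wave(1)]) (rule that)
 obtain ut1 where ut1: "joint_version ut ut1" by (rule joint_version_exists[OF ut(1)]) (rule that)
 have curve: "C1_curve u ut" using wave(2) ut by (auto simp: C1_curve_def C0_H1_def)
 have setting: "wave_setting R T\<^sub>0 \<gamma> a g u ut u1 ut1"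
  by (unfold_locales; (fact assms u1 ut1 curve weak)?) (use wave(2) assms(9) in \<open>auto simp: C0_H1_def\<close>)
 then interpret s: wave_setting R T\<^sub>0 \<gamma> a g u ut u1 ut1 .
 obtain a1 where a1: "a1 \<in> borel_measurable borel" "AE x in lborel. \<forall>t. a x t = a1 (x, t)" by (rule s.a_version) (rule that)
 interpret v: wave_version R T\<^sub>0 \<gamma> a g u ut u1 ut1 a1 by (unfold_locales) (fact a1)+
 obtain hT where hT: "causal (- R) hT" "\<And>t. AE x in lebesgue. x > R \<longrightarrow> u t x = hT (t - x)"
  "AE x in lborel. x > R \<longrightarrow> (\<forall>z. s.U x z = fourier hT z * exp (\<i> * z * of_real x))"
  by (rule s.right_transform) (rule that)
 obtain hR where hR: "causal (- R) hR" "\<And>t. AE x in lebesgue. x < - R \<longrightarrow> u t x = g (t - x) + hR (x + t)"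
  "AE x in lborel. x < - R \<longrightarrow> (\<forall>z. Im z > 0 \<longrightarrow> s.U x z = fourier g z * exp (\<i> * z * of_real x) + fourier hR z * exp (- \<i> * z * of_real x))"
  by (rule s.left_transform) (rule that)
 have f: "fourier g \<in> mult_H (\<lambda>\<omega>. 1 / (\<omega> + \<i>)) (- R)" by (rule fourier_test_mult_H[OF assms(6) s.g_zero])
 obtain V where V: "scattering_solution R a \<gamma> (fourier g) (Rp (fourier g)) (T (fourier g)) V"
  using assms(10) f unfolding scattering_operators_def by blast
 have "Rp (fourier g) \<in> mult_H (\<lambda>\<omega>. 1 / \<omega>) (- R + 2 * R)" "T (fourier g) \<in> mult_H (\<lambda>\<omega>. 1 / \<omega>) (- R + 2 * R)"
  using assms(10) f unfolding scattering_operators_def bounded_operator_def by blast+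
 then have hol: "Rp (fourier g) holomorphic_on upper_half" "T (fourier g) holomorphic_on upper_half" by (auto intro: mult_H_holomorphic)
 interpret w: wave_scattering R T\<^sub>0 \<gamma> a g u ut u1 ut1 a1 "Rp (fourier g)" "T (fourier g)" hR hT V
  by (unfold_locales) (fact hol V hR(1) hT(1) hT(3) hR(3))+
 show ?thesis
 proof (intro exI conjI allI)
  show "has_fourier_boundary_value hR (Rp (fourier g))"
   by (rule causal_boundary_value[OF hR(1)]) (use w.scattering_data_are_transforms in auto)
  show "has_fourier_boundary_value hT (T (fourier g))"
   by (rule causal_boundary_value[OF hT(1)]) (use w.scattering_data_are_transforms in auto)
  show "AE x in lebesgue. (x < - R \<longrightarrow> u t x = g (t - x) + hR (x + t)) \<and> (x > R \<longrightarrow> u t x = hT (t - x))" for t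
   using hR(2)[of t] hT(2)[of t] by eventually_elim simp
 qed
qed

end
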